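(* Let $(A_n,\rho_{n+1,n})_n$ be a $C^*$-encoding system with limit $L\subset A_\infty$ and $C^*$-limit $C^*_{\bullet}(L)$. Then the map $\Theta=\mathrm{id}_{L}\colon C^*_{\bullet}(L)\to A_\infty$ (the identity map of the underlying set $L$, viewed as a map from the $C^*$-algebra $C^*_\bullet(L)$ into $A_\infty$) is a complete order embedding.
   Context: A map is c.p.c. if it is completely positive and contractive. For a sequence $(A_n)_{n\ge 0}$ of $C^*$-algebras, $\prod_n A_n$ denotes the $C^*$-algebra of norm bounded sequences, $\bigoplus_n A_n$ its ideal of sequences converging to $0$ in norm, $A_\infty=\prod_n A_n/\bigoplus_n A_n$, and $[(a_n)_n]$ the class of $(a_n)_n$. A c.p.c. system $(A_n,\rho_{n+1,n})_n$ consists of $C^*$-algebras $(A_n)_{n\ge0}$ and c.p.c. maps $\rho_{n+1,n}\colon A_n\to A_{n+1}$. For $m>n$ set $\rho_{m,n}=\rho_{m,m-1}\circ\cdots\circ\rho_{n+1,n}$ and $\rho_{n,n}=\mathrm{id}_{A_n}$. Define $\rho_n\colon A_n\to A_\infty$ by $\rho_n(x)=[(\rho_{m,n}(x))_{m>n}]$. The limit of the system is the closed self-adjoint subspace $L=\overline{\bigcup_n\rho_n(A_n)}\subset A_\infty$. A c.p.c. system is $C^*$-encoding if for any $k\ge0$, $x,y\in A_k$ and $\varepsilon>0$ there is $M>k$ such that for all $m>n,j>M$ (that is, $n,j>M$ and $m>\max\{n,j\}$), $$\|\rho_{m,n}(\rho_{n,k}(x)\rho_{n,k}(y))-\rho_{m,j}(\rho_{j,k}(x)\rho_{j,k}(y))\|<\varepsilon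 .$$ The $C^*$-limit of a $C^*$-encoding system is the $C^*$-algebra $C^*_{\bullet}(L)$ obtained by equipping $L$ with the norm and involution inherited from $A_\infty$ and with the (bounded, associative, bilinear) product $\bullet\colon L\times L\to L$ determined on the dense subspace $\bigcup_n\rho_n(A_n)$ by $\rho_k(x)\bullet\rho_k(y)=\lim_n\rho_n(\rho_{n,k}(x)\rho_{n,k}(y))$ for $k\ge0$, $x,y\in A_k$. For self-adjoint subspaces $X\subset A$, $Y\subset B$ of $C^*$-algebras, a $*$-linear map $\theta\colon X\to Y$ is completely positive (c.p.) if for every $r\ge1$ the amplification $\theta^{(r)}\colon M_r(X)\to M_r(Y)$ sends elements that are positive in $M_r(A)$ to elements positive in $M_r(B)$; it is completely isometric if every $\theta^{(r)}$ is isometric for the norms of $M_r(A)$ and $M_r(B)$. It is a complete order embedding if it is c.p. and completely isometric and $\theta^{-1}\colon\theta(X)\to X$ is c.p. *)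

theory Defs
  imports "HOL-Analysis.Analysis" "HOL-Algebra.QuotRing" "HOL-Algebra.Module"
begin

section \<open>C*-algebras\<close>

text \<open>
  C*-algebras are carrier-based, so that the algebras of a sequence may differ while their
  elements live in one type, and they are not assumed to be unital: the inherited field
  \<open>one\<close> carries no meaning anywhere in this theory.
\<close>

record 'a cstar = "(complex, 'a) module" +
  star :: "'a \<Rightarrow> 'a"
  cnorm :: "'a \<Rightarrow> real"

text \<open>The value off the carrier is fixed because \<open>Metric_space\<close> requires a distance that is
  nonnegative and symmetric on the whole type.\<close>

definition cdist :: "('a, 'm) cstar_scheme \<Rightarrow> 'a \<Rightarrow> 'a \<Rightarrow> real" where
  "cdist A x y = (if x \<in> carrier A \<and> y \<in> carrier A then cnorm A (x \<ominus>\<^bsub>A\<^esub> y) else 0)"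

definition ctopology :: "('a, 'm) cstar_scheme \<Rightarrow> 'a topology" where
  "ctopology A = Metric_space.mtopology (carrier A) (cdist A)"

locale cstar_algebra = abelian_group A for A :: "('a, 'm) cstar_scheme" (structure) +
  assumes smult_closed: "x \<in> carrier A \<Longrightarrow> c \<odot> x \<in> carrier A"
    and smult_l_distr: "x \<in> carrier A \<Longrightarrow> (c + d) \<odot> x = c \<odot> x \<oplus> d \<odot> x"
    and smult_r_distr: "x \<in> carrier A \<Longrightarrow> y \<in> carrier A \<Longrightarrow> c \<odot> (x \<oplus> y) = c \<odot> x \<oplus> c \<odot> y"
    and smult_assoc1: "x \<in> carrier A \<Longrightarrow> (c * d) \<odot> x = c \<odot> (d \<odot> x)"
    and smult_one: "x \<in> carrier A \<Longrightarrow> 1 \<odot> x = x"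
    and m_closed: "x \<in> carrier A \<Longrightarrow> y \<in> carrier A \<Longrightarrow> x \<otimes> y \<in> carrier A"
    and m_assoc: "x \<in> carrier A \<Longrightarrow> y \<in> carrier A \<Longrightarrow> z \<in> carrier A \<Longrightarrow>
          (x \<otimes> y) \<otimes> z = x \<otimes> (y \<otimes> z)"
    and l_distr: "x \<in> carrier A \<Longrightarrow> y \<in> carrier A \<Longrightarrow> z \<in> carrier A \<Longrightarrow>
          (x \<oplus> y) \<otimes> z = x \<otimes> z \<oplus> y \<otimes> z"
    and r_distr: "x \<in> carrier A \<Longrightarrow> y \<in> carrier A \<Longrightarrow> z \<in> carrier A \<Longrightarrow>
          z \<otimes> (x \<oplus> y) = z \<otimes> x \<oplus> z \<otimes> y"
    and smult_mult_l: "x \<in> carrier A \<Longrightarrow> y \<in> carrier A \<Longrightarrow> (c \<odot> x) \<otimes> y = c \<odot> (x \<otimes> y)"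
    and smult_mult_r: "x \<in> carrier A \<Longrightarrow> y \<in> carrier A \<Longrightarrow> x \<otimes> (c \<odot> y) = c \<odot> (x \<otimes> y)"
    and star_closed: "x \<in> carrier A \<Longrightarrow> star A x \<in> carrier A"
    and star_star: "x \<in> carrier A \<Longrightarrow> star A (star A x) = x"
    and star_add: "x \<in> carrier A \<Longrightarrow> y \<in> carrier A \<Longrightarrow> star A (x \<oplus> y) = star A x \<oplus> star A y"
    and star_smult: "x \<in> carrier A \<Longrightarrow> star A (c \<odot> x) = cnj c \<odot> star A x"
    and star_mult: "x \<in> carrier A \<Longrightarrow> y \<in> carrier A \<Longrightarrow> star A (x \<otimes> y) = star A y \<otimes> star A x"
    and norm_nonneg: "x \<in> carrier A \<Longrightarrow> 0 \<le> cnorm A x"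
    and norm_eq_zero: "x \<in> carrier A \<Longrightarrow> cnorm A x = 0 \<longleftrightarrow> x = \<zero>"
    and norm_triangle: "x \<in> carrier A \<Longrightarrow> y \<in> carrier A \<Longrightarrow> cnorm A (x \<oplus> y) \<le> cnorm A x + cnorm A y"
    and norm_smult: "x \<in> carrier A \<Longrightarrow> cnorm A (c \<odot> x) = cmod c * cnorm A x"
    and norm_mult: "x \<in> carrier A \<Longrightarrow> y \<in> carrier A \<Longrightarrow> cnorm A (x \<otimes> y) \<le> cnorm A x * cnorm A y"
    and cstar_identity: "x \<in> carrier A \<Longrightarrow> cnorm A (star A x \<otimes> x) = (cnorm A x)\<^sup>2"
    and complete: "Metric_space.mcomplete (carrier A) (cdist A)"

definition positive :: "('a, 'm) cstar_scheme \<Rightarrow> 'a \<Rightarrow> bool" where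
  "positive A x \<longleftrightarrow> (\<exists>y\<in>carrier A. x = star A y \<otimes>\<^bsub>A\<^esub> y)"


section \<open>Matrix algebras\<close>

definition idx :: "nat \<Rightarrow> (nat \<times> nat) set" where
  "idx r = {..<r} \<times> {..<r}"

definition mats :: "nat \<Rightarrow> 'a set \<Rightarrow> (nat \<times> nat \<Rightarrow> 'a) set" where
  "mats r X = idx r \<rightarrow>\<^sub>E X"

definition mat_alg_with :: "nat \<Rightarrow> ('a, 'm) cstar_scheme \<Rightarrow> ((nat \<times> nat \<Rightarrow> 'a) \<Rightarrow> real)
    \<Rightarrow> (nat \<times> nat \<Rightarrow> 'a) cstar" where
  "mat_alg_with r A N =
    \<lparr>carrier = mats r (carrier A),
     mult = (\<lambda>x y. \<lambda>(i, j)\<in>idx r. \<Oplus>\<^bsub>A\<^esub>k\<in>{..<r}. x (i, k) \<otimes>\<^bsub>A\<^esub> y (k, j)),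
     one = undefined,
     zero = (\<lambda>p\<in>idx r. \<zero>\<^bsub>A\<^esub>),
     add = (\<lambda>x y. \<lambda>p\<in>idx r. x p \<oplus>\<^bsub>A\<^esub> y p),
     smult = (\<lambda>c x. \<lambda>p\<in>idx r. c \<odot>\<^bsub>A\<^esub> x p),
     star = (\<lambda>x. \<lambda>(i, j)\<in>idx r. star A (x (j, i))),
     cnorm = N\<rparr>"

text \<open>For a C*-algebra \<open>A\<close> the *-algebra of matrices over \<open>A\<close> carries exactly one C*-norm, so the
  choice only concerns values off the carrier.\<close>

definition mat_alg :: "nat \<Rightarrow> ('a, 'm) cstar_scheme \<Rightarrow> (nat \<times> nat \<Rightarrow> 'a) cstar" where
  "mat_alg r A = mat_alg_with r A (SOME N. cstar_algebra (mat_alg_with r A N))"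

definition amplify :: "nat \<Rightarrow> ('a \<Rightarrow> 'b) \<Rightarrow> (nat \<times> nat \<Rightarrow> 'a) \<Rightarrow> (nat \<times> nat \<Rightarrow> 'b)" where
  "amplify r \<theta> x = (\<lambda>p\<in>idx r. \<theta> (x p))"


section \<open>Maps between self-adjoint subspaces\<close>

definition selfadjoint_subspace :: "('a, 'm) cstar_scheme \<Rightarrow> 'a set \<Rightarrow> bool" where
  "selfadjoint_subspace A X \<longleftrightarrow> X \<subseteq> carrier A \<and> \<zero>\<^bsub>A\<^esub> \<in> X \<and>
     (\<forall>x\<in>X. \<forall>y\<in>X. x \<oplus>\<^bsub>A\<^esub> y \<in> X) \<and> (\<forall>c. \<forall>x\<in>X. c \<odot>\<^bsub>A\<^esub> x \<in> X) \<and> (\<forall>x\<in>X. star A x \<in> X)"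

definition star_linear ::
  "('a, 'm) cstar_scheme \<Rightarrow> 'a set \<Rightarrow> ('b, 'n) cstar_scheme \<Rightarrow> 'b set \<Rightarrow> ('a \<Rightarrow> 'b) \<Rightarrow> bool" where
  "star_linear A X B Y \<theta> \<longleftrightarrow>
     cstar_algebra A \<and> selfadjoint_subspace A X \<and> cstar_algebra B \<and> selfadjoint_subspace B Y \<and>
     \<theta> \<in> X \<rightarrow> Y \<and>
     (\<forall>x\<in>X. \<forall>y\<in>X. \<theta> (x \<oplus>\<^bsub>A\<^esub> y) = \<theta> x \<oplus>\<^bsub>B\<^esub> \<theta> y) \<and>
     (\<forall>c. \<forall>x\<in>X. \<theta> (c \<odot>\<^bsub>A\<^esub> x) = c \<odot>\<^bsub>B\<^esub> \<theta> x) \<and>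
     (\<forall>x\<in>X. \<theta> (star A x) = star B (\<theta> x))"

definition completely_positive ::
  "('a, 'm) cstar_scheme \<Rightarrow> 'a set \<Rightarrow> ('b, 'n) cstar_scheme \<Rightarrow> 'b set \<Rightarrow> ('a \<Rightarrow> 'b) \<Rightarrow> bool" where
  "completely_positive A X B Y \<theta> \<longleftrightarrow> star_linear A X B Y \<theta> \<and>
     (\<forall>r\<ge>1. \<forall>x\<in>mats r X. positive (mat_alg r A) x \<longrightarrow> positive (mat_alg r B) (amplify r \<theta> x))"

definition completely_isometric ::
  "('a, 'm) cstar_scheme \<Rightarrow> 'a set \<Rightarrow> ('b, 'n) cstar_scheme \<Rightarrow> 'b set \<Rightarrow> ('a \<Rightarrow> 'b) \<Rightarrow> bool" where
  "completely_isometric A X B Y \<theta> \<longleftrightarrow> star_linear A X B Y \<theta> \<and>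
     (\<forall>r\<ge>1. \<forall>x\<in>mats r X. cnorm (mat_alg r B) (amplify r \<theta> x) = cnorm (mat_alg r A) x)"

definition complete_order_embedding ::
  "('a, 'm) cstar_scheme \<Rightarrow> 'a set \<Rightarrow> ('b, 'n) cstar_scheme \<Rightarrow> 'b set \<Rightarrow> ('a \<Rightarrow> 'b) \<Rightarrow> bool" where
  "complete_order_embedding A X B Y \<theta> \<longleftrightarrow>
     completely_positive A X B Y \<theta> \<and> completely_isometric A X B Y \<theta> \<and>
     completely_positive B (\<theta> ` X) A X (inv_into X \<theta>)"

definition cpc :: "('a, 'm) cstar_scheme \<Rightarrow> ('b, 'n) cstar_scheme \<Rightarrow> ('a \<Rightarrow> 'b) \<Rightarrow> bool" where
  "cpc A B \<theta> \<longleftrightarrow> completely_positive A (carrier A) B (carrier B) \<theta> \<and>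
     (\<forall>x\<in>carrier A. cnorm B (\<theta> x) \<le> cnorm A x)"


section \<open>Sequence algebras\<close>

definition prod_alg :: "(nat \<Rightarrow> 'a cstar) \<Rightarrow> (nat \<Rightarrow> 'a) cstar" where
  "prod_alg A =
    \<lparr>carrier = {a. (\<forall>n. a n \<in> carrier (A n)) \<and> bdd_above (range (\<lambda>n. cnorm (A n) (a n)))},
     mult = (\<lambda>a b n. a n \<otimes>\<^bsub>A n\<^esub> b n),
     one = undefined,
     zero = (\<lambda>n. \<zero>\<^bsub>A n\<^esub>),
     add = (\<lambda>a b n. a n \<oplus>\<^bsub>A n\<^esub> b n),
     smult = (\<lambda>c a n. c \<odot>\<^bsub>A n\<^esub> a n),
     star = (\<lambda>a n. star (A n) (a n)),
     cnorm = (\<lambda>a. SUP n. cnorm (A n) (a n))\<rparr>"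

definition c0_sum :: "(nat \<Rightarrow> 'a cstar) \<Rightarrow> (nat \<Rightarrow> 'a) set" where
  "c0_sum A = {a. (\<forall>n. a n \<in> carrier (A n)) \<and> (\<lambda>n. cnorm (A n) (a n)) \<longlonglongrightarrow> 0}"

text \<open>The quotient by an ideal, with the cosets of \<open>FactRing\<close> as elements and the quotient norm.\<close>

definition quot_alg :: "('a, 'm) cstar_scheme \<Rightarrow> 'a set \<Rightarrow> 'a set cstar" where
  "quot_alg A I =
    \<lparr>carrier = a_rcosets\<^bsub>A\<^esub> I,
     mult = rcoset_mult A I,
     one = undefined,
     zero = I,
     add = set_add A,
     smult = (\<lambda>c X. \<Union>x\<in>X. I +>\<^bsub>A\<^esub> (c \<odot>\<^bsub>A\<^esub> x)),
     star = (\<lambda>X. \<Union>x\<in>X. I +>\<^bsub>A\<^esub> star A x),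
     cnorm = (\<lambda>X. INF x\<in>X. cnorm A x)\<rparr>"

definition A_inf :: "(nat \<Rightarrow> 'a cstar) \<Rightarrow> (nat \<Rightarrow> 'a) set cstar" where
  "A_inf A = quot_alg (prod_alg A) (c0_sum A)"

definition seq_class :: "(nat \<Rightarrow> 'a cstar) \<Rightarrow> (nat \<Rightarrow> 'a) \<Rightarrow> (nat \<Rightarrow> 'a) set" where
  "seq_class A a = c0_sum A +>\<^bsub>prod_alg A\<^esub> a"


section \<open>Systems and their limits\<close>

text \<open>The connecting map of the system from \<open>A n\<close> to \<open>A (Suc n)\<close> is \<open>\<rho> n\<close>.\<close>

definition cpc_system :: "(nat \<Rightarrow> 'a cstar) \<Rightarrow> (nat \<Rightarrow> 'a \<Rightarrow> 'a) \<Rightarrow> bool" where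
  "cpc_system A \<rho> \<longleftrightarrow> (\<forall>n. cstar_algebra (A n)) \<and> (\<forall>n. cpc (A n) (A (Suc n)) (\<rho> n))"

text \<open>\<open>trans_map \<rho> m n\<close> goes from \<open>A n\<close> to \<open>A m\<close> and is meaningful for \<open>n \<le> m\<close> only.\<close>

primrec trans_map :: "(nat \<Rightarrow> 'a \<Rightarrow> 'a) \<Rightarrow> nat \<Rightarrow> nat \<Rightarrow> 'a \<Rightarrow> 'a" where
  "trans_map \<rho> 0 n = id"
| "trans_map \<rho> (Suc m) n = (if n \<le> m then \<rho> m \<circ> trans_map \<rho> m n else id)"

text \<open>The entries of index \<open>m \<le> n\<close> do not affect the class and are filled with zeros.\<close>

definition limit_map :: "(nat \<Rightarrow> 'a cstar) \<Rightarrow> (nat \<Rightarrow> 'a \<Rightarrow> 'a) \<Rightarrow> nat \<Rightarrow> 'a \<Rightarrow> (nat \<Rightarrow> 'a) set" where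
  "limit_map A \<rho> n x = seq_class A (\<lambda>m. if m > n then trans_map \<rho> m n x else \<zero>\<^bsub>A m\<^esub>)"

definition system_limit :: "(nat \<Rightarrow> 'a cstar) \<Rightarrow> (nat \<Rightarrow> 'a \<Rightarrow> 'a) \<Rightarrow> (nat \<Rightarrow> 'a) set set" where
  "system_limit A \<rho> = ctopology (A_inf A) closure_of (\<Union>n. limit_map A \<rho> n ` carrier (A n))"

definition cstar_encoding :: "(nat \<Rightarrow> 'a cstar) \<Rightarrow> (nat \<Rightarrow> 'a \<Rightarrow> 'a) \<Rightarrow> bool" where
  "cstar_encoding A \<rho> \<longleftrightarrow> cpc_system A \<rho> \<and>
     (\<forall>k. \<forall>x\<in>carrier (A k). \<forall>y\<in>carrier (A k). \<forall>\<epsilon>>0. \<exists>M>k. \<forall>m n j.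
        n > M \<and> j > M \<and> m > max n j \<longrightarrow>
        cnorm (A m)
          (trans_map \<rho> m n (trans_map \<rho> n k x \<otimes>\<^bsub>A n\<^esub> trans_map \<rho> n k y) \<ominus>\<^bsub>A m\<^esub>
           trans_map \<rho> m j (trans_map \<rho> j k x \<otimes>\<^bsub>A j\<^esub> trans_map \<rho> j k y)) < \<epsilon>)"

definition is_limit_mult :: "(nat \<Rightarrow> 'a cstar) \<Rightarrow> (nat \<Rightarrow> 'a \<Rightarrow> 'a) \<Rightarrow>
    ((nat \<Rightarrow> 'a) set \<Rightarrow> (nat \<Rightarrow> 'a) set \<Rightarrow> (nat \<Rightarrow> 'a) set) \<Rightarrow> bool" where
  "is_limit_mult A \<rho> P \<longleftrightarrow> (let L = system_limit A \<rho>; B = A_inf A in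
     (\<forall>a\<in>L. \<forall>b\<in>L. P a b \<in> L) \<and>
     (\<forall>a\<in>L. \<forall>b\<in>L. \<forall>c\<in>L. P (P a b) c = P a (P b c)) \<and>
     (\<forall>a\<in>L. \<forall>b\<in>L. \<forall>c\<in>L. P (a \<oplus>\<^bsub>B\<^esub> b) c = P a c \<oplus>\<^bsub>B\<^esub> P b c) \<and>
     (\<forall>a\<in>L. \<forall>b\<in>L. \<forall>c\<in>L. P a (b \<oplus>\<^bsub>B\<^esub> c) = P a b \<oplus>\<^bsub>B\<^esub> P a c) \<and>
     (\<forall>z. \<forall>a\<in>L. \<forall>b\<in>L. P (z \<odot>\<^bsub>B\<^esub> a) b = z \<odot>\<^bsub>B\<^esub> P a b \<and> P a (z \<odot>\<^bsub>B\<^esub> b) = z \<odot>\<^bsub>B\<^esub> P a b) \<and>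
     (\<exists>K. \<forall>a\<in>L. \<forall>b\<in>L. cnorm B (P a b) \<le> K * cnorm B a * cnorm B b) \<and>
     (\<forall>k. \<forall>x\<in>carrier (A k). \<forall>y\<in>carrier (A k).
        limitin (ctopology B)
          (\<lambda>n. limit_map A \<rho> n (trans_map \<rho> n k x \<otimes>\<^bsub>A n\<^esub> trans_map \<rho> n k y))
          (P (limit_map A \<rho> k x) (limit_map A \<rho> k y)) sequentially))"

text \<open>By density and boundedness \<open>is_limit_mult\<close> determines the product on the limit; the choice
  below only concerns arguments outside of it.\<close>

definition limit_mult :: "(nat \<Rightarrow> 'a cstar) \<Rightarrow> (nat \<Rightarrow> 'a \<Rightarrow> 'a) \<Rightarrow>
    (nat \<Rightarrow> 'a) set \<Rightarrow> (nat \<Rightarrow> 'a) set \<Rightarrow> (nat \<Rightarrow> 'a) set" where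
  "limit_mult A \<rho> = (SOME P. is_limit_mult A \<rho> P)"

definition cstar_limit :: "(nat \<Rightarrow> 'a cstar) \<Rightarrow> (nat \<Rightarrow> 'a \<Rightarrow> 'a) \<Rightarrow> (nat \<Rightarrow> 'a) set cstar" where
  "cstar_limit A \<rho> = (A_inf A)\<lparr>carrier := system_limit A \<rho>, mult := limit_mult A \<rho>\<rparr>"

end

theory Submission
  imports Defs
begin

text \<open>
  For sequences \<open>a\<close>, \<open>b\<close> with \<open>a\<^sub>n, b\<^sub>n \<in> A\<^sub>n\<close> representing \<open>X, Y \<in> L\<close>, the product \<open>X \<bullet> Y\<close> is the limit of
  \<open>\<rho>\<^sub>n (a\<^sub>n b\<^sub>n)\<close>. This description is available entrywise for matrices. The
  Kadison--Schwarz inequality for the maps \<open>\<rho>\<^sub>m\<^sub>,\<^sub>n\<close> gives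
  \<open>\<parallel>X\<^sup>* \<bullet> X\<parallel> \<ge> \<parallel>X\<parallel>\<^sup>2\<close> for the norm of \<open>M\<^sub>r(A\<^sub>\<infinity>)\<close> on \<open>M\<^sub>r(L)\<close>, while contractivity gives
  \<open>\<parallel>X \<bullet> Y\<parallel> \<le> \<parallel>X\<parallel> \<parallel>Y\<parallel>\<close>. So this norm is a C*-norm for \<open>\<bullet>\<close>, and by uniqueness of the C*-norm
  it is the one of \<open>M\<^sub>r(C*\<^sub>\<bullet>(L))\<close>: the identity is completely isometric. It is completely positive
  because \<open>X\<^sup>* \<bullet> X\<close> is a limit of images of the positive elements \<open>a\<^sub>n\<^sup>* a\<^sub>n\<close> and the positive cone is
  closed. For the inverse, a self-adjoint contraction \<open>x\<close> is positive if and only if \<open>\<parallel>b - x\<parallel> \<le> 1\<close> for all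
  positive contractions \<open>b\<close>; the positive contractions of
  \<open>M\<^sub>r(C*\<^sub>\<bullet>(L))\<close> are already known to be among those of \<open>M\<^sub>r(A\<^sub>\<infinity>)\<close>, and the norms agree.

  Complete positivity in the non-unital setting is reduced to Gram matrices, and the missing units are
  replaced by positive contractions \<open>e\<close> acting as approximate units.
\<close>

section \<open>Unital C*-algebras as a type class\<close>

text \<open>The algebras live on carriers and have no units, whereas positivity is handled most
  easily in a unital ring that is a type. So all C*-algebras on one type \<open>'a\<close> are
  embedded isometrically, by \<open>J\<close>, into one unital C*-algebra \<open>'a uni\<close>.
  What is constructed there must be brought back, hence the clauses about closed subalgebras
  \<open>csub\<close>. Neither spectrum nor functional calculus occurs: roots come from an iteration
  with a scalar majorant, and positivity of a self-adjoint h becomes the norm condition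
  \<open>norm (t *\<^sub>R 1 - h) \<le> t\<close>. The obstacle is that the limit maps are not
  multiplicative, so associativity of \<bullet> is not inherited from the algebras of the system.
  The defect \<rho>(x y) - \<rho>(x) \<rho>(y) is controlled by a Cauchy-Schwarz inequality for
  defects, in which one factor is small by the encoding condition. Since \<open>mat_alg\<close>
  chooses its norm by \<open>SOME\<close>, uniqueness of the C*-norm is what makes that norm
  computable: as an operator norm in general, as a limit superior over \<open>A_inf A\<close>, and
  over the C*-limit as the norm inherited from \<open>A_inf A\<close>.\<close>

text \<open>The imaginary unit \<open>iu\<close> turns the real algebra into a complex one.\<close>

class ucstar = real_normed_algebra_1 + banach +
  fixes adj :: "'a \<Rightarrow> 'a" and iu :: 'a
  assumes adj_add: "adj (x + y) = adj x + adj y"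
    and adj_mult: "adj (x * y) = adj y * adj x"
    and adj_adj [simp]: "adj (adj x) = x"
    and adj_scaleR [simp]: "adj (r *\<^sub>R x) = r *\<^sub>R adj x"
    and iu_commute: "iu * x = x * iu"
    and iu_iu [simp]: "iu * iu = - 1"
    and adj_iu [simp]: "adj iu = - iu"
    and norm_adj_mult: "norm (adj x * x) = (norm x)\<^sup>2"

lemma adj_zero [simp]: "adj (0::'a::ucstar) = 0"
  using adj_scaleR[of 0 "0::'a"] by simp

lemma adj_minus [simp]: "adj (- x) = - adj (x::'a::ucstar)"
  using adj_scaleR[of "-1" x] by simp

lemma adj_diff: "adj (x - y) = adj x - adj (y::'a::ucstar)"
  using adj_add[of x "- y"] by simp

lemma adj_one [simp]: "adj 1 = (1::'a::ucstar)"
  by (metis adj_adj adj_mult mult_1_left mult_1_right)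

lemma adj_sum: "adj (sum f I) = (\<Sum>i\<in>I. adj (f i :: 'a::ucstar))"
  by (induction I rule: infinite_finite_induct) (auto simp: adj_add)

lemma norm_adj [simp]: "norm (adj x) = norm (x::'a::ucstar)"
proof -
  have *: "norm y \<le> norm (adj y)" for y :: 'a
  proof (cases "norm y = 0")
    case False
    have "(norm y)\<^sup>2 \<le> norm (adj y) * norm y"
      using norm_adj_mult[of y] norm_mult_ineq[of "adj y" y] by simp
    then show ?thesis using False by (simp add: power2_eq_square)
  qed simp
  show ?thesis using *[of x] *[of "adj x"] by simp
qed

lemma norm_square_sa: "adj h = h \<Longrightarrow> norm (h * h :: 'a::ucstar) = (norm h)\<^sup>2"
  using norm_adj_mult[of h] by simp

lemma tendsto_adj: "(f \<longlongrightarrow> l) F \<Longrightarrow> ((\<lambda>x. adj (f x)) \<longlongrightarrow> adj (l::'a::ucstar)) F"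
  by (simp add: tendsto_iff dist_norm flip: adj_diff)

lemma tendsto_unique_adj:
  fixes f :: "nat \<Rightarrow> 'a::ucstar"
  assumes "f \<longlonglongrightarrow> l" "\<And>n. adj (f n) = f n" shows "adj l = l"
  using LIMSEQ_unique[OF tendsto_adj[OF assms(1)]] assms by simp

text \<open>Closed real subalgebras, without a unit and without closure under \<open>adj\<close>.
  Two instances matter: commutants, through which a root of h commutes with whatever h commutes
  with, and the image of a non-unital algebra under \<open>J\<close>, in which roots of its elements
  must remain.\<close>

definition csub :: "'a::ucstar set \<Rightarrow> bool" where
  "csub C \<longleftrightarrow> closed C \<and> subspace C \<and> (\<forall>x\<in>C. \<forall>y\<in>C. x * y \<in> C)"

lemma csub_closed: "csub C \<Longrightarrow> (\<And>n. f n \<in> C) \<Longrightarrow> f \<longlonglongrightarrow> l \<Longrightarrow> l \<in> C"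
  unfolding csub_def by (metis closed_sequentially)

lemma csub_rules:
  assumes "csub C"
  shows "x \<in> C \<Longrightarrow> y \<in> C \<Longrightarrow> x + y \<in> C" "x \<in> C \<Longrightarrow> y \<in> C \<Longrightarrow> x - y \<in> C"
    "x \<in> C \<Longrightarrow> y \<in> C \<Longrightarrow> x * y \<in> C" "x \<in> C \<Longrightarrow> r *\<^sub>R x \<in> C" "0 \<in> C" "x \<in> C \<Longrightarrow> - x \<in> C"
  using assms unfolding csub_def by (auto intro: subspace_add subspace_diff subspace_scale subspace_0 subspace_neg)

lemma csub_commutant: "csub {x::'a::ucstar. x * z = z * x}"
proof -
  have "{x. x * z = z * x} = (\<lambda>x. x * z - z * x) -` {0}" by auto
  moreover have "closed ((\<lambda>x. x * z - z * x) -` {0})"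
    by (rule closed_vimage) (auto intro!: continuous_intros)
  moreover have "subspace {x. x * z = z * x}"
    by (auto simp: subspace_def algebra_simps)
  moreover have "x * y * z = z * (x * y)" if "x * z = z * x" "y * z = z * y" for x y :: 'a
    by (metis mult.assoc that)
  ultimately show ?thesis by (auto simp: csub_def)
qed

subsection \<open>Square roots\<close>

text \<open>A fixed point s satisfies s + s - s * s = h, so 1 - s is a square root of 1 - h.\<close>

primrec rt :: "'a::ucstar \<Rightarrow> nat \<Rightarrow> 'a" where
  "rt h 0 = 0"
| "rt h (Suc n) = (1/2) *\<^sub>R (h + rt h n * rt h n)"

text \<open>The same iteration for the real number h = 1. It increases to 1 and dominates
  \<open>rt h\<close> in norm for every contraction h, which takes the place of estimates on a
  binomial series.\<close>

primrec rtr :: "nat \<Rightarrow> real" where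
  "rtr 0 = 0"
| "rtr (Suc n) = (1 + rtr n * rtr n) / 2"

lemma rtr_bounds: "0 \<le> rtr n \<and> rtr n \<le> 1"
proof (induction n)
  case (Suc n)
  then have "rtr n * rtr n \<le> 1" by (simp add: mult_le_one)
  then show ?case using Suc by simp
qed simp

lemma rtr_mono: "rtr n \<le> rtr (Suc n)"
proof -
  have "0 \<le> (1 - rtr n)\<^sup>2" by simp
  then show ?thesis by (simp add: power2_eq_square algebra_simps)
qed

lemma rtr_tendsto: "rtr \<longlonglongrightarrow> 1"
proof -
  have "incseq rtr" by (rule incseq_SucI) (rule rtr_mono)
  then obtain l where l: "rtr \<longlonglongrightarrow> l"
    using incseq_convergent[of rtr 1] rtr_bounds by blast
  have "(\<lambda>n. (1 + rtr n * rtr n) / 2) \<longlonglongrightarrow> (1 + l * l) / 2" by (intro tendsto_intros l) simp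
  moreover have "(\<lambda>n. (1 + rtr n * rtr n) / 2) \<longlonglongrightarrow> l"
    using LIMSEQ_Suc[OF l] by simp
  ultimately have "l = (1 + l * l) / 2" using LIMSEQ_unique by blast
  then have "(l - 1)\<^sup>2 = 0" by (simp add: power2_eq_square algebra_simps)
  then show ?thesis using l by simp
qed

lemma rt_commute: "rt h n * rt h m = rt h m * rt h n" "h * rt h n = rt h n * h"
proof -
  have c: "rt h n * z = z * rt h n" if "z * h = h * z" for z n
  proof (induction n)
    case (Suc n)
    have "rt h n * rt h n * z = z * (rt h n * rt h n)" by (metis Suc mult.assoc)
    then show ?case using that by (simp add: algebra_simps)
  qed simp
  show h: "h * rt h n = rt h n * h" for n using c[of h] by simp
  show "rt h n * rt h m = rt h m * rt h n" using c[of "rt h m" n] h[of m] by simp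
qed

lemma rt_norm: "norm h \<le> 1 \<Longrightarrow> norm (rt h n) \<le> rtr n"
proof (induction n)
  case (Suc n)
  have "norm (rt h n * rt h n) \<le> rtr n * rtr n"
    by (rule order_trans[OF norm_mult_ineq mult_mono]) (use Suc rtr_bounds[of n] in auto)
  then have "norm (h + rt h n * rt h n) \<le> 1 + rtr n * rtr n"
    using Suc.prems norm_triangle_ineq[of h "rt h n * rt h n"] by linarith
  then show ?case by simp
qed simp

text \<open>The iterates commute, so one step of the iteration is half the product of the previous
  difference and the sum of the two iterates. The same identity holds for \<open>rtr\<close>, and
  each factor is dominated by its scalar counterpart.\<close>

lemma rt_diff: "norm h \<le> 1 \<Longrightarrow> norm (rt h (Suc n) - rt h n) \<le> rtr (Suc n) - rtr n"
proof (induction n)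
  case (Suc n)
  let ?s = "rt h (Suc n)" and ?t = "rt h n"
  have *: "rt h (Suc (Suc n)) - ?s = (1/2) *\<^sub>R ((?s - ?t) * (?s + ?t))"
  proof -
    have "(?s - ?t) * (?s + ?t) = ?s * ?s - ?t * ?t"
      using rt_commute(1)[of h "Suc n" n] by (simp only: distrib_left distrib_right left_diff_distrib right_diff_distrib) simp
    then have "(1/2) *\<^sub>R ((?s - ?t) * (?s + ?t)) = (1/2) *\<^sub>R ((h + ?s * ?s) - (h + ?t * ?t))"
      by simp
    also have "\<dots> = rt h (Suc (Suc n)) - ?s"
      by (simp only: rt.simps scaleR_diff_right)
    finally show ?thesis by simp
  qed
  have "norm (?s + ?t) \<le> rtr (Suc n) + rtr n"
    using norm_triangle_ineq[of ?s ?t] rt_norm[OF Suc.prems, of n] rt_norm[OF Suc.prems, of "Suc n"]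
    by linarith
  then have "norm ((?s - ?t) * (?s + ?t)) \<le> (rtr (Suc n) - rtr n) * (rtr (Suc n) + rtr n)"
    by (intro order_trans[OF norm_mult_ineq mult_mono] Suc) (use rtr_mono[of n] in auto)
  also have "\<dots> = rtr (Suc n) * rtr (Suc n) - rtr n * rtr n" by (simp only: algebra_simps)
  finally have 1: "norm ((?s - ?t) * (?s + ?t)) \<le> rtr (Suc n) * rtr (Suc n) - rtr n * rtr n" .
  have 2: "rtr (Suc (Suc n)) - rtr (Suc n) = (rtr (Suc n) * rtr (Suc n) - rtr n * rtr n) / 2"
    by (subst (1 3) rtr.simps) (simp add: field_simps)
  show ?case unfolding * 2 norm_scaleR using 1 by simp
qed simp

text \<open>Telescoping \<open>rt_diff\<close> lets \<open>rt h\<close> inherit the Cauchy property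
  of \<open>rtr\<close>.\<close>

lemma rt_convergent:
  fixes h :: "'a::ucstar"
  assumes "norm h \<le> 1" shows "\<exists>s. rt h \<longlonglongrightarrow> s"
proof -
  have "norm (rt h (n + k) - rt h n) \<le> rtr (n + k) - rtr n" for n k
  proof (induction k)
    case (Suc k)
    then show ?case
      using rt_diff[OF assms, of "n + k"] norm_triangle_ineq[of "rt h (Suc (n+k)) - rt h (n+k)" "rt h (n+k) - rt h n"]
      by simp
  qed simp
  then have *: "n \<le> m \<Longrightarrow> norm (rt h m - rt h n) \<le> \<bar>rtr m - rtr n\<bar>" for m n
    by (metis abs_ge_self le_iff_add order_trans)
  have d: "norm (rt h m - rt h n) \<le> \<bar>rtr m - rtr n\<bar>" for m n
    using *[of n m] *[of m n] by (cases "n \<le> m") (auto simp: norm_minus_commute abs_minus_commute)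
  have "Cauchy rtr" using rtr_tendsto LIMSEQ_imp_Cauchy by blast
  then have "Cauchy (rt h)"
    unfolding Cauchy_def dist_norm by (metis d le_less_trans real_norm_def)
  then show ?thesis using Cauchy_convergent convergent_def by blast
qed

text \<open>The first membership clause keeps s in a commutant or an algebra that contains h. The
  second one is for algebras that contain 1 - h but possibly not 1: there it is the root 1 - s
  itself that has to stay inside.\<close>

lemma root_exists:
  fixes h :: "'a::ucstar"
  assumes "adj h = h" "norm h \<le> 1"
  obtains s where "adj s = s" "norm s \<le> 1" "s + s - s * s = h" "\<forall>C. csub C \<longrightarrow> h \<in> C \<longrightarrow> s \<in> C"
    "\<forall>C. csub C \<longrightarrow> 1 - h \<in> C \<longrightarrow> 1 - s \<in> C"
proof -
  obtain s where s: "rt h \<longlonglongrightarrow> s" using rt_convergent assms by blast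
  have a: "adj s = s"
  proof (rule tendsto_unique_adj[OF s])
    fix n show "adj (rt h n) = rt h n"
      by (induction n) (auto simp: adj_add adj_mult assms)
  qed
  have n: "norm s \<le> 1"
    using LIMSEQ_le_const2[OF tendsto_norm[OF s]] rt_norm[OF assms(2)] rtr_bounds
    by (meson order_trans)
  have "(\<lambda>n. (1/2) *\<^sub>R (h + rt h n * rt h n)) \<longlonglongrightarrow> (1/2) *\<^sub>R (h + s * s)"
    by (intro tendsto_intros s)
  moreover have "(\<lambda>n. (1/2) *\<^sub>R (h + rt h n * rt h n)) \<longlonglongrightarrow> s"
    using LIMSEQ_Suc[OF s] by simp
  ultimately have "s = (1/2) *\<^sub>R (h + s * s)" using LIMSEQ_unique by blast
  then have "s + s = (1/2) *\<^sub>R (h + s * s) + (1/2) *\<^sub>R (h + s * s)" by simp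
  also have "\<dots> = h + s * s" by (simp flip: scaleR_left_distrib)
  finally have e: "s + s - s * s = h" by simp
  have c: "s \<in> C" if "csub C" "h \<in> C" for C
  proof (rule csub_closed[OF that(1) _ s])
    fix n show "rt h n \<in> C" by (induction n) (auto intro!: csub_rules[OF that(1)] that)
  qed
  have d: "1 - s \<in> C" if C: "csub C" and h: "1 - h \<in> C" for C
  proof -
    \<comment> \<open>The iterate is subtracted from \<open>rtr n\<close> and not from 1, so that
      the induction starts at 0, which lies in C even when 1 does not; in the limit
      \<open>rtr n\<close> becomes 1.\<close>
    have "rtr n *\<^sub>R 1 - rt h n \<in> C" for n
    proof (induction n)
      case 0 show ?case by (simp add: csub_rules[OF C])
    next
      case (Suc n)
      let ?c = "rtr n *\<^sub>R 1 - rt h n"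
      have "rt h n * rt h n = (rtr n * rtr n) *\<^sub>R 1 - (2 * rtr n) *\<^sub>R ?c + ?c * ?c"
      proof -
        have "(rtr n * rtr n) *\<^sub>R 1 - (2 * rtr n) *\<^sub>R ?c + ?c * ?c =
          (2 * (rtr n * rtr n)) *\<^sub>R 1 - (2 * (rtr n * rtr n)) *\<^sub>R 1 + rt h n * rt h n"
          by (simp add: algebra_simps scaleR_2 flip: scaleR_add_left)
        then show ?thesis by simp
      qed
      then have "rtr (Suc n) *\<^sub>R 1 - rt h (Suc n) =
        (1/2) *\<^sub>R ((1 - h) + (2 * rtr n) *\<^sub>R ?c - ?c * ?c)"
        by (simp add: algebra_simps add_divide_distrib)
      moreover have "(1/2) *\<^sub>R ((1 - h) + (2 * rtr n) *\<^sub>R ?c - ?c * ?c) \<in> C"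
        by (intro csub_rules[OF C] h Suc)
      ultimately show ?case by metis
    qed
    moreover have "(\<lambda>n. rtr n *\<^sub>R 1 - rt h n) \<longlonglongrightarrow> 1 *\<^sub>R 1 - s"
      by (intro tendsto_intros rtr_tendsto s)
    ultimately show ?thesis using csub_closed[OF C, of "\<lambda>n. rtr n *\<^sub>R 1 - rt h n"] by simp
  qed
  show thesis using that[OF a n e] c d by blast
qed

subsection \<open>Positive elements\<close>

text \<open>With squares of self-adjoint elements, \<open>pos_norm\<close> and
  \<open>pos_root\<close> turn positivity into a norm condition, from which sums and limits follow
  at once. Agreement with the form \<open>adj y * y\<close> is a theorem,
  \<open>pos_adj_mult\<close>.\<close>

definition pos :: "'a::ucstar \<Rightarrow> bool" where
  "pos h \<longleftrightarrow> (\<exists>k. adj k = k \<and> h = k * k)"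

lemma pos_sa: "pos h \<Longrightarrow> adj h = h"
  unfolding pos_def by (auto simp: adj_mult)

lemma pos_square: "adj k = k \<Longrightarrow> pos (k * k)"
  unfolding pos_def by auto

lemma mult_iu_left: "x * (iu * y) = iu * (x * y)" for x y :: "'a::ucstar"
  by (metis iu_commute mult.assoc)

lemma iu_mult_iu [simp]: "iu * (iu * x) = - x" for x :: "'a::ucstar"
  by (metis iu_iu mult.assoc mult_minus1)

text \<open>Here m and k act as real and imaginary part. If m * m + k * k is a scalar, the
  C*-identity gives the norm of the whole element and thereby a bound for its real part.\<close>

lemma adj_mult_add_iu:
  fixes m :: "'a::ucstar"
  assumes "adj m = m" "adj k = k" "m * k = k * m"
  shows "adj (m + iu * k) * (m + iu * k) = m * m + k * k"
proof -
  have a: "adj (m + iu * k) = m - iu * k" by (simp add: adj_add adj_mult assms iu_commute)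
  show ?thesis unfolding a
    by (simp add: distrib_left left_diff_distrib mult.assoc assms(3) mult_iu_left[of m] mult_iu_left[of k])
qed

text \<open>k is completed to u = m + i k with \<open>adj u * u = 1\<close>, where m squares to 1 -
  k * k and commutes with k. As the real part of u, m is a contraction, and so is its
  square.\<close>

lemma norm_one_minus_square:
  fixes k :: "'a::ucstar"
  assumes k: "adj k = k" "norm k \<le> 1"
  shows "norm (1 - k * k) \<le> 1"
proof -
  have "norm (k * k) \<le> 1" using norm_mult_ineq[of k k] k(2) by (meson mult_le_one norm_ge_zero order_trans)
  then obtain s where s: "adj s = s" "s + s - s * s = k * k" "\<forall>C. csub C \<longrightarrow> k * k \<in> C \<longrightarrow> s \<in> C"
    using root_exists[of "k * k"] k by (metis adj_mult)
  have sk: "s * k = k * s" using s(3)[rule_format, OF csub_commutant[of k]] by (simp add: mult.assoc)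
  define m u where "m = 1 - s" and "u = m + iu * k"
  have mm: "m * m = 1 - k * k" unfolding m_def s(2)[symmetric] by (simp add: algebra_simps)
  have mk: "m * k = k * m" by (simp add: m_def algebra_simps sk)
  have ma: "adj m = m" by (simp add: m_def adj_diff s)
  have au: "adj u = m - iu * k" by (simp add: u_def adj_add adj_mult ma k iu_commute)
  have "adj u * u = 1" using adj_mult_add_iu[OF ma k(1) mk] mm by (simp add: u_def)
  then have "(norm u)\<^sup>2 \<le> 1\<^sup>2" using norm_adj_mult[of u] by simp
  then have "norm u \<le> 1" by (rule power2_le_imp_le) simp
  moreover have "2 *\<^sub>R m = u + adj u" unfolding au by (simp add: u_def scaleR_2)
  ultimately have "norm (2 *\<^sub>R m) \<le> 2" using norm_triangle_ineq[of u "adj u"] by simp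
  then have "norm m \<le> 1" by simp
  then show ?thesis unfolding mm[symmetric] using norm_mult_ineq[of m m]
    by (meson mult_le_one norm_ge_zero order_trans)
qed

text \<open>Scaling the self-adjoint root of h by 1 / sqrt t reduces this to
  \<open>norm_one_minus_square\<close>. That every t above the norm is admissible, and not only the
  norm, is what makes the condition additive.\<close>

lemma pos_norm:
  assumes "pos h" "norm h \<le> t" shows "norm (t *\<^sub>R 1 - h) \<le> t"
proof (cases "t = 0")
  case False
  then have t: "t > 0" using assms(2) norm_ge_zero[of h] by linarith
  obtain k where k: "adj k = k" "h = k * k" using assms unfolding pos_def by auto
  have "(norm k)\<^sup>2 \<le> t" using assms(2) norm_square_sa[of k] k by simp
  then have "norm k \<le> sqrt t" by (simp add: real_le_rsqrt)
  then have "norm ((1 / sqrt t) *\<^sub>R k) \<le> 1" using t by (simp add: field_simps)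
  then have "norm (1 - ((1 / sqrt t) *\<^sub>R k) * ((1 / sqrt t) *\<^sub>R k)) \<le> 1"
    by (intro norm_one_minus_square) (use k in auto)
  also have "1 - ((1 / sqrt t) *\<^sub>R k) * ((1 / sqrt t) *\<^sub>R k) = (1/t) *\<^sub>R (t *\<^sub>R 1 - h)"
    using t by (simp add: k algebra_simps)
  finally have "(1/t) * norm (t *\<^sub>R 1 - h) \<le> 1" using t by (simp only: norm_scaleR) simp
  then show ?thesis using t by (simp add: field_simps)
qed (use assms in auto)

text \<open>Converse of \<open>pos_norm\<close>: for g = 1 - h / t, a contraction,
  \<open>root_exists\<close> provides s with s + s - s * s = g, and sqrt t times 1 - s squares to h.
  The last clause is the norm condition for the root itself, which makes it positive again.\<close>

lemma pos_root:
  fixes h :: "'a::ucstar"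
  assumes "adj h = h" "norm (t *\<^sub>R 1 - h) \<le> t"
  obtains k where "adj k = k" "k * k = h" "\<forall>C. csub C \<longrightarrow> h \<in> C \<longrightarrow> k \<in> C"
    "norm (sqrt t *\<^sub>R 1 - k) \<le> sqrt t"
proof (cases "t \<le> 0")
  case True
  then have "t = 0" using assms(2) norm_ge_zero[of "t *\<^sub>R 1 - h"] by linarith
  then have "t = 0" "h = 0" using assms(2) by auto
  then show thesis using that[of 0] csub_rules(5) by auto
next
  case False
  then have t: "t > 0" by simp
  let ?g = "(1/t) *\<^sub>R (t *\<^sub>R 1 - h)"
  have g: "?g = 1 - (1/t) *\<^sub>R h" using t by (simp add: algebra_simps)
  have "norm ?g = (1/t) * norm (t *\<^sub>R 1 - h)" using t by (simp only: norm_scaleR) simp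
  also have "\<dots> \<le> 1" using assms t by (simp add: field_simps)
  finally have n: "norm ?g \<le> 1" .
  have a: "adj ?g = ?g" by (simp add: adj_diff assms)
  obtain s where s: "adj s = s" "norm s \<le> 1" "s + s - s * s = ?g"
      "\<forall>C. csub C \<longrightarrow> ?g \<in> C \<longrightarrow> s \<in> C"
      "\<forall>C. csub C \<longrightarrow> 1 - ?g \<in> C \<longrightarrow> 1 - s \<in> C"
    by (rule root_exists[OF a n])
  define k where "k = sqrt t *\<^sub>R (1 - s)"
  have "(1 - s) * (1 - s) = (1/t) *\<^sub>R h"
    using s(3) unfolding g by (simp add: algebra_simps)
  then have "k * k = h" unfolding k_def using t by simp
  moreover have "adj k = k" by (simp add: k_def s adj_diff)
  moreover have "k \<in> C" if "csub C" "h \<in> C" for C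
    unfolding k_def using csub_rules(4)[OF that(1)] s(5) that g by simp
  moreover have "sqrt t *\<^sub>R 1 - k = sqrt t *\<^sub>R s" by (simp add: k_def algebra_simps)
  then have "norm (sqrt t *\<^sub>R 1 - k) \<le> sqrt t" using s t by simp
  ultimately show thesis using that by metis
qed

lemma posI: "adj h = h \<Longrightarrow> norm (t *\<^sub>R 1 - h) \<le> t \<Longrightarrow> pos h"
  using pos_root unfolding pos_def by metis

lemma pos_root':
  fixes h :: "'a::ucstar"
  assumes "pos h"
  obtains k where "adj k = k" "k * k = h" "\<forall>C. csub C \<longrightarrow> h \<in> C \<longrightarrow> k \<in> C" "pos k"
  using pos_root[OF pos_sa[OF assms] pos_norm[OF assms order_refl]] posI by metis

lemma pos_zero [simp]: "pos 0" and pos_one [simp]: "pos 1"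
  using pos_square[of 0] pos_square[of 1] by auto

text \<open>In terms of the norm condition, with t the sum of the two norms, this is the triangle
  inequality.\<close>

lemma pos_add: assumes "pos a" "pos b" shows "pos (a + b)"
proof (rule posI)
  have "(norm a + norm b) *\<^sub>R 1 - (a + b) = (norm a *\<^sub>R 1 - a) + (norm b *\<^sub>R 1 - b)"
    by (simp add: algebra_simps)
  then show "norm ((norm a + norm b) *\<^sub>R 1 - (a + b)) \<le> norm a + norm b"
    using pos_norm[OF assms(1) order_refl] pos_norm[OF assms(2) order_refl]
    by (metis norm_triangle_mono)
qed (use assms pos_sa adj_add in metis)

lemma pos_scaleR: assumes "pos a" "t \<ge> 0" shows "pos (t *\<^sub>R a)"
proof -
  obtain k where k: "adj k = k" "a = k * k" using assms unfolding pos_def by auto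
  have "t *\<^sub>R a = (sqrt t *\<^sub>R k) * (sqrt t *\<^sub>R k)" using assms by (simp add: k)
  then show ?thesis using pos_square[of "sqrt t *\<^sub>R k"] k(1) by (metis adj_scaleR)
qed

lemma pos_sum: "(\<And>i. i \<in> I \<Longrightarrow> pos (f i)) \<Longrightarrow> pos (sum f I)"
  by (induction I rule: infinite_finite_induct) (auto intro: pos_add)

text \<open>The norm condition with t = norm (f n) passes to the limit.\<close>

lemma pos_closed:
  fixes f :: "nat \<Rightarrow> 'a::ucstar"
  assumes "f \<longlonglongrightarrow> l" "\<And>n. pos (f n)" shows "pos l"
proof (rule posI)
  show "adj l = l" using tendsto_unique_adj[OF assms(1)] pos_sa assms(2) by blast
  have "(\<lambda>n. norm (norm (f n) *\<^sub>R 1 - f n)) \<longlonglongrightarrow> norm (norm l *\<^sub>R 1 - l)"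
    by (intro tendsto_intros assms)
  moreover have "(\<lambda>n. norm (f n)) \<longlonglongrightarrow> norm l" by (intro tendsto_intros assms)
  ultimately show "norm (norm l *\<^sub>R 1 - l) \<le> norm l"
    by (rule LIMSEQ_le) (use pos_norm[OF assms(2) order_refl] in auto)
qed

text \<open>The roots k of a and l of b commute: apply the subalgebra clause of
  \<open>pos_root'\<close> first to the commutant of b and then to that of k. So a * b is the square
  of the self-adjoint k * l.\<close>

lemma pos_mult_commute:
  fixes a :: "'a::ucstar"
  assumes "pos a" "pos b" "a * b = b * a" shows "pos (a * b)"
proof -
  obtain k where k: "adj k = k" "k * k = a" "\<forall>C. csub C \<longrightarrow> a \<in> C \<longrightarrow> k \<in> C"
    using pos_root'[OF assms(1)] by metis
  obtain l where l: "adj l = l" "l * l = b" "\<forall>C. csub C \<longrightarrow> b \<in> C \<longrightarrow> l \<in> C"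
    using pos_root'[OF assms(2)] by metis
  have "k * b = b * k" using k(3)[rule_format, OF csub_commutant[of b]] assms(3) by simp
  then have lk: "l * k = k * l" using l(3)[rule_format, OF csub_commutant[of k]] by simp
  have "a * b = (k * l) * (k * l)" by (metis k(2) l(2) lk mult.assoc)
  moreover have "adj (k * l) = k * l" by (simp add: adj_mult k l lk)
  ultimately show ?thesis using pos_square by metis
qed

text \<open>As in \<open>norm_one_minus_square\<close>: commuting roots k of a and l of t - a
  combine to u = k + i l with \<open>adj u * u\<close> equal to t, and k is the real part of
  u.\<close>

lemma pos_le_norm:
  fixes a :: "'a::ucstar"
  assumes "pos a" "pos (t *\<^sub>R 1 - a)" "t \<ge> 0" shows "norm a \<le> t"
proof -
  obtain k where k: "adj k = k" "k * k = a" "\<forall>C. csub C \<longrightarrow> a \<in> C \<longrightarrow> k \<in> C"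
    using pos_root'[OF assms(1)] by metis
  obtain l where l: "adj l = l" "l * l = t *\<^sub>R 1 - a" "\<forall>C. csub C \<longrightarrow> t *\<^sub>R 1 - a \<in> C \<longrightarrow> l \<in> C"
    using pos_root'[OF assms(2)] by metis
  have "(t *\<^sub>R 1 - a) * k = k * (t *\<^sub>R 1 - a)" by (simp add: algebra_simps mult.assoc flip: k(2))
  then have lk: "l * k = k * l" using l(3)[rule_format, OF csub_commutant[of k]] by simp
  define u where "u = k + iu * l"
  have au: "adj u = k - iu * l" by (simp add: u_def adj_add adj_mult k l iu_commute)
  have "adj u * u = t *\<^sub>R 1"
    using adj_mult_add_iu[OF k(1) l(1) lk[symmetric]] by (simp add: u_def k l)
  then have "(norm u)\<^sup>2 = t" using norm_adj_mult[of u] assms(3) by simp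
  then have nu: "norm u = sqrt t" by (metis norm_ge_zero real_sqrt_unique)
  have "2 *\<^sub>R k = u + adj u" unfolding au by (simp add: u_def scaleR_2)
  then have "norm (2 *\<^sub>R k) \<le> 2 * sqrt t" using norm_triangle_ineq[of u "adj u"] nu by simp
  then have "norm k \<le> sqrt t" by simp
  then have "norm k * norm k \<le> sqrt t * sqrt t" by (intro mult_mono) (use assms(3) in auto)
  then show ?thesis using norm_square_sa[OF k(1)] k(2) assms(3) by (simp add: power2_eq_square)
qed

lemma pos_diff_norm: "adj b = b \<Longrightarrow> norm b \<le> t \<Longrightarrow> pos (t *\<^sub>R 1 - b)"
  by (rule posI[of _ t]) (auto simp: adj_diff)

lemma pos_norm_mono:
  assumes "pos a" "pos (b - a)" shows "norm a \<le> norm b"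
proof (rule pos_le_norm[OF assms(1)])
  have "adj b = b" using pos_sa[OF assms(1)] pos_sa[OF assms(2)] by (simp add: adj_diff)
  then have "pos ((b - a) + (norm b *\<^sub>R 1 - b))" using pos_add assms pos_diff_norm by blast
  then show "pos (norm b *\<^sub>R 1 - a)" by simp
qed simp

lemma pos_antisym: "pos a \<Longrightarrow> pos (- a) \<Longrightarrow> a = 0"
  using pos_le_norm[of a 0] by simp

text \<open>The two positive elements commute, so their product is positive, and it bounds x * x by
  the square of t.\<close>

lemma norm_le_both:
  fixes x :: "'a::ucstar"
  assumes "pos (t *\<^sub>R 1 - x)" "pos (t *\<^sub>R 1 + x)" "t \<ge> 0" shows "norm x \<le> t"
proof -
  have x: "adj x = x" using pos_sa[OF assms(2)] by (simp add: adj_add)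
  have "pos ((t *\<^sub>R 1 - x) * (t *\<^sub>R 1 + x))"
    by (intro pos_mult_commute assms) (simp add: algebra_simps)
  also have "(t *\<^sub>R 1 - x) * (t *\<^sub>R 1 + x) = t\<^sup>2 *\<^sub>R 1 - x * x" by (simp add: algebra_simps power2_eq_square)
  finally have "norm (x * x) \<le> t\<^sup>2"
    by (intro pos_le_norm pos_square[OF x]) auto
  then have "(norm x)\<^sup>2 \<le> t\<^sup>2" by (simp only: norm_square_sa[OF x])
  then show ?thesis using assms(3) by (rule power2_le_imp_le)
qed

lemma norm_diff_contractions:
  fixes p :: "'a::ucstar"
  assumes "pos p" "pos q" "norm p \<le> 1" "norm q \<le> 1" shows "norm (p - q) \<le> 1"
proof (rule norm_le_both)
  have "pos ((1 *\<^sub>R 1 - p) + q)" "pos ((1 *\<^sub>R 1 - q) + p)"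
    using assms by (intro pos_add pos_diff_norm pos_sa; simp)+
  then show "pos (1 *\<^sub>R 1 - (p - q))" "pos (1 *\<^sub>R 1 + (p - q))" by (simp_all add: algebra_simps)
qed simp

lemma sa_square_zero:
  fixes h :: "'a::ucstar"
  shows "adj h = h \<Longrightarrow> h * h = 0 \<Longrightarrow> h = 0"
  using norm_square_sa[of h] by simp

section \<open>Positivity of \<open>adj x * x\<close>\<close>

text \<open>Cartesian decomposition: with a = y + \<open>adj y\<close> and b = i (y -
  \<open>adj y\<close>), both self-adjoint, the sum is half of a * a + b * b.\<close>

lemma pos_adj_mult_add_mult_adj: "pos (adj y * y + y * adj y)"
proof -
  define a b where "a = y + adj y" and "b = iu * (y - adj y)"
  have a: "adj a = a" by (simp add: a_def adj_add add.commute)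
  have b: "adj b = b"
    by (simp add: b_def adj_mult adj_diff iu_commute left_diff_distrib right_diff_distrib)
  have "b * b = - ((y - adj y) * (y - adj y))"
    by (simp only: b_def mult.assoc mult_iu_left[of "y - adj y"] iu_mult_iu)
  then have "a * a + b * b = 2 *\<^sub>R (adj y * y + y * adj y)"
    by (simp add: a_def distrib_left distrib_right left_diff_distrib right_diff_distrib scaleR_2)
  then have "adj y * y + y * adj y = (1/2) *\<^sub>R (a * a + b * b)" by simp
  then show ?thesis using pos_scaleR[OF pos_add[OF pos_square[OF a] pos_square[OF b]], of "1/2"] by simp
qed

text \<open>A substitute for \<open>adj y * y\<close> and \<open>y * adj y\<close> having the same
  nonzero spectrum. Writing - \<open>adj y * y\<close> as l * l, the element T =
  \<open>y * adj y\<close> is positive, and z = \<open>l * adj y\<close> satisfies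
  \<open>adj z * z = - (T * T)\<close>, while \<open>z * adj z\<close> is - l^4. The Cartesian sum
  for z plus T * T shows that - l^4 is positive, which forces l = 0.\<close>

lemma adj_mult_eq_0_if_neg:
  assumes "pos (- (adj y * y))" shows "adj y * y = 0"
proof -
  obtain l where l: "adj l = l" "- (adj y * y) = l * l" using assms unfolding pos_def by auto
  then have l': "adj y * y = - (l * l)" by (metis minus_minus)
  define T where "T = y * adj y"
  have "pos T"
    using pos_add[OF pos_adj_mult_add_mult_adj[of y] assms] by (simp add: T_def)
  then have TT: "pos (T * T)" using pos_square pos_sa by blast
  define z where "z = l * adj y"
  have "adj z * z = y * (l * l) * adj y" by (simp add: z_def adj_mult l mult.assoc)
  also have "\<dots> = - (T * T)"
    using l' by (metis T_def minus_minus mult.assoc mult_minus_left mult_minus_right)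
  finally have 1: "adj z * z = - (T * T)" .
  have "z * adj z = l * (adj y * y) * l" by (simp add: z_def adj_mult l mult.assoc)
  then have 2: "z * adj z = - (l * l * (l * l))" by (simp add: l' mult.assoc)
  have "pos (adj z * z + z * adj z + T * T)" using pos_add[OF pos_adj_mult_add_mult_adj TT] .
  then have "pos (- (l * l * (l * l)))" by (simp add: 1 2)
  moreover have ll: "adj (l * l) = l * l" by (simp add: adj_mult l)
  then have "pos (l * l * (l * l))" by (rule pos_square)
  ultimately have "l * l * (l * l) = 0" using pos_antisym by blast
  then have "l * l = 0" using sa_square_zero[OF ll] by simp
  then show ?thesis by (simp add: l')
qed

text \<open>k is the absolute value of h. At this stage only the cube of n = k - h is accessible: n
  * n = 2 k n makes it twice the square of g n, where g is a root of k. This suffices for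
  \<open>pos_adj_mult\<close>; positivity of n itself comes from conjugation, which depends on
  \<open>pos_adj_mult\<close>.\<close>

lemma abs_exists:
  fixes h :: "'a::ucstar"
  assumes h: "adj h = h"
  obtains k where "pos k" "k * k = h * h" "k * h = h * k" "\<forall>C. csub C \<longrightarrow> h \<in> C \<longrightarrow> k \<in> C"
    "pos ((k - h) * (k - h) * (k - h))"
proof -
  obtain k where k: "pos k" "k * k = h * h" "\<forall>C. csub C \<longrightarrow> h * h \<in> C \<longrightarrow> k \<in> C"
    using pos_root'[OF pos_square[OF h]] by metis
  have kh: "k * h = h * k" using k(3)[rule_format, OF csub_commutant[of h]] by (simp add: mult.assoc)
  define n where "n = k - h"
  obtain g where g: "adj g = g" "g * g = k" "\<forall>C. csub C \<longrightarrow> k \<in> C \<longrightarrow> g \<in> C"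
    using pos_root'[OF k(1)] by metis
  have "k * n = n * k" by (simp add: n_def left_diff_distrib right_diff_distrib kh)
  then have gn: "g * n = n * g" using g(3)[rule_format, OF csub_commutant[of n]] by simp
  have nn: "n * n = 2 *\<^sub>R (k * n)"
    by (simp add: n_def left_diff_distrib right_diff_distrib kh k(2) scaleR_2)
  have an: "adj n = n" by (simp add: n_def adj_diff h pos_sa[OF k(1)])
  have "(g * n) * (g * n) = k * n * n" by (metis g(2) gn mult.assoc)
  then have "n * n * n = 2 *\<^sub>R ((g * n) * (g * n))" by (simp add: nn)
  moreover have "adj (g * n) = g * n" by (simp add: adj_mult g an gn)
  ultimately have "pos (n * n * n)" using pos_scaleR[OF pos_square, of "g * n" 2] by simp
  then show thesis using that[OF k(1,2) kh] k(3) csub_rules(3) unfolding n_def by blast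
qed

text \<open>Kaplansky's argument: with \<open>n\<close> twice the negative part of \<open>x\<^sup>* x\<close>, the element
  \<open>y = x n\<close> satisfies \<open>y\<^sup>* y = - n\<^sup>3 / 2\<close>.\<close>

lemma pos_adj_mult: "pos (adj x * x)"
proof -
  define h where "h = adj x * x"
  have h: "adj h = h" by (simp add: h_def adj_mult)
  obtain k where k: "pos k" "k * k = h * h" "k * h = h * k" "pos ((k - h) * (k - h) * (k - h))"
    using abs_exists[OF h] by metis
  define n where "n = k - h"
  have an: "adj n = n" by (simp add: n_def adj_diff h pos_sa[OF k(1)])
  have hn: "2 *\<^sub>R (h * n) = - (n * n)"
    by (simp add: n_def left_diff_distrib right_diff_distrib k(2,3) scaleR_2)
  have "adj (x * n) * (x * n) = n * (h * n)" by (simp add: adj_mult an h_def mult.assoc)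
  also have "\<dots> = (1/2) *\<^sub>R (n * (2 *\<^sub>R (h * n)))" by simp
  also have "\<dots> = - ((1/2) *\<^sub>R (n * n * n))" by (subst hn) (simp add: mult.assoc)
  finally have e: "adj (x * n) * (x * n) = - ((1/2) *\<^sub>R (n * n * n))" .
  then have "pos (- (adj (x * n) * (x * n)))"
    using pos_scaleR[OF k(4), of "1/2"] by (simp add: n_def)
  then have "(1/2) *\<^sub>R (n * n * n) = 0" using adj_mult_eq_0_if_neg e by fastforce
  then have "n * n * n = 0" by simp
  then have "(n * n) * (n * n) = 0" by (simp flip: mult.assoc)
  then have "n * n = 0" using sa_square_zero[of "n * n"] by (simp add: adj_mult an)
  then have "n = 0" using sa_square_zero[OF an] by simp
  then show ?thesis using k(1) by (simp add: n_def h_def)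
qed

lemma pos_conj:
  assumes "pos a" shows "pos (adj c * a * c)"
proof -
  obtain k where "adj k = k" "a = k * k" using assms unfolding pos_def by auto
  then have "adj c * a * c = adj (k * c) * (k * c)" by (simp add: adj_mult mult.assoc)
  then show ?thesis using pos_adj_mult by metis
qed

text \<open>With q the absolute value of n, d = q - n is twice the negative part of n: next to d, q
  acts as d / 2 and n as - d / 2. Conjugating the positive cubes of q and n by d shows that d^5 / 8
  and its negative are both positive.\<close>

lemma pos_cube_imp_pos:
  fixes n :: "'a::ucstar"
  assumes n: "adj n = n" and "pos (n * n * n)" shows "pos n"
proof -
  obtain q where q: "pos q" "q * q = n * n" "q * n = n * q" using abs_exists[OF n] by metis
  define d where "d = q - n"
  have ad: "adj d = d" by (simp add: d_def adj_diff n pos_sa[OF q(1)])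
  have dq: "d * q = (1/2) *\<^sub>R (d * d)" "q * d = (1/2) *\<^sub>R (d * d)"
    and dn: "d * n = (- 1/2) *\<^sub>R (d * d)" "n * d = (- 1/2) *\<^sub>R (d * d)"
  proof -
    have dd: "d * d = 2 *\<^sub>R (n * n) - 2 *\<^sub>R (n * q)"
      by (simp add: d_def left_diff_distrib right_diff_distrib q scaleR_2)
    show "d * q = (1/2) *\<^sub>R (d * d)" "q * d = (1/2) *\<^sub>R (d * d)"
      "d * n = (- 1/2) *\<^sub>R (d * d)" "n * d = (- 1/2) *\<^sub>R (d * d)"
      unfolding dd scaleR_diff_right by (simp_all add: d_def left_diff_distrib right_diff_distrib q)
  qed
  have dq': "d * (q * x) = (1/2) *\<^sub>R (d * (d * x))" and dn': "d * (n * x) = (- 1/2) *\<^sub>R (d * (d * x))" for x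
    using dq(1) dn(1) by (metis mult.assoc mult_scaleR_left)+
  define d5 where "d5 = d * (d * (d * (d * d)))"
  have "pos (adj d * (q * q * q) * d)"
    by (intro pos_conj pos_mult_commute q) (simp_all add: mult.assoc)
  also have "adj d * (q * q * q) * d = (1/8) *\<^sub>R d5"
    by (simp add: ad mult.assoc dq dq' d5_def)
  finally have 1: "pos ((1/8) *\<^sub>R d5)" .
  have "pos (adj d * (n * n * n) * d)" by (intro pos_conj assms)
  also have "adj d * (n * n * n) * d = - ((1/8) *\<^sub>R d5)"
    by (simp add: ad mult.assoc dn dn' d5_def)
  finally have "(1/8) *\<^sub>R d5 = 0" using pos_antisym 1 by blast
  then have "d * (d * (d * (d * d))) = 0" by (simp add: d5_def)
  \<comment> \<open>Raising d^5 = 0 to d^8 = 0 gives a power of two, from which squares of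
    self-adjoint elements are peeled off one at a time.\<close>
  then have "((d * d) * (d * d)) * ((d * d) * (d * d)) = 0" by (simp add: mult.assoc)
  then have "(d * d) * (d * d) = 0" using sa_square_zero[of "(d * d) * (d * d)"]
    by (simp add: adj_mult ad mult.assoc)
  then have "d * d = 0" using sa_square_zero[of "d * d"] by (simp add: adj_mult ad)
  then have "d = 0" using sa_square_zero[OF ad] by simp
  then show ?thesis using q(1) by (simp add: d_def)
qed

section \<open>Negative parts, tests for positivity, and the unit ball\<close>

text \<open>n is the negative part of h, n + h the positive part and n + n + h the absolute value.
  Positivity of the latter becomes positivity of h as soon as n = 0 is known.\<close>

lemma jordan_decomposition:
  fixes h :: "'a::ucstar"
  assumes h: "adj h = h" and C: "csub C" "h \<in> C"
  obtains n where "pos n" "n \<in> C" "n * (n + h) = 0" "pos (n + n + h)"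
proof -
  obtain k where k: "pos k" "k * k = h * h" "k * h = h * k" "k \<in> C" "pos ((k - h) * (k - h) * (k - h))"
    by (rule abs_exists[OF h]) (use C in blast)
  define n p where "n = (1/2) *\<^sub>R (k - h)" and "p = n + h"
  have n: "pos n"
    unfolding n_def using pos_scaleR[OF pos_cube_imp_pos[OF _ k(5)], of "1/2"]
    by (simp add: adj_diff h pos_sa[OF k(1)])
  have k2: "k = n + n + h"
    unfolding n_def scaleR_left_distrib[symmetric] by simp
  have nC: "n \<in> C" unfolding n_def by (intro csub_rules[OF C(1)] k C)
  have np: "n * p = 0"
  proof -
    have "2 *\<^sub>R (p :: 'a) = k + h" by (simp add: p_def scaleR_2 k2)
    moreover have "2 *\<^sub>R n = k - h" by (simp add: n_def)
    ultimately have "(2 *\<^sub>R n) * (2 *\<^sub>R p) = 0"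
      by (simp add: left_diff_distrib distrib_left k)
    then show ?thesis by simp
  qed
  show thesis using that[OF n nC] np k(1) k2 by (simp add: p_def)
qed

text \<open>If the negative part n of x has norm \<mu> > 0, the test element is n / \<mu>, a square
  of an element of C. As n annihilates the positive part, n times the difference of n / \<mu> and x
  is (1 / \<mu> + 1) n n, of norm \<mu> + \<mu> \<mu>, whereas the assumption allows only
  \<mu>.\<close>

lemma pos_by_contractions:
  fixes x :: "'a::ucstar"
  assumes x: "adj x = x" and C: "csub C" "x \<in> C"
    and *: "\<And>k. k \<in> C \<Longrightarrow> adj k = k \<Longrightarrow> norm (k * k) \<le> 1 \<Longrightarrow> norm (k * k - x) \<le> 1"
  shows "pos x"
proof -
  obtain n where n: "pos n" "n \<in> C" "n * (n + x) = 0" "pos (n + n + x)"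
    by (rule jordan_decomposition[OF x C])
  have "n = 0"
  proof (rule ccontr)
    assume "n \<noteq> 0"
    define \<mu> where "\<mu> = norm n"
    have \<mu>: "\<mu> > 0" using \<open>n \<noteq> 0\<close> by (simp add: \<mu>_def)
    have "pos ((1/\<mu>) *\<^sub>R n)" using n \<mu> by (intro pos_scaleR) auto
    then obtain k where k: "adj k = k" "k * k = (1/\<mu>) *\<^sub>R n" "k \<in> C"
      using pos_root' csub_rules(4)[OF C(1) n(2)] C(1) by metis
    have "norm (k * k) \<le> 1" using \<mu> by (simp add: k \<mu>_def)
    then have le: "norm (k * k - x) \<le> 1" using * k by blast
    have "n * x = - (n * n)" using n(3) by (metis add.commute distrib_left eq_neg_iff_add_eq_0)
    then have "n * (k * k - x) = (1/\<mu> + 1) *\<^sub>R (n * n)"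
      by (simp add: k right_diff_distrib scaleR_left_distrib)
    moreover have "norm (n * n) = \<mu>\<^sup>2" using norm_square_sa pos_sa n(1) \<mu>_def by blast
    ultimately have "(1/\<mu> + 1) * \<mu>\<^sup>2 \<le> norm n * norm (k * k - x)"
      using norm_mult_ineq[of n "k * k - x"] \<mu> by simp
    also have "norm n * norm (k * k - x) \<le> \<mu> * 1" unfolding \<mu>_def by (intro mult_left_mono le) auto
    also have "(1/\<mu> + 1) * \<mu>\<^sup>2 = \<mu> + \<mu> * \<mu>"
      using \<mu> by (simp add: power2_eq_square field_simps)
    finally show False using mult_pos_pos[OF \<mu> \<mu>] by linarith
  qed
  then show ?thesis using n(4) by simp
qed

text \<open>The equation says that 1 - \<open>adj x * x\<close> is the square of 1 - k, but mentions
  no unit. So it makes sense in a non-unital algebra and is carried over by *-homomorphisms.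
  \<open>norm_square_le_root\<close> is the way back, with an error term.\<close>

lemma norm_le_one_root:
  fixes x :: "'a::ucstar"
  assumes "norm x \<le> 1" "csub C" "adj x * x \<in> C"
  obtains k where "k \<in> C" "adj k = k" "norm k \<le> 1" "adj x * x = k + k - k * k"
proof -
  have "norm (adj x * x) \<le> 1" using assms(1) by (simp add: norm_adj_mult power_le_one)
  then show thesis using root_exists[of "adj x * x"] that assms(2,3) by (metis adj_adj adj_mult)
qed

lemma norm_square_le_root:
  fixes x :: "'a::ucstar"
  assumes k: "adj k = k" and d: "norm (adj x * x - (k + k - k * k)) \<le> \<delta>"
  shows "(norm x)\<^sup>2 \<le> 1 + \<delta>"
proof -
  define y where "y = adj x * x - (k + k - k * k)"
  have ay: "adj y = y" by (simp add: y_def adj_diff adj_add adj_mult k)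
  have "pos ((1 - k) * (1 - k) + (\<delta> *\<^sub>R 1 - y))"
    using d k ay by (intro pos_add pos_square pos_diff_norm) (auto simp: y_def adj_diff)
  moreover have "(1 + \<delta>) *\<^sub>R 1 - adj x * x = (1 - k) * (1 - k) + (\<delta> *\<^sub>R 1 - y)"
    by (simp add: y_def left_diff_distrib right_diff_distrib scaleR_left_distrib)
  ultimately have "norm (adj x * x) \<le> 1 + \<delta>"
    using order_trans[OF norm_ge_zero d] by (intro pos_le_norm pos_adj_mult) auto
  then show ?thesis by (simp add: norm_adj_mult)
qed

section \<open>Cauchy-Schwarz inequality and approximate units\<close>

lemma norm_mult_adj: "norm (x * adj x) = (norm (x::'a::ucstar))\<^sup>2"
  using norm_adj_mult[of "adj x"] by simp

text \<open>With b the inner product on the left, the sum of the squares of x_i b - \<xi> y_i is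
  positive, and so is \<open>adj b * (\<xi> *\<^sub>R 1 - X) * b\<close>. Adding the two leaves
  \<xi> \<open>adj b * b\<close> below \<xi>^2 Y, and dividing by \<xi> gives the bound with \<xi>
  in place of the norm of X.\<close>

lemma cauchy_schwarz:
  fixes x y :: "'i \<Rightarrow> 'a::ucstar"
  shows "(norm (\<Sum>i\<in>I. adj (x i) * y i))\<^sup>2 \<le>
    norm (\<Sum>i\<in>I. adj (x i) * x i) * norm (\<Sum>i\<in>I. adj (y i) * y i)"
proof -
  define X Y b where "X = (\<Sum>i\<in>I. adj (x i) * x i)" and "Y = (\<Sum>i\<in>I. adj (y i) * y i)"
    and "b = (\<Sum>i\<in>I. adj (x i) * y i)"
  have aX: "adj X = X" by (simp add: X_def adj_sum adj_mult)
  have *: "(norm b)\<^sup>2 \<le> \<xi> * norm Y" if \<xi>: "norm X \<le> \<xi>" "\<xi> > 0" for \<xi>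
  proof -
    have "adj (x i * b - \<xi> *\<^sub>R y i) * (x i * b - \<xi> *\<^sub>R y i) =
       adj b * (adj (x i) * x i) * b - \<xi> *\<^sub>R (adj b * (adj (x i) * y i)) -
       \<xi> *\<^sub>R ((adj (y i) * x i) * b) + (\<xi> * \<xi>) *\<^sub>R (adj (y i) * y i)" for i
      by (simp add: adj_diff adj_mult left_diff_distrib right_diff_distrib mult.assoc scaleR_diff_right)
    then have "(\<Sum>i\<in>I. adj (x i * b - \<xi> *\<^sub>R y i) * (x i * b - \<xi> *\<^sub>R y i)) =
       adj b * X * b - \<xi> *\<^sub>R (adj b * b) - \<xi> *\<^sub>R (adj b * b) + (\<xi> * \<xi>) *\<^sub>R Y"
      by (simp add: sum.distrib sum_subtractf X_def Y_def
          flip: sum_distrib_left sum_distrib_right scaleR_right.sum) (simp add: b_def adj_sum adj_mult)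
    moreover have "pos (\<Sum>i\<in>I. adj (x i * b - \<xi> *\<^sub>R y i) * (x i * b - \<xi> *\<^sub>R y i))"
      by (intro pos_sum pos_adj_mult)
    moreover have "pos (adj b * (\<xi> *\<^sub>R 1 - X) * b)"
      by (intro pos_conj pos_diff_norm aX \<xi>)
    ultimately have "pos ((adj b * X * b - \<xi> *\<^sub>R (adj b * b) - \<xi> *\<^sub>R (adj b * b) + (\<xi> * \<xi>) *\<^sub>R Y)
       + adj b * (\<xi> *\<^sub>R 1 - X) * b)" using pos_add by metis
    also have "(adj b * X * b - \<xi> *\<^sub>R (adj b * b) - \<xi> *\<^sub>R (adj b * b) + (\<xi> * \<xi>) *\<^sub>R Y)
       + adj b * (\<xi> *\<^sub>R 1 - X) * b = (\<xi> * \<xi>) *\<^sub>R Y - \<xi> *\<^sub>R (adj b * b)"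
      by (simp add: left_diff_distrib right_diff_distrib)
    finally have "norm (\<xi> *\<^sub>R (adj b * b)) \<le> norm ((\<xi> * \<xi>) *\<^sub>R Y)"
      using \<xi> by (intro pos_norm_mono pos_scaleR pos_adj_mult) auto
    then show ?thesis using \<xi> by (simp add: norm_adj_mult)
  qed
  have "(norm b)\<^sup>2 \<le> norm X * norm Y"
  proof (cases "X = 0")
    case False then show ?thesis using * by simp
  next
    case True
    \<comment> \<open>\<xi> must be positive for the division; for X = 0 it is sent to 0 from the
      right.\<close>
    have "((\<lambda>\<xi>. \<xi> * norm Y) \<longlongrightarrow> 0 * norm Y) (at_right 0)" by (intro tendsto_intros)
    moreover have "eventually (\<lambda>\<xi>. (norm b)\<^sup>2 \<le> \<xi> * norm Y) (at_right (0::real))"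
      using eventually_at_right_less[of "0::real"] by eventually_elim (use * True in auto)
    ultimately have "(norm b)\<^sup>2 \<le> 0 * norm Y" by (intro tendsto_lowerbound[of _ _ "at_right (0::real)"]) auto
    then show ?thesis using True by simp
  qed
  then show ?thesis by (simp add: X_def Y_def b_def)
qed

text \<open>With \<open>v = 1 - h\<close>: the products \<open>h v\<^sup>i\<close> decrease and \<open>\<Sum>i<n. h v\<^sup>i = 1 - v\<^sup>n\<close>.\<close>

lemma norm_mult_power_le:
  fixes h :: "'a::ucstar"
  assumes h: "pos h" "norm h \<le> 1"
  shows "real n * norm (h * (1 - h) ^ n) \<le> 1"
proof -
  define v where "v = 1 - h"
  have v: "pos v" unfolding v_def using pos_diff_norm[OF pos_sa] h by force
  have hv: "h * v ^ n = v ^ n * h" for n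
    by (intro power_commuting_commutes[symmetric]) (simp add: v_def left_diff_distrib right_diff_distrib)
  have hv': "h * (v ^ n * x) = v ^ n * (h * x)" for n x by (metis hv mult.assoc)
  have pv: "pos (v ^ n)" for n
    by (induction n) (auto intro!: pos_mult_commute v simp: power_commutes)
  have phv: "pos (h * v ^ n)" for n by (intro pos_mult_commute h pv hv)
  \<comment> \<open>Since v^(n+1) = v^n - h v^n, the claim for n + 1 exceeds the claim for n by the
    positive element (n + 1) h h v^n.\<close>
  have "pos (1 - v ^ n - real n *\<^sub>R (h * v ^ n))"
  proof (induction n)
    case (Suc n)
    have e: "v ^ Suc n = v ^ n - h * v ^ n" by (simp add: v_def left_diff_distrib)
    have "pos ((1 - v ^ n - real n *\<^sub>R (h * v ^ n)) + real (Suc n) *\<^sub>R (h * (h * v ^ n)))"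
      by (intro pos_add pos_scaleR pos_mult_commute[of h "h * v ^ n"] phv h Suc) (auto simp: hv hv' mult.assoc)
    also have "(1 - v ^ n - real n *\<^sub>R (h * v ^ n)) + real (Suc n) *\<^sub>R (h * (h * v ^ n)) =
      1 - v ^ Suc n - real (Suc n) *\<^sub>R (h * v ^ Suc n)"
      unfolding e by (simp add: right_diff_distrib scaleR_left_distrib algebra_simps)
    finally show ?case .
  qed simp
  then have "pos ((1 - v ^ n - real n *\<^sub>R (h * v ^ n)) + v ^ n)" using pv pos_add by blast
  then have "norm (real n *\<^sub>R (h * v ^ n)) \<le> 1"
    by (intro pos_le_norm pos_scaleR phv) auto
  then show ?thesis by (simp add: v_def)
qed

text \<open>e is the polynomial 1 - (1 - h)^(2n) in h = H / t, where H dominates each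
  \<open>a i * adj (a i)\<close>. It has no constant term and hence lies in C even when 1 does not.
  With w = (1 - h)^n, the square of the error at a_i is at most the norm of w w H w w, which is at
  most t / n by \<open>norm_mult_power_le\<close>.\<close>

lemma approximate_unit:
  fixes a :: "'i \<Rightarrow> 'a::ucstar"
  assumes C: "csub C" and a: "\<And>i. i \<in> I \<Longrightarrow> a i \<in> C" "\<And>i. i \<in> I \<Longrightarrow> adj (a i) \<in> C"
    and I: "finite I" and \<epsilon>: "\<epsilon> > 0"
  obtains e where "e \<in> C" "adj e = e" "norm e \<le> 1" "\<forall>i\<in>I. norm (e * a i - a i) < \<epsilon>"
proof -
  define H where "H = (\<Sum>i\<in>I. a i * adj (a i))"
  have pH: "pos H" unfolding H_def using pos_adj_mult[of "adj _"] by (intro pos_sum) simp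
  define t where "t = norm H + 1"
  have t: "t > 0" by (simp add: t_def add_nonneg_pos)
  define h where "h = (1/t) *\<^sub>R H"
  have ph: "pos h" unfolding h_def using pH t by (intro pos_scaleR) auto
  have nh: "norm h \<le> 1" using t by (simp add: h_def t_def)
  have hC: "h \<in> C"
  proof -
    have "H \<in> C" unfolding H_def using C unfolding csub_def by (intro subspace_sum) (auto intro: a)
    then show ?thesis unfolding h_def by (rule csub_rules(4)[OF C])
  qed
  define v where "v = 1 - h"
  have av: "adj v = v" by (simp add: v_def adj_diff pos_sa ph)
  have nv: "norm v \<le> 1" unfolding v_def using pos_norm[OF ph nh] by simp
  obtain n :: nat where n: "n > 0" "t / real n < \<epsilon>\<^sup>2"
  proof -
    obtain m :: nat where m: "t / \<epsilon>\<^sup>2 < real m" using reals_Archimedean2 by blast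
    have "0 < t / \<epsilon>\<^sup>2" using t \<epsilon> by simp
    then have "m > 0" using m by (metis less_trans of_nat_0_less_iff)
    then show thesis using that[of m] m \<epsilon> by (simp add: field_simps)
  qed
  define w where "w = v ^ n"
  have aw: "adj w = w" unfolding w_def
    by (induction n) (auto simp: adj_mult av power_commutes)
  have nw: "norm w \<le> 1" unfolding w_def using nv by (meson norm_ge_zero norm_power_ineq order_trans power_le_one)
  have nww: "norm (w * w) \<le> 1" using nw norm_mult_ineq[of w w] by (meson mult_le_one norm_ge_zero order_trans)
  define e where "e = 1 - w * w"
  have "1 - v ^ m \<in> C" for m
  proof (induction m)
    case (Suc m)
    have "1 - v ^ Suc m = (1 - v ^ m) + h - (1 - v ^ m) * h"
      unfolding power_Suc2 by (simp add: v_def algebra_simps)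
    then show ?case using Suc hC csub_rules[OF C] by metis
  qed (simp add: csub_rules[OF C])
  then have eC: "e \<in> C" unfolding e_def w_def by (simp flip: power_add)
  have ne: "norm e \<le> 1" unfolding e_def by (intro norm_one_minus_square aw nw)
  have ae: "adj e = e" by (simp add: e_def adj_diff adj_mult aw)
  have "norm (e * a i - a i) < \<epsilon>" if i: "i \<in> I" for i
  proof -
    have "(norm (e * a i - a i))\<^sup>2 = (norm (w * w * a i))\<^sup>2"
      by (simp add: e_def left_diff_distrib)
    also have "\<dots> = norm (w * w * a i * adj (w * w * a i))" by (rule norm_mult_adj[symmetric])
    also have "\<dots> = norm (w * w * (a i * adj (a i)) * (w * w))" by (simp add: adj_mult aw mult.assoc)
    also have "\<dots> \<le> norm (w * w * H * (w * w))"
    proof (rule pos_norm_mono)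
      have ww: "adj (w * w) = w * w" by (simp add: adj_mult aw)
      show "pos (w * w * (a i * adj (a i)) * (w * w))"
        using pos_conj[of "a i * adj (a i)" "w * w"] pos_adj_mult[of "adj (a i)"] ww by simp
      have "H - a i * adj (a i) = (\<Sum>j\<in>I-{i}. a j * adj (a j))"
        unfolding H_def using I i by (simp add: sum_diff1)
      then have "pos (H - a i * adj (a i))"
        using pos_adj_mult[of "adj _"] by (auto intro!: pos_sum)
      then have "pos (w * w * (H - a i * adj (a i)) * (w * w))"
        using pos_conj[of _ "w * w"] ww by metis
      then show "pos (w * w * H * (w * w) - w * w * (a i * adj (a i)) * (w * w))"
        by (simp add: left_diff_distrib right_diff_distrib)
    qed
    also have "w * w * H * (w * w) = t *\<^sub>R (w * (h * v ^ n) * (w * w))"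
    proof -
      have "w * h = h * w" unfolding w_def
        by (intro power_commuting_commutes) (simp add: v_def left_diff_distrib right_diff_distrib)
      then show ?thesis using t by (simp add: h_def w_def mult.assoc)
    qed
    also have "norm \<dots> \<le> t * norm (h * v ^ n)"
    proof -
      have "norm (w * (h * v ^ n) * (w * w)) \<le> norm (w * (h * v ^ n)) * 1"
        by (intro order_trans[OF norm_mult_ineq] mult_left_mono nww) auto
      also have "\<dots> \<le> 1 * norm (h * v ^ n)"
        by (simp, intro order_trans[OF norm_mult_ineq]) (use nw in \<open>simp add: mult_left_le_one_le\<close>)
      finally show ?thesis using t by simp
    qed
    also have "\<dots> \<le> t * (1 / real n)"
      using norm_mult_power_le[OF ph nh, of n] n(1) t
      by (intro mult_left_mono) (auto simp: v_def field_simps)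
    also have "\<dots> < \<epsilon>\<^sup>2" using n by simp
    finally show ?thesis by (rule power2_less_imp_less) (use \<epsilon> in simp)
  qed
  then show thesis using that eC ae ne by blast
qed

section \<open>The universal unital C*-algebra over a type\<close>

context cstar_algebra
begin

lemmas cl [simp] = smult_closed m_closed star_closed

lemma smult_zero_left [simp]: "x \<in> carrier A \<Longrightarrow> 0 \<odot> x = \<zero>"
  using smult_l_distr[of x 0 0] by (metis add.r_cancel_one' add_0 smult_closed)

lemma smult_zero_right [simp]: "c \<odot> \<zero> = \<zero>"
  by (metis mult_zero_right smult_assoc1 smult_zero_left zero_closed)

lemma smult_minus_one: "x \<in> carrier A \<Longrightarrow> (- 1) \<odot> x = \<ominus> x"
proof -
  assume x: "x \<in> carrier A"
  have "(- 1) \<odot> x \<oplus> x = \<zero>" using smult_l_distr[OF x, of "-1" 1] x by (simp add: smult_one)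
  then show ?thesis using x by (simp add: minus_equality)
qed

lemma minus_smult: "x \<in> carrier A \<Longrightarrow> y \<in> carrier A \<Longrightarrow> x \<ominus> y = x \<oplus> (- 1) \<odot> y"
  by (simp add: a_minus_def smult_minus_one)

lemma minus_zero [simp]: "x \<in> carrier A \<Longrightarrow> x \<ominus> \<zero> = x"
  by (simp add: minus_smult)

lemma mult_zero_l [simp]: "x \<in> carrier A \<Longrightarrow> \<zero> \<otimes> x = \<zero>"
  by (metis m_closed smult_mult_l smult_zero_left zero_closed)

lemma mult_zero_r [simp]: "x \<in> carrier A \<Longrightarrow> x \<otimes> \<zero> = \<zero>"
  by (metis m_closed smult_mult_r smult_zero_left zero_closed)

lemma star_zero [simp]: "star A \<zero> = \<zero>"
  by (metis star_smult complex_cnj_zero smult_zero_left star_closed zero_closed)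

lemma norm_zero [simp]: "cnorm A \<zero> = 0" by (simp add: norm_eq_zero)

lemma norm_a_inv [simp]: "x \<in> carrier A \<Longrightarrow> cnorm A (\<ominus> x) = cnorm A x"
  using norm_smult[of x "-1"] by (simp add: smult_minus_one)

lemma norm_minus_commute: "x \<in> carrier A \<Longrightarrow> y \<in> carrier A \<Longrightarrow> cnorm A (x \<ominus> y) = cnorm A (y \<ominus> x)"
  using norm_a_inv[of "x \<ominus> y"] by (simp add: a_minus_def minus_add a_comm)

lemma norm_minus_eq_zero: "x \<in> carrier A \<Longrightarrow> y \<in> carrier A \<Longrightarrow> cnorm A (x \<ominus> y) = 0 \<longleftrightarrow> x = y"
  by (simp add: norm_eq_zero) (metis a_inv_closed a_minus_def minus_equality minus_minus r_neg)

lemma minus_add_minus: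
  "x \<in> carrier A \<Longrightarrow> y \<in> carrier A \<Longrightarrow> z \<in> carrier A \<Longrightarrow> (x \<ominus> y) \<oplus> (y \<ominus> z) = x \<ominus> z"
  by (simp add: a_minus_def a_assoc) (metis a_assoc a_inv_closed l_neg l_zero)

lemma norm_triangle_minus:
  "x \<in> carrier A \<Longrightarrow> y \<in> carrier A \<Longrightarrow> z \<in> carrier A \<Longrightarrow>
    cnorm A (x \<ominus> z) \<le> cnorm A (x \<ominus> y) + cnorm A (y \<ominus> z)"
  using norm_triangle[of "x \<ominus> y" "y \<ominus> z"] by (simp add: minus_add_minus)

lemma minus_mult_l: "x \<in> carrier A \<Longrightarrow> y \<in> carrier A \<Longrightarrow> z \<in> carrier A \<Longrightarrow> x \<otimes> z \<ominus> y \<otimes> z = (x \<ominus> y) \<otimes> z"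
  by (simp add: minus_smult l_distr smult_mult_l)

lemma minus_mult_r: "x \<in> carrier A \<Longrightarrow> y \<in> carrier A \<Longrightarrow> z \<in> carrier A \<Longrightarrow> z \<otimes> x \<ominus> z \<otimes> y = z \<otimes> (x \<ominus> y)"
  by (simp add: minus_smult r_distr smult_mult_r)

lemma star_minus: "x \<in> carrier A \<Longrightarrow> y \<in> carrier A \<Longrightarrow> star A x \<ominus> star A y = star A (x \<ominus> y)"
  by (simp add: minus_smult star_add star_smult)

lemma metric: "Metric_space (carrier A) (cdist A)"
proof
  fix x y z
  show "0 \<le> cdist A x y" by (auto simp: cdist_def norm_nonneg)
  show "cdist A x y = cdist A y x" by (auto simp: cdist_def norm_minus_commute)
  show "x \<in> carrier A \<Longrightarrow> y \<in> carrier A \<Longrightarrow> cdist A x y = 0 \<longleftrightarrow> x = y"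
    by (auto simp: cdist_def norm_minus_eq_zero)
  show "x \<in> carrier A \<Longrightarrow> y \<in> carrier A \<Longrightarrow> z \<in> carrier A \<Longrightarrow> cdist A x z \<le> cdist A x y + cdist A y z"
    by (auto simp: cdist_def norm_triangle_minus)
qed

lemma norm_star [simp]: assumes "x \<in> carrier A" shows "cnorm A (star A x) = cnorm A x"
proof -
  have *: "cnorm A y \<le> cnorm A (star A y)" if y: "y \<in> carrier A" for y
  proof (cases "cnorm A y = 0")
    case False
    then have "cnorm A y > 0" using norm_nonneg[OF y] by simp
    moreover have "(cnorm A y)\<^sup>2 \<le> cnorm A (star A y) * cnorm A y"
      using norm_mult[of "star A y" y] y cstar_identity[OF y] by simp
    ultimately show ?thesis by (simp add: power2_eq_square)
  qed (use y in \<open>simp add: norm_nonneg\<close>)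
  show ?thesis using *[OF assms] *[of "star A x"] assms by (simp add: star_star)
qed

text \<open>Taking x = y - z, the C*-identity makes y - z vanish. This is the extensionality test
  for double centralizers, whose adjoint relation only speaks about products with a starred left
  factor.\<close>

lemma star_cancel:
  assumes "y \<in> carrier A" "z \<in> carrier A" "\<And>x. x \<in> carrier A \<Longrightarrow> star A x \<otimes> y = star A x \<otimes> z"
  shows "y = z"
proof -
  let ?d = "y \<oplus> (- 1) \<odot> z"
  have "star A ?d \<otimes> ?d = star A ?d \<otimes> y \<oplus> (- 1) \<odot> (star A ?d \<otimes> z)"
    using assms by (simp add: r_distr smult_mult_r)
  also have "\<dots> = \<zero>"
    using assms by (simp add: smult_minus_one r_neg del: star_add)
  finally have "(cnorm A ?d)\<^sup>2 = 0" using cstar_identity[of ?d] assms by simp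
  then have "y \<ominus> z = \<zero>" using assms by (simp add: minus_smult norm_eq_zero)
  then show ?thesis using assms by (metis norm_minus_eq_zero norm_zero)
qed

lemma converges:
  assumes s: "\<And>n. s n \<in> carrier A"
    and "\<And>e. e > 0 \<Longrightarrow> \<exists>N. \<forall>m\<ge>N. \<forall>n\<ge>N. cnorm A (s m \<ominus> s n) < e"
  obtains l where "l \<in> carrier A" "(\<lambda>n. cnorm A (s n \<ominus> l)) \<longlonglongrightarrow> 0"
proof -
  interpret M: Metric_space "carrier A" "cdist A" by (rule metric)
  have "M.MCauchy s" unfolding M.MCauchy_def using assms by (auto simp: cdist_def)
  then obtain l where l: "limitin M.mtopology s l sequentially"
    using complete unfolding M.mcomplete_def by blast
  then have "l \<in> carrier A" "(\<lambda>n. cdist A (s n) l) \<longlonglongrightarrow> 0"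
    by (simp_all add: M.limitin_metric_dist_null)
  then show thesis using that s by (simp add: cdist_def)
qed

end

lemma mcompleteI:
  fixes A :: "('a, 'm) cstar_scheme" (structure)
  assumes M: "Metric_space (carrier A) (cdist A)"
    and *: "\<And>s. (\<And>n. s n \<in> carrier A) \<Longrightarrow>
       (\<And>e. e > 0 \<Longrightarrow> \<exists>N. \<forall>m\<ge>N. \<forall>n\<ge>N. cnorm A (s m \<ominus> s n) < e) \<Longrightarrow>
       \<exists>l\<in>carrier A. (\<lambda>n. cnorm A (s n \<ominus> l)) \<longlonglongrightarrow> 0"
  shows "Metric_space.mcomplete (carrier A) (cdist A)"
proof -
  interpret M: Metric_space "carrier A" "cdist A" by (rule M)
  show ?thesis unfolding M.mcomplete_def
  proof (intro allI impI)
    fix s assume s: "M.MCauchy s"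
    have sc: "s n \<in> carrier A" for n using s by (auto simp: M.MCauchy_def)
    have c: "\<forall>e>0. \<exists>N. \<forall>m n. N \<le> m \<longrightarrow> N \<le> n \<longrightarrow> cdist A (s m) (s n) < e"
      using s by (simp add: M.MCauchy_def)
    have "\<exists>l\<in>carrier A. (\<lambda>n. cnorm A (s n \<ominus> l)) \<longlonglongrightarrow> 0"
    proof (rule *)
      show "\<exists>N. \<forall>m\<ge>N. \<forall>n\<ge>N. cnorm A (s m \<ominus> s n) < e" if "e > 0" for e
        using c[rule_format, OF that] by (simp add: cdist_def sc)
    qed (rule sc)
    then obtain l where "l \<in> carrier A" "(\<lambda>n. cnorm A (s n \<ominus> l)) \<longlonglongrightarrow> 0" by blast
    then have "limitin M.mtopology s l sequentially"
      using sc by (simp add: M.limitin_metric_dist_null cdist_def)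
    then show "\<exists>x. limitin M.mtopology s x sequentially" by blast
  qed
qed

section \<open>Double centralizers over all C*-algebras on a type\<close>

text \<open>Lets a quantifier over all records have an effect only on those that are
  C*-algebras.\<close>

definition cdom :: "'a cstar \<Rightarrow> 'a set" where
  "cdom A = (if cstar_algebra A then carrier A else {})"

lemma cdomD: "x \<in> cdom A \<Longrightarrow> cstar_algebra A \<and> x \<in> carrier A"
  by (auto simp: cdom_def split: if_splits)

text \<open>Families of double centralizers \<open>(f, g)\<close>, one for every C*-algebra on the type, so that all
  these algebras embed into a single type. The scalar component of \<open>uni\<close> only makes the type
  nontrivial.\<close>

definition dcent :: "('a cstar \<Rightarrow> 'a \<Rightarrow> 'a) \<Rightarrow> ('a cstar \<Rightarrow> 'a \<Rightarrow> 'a) \<Rightarrow> bool" where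
  "dcent f g \<longleftrightarrow> (\<forall>A. \<forall>x. x \<notin> cdom A \<longrightarrow> f A x = x \<and> g A x = x) \<and>
    (\<forall>A. \<forall>x\<in>cdom A. f A x \<in> cdom A \<and> g A x \<in> cdom A \<and>
       (\<forall>y\<in>cdom A. star A (f A x) \<otimes>\<^bsub>A\<^esub> y = star A x \<otimes>\<^bsub>A\<^esub> g A y)) \<and>
    (\<exists>K. \<forall>A. \<forall>x\<in>cdom A. cnorm A (f A x) \<le> K * cnorm A x) \<and>
    (\<exists>K. \<forall>A. \<forall>x\<in>cdom A. cnorm A (g A x) \<le> K * cnorm A x)"

typedef 'a uni = "{(c::complex, f :: 'a cstar \<Rightarrow> 'a \<Rightarrow> 'a, g :: 'a cstar \<Rightarrow> 'a \<Rightarrow> 'a). dcent f g}"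
proof -
  have "dcent (\<lambda>_ x. x) (\<lambda>_ x. x)"
    unfolding dcent_def by (auto intro!: exI[of _ 1])
  then show ?thesis by blast
qed

definition uc :: "'a uni \<Rightarrow> complex" where "uc u = fst (Rep_uni u)"
definition uf :: "'a uni \<Rightarrow> 'a cstar \<Rightarrow> 'a \<Rightarrow> 'a" where "uf u = fst (snd (Rep_uni u))"
definition ug :: "'a uni \<Rightarrow> 'a cstar \<Rightarrow> 'a \<Rightarrow> 'a" where "ug u = snd (snd (Rep_uni u))"

lemma dcent_uni: "dcent (uf u) (ug u)"
  using Rep_uni[of u] by (auto simp: uf_def ug_def)

lemma uni_Abs:
  assumes "dcent f g"
  shows "uc (Abs_uni (c, f, g)) = c" "uf (Abs_uni (c, f, g)) = f" "ug (Abs_uni (c, f, g)) = g"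
  using assms by (simp_all add: uc_def uf_def ug_def Abs_uni_inverse)

lemma uni_closed [simp]:
  "x \<in> cdom A \<Longrightarrow> uf u A x \<in> cdom A" "x \<in> cdom A \<Longrightarrow> ug u A x \<in> cdom A"
  using dcent_uni[of u] unfolding dcent_def by auto

lemma uni_off: "x \<notin> cdom A \<Longrightarrow> uf u A x = x" "x \<notin> cdom A \<Longrightarrow> ug u A x = x"
  using dcent_uni[of u] unfolding dcent_def by auto

lemma uni_adj:
  "x \<in> cdom A \<Longrightarrow> y \<in> cdom A \<Longrightarrow> star A (uf u A x) \<otimes>\<^bsub>A\<^esub> y = star A x \<otimes>\<^bsub>A\<^esub> ug u A y"
  using dcent_uni[of u] unfolding dcent_def by auto

lemma uni_adj':
  fixes A :: "'a cstar" (structure)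
  assumes x: "x \<in> cdom A" and y: "y \<in> cdom A"
  shows "star A (ug u A x) \<otimes>\<^bsub>A\<^esub> y = star A x \<otimes>\<^bsub>A\<^esub> uf u A y"
proof -
  interpret cstar_algebra A using cdomD[OF x] by simp
  have "star A (star A (uf u A y) \<otimes> x) = star A (star A y \<otimes> ug u A x)"
    using uni_adj[OF y x] by simp
  then show ?thesis
    using cdomD[OF uni_closed(1)[OF y]] cdomD[OF uni_closed(2)[OF x]] cdomD[OF x] cdomD[OF y]
    by (simp add: star_mult star_star)
qed

text \<open>The first component determines the second: the adjoint relation fixes all products of a
  starred element with \<open>ug u A x\<close>, and \<open>star_cancel\<close> removes the left
  factor.\<close>

lemma uni_eqI:
  assumes "uc u = uc v" and *: "\<And>A x. x \<in> cdom A \<Longrightarrow> uf u A x = uf v A x"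
  shows "u = v"
proof -
  have "uf u = uf v"
    by (intro ext) (metis * uni_off(1))
  moreover have "ug u A x = ug v A x" for A x
  proof (cases "x \<in> cdom A")
    case True
    interpret cstar_algebra A using cdomD[OF True] by simp
    have "carrier A = cdom A" using cstar_algebra_axioms by (simp add: cdom_def)
    then have "star A z \<otimes>\<^bsub>A\<^esub> ug u A x = star A z \<otimes>\<^bsub>A\<^esub> ug v A x" if "z \<in> carrier A" for z
      using uni_adj[of z A x u] uni_adj[of z A x v] *[of z A] True that by simp
    then show ?thesis
      using star_cancel cdomD[OF uni_closed(2)[OF True]] by blast
  qed (simp add: uni_off)
  then have "ug u = ug v" by blast
  ultimately show ?thesis using assms(1)
    by (metis Rep_uni_inverse prod.collapse uc_def uf_def ug_def)
qed

lemma uni_bound: "\<exists>K\<ge>0. cmod (uc u) \<le> K \<and> (\<forall>A. \<forall>x\<in>cdom A. cnorm A (uf u A x) \<le> K * cnorm A x)"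
proof -
  obtain K where K: "\<And>A x. x \<in> cdom A \<Longrightarrow> cnorm A (uf u A x) \<le> K * cnorm A x"
    using dcent_uni[of u] unfolding dcent_def by metis
  let ?K = "max K (cmod (uc u))"
  have "cnorm A (uf u A x) \<le> ?K * cnorm A x" if "x \<in> cdom A" for A x
    using K[OF that] cstar_algebra.norm_nonneg[of A x] cdomD[OF that]
    by (meson max.cobounded1 mult_right_mono order_trans)
  then show ?thesis by (intro exI[of _ ?K]) (auto intro: max.coboundedI2)
qed

text \<open>By the C*-identity and the adjoint relation, the squared norm of \<open>g A x\<close> is
  the norm of \<open>star A (f A (g A x)) \<otimes> x\<close>; one factor then cancels. So a bound
  for one component is enough in \<open>dcentI\<close>.\<close>

lemma bound_transfer:
  fixes A :: "'a cstar" (structure)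
  assumes "K \<ge> 0" and *: "\<And>A x. x \<in> cdom A \<Longrightarrow> f A x \<in> cdom A \<and> g A x \<in> cdom A"
    "\<And>A x y. x \<in> cdom A \<Longrightarrow> y \<in> cdom A \<Longrightarrow> star A (f A x) \<otimes>\<^bsub>A\<^esub> y = star A x \<otimes>\<^bsub>A\<^esub> g A y"
    "\<And>A x. x \<in> cdom A \<Longrightarrow> cnorm A (f A x) \<le> K * cnorm A x"
    and x: "x \<in> cdom A"
  shows "cnorm A (g A x) \<le> K * cnorm A x"
proof -
  interpret cstar_algebra A using cdomD[OF x] by simp
  have gx [simp]: "g A x \<in> cdom A" using *(1)[OF x] by simp
  have "f A (g A x) \<in> cdom A" using *(1)[OF gx] by simp
  with gx x have [simp]: "x \<in> carrier A" "g A x \<in> carrier A" "f A (g A x) \<in> carrier A"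
    by (simp_all add: cdomD)
  have "(cnorm A (g A x))\<^sup>2 = cnorm A (star A (g A x) \<otimes> g A x)" by (simp add: cstar_identity)
  also have "\<dots> = cnorm A (star A (f A (g A x)) \<otimes> x)" using *(2)[of "g A x" A x] x by simp
  also have "\<dots> \<le> cnorm A (f A (g A x)) * cnorm A x"
    using norm_mult[of "star A (f A (g A x))" x] by simp
  also have "\<dots> \<le> K * cnorm A (g A x) * cnorm A x"
    by (intro mult_right_mono *(3)) (auto simp: norm_nonneg)
  finally have "cnorm A (g A x) * cnorm A (g A x) \<le> cnorm A (g A x) * (K * cnorm A x)"
    by (simp add: power2_eq_square mult_ac)
  moreover have "0 \<le> K * cnorm A x" using assms(1) norm_nonneg[of x] by simp
  ultimately show ?thesis using norm_nonneg[of "g A x"] 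
    by (cases "cnorm A (g A x) = 0") (auto simp: mult_le_cancel_left)
qed

lemma dcentI:
  assumes "K \<ge> 0" "\<And>A x. x \<notin> cdom A \<Longrightarrow> f A x = x \<and> g A x = x"
    "\<And>A x. x \<in> cdom A \<Longrightarrow> f A x \<in> cdom A \<and> g A x \<in> cdom A"
    "\<And>A x y. x \<in> cdom A \<Longrightarrow> y \<in> cdom A \<Longrightarrow> star A (f A x) \<otimes>\<^bsub>A\<^esub> y = star A x \<otimes>\<^bsub>A\<^esub> g A y"
    "\<And>A x. x \<in> cdom A \<Longrightarrow> cnorm A (f A x) \<le> K * cnorm A x"
  shows "dcent f g"
  unfolding dcent_def using assms bound_transfer[OF assms(1,3,4,5)] by blast

text \<open>The operator norm of the first component over all algebras at once, joined with the
  modulus of the scalar part. Admissible bounds exist because \<open>dcent\<close> asks for a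
  constant independent of the algebra.\<close>

definition uni_norm :: "'a uni \<Rightarrow> real" where
  "uni_norm u = Inf {K. 0 \<le> K \<and> cmod (uc u) \<le> K \<and> (\<forall>A. \<forall>x\<in>cdom A. cnorm A (uf u A x) \<le> K * cnorm A x)}"

lemma uni_norm_le:
  assumes "0 \<le> K" "cmod (uc u) \<le> K" "\<And>A x. x \<in> cdom A \<Longrightarrow> cnorm A (uf u A x) \<le> K * cnorm A x"
  shows "uni_norm u \<le> K"
  unfolding uni_norm_def by (rule cInf_lower) (use assms in \<open>auto intro!: bdd_belowI[of _ 0]\<close>)

lemma uni_norm_ge: "0 \<le> uni_norm u" "cmod (uc u) \<le> uni_norm u"
  unfolding uni_norm_def using uni_bound[of u] by (auto intro!: cInf_greatest)

lemma uni_norm_bound: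
  assumes x: "x \<in> cdom A" shows "cnorm A (uf u A x) \<le> uni_norm u * cnorm A x"
proof -
  interpret cstar_algebra A using cdomD[OF x] by simp
  have xc: "x \<in> carrier A" "uf u A x \<in> carrier A" using cdomD[OF x] cdomD[OF uni_closed(1)[OF x]] by simp_all
  show ?thesis
  proof (cases "cnorm A x = 0")
    case True
    obtain K where "cnorm A (uf u A x) \<le> K * cnorm A x" using uni_bound[of u] x by blast
    then show ?thesis using True by simp
  next
    case False
    then have p: "cnorm A x > 0" using norm_nonneg[OF xc(1)] by simp
    have "cnorm A (uf u A x) / cnorm A x \<le> uni_norm u"
      unfolding uni_norm_def
    proof (rule cInf_greatest)
      fix K assume "K \<in> {K. 0 \<le> K \<and> cmod (uc u) \<le> K \<and> (\<forall>A. \<forall>x\<in>cdom A. cnorm A (uf u A x) \<le> K * cnorm A x)}"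
      then show "cnorm A (uf u A x) / cnorm A x \<le> K" using x p by (simp add: divide_le_eq)
    qed (use uni_bound[of u] in auto)
    then show ?thesis using p by (simp add: divide_le_eq)
  qed
qed

lemma uni_norm_bound':
  "x \<in> cdom A \<Longrightarrow> cnorm A (ug u A x) \<le> uni_norm u * cnorm A x"
  by (rule bound_transfer[where f = "uf u" and g = "ug u"])
    (auto simp: uni_norm_ge uni_norm_bound uni_adj)

lemma cdom_algebra:
  fixes A :: "'a cstar" (structure)
  assumes "x \<in> cdom A" "y \<in> cdom A"
  shows "x \<oplus>\<^bsub>A\<^esub> y \<in> cdom A" "c \<odot>\<^bsub>A\<^esub> x \<in> cdom A" "x \<otimes>\<^bsub>A\<^esub> y \<in> cdom A" "star A x \<in> cdom A" "\<zero>\<^bsub>A\<^esub> \<in> cdom A"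
proof -
  interpret cstar_algebra A using cdomD[OF assms(1)] by simp
  show "x \<oplus> y \<in> cdom A" "c \<odot> x \<in> cdom A" "x \<otimes> y \<in> cdom A" "star A x \<in> cdom A" "\<zero> \<in> cdom A"
    using assms cstar_algebra_axioms by (auto simp: cdom_def)
qed

text \<open>Linearity and the module property are not put into \<open>dcent\<close>; as for
  adjointable operators on a Hilbert module, they follow from the adjoint relation, here by
  \<open>star_cancel\<close>.\<close>

lemma uni_additive:
  fixes A :: "'a cstar" (structure)
  assumes x: "x \<in> cdom A" and y: "y \<in> cdom A"
  shows "uf u A (x \<oplus>\<^bsub>A\<^esub> y) = uf u A x \<oplus>\<^bsub>A\<^esub> uf u A y"
    "uf u A (c \<odot>\<^bsub>A\<^esub> x) = c \<odot>\<^bsub>A\<^esub> uf u A x"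
    "uf u A (x \<otimes>\<^bsub>A\<^esub> y) = uf u A x \<otimes>\<^bsub>A\<^esub> y"
proof -
  interpret cstar_algebra A using cdomD[OF x] by simp
  have dc: "cdom A = carrier A" using cstar_algebra_axioms by (simp add: cdom_def)
  have cl: "z \<in> carrier A \<Longrightarrow> uf u A z \<in> carrier A" "z \<in> carrier A \<Longrightarrow> ug u A z \<in> carrier A" for z
    using uni_closed[of z A u] dc by auto
  have *: "star A z \<otimes> uf u A w = star A (ug u A z) \<otimes> w" if "z \<in> carrier A" "w \<in> carrier A" for z w
    using uni_adj'[of z A w u] that dc by simp
  note [simp] = x[unfolded dc] y[unfolded dc] cl
  show "uf u A (x \<oplus> y) = uf u A x \<oplus> uf u A y"
    by (rule star_cancel) (auto simp: * r_distr)
  show "uf u A (c \<odot> x) = c \<odot> uf u A x"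
    by (rule star_cancel) (auto simp: * smult_mult_r)
  show "uf u A (x \<otimes> y) = uf u A x \<otimes> y"
    by (rule star_cancel) (auto simp: * simp flip: m_assoc)
qed

lemma uni_smult: "x \<in> cdom A \<Longrightarrow> uf u A (c \<odot>\<^bsub>A\<^esub> x) = c \<odot>\<^bsub>A\<^esub> uf u A x"
  by (rule uni_additive(2))

section \<open>The normed algebra of double centralizers and its completeness\<close>

instantiation uni :: (type) real_normed_algebra_1
begin

text \<open>Off \<open>cdom\<close> all operations fix the argument, the normal form that
  \<open>dcent\<close> prescribes. In a product the second components compose in the opposite order,
  as adjoints do.\<close>

definition "zero_uni = Abs_uni (0, \<lambda>A x. if x \<in> cdom A then \<zero>\<^bsub>A\<^esub> else x,
  \<lambda>A x. if x \<in> cdom A then \<zero>\<^bsub>A\<^esub> else x)"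
definition "one_uni = Abs_uni (1, \<lambda>A x. x, \<lambda>A x. x)"
definition "plus_uni u v = Abs_uni (uc u + uc v,
  \<lambda>A x. if x \<in> cdom A then uf u A x \<oplus>\<^bsub>A\<^esub> uf v A x else x,
  \<lambda>A x. if x \<in> cdom A then ug u A x \<oplus>\<^bsub>A\<^esub> ug v A x else x)"
definition "scaleR_uni r u = Abs_uni (of_real r * uc u,
  \<lambda>A x. if x \<in> cdom A then of_real r \<odot>\<^bsub>A\<^esub> uf u A x else x,
  \<lambda>A x. if x \<in> cdom A then of_real r \<odot>\<^bsub>A\<^esub> ug u A x else x)"
definition "uminus_uni u = (-1) *\<^sub>R (u :: 'a uni)"
definition "minus_uni u v = u + (- v :: 'a uni)"
definition "times_uni u v = Abs_uni (uc u * uc v, \<lambda>A x. uf u A (uf v A x), \<lambda>A x. ug v A (ug u A x))"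
definition "norm_uni = (uni_norm :: 'a uni \<Rightarrow> real)"
definition "dist_uni u v = norm (u - v :: 'a uni)"
definition "sgn_uni u = inverse (norm u) *\<^sub>R (u :: 'a uni)"
definition uniformity_uni :: "('a uni \<times> 'a uni) filter"
  where "uniformity_uni = (INF e\<in>{0 <..}. principal {(x, y). dist x y < e})"
definition open_uni :: "'a uni set \<Rightarrow> bool"
  where "open_uni U \<longleftrightarrow> (\<forall>x\<in>U. eventually (\<lambda>(x', y). x' = x \<longrightarrow> y \<in> U) uniformity)"

lemma uni_zero: "uc 0 = 0" "uf 0 = (\<lambda>A x. if x \<in> cdom A then \<zero>\<^bsub>A\<^esub> else x)"
proof -
  have "dcent (\<lambda>A x. if x \<in> cdom A then \<zero>\<^bsub>A\<^esub> else x) (\<lambda>A x. if x \<in> cdom A then \<zero>\<^bsub>A\<^esub> else x :: 'a)"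
  proof (rule dcentI[of 0], goal_cases)
    case (4 A x y)
    interpret cstar_algebra A using cdomD[OF 4(1)] by simp
    show ?case using 4 cdomD[of x A] cdomD[of y A] by simp
  next
    case (5 A x)
    interpret cstar_algebra A using cdomD[OF 5] by simp
    show ?case using 5 by simp
  qed (auto simp: cdom_algebra)
  then show "uc 0 = 0" "uf 0 = (\<lambda>A x. if x \<in> cdom A then \<zero>\<^bsub>A\<^esub> else x :: 'a)"
    unfolding zero_uni_def by (simp_all add: uni_Abs)
qed

lemma uni_one: "uc 1 = 1" "uf 1 = (\<lambda>A x. x :: 'a)"
proof -
  have "dcent (\<lambda>A x. x) (\<lambda>A x. x :: 'a)" by (rule dcentI[of 1]) auto
  then show "uc 1 = 1" "uf 1 = (\<lambda>A x. x :: 'a)"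
    unfolding one_uni_def by (simp_all add: uni_Abs)
qed

lemma uni_plus: "uc (u + v) = uc u + uc v" 
  "uf (u + v) = (\<lambda>A x. if x \<in> cdom A then uf u A x \<oplus>\<^bsub>A\<^esub> uf v A x else x :: 'a)"
  "ug (u + v) = (\<lambda>A x. if x \<in> cdom A then ug u A x \<oplus>\<^bsub>A\<^esub> ug v A x else x :: 'a)"
proof -
  have "dcent (\<lambda>A x. if x \<in> cdom A then uf u A x \<oplus>\<^bsub>A\<^esub> uf v A x else x :: 'a)
    (\<lambda>A x. if x \<in> cdom A then ug u A x \<oplus>\<^bsub>A\<^esub> ug v A x else x)"
  proof (rule dcentI[of "uni_norm u + uni_norm v"], goal_cases)
    case 1 show ?case by (simp add: uni_norm_ge)
  next
    case (4 A x y)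
    interpret cstar_algebra A using cdomD[OF 4(1)] by simp
    show ?case using 4 cdomD[OF uni_closed(1), of x A] cdomD[OF uni_closed(2), of y A] cdomD[of x A] cdomD[of y A]
      by (simp add: star_add l_distr r_distr uni_adj)
  next
    case (5 A x)
    interpret cstar_algebra A using cdomD[OF 5] by simp
    have "cnorm A (uf u A x \<oplus>\<^bsub>A\<^esub> uf v A x) \<le> cnorm A (uf u A x) + cnorm A (uf v A x)"
      using 5 cdomD[OF uni_closed(1), of x A] by (intro norm_triangle) auto
    then show ?case using 5 uni_norm_bound[of x A u] uni_norm_bound[of x A v] by (simp add: distrib_right)
  qed (auto simp: cdom_algebra)
  then show "uc (u + v) = uc u + uc v" 
  "uf (u + v) = (\<lambda>A x. if x \<in> cdom A then uf u A x \<oplus>\<^bsub>A\<^esub> uf v A x else x :: 'a)"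
  "ug (u + v) = (\<lambda>A x. if x \<in> cdom A then ug u A x \<oplus>\<^bsub>A\<^esub> ug v A x else x :: 'a)"
    unfolding plus_uni_def by (simp_all add: uni_Abs)
qed

lemma uni_scaleR: "uc (r *\<^sub>R u) = of_real r * uc u" 
  "uf (r *\<^sub>R u) = (\<lambda>A x. if x \<in> cdom A then of_real r \<odot>\<^bsub>A\<^esub> uf u A x else x :: 'a)"
  "ug (r *\<^sub>R u) = (\<lambda>A x. if x \<in> cdom A then of_real r \<odot>\<^bsub>A\<^esub> ug u A x else x :: 'a)"
proof -
  have "dcent (\<lambda>A x. if x \<in> cdom A then of_real r \<odot>\<^bsub>A\<^esub> uf u A x else x :: 'a)
    (\<lambda>A x. if x \<in> cdom A then of_real r \<odot>\<^bsub>A\<^esub> ug u A x else x)"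
  proof (rule dcentI[of "\<bar>r\<bar> * uni_norm u"], goal_cases)
    case 1 show ?case by (simp add: uni_norm_ge)
  next
    case (4 A x y)
    interpret cstar_algebra A using cdomD[OF 4(1)] by simp
    show ?case using 4 cdomD[OF uni_closed(1), of x A] cdomD[OF uni_closed(2), of y A] cdomD[of x A] cdomD[of y A]
      by (simp add: star_smult smult_mult_l smult_mult_r uni_adj)
  next
    case (5 A x)
    interpret cstar_algebra A using cdomD[OF 5] by simp
    show ?case using 5 cdomD[OF uni_closed(1), of x A] uni_norm_bound[of x A u]
      by (simp add: norm_smult mult.assoc mult_left_mono)
  qed (auto simp: cdom_algebra)
  then show "uc (r *\<^sub>R u) = of_real r * uc u" 
    "uf (r *\<^sub>R u) = (\<lambda>A x. if x \<in> cdom A then of_real r \<odot>\<^bsub>A\<^esub> uf u A x else x :: 'a)"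
    "ug (r *\<^sub>R u) = (\<lambda>A x. if x \<in> cdom A then of_real r \<odot>\<^bsub>A\<^esub> ug u A x else x :: 'a)"
    unfolding scaleR_uni_def by (simp_all add: uni_Abs)
qed

lemma uni_times: "uc (u * v) = uc u * uc v" "uf (u * v) = (\<lambda>A x. uf u A (uf v A x :: 'a))"
  "ug (u * v) = (\<lambda>A x. ug v A (ug u A x :: 'a))"
proof -
  have "dcent (\<lambda>A x. uf u A (uf v A x :: 'a)) (\<lambda>A x. ug v A (ug u A x))"
  proof (rule dcentI[of "uni_norm u * uni_norm v"], goal_cases)
    case (5 A x)
    have "cnorm A (uf u A (uf v A x)) \<le> uni_norm u * cnorm A (uf v A x)"
      using 5 by (intro uni_norm_bound) simp
    also have "\<dots> \<le> uni_norm u * (uni_norm v * cnorm A x)"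
      using 5 by (intro mult_left_mono uni_norm_bound uni_norm_ge)
    finally show ?case by (simp add: mult.assoc)
  qed (auto simp: uni_norm_ge uni_off uni_adj)
  then show "uc (u * v) = uc u * uc v" "uf (u * v) = (\<lambda>A x. uf u A (uf v A x :: 'a))"
    "ug (u * v) = (\<lambda>A x. ug v A (ug u A x :: 'a))"
    unfolding times_uni_def by (simp_all add: uni_Abs)
qed

lemma uni_neg: "uc (- u) = - uc u"
  "uf (- u) = (\<lambda>A x. if x \<in> cdom A then (- 1) \<odot>\<^bsub>A\<^esub> uf u A x else x :: 'a)"
  by (simp_all add: uminus_uni_def uni_scaleR cong: if_cong)

lemma uni_minus: "uc (u - v) = uc u - uc v"
  "x \<in> cdom A \<Longrightarrow> uf (u - v) A x = uf u A x \<ominus>\<^bsub>A\<^esub> uf v A (x :: 'a)"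
proof -
  show "uc (u - v) = uc u - uc v" by (simp add: minus_uni_def uminus_uni_def uni_plus uni_scaleR)
  assume x: "x \<in> cdom A"
  interpret cstar_algebra A using cdomD[OF x] by blast
  show "uf (u - v) A x = uf u A x \<ominus>\<^bsub>A\<^esub> uf v A x"
    using x cdomD[OF uni_closed(1)[OF x]]
    by (simp add: minus_uni_def uminus_uni_def uni_plus uni_scaleR minus_smult)
qed

lemma uni_minus_g: "x \<in> cdom A \<Longrightarrow> ug (u - v) A x = ug u A x \<ominus>\<^bsub>A\<^esub> ug v A (x :: 'a)"
proof -
  assume x: "x \<in> cdom A"
  interpret cstar_algebra A using cdomD[OF x] by blast
  show "ug (u - v) A x = ug u A x \<ominus>\<^bsub>A\<^esub> ug v A x"
    using x cdomD[OF uni_closed(2)[OF x]]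
    by (simp add: minus_uni_def uminus_uni_def uni_plus uni_scaleR minus_smult)
qed

lemma uni_norm_times: "uni_norm (u * v) \<le> uni_norm u * uni_norm (v :: 'a uni)"
proof (rule uni_norm_le)
  show "cmod (uc (u * v)) \<le> uni_norm u * uni_norm v"
    by (simp add: uni_times norm_mult mult_mono uni_norm_ge)
  fix A and x :: 'a assume x: "x \<in> cdom A"
  have "cnorm A (uf u A (uf v A x)) \<le> uni_norm u * cnorm A (uf v A x)"
    using x by (intro uni_norm_bound) simp
  also have "\<dots> \<le> uni_norm u * (uni_norm v * cnorm A x)"
    using x by (intro mult_left_mono uni_norm_bound uni_norm_ge)
  finally show "cnorm A (uf (u * v) A x) \<le> uni_norm u * uni_norm v * cnorm A x"
    by (simp add: mult.assoc uni_times)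
qed (simp add: uni_norm_ge)

lemma uni_norm_plus: "uni_norm (u + v) \<le> uni_norm u + uni_norm (v :: 'a uni)"
proof (rule uni_norm_le)
  show "cmod (uc (u + v)) \<le> uni_norm u + uni_norm v"
    using norm_triangle_ineq[of "uc u" "uc v"] uni_norm_ge(2)[of u] uni_norm_ge(2)[of v]
    unfolding uni_plus by linarith
  fix A and x :: 'a assume x: "x \<in> cdom A"
  interpret cstar_algebra A using cdomD[OF x] by blast
  have "cnorm A (uf u A x \<oplus>\<^bsub>A\<^esub> uf v A x) \<le> cnorm A (uf u A x) + cnorm A (uf v A x)"
    using x cdomD[OF uni_closed(1), of x A] by (intro norm_triangle) auto
  then show "cnorm A (uf (u + v) A x) \<le> (uni_norm u + uni_norm v) * cnorm A x"
    using x uni_norm_bound[of x A u] uni_norm_bound[of x A v] by (simp add: distrib_right uni_plus)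
qed (simp add: uni_norm_ge)

lemma uni_norm_scaleR: "uni_norm (r *\<^sub>R u) \<le> \<bar>r\<bar> * uni_norm (u :: 'a uni)"
proof (rule uni_norm_le)
  show "cmod (uc (r *\<^sub>R u)) \<le> \<bar>r\<bar> * uni_norm u"
    by (simp add: uni_scaleR norm_mult mult_left_mono uni_norm_ge)
  fix A and x :: 'a assume x: "x \<in> cdom A"
  interpret cstar_algebra A using cdomD[OF x] by blast
  show "cnorm A (uf (r *\<^sub>R u) A x) \<le> \<bar>r\<bar> * uni_norm u * cnorm A x"
    using x cdomD[OF uni_closed(1), of x A] uni_norm_bound[of x A u]
    by (simp add: norm_smult mult.assoc mult_left_mono uni_scaleR)
qed (simp add: uni_norm_ge)

instance
proof
  fix u v w :: "'a uni" and r s :: real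
  have alg: "abelian_group A" "cstar_algebra A" "uf u' A x \<in> carrier A" "x \<in> carrier A"
    if "x \<in> cdom A" for A and x :: 'a and u'
    using cdomD[OF that] cdomD[OF uni_closed(1)[OF that]] by (auto simp: cstar_algebra_def)
  note [simp] = cdom_algebra
  show "u + v + w = u + (v + w)"
    by (rule uni_eqI) (auto simp: uni_plus alg abelian_monoid.a_assoc abelian_group.axioms)
  show "u + v = v + u"
    by (rule uni_eqI) (auto simp: uni_plus alg abelian_monoid.a_comm abelian_group.axioms)
  show "0 + u = u"
    by (rule uni_eqI) (auto simp: uni_plus uni_zero alg abelian_monoid.l_zero abelian_group.axioms)
  show "- u + u = 0"
    by (rule uni_eqI) (auto simp: uni_plus uni_zero uminus_uni_def uni_scaleR alg
        cstar_algebra.smult_minus_one abelian_group.l_neg)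
  show "u - v = u + - v" by (simp add: minus_uni_def)
  show "u * v * w = u * (v * w)" by (rule uni_eqI) (auto simp: uni_times)
  show "1 * u = u" "u * 1 = u" by (rule uni_eqI; simp add: uni_times uni_one)+
  show "(u + v) * w = u * w + v * w"
    by (rule uni_eqI) (auto simp: uni_times uni_plus distrib_right)
  show "u * (v + w) = u * v + u * w"
    by (rule uni_eqI) (auto simp: uni_times uni_plus distrib_left uni_additive)
  show "(0::'a uni) \<noteq> 1" by (metis uni_zero(1) uni_one(1) zero_neq_one)
  show "r *\<^sub>R (u + v) = r *\<^sub>R u + r *\<^sub>R v"
    by (rule uni_eqI) (auto simp: uni_plus uni_scaleR distrib_left alg cstar_algebra.smult_r_distr)
  show "(r + s) *\<^sub>R u = r *\<^sub>R u + s *\<^sub>R u"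
    by (rule uni_eqI) (auto simp: uni_plus uni_scaleR distrib_right alg cstar_algebra.smult_l_distr)
  show "r *\<^sub>R s *\<^sub>R u = (r * s) *\<^sub>R u"
    by (rule uni_eqI) (auto simp: uni_scaleR alg cstar_algebra.smult_assoc1)
  show "1 *\<^sub>R u = u"
    by (rule uni_eqI) (auto simp: uni_scaleR alg cstar_algebra.smult_one)
  show "r *\<^sub>R u * v = r *\<^sub>R (u * v)"
    by (rule uni_eqI) (auto simp: uni_scaleR uni_times)
  show "u * r *\<^sub>R v = r *\<^sub>R (u * v)"
    by (rule uni_eqI) (auto simp: uni_scaleR uni_times uni_smult)
  show "dist u v = norm (u - v)" by (simp add: dist_uni_def)
  show "sgn u = inverse (norm u) *\<^sub>R u" by (simp add: sgn_uni_def)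
  show "uniformity = (INF e\<in>{0 <..}. principal {(x, y :: 'a uni). dist x y < e})"
    by (simp add: uniformity_uni_def)
  show "open U = (\<forall>x\<in>U. eventually (\<lambda>(x', y). x' = x \<longrightarrow> y \<in> U) uniformity)" for U :: "'a uni set"
    by (simp add: open_uni_def)
  show n0: "norm u = 0 \<longleftrightarrow> u = 0"
  proof
    assume "norm u = 0"
    then have n: "uni_norm u = 0" by (simp add: norm_uni_def)
    show "u = 0"
    proof (rule uni_eqI)
      show "uc u = uc 0" using uni_norm_ge(2)[of u] n by (simp add: uni_zero)
      fix A and x :: 'a assume x: "x \<in> cdom A"
      interpret cstar_algebra A using cdomD[OF x] by blast
      have "cnorm A (uf u A x) = 0"
        using uni_norm_bound[OF x, of u] n norm_nonneg[OF alg(3)[OF x]] by (simp add: order_antisym)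
      then show "uf u A x = uf 0 A x" using x norm_eq_zero alg(3)[OF x] by (simp add: uni_zero)
    qed
  next
    assume "u = 0"
    then have "uni_norm u \<le> 0"
      using alg(2) by (intro uni_norm_le) (auto simp: uni_zero cstar_algebra.norm_zero)
    then show "norm u = 0" using uni_norm_ge(1)[of u] by (simp add: norm_uni_def)
  qed
  show "norm (u + v) \<le> norm u + norm v" by (simp add: norm_uni_def uni_norm_plus)
  show "norm (r *\<^sub>R u) = \<bar>r\<bar> * norm u"
  proof (cases "r = 0")
    case True
    then show ?thesis using uni_norm_scaleR[of r u] uni_norm_ge(1)[of "r *\<^sub>R u"] by (simp add: norm_uni_def)
  next
    case False
    \<comment> \<open>Homogeneity is available as an inequality; applied to the inverse scalar it
      gives the reverse one.\<close>
    have "inverse r *\<^sub>R (r *\<^sub>R u) = u"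
      by (rule uni_eqI) (auto simp: uni_scaleR alg False cstar_algebra.smult_one
          simp flip: cstar_algebra.smult_assoc1 of_real_mult)
    then have "uni_norm u \<le> \<bar>inverse r\<bar> * uni_norm (r *\<^sub>R u)"
      using uni_norm_scaleR[of "inverse r" "r *\<^sub>R u"] by simp
    then have "\<bar>r\<bar> * uni_norm u \<le> uni_norm (r *\<^sub>R u)" using False by (simp add: field_simps)
    then show ?thesis using uni_norm_scaleR[of r u] by (simp add: norm_uni_def)
  qed
  show "norm (u * v) \<le> norm u * norm v" by (simp add: norm_uni_def uni_norm_times)
  have "uni_norm (1::'a uni) \<le> 1" by (rule uni_norm_le) (auto simp: uni_one)
  moreover have "1 \<le> uni_norm (1::'a uni)" using uni_norm_ge(2)[of "1::'a uni"] by (simp add: uni_one)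
  ultimately show "norm (1::'a uni) = 1" by (simp add: norm_uni_def)
qed

end

text \<open>Both components of a Cauchy sequence converge pointwise in each algebra. The pointwise
  limits F and G inherit the adjoint relation and a common bound, hence form an element of the type,
  and the Cauchy estimate, being uniform over all algebras, gives convergence in norm.\<close>

instance uni :: (type) banach
proof
  fix X :: "nat \<Rightarrow> 'a uni"
  assume X: "Cauchy X"
  have cau: "\<exists>N. \<forall>m\<ge>N. \<forall>n\<ge>N. norm (X m - X n) * c < e" if "e > 0" "c \<ge> 0" for e c
  proof -
    obtain N where N: "\<And>m n. m \<ge> N \<Longrightarrow> n \<ge> N \<Longrightarrow> norm (X m - X n) < e / (c + 1)"
      using X \<open>e > 0\<close> \<open>c \<ge> 0\<close> unfolding Cauchy_def dist_norm
      by (metis add_nonneg_pos divide_pos_pos zero_less_one)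
    have "norm (X m - X n) * c < e" if "m \<ge> N" "n \<ge> N" for m n
    proof -
      have "norm (X m - X n) * c \<le> norm (X m - X n) * (c + 1)" by (simp add: mult_left_mono)
      also have "\<dots> < e" using N[OF that] \<open>c \<ge> 0\<close> by (simp add: pos_less_divide_eq)
      finally show ?thesis .
    qed
    then show ?thesis by blast
  qed
  have nb: "uni_norm u = norm u" for u :: "'a uni" by (simp add: norm_uni_def)
  have "\<exists>l. l \<in> carrier A \<and> (\<lambda>n. cnorm A (uf (X n) A x \<ominus>\<^bsub>A\<^esub> l)) \<longlonglongrightarrow> 0" if x: "x \<in> cdom A" for A x
  proof -
    interpret cstar_algebra A using cdomD[OF x] by simp
    have "\<exists>N. \<forall>m\<ge>N. \<forall>n\<ge>N. cnorm A (uf (X m) A x \<ominus>\<^bsub>A\<^esub> uf (X n) A x) < e" if "e > 0" for e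
      using cau[OF that norm_nonneg] uni_norm_bound[OF x, of "X _ - X _"] cdomD[OF x]
      unfolding uni_minus(2)[OF x] nb by (meson le_less_trans)
    then show ?thesis
      using converges[of "\<lambda>n. uf (X n) A x"] cdomD[OF uni_closed(1)[OF x]] by metis
  qed
  note exF = this
  define F where "F = (\<lambda>A x. SOME l. l \<in> carrier A \<and> (\<lambda>n. cnorm A (uf (X n) A x \<ominus>\<^bsub>A\<^esub> l)) \<longlonglongrightarrow> 0)"
  have F: "F A x \<in> carrier A" "(\<lambda>n. cnorm A (uf (X n) A x \<ominus>\<^bsub>A\<^esub> F A x)) \<longlonglongrightarrow> 0"
    if "x \<in> cdom A" for A x
    using someI_ex[OF exF[OF that]] unfolding F_def by blast+
  have "\<exists>l. l \<in> carrier A \<and> (\<lambda>n. cnorm A (ug (X n) A x \<ominus>\<^bsub>A\<^esub> l)) \<longlonglongrightarrow> 0" if x: "x \<in> cdom A" for A x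
  proof -
    interpret cstar_algebra A using cdomD[OF x] by simp
    have "\<exists>N. \<forall>m\<ge>N. \<forall>n\<ge>N. cnorm A (ug (X m) A x \<ominus>\<^bsub>A\<^esub> ug (X n) A x) < e" if "e > 0" for e
      using cau[OF that norm_nonneg] uni_norm_bound'[OF x, of "X _ - X _"] cdomD[OF x]
      unfolding uni_minus_g[OF x] nb by (meson le_less_trans)
    then show ?thesis
      using converges[of "\<lambda>n. ug (X n) A x"] cdomD[OF uni_closed(2)[OF x]] by metis
  qed
  note exG = this
  define G where "G = (\<lambda>A x. SOME l. l \<in> carrier A \<and> (\<lambda>n. cnorm A (ug (X n) A x \<ominus>\<^bsub>A\<^esub> l)) \<longlonglongrightarrow> 0)"
  have G: "G A x \<in> carrier A" "(\<lambda>n. cnorm A (ug (X n) A x \<ominus>\<^bsub>A\<^esub> G A x)) \<longlonglongrightarrow> 0"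
    if "x \<in> cdom A" for A x
    using someI_ex[OF exG[OF that]] unfolding G_def by blast+
  have "Cauchy (\<lambda>n. uc (X n))"
    unfolding Cauchy_def dist_norm
  proof (intro allI impI)
    fix e :: real assume "e > 0"
    then obtain N where N: "\<And>m n. m \<ge> N \<Longrightarrow> n \<ge> N \<Longrightarrow> norm (X m - X n) < e"
      using X unfolding Cauchy_def dist_norm by metis
    have "cmod (uc (X m) - uc (X n)) < e" if "m \<ge> N" "n \<ge> N" for m n
      using le_less_trans[OF uni_norm_ge(2)[of "X m - X n"]] N[OF that] by (simp add: nb uni_minus)
    then show "\<exists>N. \<forall>m\<ge>N. \<forall>n\<ge>N. cmod (uc (X m) - uc (X n)) < e"
      by blast
  qed
  then obtain c where c: "(\<lambda>n. uc (X n)) \<longlonglongrightarrow> c" using Cauchy_convergent convergent_def by blast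
  obtain B where B: "B > 0" "\<And>n. norm (X n) \<le> B"
    using Cauchy_Bseq[OF X] by (auto elim: BseqE)
  define f where "f = (\<lambda>A x. if x \<in> cdom A then F A x else x)"
  define g where "g = (\<lambda>A x. if x \<in> cdom A then G A x else x)"
  have "dcent f g"
  proof (rule dcentI[of B], goal_cases)
    case (3 A x)
    then show ?case using F(1)[OF 3] G(1)[OF 3] cdomD[OF 3] by (simp add: f_def g_def cdom_def)
  next
    case (4 A x y)
    interpret cstar_algebra A using cdomD[OF 4(1)] by simp
    have [simp]: "x \<in> carrier A" "y \<in> carrier A" "F A x \<in> carrier A" "G A y \<in> carrier A"
      "uf (X n) A x \<in> carrier A" "ug (X n) A y \<in> carrier A" for n
      using cdomD[OF 4(1)] cdomD[OF 4(2)] F 4 G cdomD[OF uni_closed(1)[OF 4(1)]]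
        cdomD[OF uni_closed(2)[OF 4(2)]] by simp_all
    let ?D = "star A (F A x) \<otimes>\<^bsub>A\<^esub> y \<ominus>\<^bsub>A\<^esub> star A x \<otimes>\<^bsub>A\<^esub> G A y"
    have "cnorm A ?D \<le> cnorm A (uf (X n) A x \<ominus>\<^bsub>A\<^esub> F A x) * cnorm A y +
       cnorm A x * cnorm A (ug (X n) A y \<ominus>\<^bsub>A\<^esub> G A y)" for n
    proof -
      have "cnorm A ?D \<le> cnorm A (star A (F A x) \<otimes>\<^bsub>A\<^esub> y \<ominus>\<^bsub>A\<^esub> star A (uf (X n) A x) \<otimes>\<^bsub>A\<^esub> y) +
        cnorm A (star A x \<otimes>\<^bsub>A\<^esub> ug (X n) A y \<ominus>\<^bsub>A\<^esub> star A x \<otimes>\<^bsub>A\<^esub> G A y)"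
        using norm_triangle_minus[of "star A (F A x) \<otimes>\<^bsub>A\<^esub> y" "star A (uf (X n) A x) \<otimes>\<^bsub>A\<^esub> y"
           "star A x \<otimes>\<^bsub>A\<^esub> G A y"] uni_adj[OF 4, of "X n"] by simp
      also have "star A (F A x) \<otimes>\<^bsub>A\<^esub> y \<ominus>\<^bsub>A\<^esub> star A (uf (X n) A x) \<otimes>\<^bsub>A\<^esub> y =
         star A (F A x \<ominus>\<^bsub>A\<^esub> uf (X n) A x) \<otimes>\<^bsub>A\<^esub> y" by (simp add: minus_mult_l star_minus)
      also have "star A x \<otimes>\<^bsub>A\<^esub> ug (X n) A y \<ominus>\<^bsub>A\<^esub> star A x \<otimes>\<^bsub>A\<^esub> G A y =
         star A x \<otimes>\<^bsub>A\<^esub> (ug (X n) A y \<ominus>\<^bsub>A\<^esub> G A y)" by (simp add: minus_mult_r)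
      also have "cnorm A (star A (F A x \<ominus>\<^bsub>A\<^esub> uf (X n) A x) \<otimes>\<^bsub>A\<^esub> y) \<le>
         cnorm A (uf (X n) A x \<ominus>\<^bsub>A\<^esub> F A x) * cnorm A y"
        using norm_mult[of "star A (F A x \<ominus>\<^bsub>A\<^esub> uf (X n) A x)" y]
        by (simp add: norm_minus_commute)
      also have "cnorm A (star A x \<otimes>\<^bsub>A\<^esub> (ug (X n) A y \<ominus>\<^bsub>A\<^esub> G A y)) \<le>
         cnorm A x * cnorm A (ug (X n) A y \<ominus>\<^bsub>A\<^esub> G A y)"
        using norm_mult[of "star A x" "ug (X n) A y \<ominus>\<^bsub>A\<^esub> G A y"] by simp
      finally show ?thesis by simp
    qed
    moreover have "(\<lambda>n. cnorm A (uf (X n) A x \<ominus>\<^bsub>A\<^esub> F A x) * cnorm A y +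
       cnorm A x * cnorm A (ug (X n) A y \<ominus>\<^bsub>A\<^esub> G A y)) \<longlonglongrightarrow> 0 * cnorm A y + cnorm A x * 0"
      by (intro tendsto_intros F G 4)
    ultimately have "cnorm A ?D \<le> 0 * cnorm A y + cnorm A x * 0"
      by (intro LIMSEQ_le_const) auto
    then have "cnorm A ?D = 0" using norm_nonneg[of ?D] by simp
    then show ?case using norm_minus_eq_zero 4 by (simp add: f_def g_def)
  next
    case (5 A x)
    interpret cstar_algebra A using cdomD[OF 5] by simp
    have [simp]: "x \<in> carrier A" "F A x \<in> carrier A" "uf (X n) A x \<in> carrier A" for n
      using cdomD[OF 5] F 5 cdomD[OF uni_closed(1)[OF 5]] by simp_all
    have "cnorm A (F A x) \<le> cnorm A (uf (X n) A x \<ominus>\<^bsub>A\<^esub> F A x) + B * cnorm A x" for n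
    proof -
      have "cnorm A (F A x) \<le> cnorm A (F A x \<ominus>\<^bsub>A\<^esub> uf (X n) A x) + cnorm A (uf (X n) A x)"
        using norm_triangle_minus[of "F A x" "uf (X n) A x" "\<zero>\<^bsub>A\<^esub>"] by simp
      moreover have "cnorm A (uf (X n) A x) \<le> B * cnorm A x"
        using uni_norm_bound[OF 5, of "X n"] mult_right_mono[OF B(2)[of n] norm_nonneg[of x]]
        unfolding nb by simp
      ultimately show ?thesis by (simp add: norm_minus_commute)
    qed
    moreover have "(\<lambda>n. cnorm A (uf (X n) A x \<ominus>\<^bsub>A\<^esub> F A x) + B * cnorm A x) \<longlonglongrightarrow> 0 + B * cnorm A x"
      by (intro tendsto_intros F 5)
    ultimately have "cnorm A (F A x) \<le> 0 + B * cnorm A x"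
      by (intro LIMSEQ_le_const) auto
    then show ?case using 5 by (simp add: f_def)
  qed (use B in \<open>auto simp: f_def g_def\<close>)
  then have U: "uc (Abs_uni (c, f, g)) = c" "uf (Abs_uni (c, f, g)) = f"
    by (simp_all add: uni_Abs)
  let ?U = "Abs_uni (c, f, g)"
  have "X \<longlonglongrightarrow> ?U"
    unfolding LIMSEQ_iff
  proof (intro allI impI)
    fix e :: real assume e: "e > 0"
    obtain N where N: "\<And>m n. m \<ge> N \<Longrightarrow> n \<ge> N \<Longrightarrow> norm (X m - X n) < e / 2"
      using X e unfolding Cauchy_def dist_norm by (metis half_gt_zero)
    have "norm (X n - ?U) < e" if n: "n \<ge> N" for n
    proof -
      have "uni_norm (X n - ?U) \<le> e / 2"
      proof (rule uni_norm_le)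
        show "0 \<le> e / 2" using e by simp
        have "(\<lambda>m. cmod (uc (X n) - uc (X m))) \<longlonglongrightarrow> cmod (uc (X n) - c)"
          by (intro tendsto_intros c)
        moreover have "cmod (uc (X n) - uc (X m)) \<le> e / 2" if "m \<ge> N" for m
          using N[OF n that] uni_norm_ge(2)[of "X n - X m"] by (simp add: nb uni_minus)
        ultimately have "cmod (uc (X n) - c) \<le> e / 2" by (intro LIMSEQ_le_const2) auto
        then show "cmod (uc (X n - ?U)) \<le> e / 2" by (simp add: uni_minus U)
        fix A and x :: 'a assume x: "x \<in> cdom A"
        interpret cstar_algebra A using cdomD[OF x] by simp
        have [simp]: "x \<in> carrier A" "F A x \<in> carrier A" "uf (X n) A x \<in> carrier A" for n
          using cdomD[OF x] F x cdomD[OF uni_closed(1)[OF x]] by simp_all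
        have "cnorm A (uf (X n) A x \<ominus>\<^bsub>A\<^esub> F A x) \<le> e / 2 * cnorm A x + cnorm A (uf (X m) A x \<ominus>\<^bsub>A\<^esub> F A x)"
          if m: "m \<ge> N" for m
        proof -
          have "cnorm A (uf (X n) A x \<ominus>\<^bsub>A\<^esub> uf (X m) A x) \<le> norm (X n - X m) * cnorm A x"
            using uni_norm_bound[OF x, of "X n - X m"] by (simp add: nb uni_minus x)
          also have "\<dots> \<le> e / 2 * cnorm A x"
            using N[OF n m] by (intro mult_right_mono norm_nonneg) auto
          finally show ?thesis
            using norm_triangle_minus[of "uf (X n) A x" "uf (X m) A x" "F A x"] by simp
        qed
        moreover have "(\<lambda>m. e / 2 * cnorm A x + cnorm A (uf (X m) A x \<ominus>\<^bsub>A\<^esub> F A x)) \<longlonglongrightarrow> e / 2 * cnorm A x + 0"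
          by (intro tendsto_intros F x)
        ultimately have "cnorm A (uf (X n) A x \<ominus>\<^bsub>A\<^esub> F A x) \<le> e / 2 * cnorm A x + 0"
          by (intro LIMSEQ_le_const) auto
        then show "cnorm A (uf (X n - ?U) A x) \<le> e / 2 * cnorm A x"
          unfolding uni_minus(2)[OF x] U(2) using x by (simp add: f_def)
      qed
      then show ?thesis using e by (simp add: nb)
    qed
    then show "\<exists>no. \<forall>n\<ge>no. norm (X n - ?U) < e" by blast
  qed
  then show "convergent X" by (rule convergentI)
qed

section \<open>Involution, imaginary unit and C*-identity\<close>

instantiation uni :: (type) ucstar
begin

definition "adj_uni u = Abs_uni (cnj (uc u), ug u, uf u)"
definition "iu_uni = Abs_uni (\<i>, \<lambda>A x. if x \<in> cdom A then \<i> \<odot>\<^bsub>A\<^esub> x else x,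
  \<lambda>A x. if x \<in> cdom A then (- \<i>) \<odot>\<^bsub>A\<^esub> x else x)"
lemma uni_adjoint: "uc (adj u) = cnj (uc u)" "uf (adj u) = (ug u :: 'a cstar \<Rightarrow> 'a \<Rightarrow> 'a)"
  "ug (adj u) = (uf u :: 'a cstar \<Rightarrow> 'a \<Rightarrow> 'a)"
proof -
  have "dcent (ug u) (uf u)"
    by (rule dcentI[of "uni_norm u"]) (auto simp: uni_norm_ge uni_off uni_adj' uni_norm_bound')
  then show "uc (adj u) = cnj (uc u)" "uf (adj u) = ug u" "ug (adj u) = uf u"
    unfolding adj_uni_def by (simp_all add: uni_Abs)
qed

lemma uni_iu: "uc iu = \<i>" "uf iu = (\<lambda>A x. if x \<in> cdom A then \<i> \<odot>\<^bsub>A\<^esub> x else x :: 'a)"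
  "ug iu = (\<lambda>A x. if x \<in> cdom A then (- \<i>) \<odot>\<^bsub>A\<^esub> x else x :: 'a)"
proof -
  have "dcent (\<lambda>A x. if x \<in> cdom A then \<i> \<odot>\<^bsub>A\<^esub> x else x) (\<lambda>A x. if x \<in> cdom A then (- \<i>) \<odot>\<^bsub>A\<^esub> x else x :: 'a)"
  proof (rule dcentI[of 1], goal_cases)
    case (4 A x y)
    interpret cstar_algebra A using cdomD[OF 4(1)] by simp
    show ?case using 4 cdomD[of x A] cdomD[of y A] by (simp add: star_smult smult_mult_l smult_mult_r)
  next
    case (5 A x)
    interpret cstar_algebra A using cdomD[OF 5] by simp
    show ?case using 5 cdomD[of x A] by (simp add: norm_smult)
  qed (auto simp: cdom_algebra)
  then show "uc iu = \<i>" "uf iu = (\<lambda>A x. if x \<in> cdom A then \<i> \<odot>\<^bsub>A\<^esub> x else x :: 'a)"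
    "ug iu = (\<lambda>A x. if x \<in> cdom A then (- \<i>) \<odot>\<^bsub>A\<^esub> x else x :: 'a)"
    unfolding iu_uni_def by (simp_all add: uni_Abs)
qed

text \<open>The C*-identity of each algebra is used pointwise: moving one copy of u across the
  adjoint relation expresses the squared norm of u x through \<open>adj u * u\<close> applied to
  x.\<close>

lemma uni_norm_square_le: "(uni_norm (u :: 'a uni))\<^sup>2 \<le> uni_norm (adj u * u)"
proof -
  let ?N = "uni_norm (adj u * u)"
  have N: "0 \<le> ?N" by (simp add: uni_norm_ge)
  have "uni_norm u \<le> sqrt ?N"
  proof (rule uni_norm_le)
    have "cmod (uc (adj u * u)) \<le> ?N" by (rule uni_norm_ge)
    then have "(cmod (uc u))\<^sup>2 \<le> ?N" by (simp add: uni_times uni_adjoint norm_mult power2_eq_square)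
    then show "cmod (uc u) \<le> sqrt ?N" by (simp add: real_le_rsqrt)
    fix A and x :: 'a assume x: "x \<in> cdom A"
    interpret cstar_algebra A using cdomD[OF x] by blast
    have c: "x \<in> carrier A" "uf u A x \<in> carrier A" "ug u A (uf u A x) \<in> carrier A"
      using cdomD[OF x] cdomD[OF uni_closed(1)[OF x]] cdomD[OF uni_closed(2)[OF uni_closed(1)[OF x]]]
      by simp_all
    have "(cnorm A (uf u A x))\<^sup>2 = cnorm A (star A (uf u A x) \<otimes>\<^bsub>A\<^esub> uf u A x)"
      using c by (simp add: cstar_identity)
    also have "\<dots> = cnorm A (star A x \<otimes>\<^bsub>A\<^esub> ug u A (uf u A x))"
      using x by (simp add: uni_adj)
    also have "\<dots> \<le> cnorm A x * cnorm A (ug u A (uf u A x))"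
      using norm_mult[of "star A x" "ug u A (uf u A x)"] c by simp
    also have "\<dots> \<le> cnorm A x * (?N * cnorm A x)"
      using uni_norm_bound[OF x, of "adj u * u"] c by (intro mult_left_mono norm_nonneg) (simp add: uni_times uni_adjoint)
    also have "\<dots> = (sqrt ?N * cnorm A x)\<^sup>2" using N by (simp add: power2_eq_square mult_ac)
    finally show "cnorm A (uf u A x) \<le> sqrt ?N * cnorm A x"
      by (rule power2_le_imp_le) (use N norm_nonneg c in auto)
  qed (use N in simp)
  then have "(uni_norm u)\<^sup>2 \<le> (sqrt ?N)\<^sup>2" using uni_norm_ge by (intro power_mono) auto
  then show ?thesis using N by simp
qed

lemma uni_norm_adj_le: "uni_norm (adj u) \<le> uni_norm (u :: 'a uni)"
  by (rule uni_norm_le) (auto simp: uni_norm_ge uni_adjoint uni_norm_bound')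

instance
proof
  fix u v w :: "'a uni" and r s :: real
  have alg: "abelian_group A" "cstar_algebra A" "uf u' A x \<in> carrier A" "x \<in> carrier A"
    if "x \<in> cdom A" for A and x :: 'a and u'
    using cdomD[OF that] cdomD[OF uni_closed(1)[OF that]] by (auto simp: cstar_algebra_def)
  note [simp] = cdom_algebra
  show "adj (u + v) = adj u + adj v"
    by (rule uni_eqI) (auto simp: uni_adjoint uni_plus)
  show "adj (u * v) = adj v * adj u"
    by (rule uni_eqI) (auto simp: uni_adjoint uni_times)
  show "adj (adj u) = u"
    by (rule uni_eqI) (auto simp: uni_adjoint)
  show "adj (r *\<^sub>R u) = r *\<^sub>R adj u"
    by (rule uni_eqI) (auto simp: uni_adjoint uni_scaleR)
  show "iu * u = u * iu"
    by (rule uni_eqI) (auto simp: uni_neg uni_iu uni_times uni_smult)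
  show "iu * iu = - (1::'a uni)"
    by (rule uni_eqI) (auto simp: uni_neg uni_iu uni_times uni_one  uni_scaleR alg
        simp flip: cstar_algebra.smult_assoc1)
  show "adj iu = - (iu::'a uni)"
    by (rule uni_eqI) (auto simp: uni_neg uni_iu uni_adjoint  uni_scaleR alg
        simp flip: cstar_algebra.smult_assoc1)
  show "norm (adj u * u) = (norm u)\<^sup>2"
  proof -
    have "uni_norm (adj u * u) \<le> uni_norm u * uni_norm u"
      by (rule order_trans[OF uni_norm_times mult_right_mono[OF uni_norm_adj_le]]) (rule uni_norm_ge)
    then show ?thesis using uni_norm_square_le[of u] by (simp add: norm_uni_def power2_eq_square)
  qed
qed

end

section \<open>The isometric embedding of a C*-algebra into the universal one\<close>

text \<open>The class is an algebra over the reals; complex scalars act through the central element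
  \<open>iu\<close>.\<close>

definition cscale :: "complex \<Rightarrow> 'a::ucstar \<Rightarrow> 'a" where
  "cscale c x = Re c *\<^sub>R x + Im c *\<^sub>R (iu * x)"

text \<open>Each algebra gets a coordinate of its own, so different operations on the same type do
  not interfere. The scalar part 0 keeps 1 out of the image.\<close>

definition J :: "'a cstar \<Rightarrow> 'a \<Rightarrow> 'a uni" where
  "J A a = Abs_uni (0, \<lambda>B x. if x \<in> cdom B then if B = A then a \<otimes>\<^bsub>A\<^esub> x else \<zero>\<^bsub>B\<^esub> else x,
     \<lambda>B x. if x \<in> cdom B then if B = A then star A a \<otimes>\<^bsub>A\<^esub> x else \<zero>\<^bsub>B\<^esub> else x)"

context
  fixes A :: "'a cstar" (structure)
  assumes A: "cstar_algebra A"
begin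

interpretation cstar_algebra A by (rule A)

lemma cdom_carrier: "cdom A = carrier A"
  using A by (simp add: cdom_def)

lemma J_rep:
  assumes a: "a \<in> carrier A"
  shows "uc (J A a) = 0"
    "uf (J A a) = (\<lambda>B x. if x \<in> cdom B then if B = A then a \<otimes> x else \<zero>\<^bsub>B\<^esub> else x)"
    "ug (J A a) = (\<lambda>B x. if x \<in> cdom B then if B = A then star A a \<otimes> x else \<zero>\<^bsub>B\<^esub> else x)"
proof -
  have "dcent (\<lambda>B x. if x \<in> cdom B then if B = A then a \<otimes> x else \<zero>\<^bsub>B\<^esub> else x)
    (\<lambda>B x. if x \<in> cdom B then if B = A then star A a \<otimes> x else \<zero>\<^bsub>B\<^esub> else x)"
  proof (rule dcentI[of "cnorm A a"], goal_cases)
    case (4 B x y)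
    interpret B: cstar_algebra B using cdomD[OF 4(1)] by simp
    show ?case using 4 a cdomD[OF 4(1)] cdomD[OF 4(2)] by (auto simp: star_mult m_assoc)
  next
    case (5 B x)
    interpret B: cstar_algebra B using cdomD[OF 5] by simp
    show ?case using 5 a cdomD[OF 5] by (auto simp: norm_mult norm_nonneg B.norm_nonneg)
  qed (use a in \<open>auto simp: norm_nonneg cdom_algebra cdom_carrier\<close>)
  then show "uc (J A a) = 0"
    "uf (J A a) = (\<lambda>B x. if x \<in> cdom B then if B = A then a \<otimes> x else \<zero>\<^bsub>B\<^esub> else x)"
    "ug (J A a) = (\<lambda>B x. if x \<in> cdom B then if B = A then star A a \<otimes> x else \<zero>\<^bsub>B\<^esub> else x)"
    unfolding J_def by (simp_all add: uni_Abs)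
qed

lemma J_add: assumes [simp]: "a \<in> carrier A" "b \<in> carrier A"
  shows "J A (a \<oplus> b) = J A a + J A b"
proof (rule uni_eqI)
  fix B and x :: 'a assume x: "x \<in> cdom B"
  interpret B: cstar_algebra B using cdomD[OF x] by simp
  show "uf (J A (a \<oplus> b)) B x = uf (J A a + J A b) B x"
    using x cdomD[OF x] by (auto simp: J_rep uni_plus l_distr)
qed (simp add: J_rep uni_plus)

lemma J_mult: assumes [simp]: "a \<in> carrier A" "b \<in> carrier A"
  shows "J A (a \<otimes> b) = J A a * J A b"
proof (rule uni_eqI)
  fix B and x :: 'a assume x: "x \<in> cdom B"
  interpret B: cstar_algebra B using cdomD[OF x] by simp
  show "uf (J A (a \<otimes> b)) B x = uf (J A a * J A b) B x"
    using x cdomD[OF x] by (auto simp: J_rep uni_times m_assoc cdom_carrier cdom_algebra)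
qed (simp add: J_rep uni_times)

lemma J_star: assumes [simp]: "a \<in> carrier A"
  shows "J A (star A a) = adj (J A a)"
  by (rule uni_eqI) (auto simp: J_rep uni_adjoint)

lemma J_smult: assumes [simp]: "a \<in> carrier A"
  shows "J A (c \<odot> a) = cscale c (J A a)"
proof (rule uni_eqI)
  fix B and x :: 'a assume x: "x \<in> cdom B"
  interpret B: cstar_algebra B using cdomD[OF x] by simp
  have "(of_real (Re c) * 1 + of_real (Im c) * \<i>) \<odot> y = of_real (Re c) \<odot> y \<oplus> of_real (Im c) \<odot> (\<i> \<odot> y)"
    if "y \<in> carrier A" for y
    using that by (simp add: smult_l_distr smult_assoc1)
  moreover have "of_real (Re c) * 1 + of_real (Im c) * \<i> = c" by (simp add: complex_eq_iff)
  ultimately have "c \<odot> y = of_real (Re c) \<odot> y \<oplus> of_real (Im c) \<odot> (\<i> \<odot> y)"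
    if "y \<in> carrier A" for y
    using that by metis
  then show "uf (J A (c \<odot> a)) B x = uf (cscale c (J A a)) B x"
    using x cdomD[OF x]
    by (auto simp: J_rep uni_plus uni_scaleR cscale_def uni_times uni_iu l_distr smult_mult_l cdom_carrier cdom_algebra)
qed (simp add: J_rep uni_plus uni_scaleR cscale_def uni_times)

lemma J_scaleR: "a \<in> carrier A \<Longrightarrow> J A (of_real r \<odot> a) = r *\<^sub>R J A a"
  by (simp add: J_smult cscale_def)

lemma J_minus: assumes [simp]: "a \<in> carrier A" "b \<in> carrier A"
  shows "J A (a \<ominus> b) = J A a - J A b"
  using J_scaleR[of b "-1"] by (simp add: minus_smult J_add)

lemma J_zero: "J A \<zero> = 0"
  using J_scaleR[of "\<zero>" 0] by simp

text \<open>For the lower bound the operator is evaluated at \<open>star A a\<close>, where the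
  C*-identity produces the square of the norm.\<close>

lemma norm_J: assumes [simp]: "a \<in> carrier A"
  shows "norm (J A a) = cnorm A a"
proof (rule antisym)
  have "uni_norm (J A a) \<le> cnorm A a"
  proof (rule uni_norm_le)
    fix B and x :: 'a assume x: "x \<in> cdom B"
    interpret B: cstar_algebra B using cdomD[OF x] by simp
    show "cnorm B (uf (J A a) B x) \<le> cnorm A a * cnorm B x"
      using x cdomD[OF x] by (auto simp: J_rep norm_mult norm_nonneg B.norm_nonneg)
  qed (auto simp: J_rep norm_nonneg)
  then show "norm (J A a) \<le> cnorm A a" by (simp add: norm_uni_def)
  have "cnorm A (a \<otimes> star A a) \<le> uni_norm (J A a) * cnorm A (star A a)"
    using uni_norm_bound[of "star A a" A "J A a"] by (simp add: J_rep cdom_carrier)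
  moreover have "cnorm A (a \<otimes> star A a) = (cnorm A a)\<^sup>2"
    using cstar_identity[of "star A a"] by (simp add: star_star)
  ultimately have "cnorm A a * cnorm A a \<le> cnorm A a * norm (J A a)"
    by (simp add: norm_uni_def power2_eq_square mult.commute)
  then show "cnorm A a \<le> norm (J A a)"
    using norm_nonneg[of a] by (cases "cnorm A a = 0") (auto simp: mult_le_cancel_left)
qed

lemma J_inject: assumes "a \<in> carrier A" "b \<in> carrier A"
  shows "J A a = J A b \<longleftrightarrow> a = b"
  using norm_J[of "a \<ominus> b"] norm_minus_eq_zero[OF assms] assms by (auto simp: J_minus)

lemma J_sum: "finite I \<Longrightarrow> f \<in> I \<rightarrow> carrier A \<Longrightarrow> J A (finsum A f I) = (\<Sum>i\<in>I. J A (f i))"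
proof (induction I rule: finite_induct)
  case (insert i I)
  then have "f i \<in> carrier A" "f \<in> I \<rightarrow> carrier A" by auto
  then show ?case using insert by (simp add: finsum_insert J_add finsum_closed)
qed (simp add: J_zero)

text \<open>Closedness holds because \<open>A\<close> is complete and \<open>J A\<close> isometric.
  By this, roots and approximate units found in \<open>'a uni\<close> can be pulled back to
  \<open>A\<close>.\<close>

lemma csub_J: "csub (J A ` carrier A)"
  unfolding csub_def
proof (intro conjI)
  show "closed (J A ` carrier A)"
    unfolding closed_sequential_limits
  proof (intro allI impI, elim conjE)
    fix s l assume s: "\<forall>n. s n \<in> J A ` carrier A" and l: "s \<longlonglongrightarrow> l"
    define t where "t n = inv_into (carrier A) (J A) (s n)" for n
    have t: "t n \<in> carrier A" "s n = J A (t n)" for n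
      using s by (simp_all add: t_def inv_into_into f_inv_into_f)
    have nt: "norm (s m - s n) = cnorm A (t m \<ominus> t n)" for m n
      using t by (simp add: norm_J flip: J_minus)
    have "Cauchy s" using l LIMSEQ_imp_Cauchy by blast
    then have "\<exists>N. \<forall>m\<ge>N. \<forall>n\<ge>N. cnorm A (t m \<ominus> t n) < e" if "e > 0" for e
      using that unfolding Cauchy_def dist_norm nt by blast
    then obtain k where k: "k \<in> carrier A" "(\<lambda>n. cnorm A (t n \<ominus> k)) \<longlonglongrightarrow> 0"
      using converges[of t] t(1) by metis
    then have "(\<lambda>n. norm (s n - J A k)) \<longlonglongrightarrow> 0"
      using t by (simp add: norm_J flip: J_minus)
    then have "s \<longlonglongrightarrow> J A k" by (simp add: tendsto_norm_zero_iff LIM_zero_iff)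
    then show "l \<in> J A ` carrier A" using LIMSEQ_unique l k(1) by blast
  qed
  show "subspace (J A ` carrier A)"
  proof (rule subspaceI)
    show "0 \<in> J A ` carrier A" using J_zero by (metis imageI zero_closed)
    show "x + y \<in> J A ` carrier A" if "x \<in> J A ` carrier A" "y \<in> J A ` carrier A" for x y
      using that by (auto simp flip: J_add)
    show "c *\<^sub>R x \<in> J A ` carrier A" if "x \<in> J A ` carrier A" for c x
      using that by (auto simp flip: J_scaleR)
  qed
  show "\<forall>x\<in>J A ` carrier A. \<forall>y\<in>J A ` carrier A. x * y \<in> J A ` carrier A"
    by (auto simp flip: J_mult)
qed

text \<open>Moves convergence in a carrier to the topology of a type, with its limit rules for sums,
  products and adjoints.\<close>

lemma tendsto_J: "(\<And>n. f n \<in> carrier A) \<Longrightarrow> l \<in> carrier A \<Longrightarrow>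
   (\<lambda>n. J A (f n)) \<longlonglongrightarrow> J A l \<longleftrightarrow> (\<lambda>n. cnorm A (f n \<ominus> l)) \<longlonglongrightarrow> 0"
  by (subst LIM_zero_iff[symmetric], subst tendsto_norm_zero_iff[symmetric])
     (simp add: norm_J flip: J_minus)

end

section \<open>Consequences for C*-algebras\<close>

lemma (in abelian_group) minus_eq_zero_iff:
  "x \<in> carrier G \<Longrightarrow> y \<in> carrier G \<Longrightarrow> x \<ominus> y = \<zero> \<longleftrightarrow> x = y"
  by (metis a_inv_closed a_minus_def minus_equality minus_minus r_neg)

context
  fixes A :: "'a cstar" (structure)
  assumes A: "cstar_algebra A"
begin

interpretation cstar_algebra A by (rule A)

lemma positive_carrier: "positive A x \<Longrightarrow> x \<in> carrier A"
  by (auto simp: positive_def)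

text \<open>A root of \<open>J A x\<close> taken in \<open>'a uni\<close> lies in the image of
  \<open>J A\<close> by \<open>csub_J\<close>, so it is witnessed inside the possibly non-unital
  \<open>A\<close>.\<close>

lemma positive_iff_pos: assumes x: "x \<in> carrier A" shows "positive A x \<longleftrightarrow> pos (J A x)"
proof
  assume "positive A x"
  then obtain y where "y \<in> carrier A" "x = star A y \<otimes> y" by (auto simp: positive_def)
  then show "pos (J A x)" by (simp add: J_mult J_star A pos_adj_mult)
next
  assume "pos (J A x)"
  then obtain k where k: "adj k = k" "k * k = J A x" "k \<in> J A ` carrier A"
    using pos_root' csub_J[OF A] x by (metis imageI)
  then obtain y where y: "y \<in> carrier A" "k = J A y" by blast
  have "J A x = J A (star A y \<otimes> y)" using k y by (simp add: J_mult J_star A)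
  then have "x = star A y \<otimes> y" using x y by (simp add: J_inject[OF A])
  then show "positive A x" using y by (auto simp: positive_def)
qed

lemma positive_closed:
  assumes "\<And>n. positive A (f n)" "l \<in> carrier A" "(\<lambda>n. cnorm A (f n \<ominus> l)) \<longlonglongrightarrow> 0"
  shows "positive A l"
proof -
  have f: "f n \<in> carrier A" for n using assms(1) positive_carrier by blast
  have "(\<lambda>n. J A (f n)) \<longlonglongrightarrow> J A l" using tendsto_J[OF A] f assms by simp
  moreover have "pos (J A (f n))" for n using assms(1) positive_iff_pos f by blast
  ultimately show ?thesis using pos_closed positive_iff_pos assms(2) by blast
qed

lemma root_carrier:
  assumes x: "x \<in> carrier A" and n: "cnorm A x \<le> 1"
  obtains k where "k \<in> carrier A" "star A k = k" "cnorm A k \<le> 1" "star A x \<otimes> x = (k \<oplus> k) \<ominus> k \<otimes> k"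
proof -
  have "adj (J A x) * J A x \<in> J A ` carrier A"
    using x by (auto simp flip: J_mult[OF A] J_star[OF A])
  moreover have "norm (J A x) \<le> 1" using x n by (simp add: norm_J[OF A])
  ultimately obtain k' where k': "k' \<in> J A ` carrier A" "adj k' = k'" "norm k' \<le> 1"
      "adj (J A x) * J A x = k' + k' - k' * k'"
    using norm_le_one_root csub_J[OF A] by metis
  then obtain k where k: "k \<in> carrier A" "k' = J A k" by blast
  have "star A k = k"
    using k' k J_inject[OF A, of "star A k" k] by (simp add: J_star[OF A])
  moreover have "star A x \<otimes> x = (k \<oplus> k) \<ominus> k \<otimes> k"
    using k' k x J_inject[OF A, of "star A x \<otimes> x" "(k \<oplus> k) \<ominus> k \<otimes> k"]
    by (simp add: J_star[OF A] J_mult[OF A] J_minus[OF A] J_add[OF A])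
  ultimately show thesis using that k k' by (simp add: norm_J[OF A])
qed

lemma norm_square_le_carrier:
  assumes "x \<in> carrier A" "k \<in> carrier A" "star A k = k"
    "cnorm A (star A x \<otimes> x \<ominus> ((k \<oplus> k) \<ominus> k \<otimes> k)) \<le> \<delta>"
  shows "(cnorm A x)\<^sup>2 \<le> 1 + \<delta>"
proof -
  have "adj (J A k) = J A k" using assms by (simp flip: J_star[OF A])
  moreover have "norm (adj (J A x) * J A x - (J A k + J A k - J A k * J A k)) \<le> \<delta>"
    using assms by (simp add: norm_J[OF A] flip: J_star[OF A] J_mult[OF A] J_minus[OF A] J_add[OF A])
  ultimately show ?thesis using norm_square_le_root assms(1) by (metis norm_J[OF A])
qed

lemma cauchy_schwarz_carrier:
  assumes I: "finite I" and x: "\<And>i. i \<in> I \<Longrightarrow> x i \<in> carrier A" and y: "\<And>i. i \<in> I \<Longrightarrow> y i \<in> carrier A"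
  shows "(cnorm A (\<Oplus>i\<in>I. star A (x i) \<otimes> y i))\<^sup>2 \<le>
    cnorm A (\<Oplus>i\<in>I. star A (x i) \<otimes> x i) * cnorm A (\<Oplus>i\<in>I. star A (y i) \<otimes> y i)"
proof -
  have "cnorm A (\<Oplus>i\<in>I. star A (u i) \<otimes> v i) = norm (\<Sum>i\<in>I. adj (J A (u i)) * J A (v i))"
    if "\<And>i. i \<in> I \<Longrightarrow> u i \<in> carrier A" "\<And>i. i \<in> I \<Longrightarrow> v i \<in> carrier A" for u v
  proof -
    have "norm (J A (\<Oplus>i\<in>I. star A (u i) \<otimes> v i)) = norm (\<Sum>i\<in>I. adj (J A (u i)) * J A (v i))"
      using that by (subst J_sum[OF A I]) (auto intro!: sum.cong arg_cong[of _ _ norm] simp: J_mult[OF A] J_star[OF A])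
    then show ?thesis using that by (simp add: norm_J[OF A] finsum_closed Pi_iff)
  qed
  then show ?thesis using cauchy_schwarz[of "\<lambda>i. J A (x i)" "\<lambda>i. J A (y i)" I] x y by simp
qed

lemma approximate_unit_carrier:
  assumes I: "finite I" and a: "\<And>i. i \<in> I \<Longrightarrow> a i \<in> carrier A" and \<epsilon>: "\<epsilon> > 0"
  obtains e where "e \<in> carrier A" "star A e = e" "cnorm A e \<le> 1" "\<forall>i\<in>I. cnorm A (e \<otimes> a i \<ominus> a i) < \<epsilon>"
proof -
  obtain e' where e': "e' \<in> J A ` carrier A" "adj e' = e'" "norm e' \<le> 1"
      "\<forall>i\<in>I. norm (e' * J A (a i) - J A (a i)) < \<epsilon>"
    by (rule approximate_unit[OF csub_J[OF A], of I "\<lambda>i. J A (a i)" \<epsilon>])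
       (use I a \<epsilon> in \<open>auto simp flip: J_star[OF A]\<close>)
  then obtain e where e: "e \<in> carrier A" "e' = J A e" by blast
  have "star A e = e"
    using e' e J_inject[OF A, of "star A e" e] by (simp add: J_star[OF A])
  moreover have "cnorm A (e \<otimes> a i \<ominus> a i) = norm (e' * J A (a i) - J A (a i))" if "i \<in> I" for i
    using a[OF that] e by (simp add: norm_J[OF A] flip: J_mult[OF A] J_minus[OF A])
  ultimately show thesis using that e e' by (simp add: norm_J[OF A])
qed

lemma positive_by_contractions:
  assumes x: "x \<in> carrier A" "star A x = x"
    and *: "\<And>b. positive A b \<Longrightarrow> cnorm A b \<le> 1 \<Longrightarrow> cnorm A (b \<ominus> x) \<le> 1"
  shows "positive A x"
proof -
  have "pos (J A x)"
  proof (rule pos_by_contractions[OF _ csub_J[OF A]])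
    show "adj (J A x) = J A x" "J A x \<in> J A ` carrier A" using x by (simp_all flip: J_star[OF A])
    fix k assume k: "k \<in> J A ` carrier A" "adj k = k" "norm (k * k) \<le> 1"
    then obtain y where y: "y \<in> carrier A" "k = J A y" by blast
    have "J A (star A y) = J A y" using k y by (simp add: J_star[OF A])
    then have "star A y = y" using y by (simp add: J_inject[OF A])
    then have "positive A (y \<otimes> y)" using y unfolding positive_def by (intro bexI[of _ y]) simp_all
    moreover have "cnorm A (y \<otimes> y) \<le> 1" using k y by (simp add: norm_J[OF A] flip: J_mult[OF A])
    ultimately have "cnorm A (y \<otimes> y \<ominus> x) \<le> 1" using * by blast
    then show "norm (k * k - J A x) \<le> 1"
      using y x by (simp add: norm_J[OF A] flip: J_mult[OF A] J_minus[OF A])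
  qed
  then show ?thesis using x positive_iff_pos by blast
qed

lemma norm_diff_contractions_carrier:
  assumes "positive A p" "positive A q" "cnorm A p \<le> 1" "cnorm A q \<le> 1"
  shows "cnorm A (p \<ominus> q) \<le> 1"
proof -
  have c: "p \<in> carrier A" "q \<in> carrier A" using assms positive_carrier by auto
  have "norm (J A p - J A q) \<le> 1"
    using assms c positive_iff_pos by (intro norm_diff_contractions) (simp_all add: norm_J[OF A])
  then show ?thesis using c by (simp add: norm_J[OF A] flip: J_minus[OF A])
qed

lemma positive_star: "positive A x \<Longrightarrow> star A x = x"
  by (auto simp: positive_def star_mult star_star)

lemma positive_smult: assumes "positive A x" "t \<ge> 0" shows "positive A (of_real t \<odot> x)"
proof -
  have "x \<in> carrier A" using assms positive_carrier by blast
  then show ?thesis using assms positive_iff_pos[of "of_real t \<odot> x"] positive_iff_pos[of x] 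
    by (simp add: J_scaleR[OF A] pos_scaleR)
qed

end

text \<open>Being a contraction is encoded by the unit-free equation of \<open>root_carrier\<close>,
  which a *-homomorphism preserves verbatim. Uniqueness of C*-norms and the identification of
  matrices over sequences with sequences of matrices both come from here.\<close>

lemma star_hom_contractive:
  fixes A :: "'a cstar" and B :: "'b cstar"
  assumes A: "cstar_algebra A" and B: "cstar_algebra B"
    and cl: "\<And>x. x \<in> carrier A \<Longrightarrow> \<phi> x \<in> carrier B"
    and add: "\<And>x y. x \<in> carrier A \<Longrightarrow> y \<in> carrier A \<Longrightarrow> \<phi> (x \<oplus>\<^bsub>A\<^esub> y) = \<phi> x \<oplus>\<^bsub>B\<^esub> \<phi> y"
    and mult: "\<And>x y. x \<in> carrier A \<Longrightarrow> y \<in> carrier A \<Longrightarrow> \<phi> (x \<otimes>\<^bsub>A\<^esub> y) = \<phi> x \<otimes>\<^bsub>B\<^esub> \<phi> y"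
    and smult: "\<And>c x. x \<in> carrier A \<Longrightarrow> \<phi> (c \<odot>\<^bsub>A\<^esub> x) = c \<odot>\<^bsub>B\<^esub> \<phi> x"
    and star: "\<And>x. x \<in> carrier A \<Longrightarrow> \<phi> (star A x) = star B (\<phi> x)"
    and x: "x \<in> carrier A"
  shows "cnorm B (\<phi> x) \<le> cnorm A x"
proof (rule dense_ge)
  interpret A: cstar_algebra A by (rule A)
  interpret B: cstar_algebra B by (rule B)
  fix t assume t: "cnorm A x < t"
  then have t0: "t > 0" using A.norm_nonneg[OF x] by simp
  \<comment> \<open>Scaling by a t strictly above the norm covers x = 0 without a case
    distinction.\<close>
  define y where "y = of_real (1 / t) \<odot>\<^bsub>A\<^esub> x"
  have y: "y \<in> carrier A" using x by (simp add: y_def)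
  have "cnorm A y = cnorm A x / t" using x t0 by (simp add: y_def A.norm_smult norm_divide)
  then have "cnorm A y \<le> 1" using t t0 by simp
  then obtain k where k: "k \<in> carrier A" "star A k = k"
      "star A y \<otimes>\<^bsub>A\<^esub> y = (k \<oplus>\<^bsub>A\<^esub> k) \<ominus>\<^bsub>A\<^esub> k \<otimes>\<^bsub>A\<^esub> k"
    using root_carrier[OF A y] by metis
  have minus: "\<phi> (a \<ominus>\<^bsub>A\<^esub> b) = \<phi> a \<ominus>\<^bsub>B\<^esub> \<phi> b" if "a \<in> carrier A" "b \<in> carrier A" for a b
    using that by (simp add: A.minus_smult B.minus_smult add smult cl)
  have "star B (\<phi> y) \<otimes>\<^bsub>B\<^esub> \<phi> y = \<phi> (star A y \<otimes>\<^bsub>A\<^esub> y)" using y by (simp add: mult star)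
  also have "\<dots> = (\<phi> k \<oplus>\<^bsub>B\<^esub> \<phi> k) \<ominus>\<^bsub>B\<^esub> \<phi> k \<otimes>\<^bsub>B\<^esub> \<phi> k"
    using k by (simp add: add mult minus)
  finally have e: "star B (\<phi> y) \<otimes>\<^bsub>B\<^esub> \<phi> y = (\<phi> k \<oplus>\<^bsub>B\<^esub> \<phi> k) \<ominus>\<^bsub>B\<^esub> \<phi> k \<otimes>\<^bsub>B\<^esub> \<phi> k" .
  have R: "(\<phi> k \<oplus>\<^bsub>B\<^esub> \<phi> k) \<ominus>\<^bsub>B\<^esub> \<phi> k \<otimes>\<^bsub>B\<^esub> \<phi> k \<in> carrier B" using k cl by simp
  have "cnorm B (star B (\<phi> y) \<otimes>\<^bsub>B\<^esub> \<phi> y \<ominus>\<^bsub>B\<^esub> ((\<phi> k \<oplus>\<^bsub>B\<^esub> \<phi> k) \<ominus>\<^bsub>B\<^esub> \<phi> k \<otimes>\<^bsub>B\<^esub> \<phi> k)) \<le> 0"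
    unfolding e using B.norm_minus_eq_zero[OF R R] by simp
  then have "(cnorm B (\<phi> y))\<^sup>2 \<le> 1 + 0"
    using y k cl by (intro norm_square_le_carrier[OF B, of _ "\<phi> k"]) (auto simp flip: star)
  then have "(cnorm B (\<phi> y))\<^sup>2 \<le> 1\<^sup>2" by simp
  then have "cnorm B (\<phi> y) \<le> 1" by (rule power2_le_imp_le) simp
  moreover have "\<phi> y = of_real (1 / t) \<odot>\<^bsub>B\<^esub> \<phi> x" unfolding y_def using x by (rule smult)
  then have "cnorm B (\<phi> y) = cnorm B (\<phi> x) / t" using t0 cl[OF x] by (simp add: B.norm_smult norm_divide)
  ultimately show "cnorm B (\<phi> x) \<le> t" using t0 by simp
qed

section \<open>The C*-norm on matrices\<close>

text \<open>The algebra-valued inner product of columns. Their entries range over all of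
  \<open>'a uni\<close> and not just the image of one algebra, so that standard basis columns with
  entry 1 are available.\<close>

definition ip :: "nat \<Rightarrow> (nat \<Rightarrow> 'a::ucstar) \<Rightarrow> (nat \<Rightarrow> 'a) \<Rightarrow> 'a" where
  "ip r u v = (\<Sum>i<r. adj (u i) * v i)"

definition hn :: "nat \<Rightarrow> (nat \<Rightarrow> 'a::ucstar) \<Rightarrow> real" where
  "hn r u = sqrt (norm (ip r u u))"

definition mv :: "nat \<Rightarrow> (nat \<times> nat \<Rightarrow> 'a::ucstar) \<Rightarrow> (nat \<Rightarrow> 'a) \<Rightarrow> nat \<Rightarrow> 'a" where
  "mv r X u i = (\<Sum>j<r. X (i, j) * u j)"

text \<open>The operator norm of a matrix acting on the Hilbert module of columns.\<close>

definition opn :: "nat \<Rightarrow> (nat \<times> nat \<Rightarrow> 'a::ucstar) \<Rightarrow> real" where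
  "opn r X = Sup {hn r (mv r X u) | u. hn r u \<le> 1}"

lemma hn_nonneg [simp]: "0 \<le> hn r u" by (simp add: hn_def)

lemma hn_square: "(hn r u)\<^sup>2 = norm (ip r u u)" by (simp add: hn_def)

lemma ip_norm_le: "norm (ip r u v) \<le> hn r u * hn r v"
proof -
  have "(norm (ip r u v))\<^sup>2 \<le> (hn r u * hn r v)\<^sup>2"
    unfolding power_mult_distrib hn_square unfolding ip_def by (rule cauchy_schwarz)
  then show ?thesis by (rule power2_le_imp_le) simp
qed

lemma ip_add: "ip r u (\<lambda>i. v i + w i) = ip r u v + ip r u w"
  "ip r (\<lambda>i. v i + w i) u = ip r v u + ip r w u"
  by (simp_all add: ip_def distrib_left distrib_right adj_add sum.distrib)

lemma hn_triangle: "hn r (\<lambda>i. u i + v i) \<le> hn r u + hn r v"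
proof -
  have "(hn r (\<lambda>i. u i + v i))\<^sup>2 = norm (ip r u u + ip r u v + (ip r v u + ip r v v))"
    by (simp add: hn_square ip_add add_ac)
  also have "\<dots> \<le> norm (ip r u u) + norm (ip r u v) + (norm (ip r v u) + norm (ip r v v))"
    by (intro norm_triangle_le add_mono order_refl)
  also have "\<dots> \<le> (hn r u)\<^sup>2 + hn r u * hn r v + (hn r v * hn r u + (hn r v)\<^sup>2)"
    unfolding hn_square by (intro add_mono ip_norm_le order_refl)
  also have "\<dots> = (hn r u + hn r v)\<^sup>2" by (simp add: power2_eq_square algebra_simps)
  finally show ?thesis by (rule power2_le_imp_le) simp
qed

lemma hn_scaleR: "hn r (\<lambda>i. t *\<^sub>R u i) = \<bar>t\<bar> * hn r u"
proof -
  have "ip r (\<lambda>i. t *\<^sub>R u i) (\<lambda>i. t *\<^sub>R u i) = t\<^sup>2 *\<^sub>R ip r u u"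
    by (simp add: ip_def scaleR_right.sum power2_eq_square)
  then show ?thesis by (simp add: hn_def real_sqrt_mult)
qed

lemma adj_cscale_mult: "adj (cscale c x) * cscale c y = (cmod c)\<^sup>2 *\<^sub>R (adj x * y)"
proof -
  have 1: "adj (cscale c x) = Re c *\<^sub>R adj x - Im c *\<^sub>R (iu * adj x)"
    by (simp add: cscale_def adj_add adj_mult iu_commute)
  have "(cmod c)\<^sup>2 = Re c * Re c + Im c * Im c" unfolding cmod_power2 by (simp add: power2_eq_square)
  then show ?thesis
    by (subst 1) (simp add: cscale_def distrib_left left_diff_distrib mult.assoc mult_iu_left[of "adj x"] scaleR_left_distrib
        right_diff_distrib scaleR_diff_right scaleR_add_right)
qed

lemma hn_cscale: "hn r (\<lambda>i. cscale c (u i)) = cmod c * hn r u"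
proof -
  have "ip r (\<lambda>i. cscale c (u i)) (\<lambda>i. cscale c (u i)) = (cmod c)\<^sup>2 *\<^sub>R ip r u u"
    by (simp add: ip_def scaleR_right.sum adj_cscale_mult)
  then show ?thesis by (simp add: hn_def real_sqrt_mult)
qed

lemma hn_sum_le: "hn r u \<le> (\<Sum>i<r. norm (u i))"
proof -
  have "(hn r u)\<^sup>2 \<le> (\<Sum>i<r. norm (adj (u i) * u i))"
    unfolding hn_square ip_def by (rule norm_sum)
  also have "\<dots> = (\<Sum>i<r. (norm (u i))\<^sup>2)" by (simp add: norm_adj_mult)
  also have "\<dots> \<le> (\<Sum>i<r. norm (u i) * (\<Sum>i<r. norm (u i)))"
    unfolding power2_eq_square by (intro sum_mono mult_left_mono member_le_sum) auto
  also have "\<dots> = (\<Sum>i<r. norm (u i))\<^sup>2" by (simp add: power2_eq_square sum_distrib_right)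
  finally show ?thesis by (rule power2_le_imp_le) (simp add: sum_nonneg)
qed

lemma norm_le_hn: assumes "i < r" shows "norm (u i) \<le> hn r u"
proof -
  have "(norm (u i))\<^sup>2 = norm (adj (u i) * u i)" by (simp add: norm_adj_mult)
  also have "\<dots> \<le> norm (ip r u u)"
  proof (rule pos_norm_mono[OF pos_adj_mult])
    have "ip r u u - adj (u i) * u i = (\<Sum>j\<in>{..<r}-{i}. adj (u j) * u j)"
      using assms by (simp add: ip_def sum_diff1)
    then show "pos (ip r u u - adj (u i) * u i)" by (auto intro!: pos_sum pos_adj_mult)
  qed
  also have "\<dots> = (hn r u)\<^sup>2" by (simp add: hn_square)
  finally show ?thesis by (rule power2_le_imp_le) simp
qed

text \<open>Crude, but it makes the supremum in \<open>opn\<close> finite and bounds the operator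
  norm by the entry norms.\<close>

lemma hn_mv_le: "hn r (mv r X u) \<le> (\<Sum>p\<in>idx r. norm (X p)) * hn r u"
proof -
  have "hn r (mv r X u) \<le> (\<Sum>i<r. norm (mv r X u i))" by (rule hn_sum_le)
  also have "\<dots> \<le> (\<Sum>i<r. \<Sum>j<r. norm (X (i, j)) * hn r u)"
  proof (rule sum_mono)
    fix i
    have "norm (mv r X u i) \<le> (\<Sum>j<r. norm (X (i, j) * u j))" unfolding mv_def by (rule norm_sum)
    also have "\<dots> \<le> (\<Sum>j<r. norm (X (i, j)) * hn r u)"
      by (intro sum_mono order_trans[OF norm_mult_ineq] mult_left_mono norm_le_hn) auto
    finally show "norm (mv r X u i) \<le> (\<Sum>j<r. norm (X (i, j)) * hn r u)" .
  qed
  also have "\<dots> = (\<Sum>p\<in>idx r. norm (X p)) * hn r u"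
    by (simp add: idx_def sum.cartesian_product sum_distrib_right)
  finally show ?thesis .
qed

lemma opn_le:
  assumes "\<And>u. hn r (mv r X u) \<le> K * hn r u" "K \<ge> 0" shows "opn r X \<le> K"
  unfolding opn_def
proof (rule cSup_least)
  have "hn r (\<lambda>_. 0) \<le> 1" by (simp add: hn_def ip_def)
  then show "{hn r (mv r X u) |u. hn r u \<le> 1} \<noteq> {}" by blast
  show "x \<le> K" if "x \<in> {hn r (mv r X u) |u. hn r u \<le> 1}" for x
    using that assms by (auto intro: order_trans mult_left_le)
qed

lemma opn_bdd: "bdd_above {hn r (mv r X u) |u. hn r u \<le> 1}"
proof (rule bdd_aboveI)
  fix x assume "x \<in> {hn r (mv r X u) |u. hn r u \<le> 1}"
  then obtain u where u: "x = hn r (mv r X u)" "hn r u \<le> 1" by blast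
  have "x \<le> (\<Sum>p\<in>idx r. norm (X p)) * hn r u" unfolding u(1) by (rule hn_mv_le)
  also have "\<dots> \<le> (\<Sum>p\<in>idx r. norm (X p))" using u(2) by (intro mult_left_le sum_nonneg) auto
  finally show "x \<le> (\<Sum>p\<in>idx r. norm (X p))" .
qed

lemma opn_nonneg: "0 \<le> opn r X"
proof -
  have "hn r (mv r X (\<lambda>_. 0)) \<le> opn r X"
    unfolding opn_def by (rule cSup_upper[OF _ opn_bdd]) (auto intro!: exI[of _ "\<lambda>_. 0"] simp: hn_def ip_def)
  then show ?thesis by (rule order_trans[OF hn_nonneg])
qed

lemma hn_mv_opn: "hn r (mv r X u) \<le> opn r X * hn r u"
proof (cases "hn r u = 0")
  case True then show ?thesis using hn_mv_le[of r X u] by simp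
next
  case False
  let ?t = "1 / hn r u"
  have t: "hn r u > 0" using False hn_nonneg[of r u] by linarith
  have "hn r (mv r X (\<lambda>i. ?t *\<^sub>R u i)) \<le> opn r X"
    unfolding opn_def
    by (rule cSup_upper[OF _ opn_bdd]) (use t in \<open>auto simp: hn_scaleR intro!: exI[of _ "\<lambda>i. ?t *\<^sub>R u i"]\<close>)
  also have "mv r X (\<lambda>i. ?t *\<^sub>R u i) = (\<lambda>i. ?t *\<^sub>R mv r X u i)"
    by (simp add: mv_def scaleR_right.sum fun_eq_iff)
  finally show ?thesis using t by (simp add: hn_scaleR field_simps)
qed

lemma opn_le_sum: "opn r X \<le> (\<Sum>p\<in>idx r. norm (X p))"
  by (rule opn_le[OF hn_mv_le]) (simp add: sum_nonneg)

text \<open>Evaluation at a standard basis column isolates the entry.\<close>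

lemma norm_le_opn: assumes "p \<in> idx r" shows "norm (X p) \<le> opn r X"
proof -
  obtain i j where p: "p = (i, j)" "i < r" "j < r" using assms by (auto simp: idx_def)
  define u where "u = (\<lambda>k. if k = j then 1 else 0 :: 'a)"
  have "ip r u u = 1" using p by (simp add: ip_def u_def if_distrib[of "\<lambda>x. x * _"] if_distrib[of adj] cong: if_cong)
  then have u: "hn r u = 1" by (simp add: hn_def)
  have "mv r X u i = X p" using p by (simp add: mv_def u_def if_distrib[of "\<lambda>x. _ * x"] cong: if_cong)
  then have "norm (X p) \<le> hn r (mv r X u)" using norm_le_hn[OF p(2), of "mv r X u"] by simp
  also have "\<dots> \<le> opn r X" using hn_mv_opn[of r X u] u by simp
  finally show ?thesis .
qed

lemma hn_cong: "(\<And>i. i < r \<Longrightarrow> u i = v i) \<Longrightarrow> hn r u = hn r v"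
  by (simp add: hn_def ip_def)

lemma opn_add: "opn r (\<lambda>p. X p + Y p) \<le> opn r X + opn r Y"
proof (rule opn_le)
  fix u
  have "mv r (\<lambda>p. X p + Y p) u = (\<lambda>i. mv r X u i + mv r Y u i)"
    by (simp add: mv_def distrib_right sum.distrib fun_eq_iff)
  then have "hn r (mv r (\<lambda>p. X p + Y p) u) \<le> hn r (mv r X u) + hn r (mv r Y u)"
    by (simp add: hn_triangle)
  also have "\<dots> \<le> opn r X * hn r u + opn r Y * hn r u" by (intro add_mono hn_mv_opn)
  finally show "hn r (mv r (\<lambda>p. X p + Y p) u) \<le> (opn r X + opn r Y) * hn r u" by (simp add: distrib_right)
qed (simp add: opn_nonneg)

lemma cscale_mult: "cscale c x * y = cscale c (x * y)" "x * cscale c y = cscale c (x * y)"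
  by (simp_all add: cscale_def distrib_right distrib_left mult.assoc mult_iu_left)

lemma cscale_add: "cscale c (x + y) = cscale c x + cscale c y"
  by (simp add: cscale_def distrib_left scaleR_add_right)

lemma cscale_zero [simp]: "cscale c 0 = 0" by (simp add: cscale_def)

lemma cscale_sum: "cscale c (sum f I) = (\<Sum>i\<in>I. cscale c (f i))"
  by (induction I rule: infinite_finite_induct) (auto simp: cscale_add)

lemma opn_cscale: "opn r (\<lambda>p. cscale c (X p)) \<le> cmod c * opn r X"
proof (rule opn_le)
  fix u
  have "mv r (\<lambda>p. cscale c (X p)) u = (\<lambda>i. cscale c (mv r X u i))"
    by (simp add: mv_def cscale_mult cscale_sum fun_eq_iff)
  then show "hn r (mv r (\<lambda>p. cscale c (X p)) u) \<le> (cmod c * opn r X) * hn r u"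
    using mult_left_mono[OF hn_mv_opn[of r X u], of "cmod c"] by (simp add: hn_cscale mult.assoc)
qed (simp add: opn_nonneg)

definition mm :: "nat \<Rightarrow> (nat \<times> nat \<Rightarrow> 'a::ucstar) \<Rightarrow> (nat \<times> nat \<Rightarrow> 'a) \<Rightarrow> nat \<times> nat \<Rightarrow> 'a" where
  "mm r X Y = (\<lambda>(i, j). \<Sum>k<r. X (i, k) * Y (k, j))"

definition mstar :: "(nat \<times> nat \<Rightarrow> 'a::ucstar) \<Rightarrow> nat \<times> nat \<Rightarrow> 'a" where
  "mstar X = (\<lambda>(i, j). adj (X (j, i)))"

lemma mv_mm: "mv r (mm r X Y) u = mv r X (mv r Y u)"
proof
  fix i
  have "mv r (mm r X Y) u i = (\<Sum>j<r. \<Sum>k<r. X (i, k) * Y (k, j) * u j)"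
    by (simp add: mv_def mm_def sum_distrib_right)
  also have "\<dots> = (\<Sum>k<r. \<Sum>j<r. X (i, k) * Y (k, j) * u j)" by (rule sum.swap)
  also have "\<dots> = mv r X (mv r Y u) i" by (simp add: mv_def sum_distrib_left mult.assoc)
  finally show "mv r (mm r X Y) u i = mv r X (mv r Y u) i" .
qed

lemma ip_mv: "ip r (mv r X u) v = ip r u (mv r (mstar X) v)"
proof -
  have "ip r (mv r X u) v = (\<Sum>i<r. \<Sum>j<r. adj (u j) * adj (X (i, j)) * v i)"
    by (simp add: ip_def mv_def adj_sum adj_mult sum_distrib_right)
  also have "\<dots> = (\<Sum>j<r. \<Sum>i<r. adj (u j) * adj (X (i, j)) * v i)" by (rule sum.swap)
  also have "\<dots> = ip r u (mv r (mstar X) v)"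
    by (simp add: ip_def mv_def mstar_def sum_distrib_left mult.assoc)
  finally show ?thesis .
qed

lemma mstar_mstar [simp]: "mstar (mstar X) = X" by (auto simp: mstar_def fun_eq_iff)

lemma opn_mm: "opn r (mm r X Y) \<le> opn r X * opn r Y"
proof (rule opn_le)
  fix u
  have "hn r (mv r X (mv r Y u)) \<le> opn r X * hn r (mv r Y u)" by (rule hn_mv_opn)
  also have "\<dots> \<le> opn r X * (opn r Y * hn r u)" by (intro mult_left_mono hn_mv_opn opn_nonneg)
  finally show "hn r (mv r (mm r X Y) u) \<le> opn r X * opn r Y * hn r u" by (simp add: mv_mm mult.assoc)
qed (simp add: opn_nonneg)

lemma opn_mstar_le: "opn r (mstar X) \<le> opn r X"
proof (rule opn_le)
  fix u
  let ?w = "mv r (mstar X) u"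
  have "(hn r ?w)\<^sup>2 = norm (ip r (mv r X ?w) u)" by (simp add: hn_square ip_mv)
  also have "\<dots> \<le> hn r (mv r X ?w) * hn r u" by (rule ip_norm_le)
  also have "\<dots> \<le> opn r X * hn r ?w * hn r u" by (intro mult_right_mono hn_mv_opn) auto
  finally have "hn r ?w * hn r ?w \<le> hn r ?w * (opn r X * hn r u)" by (simp add: power2_eq_square mult_ac)
  then show "hn r ?w \<le> opn r X * hn r u"
    using opn_nonneg[of r X] hn_nonneg[of r ?w] by (cases "hn r ?w = 0") (auto simp: mult_le_cancel_left)
qed (rule opn_nonneg)

text \<open>For the nontrivial inequality, the squared norm of the column X u is the norm of the
  inner product of u with \<open>mm r (mstar X) X\<close> applied to u.\<close>

lemma opn_cstar: "opn r (mm r (mstar X) X) = (opn r X)\<^sup>2"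
proof (rule antisym)
  show "opn r (mm r (mstar X) X) \<le> (opn r X)\<^sup>2"
    using opn_mm[of r "mstar X" X] mult_right_mono[OF opn_mstar_le opn_nonneg, of r X r X]
    by (simp add: power2_eq_square)
  let ?N = "opn r (mm r (mstar X) X)"
  have "opn r X \<le> sqrt ?N"
  proof (rule opn_le)
    fix u
    have "(hn r (mv r X u))\<^sup>2 = norm (ip r u (mv r (mm r (mstar X) X) u))"
      by (simp add: hn_square ip_mv mv_mm)
    also have "\<dots> \<le> hn r u * (?N * hn r u)"
      by (rule order_trans[OF ip_norm_le mult_left_mono[OF hn_mv_opn]]) simp
    also have "\<dots> = (sqrt ?N * hn r u)\<^sup>2" using opn_nonneg[of r "mm r (mstar X) X"] by (simp add: power2_eq_square mult_ac)
    finally show "hn r (mv r X u) \<le> sqrt ?N * hn r u"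
      by (rule power2_le_imp_le) (simp add: opn_nonneg)
  qed (simp add: opn_nonneg)
  then have "(opn r X)\<^sup>2 \<le> (sqrt ?N)\<^sup>2" by (intro power_mono opn_nonneg)
  then show "(opn r X)\<^sup>2 \<le> ?N" by (simp add: opn_nonneg)
qed

lemma opn_cong: "(\<And>p. p \<in> idx r \<Longrightarrow> X p = Y p) \<Longrightarrow> opn r X = opn r Y"
proof -
  assume "\<And>p. p \<in> idx r \<Longrightarrow> X p = Y p"
  then have "hn r (mv r X u) = hn r (mv r Y u)" for u
    by (intro hn_cong) (auto simp: mv_def idx_def)
  then show ?thesis by (simp add: opn_def)
qed

section \<open>Matrices over a carrier-based C*-algebra\<close>

lemma mats_iff: "x \<in> mats r X \<longleftrightarrow> (\<forall>i<r. \<forall>j<r. x (i, j) \<in> X) \<and> x \<in> extensional (idx r)"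
  by (auto simp: mats_def PiE_iff idx_def)

lemma idx_iff [simp]: "(i, j) \<in> idx r \<longleftrightarrow> i < r \<and> j < r"
  by (simp add: idx_def)

lemma finite_idx [simp]: "finite (idx r)" by (simp add: idx_def)

lemma mats_eqI: "x \<in> mats r X \<Longrightarrow> y \<in> mats r Y \<Longrightarrow> (\<And>i j. i < r \<Longrightarrow> j < r \<Longrightarrow> x (i, j) = y (i, j)) \<Longrightarrow> x = y"
  unfolding mats_def by (rule PiE_ext) (auto simp: idx_def)

lemma mats_entry: "x \<in> mats r X \<Longrightarrow> i < r \<Longrightarrow> j < r \<Longrightarrow> x (i, j) \<in> X"
  by (simp add: mats_iff)

lemma mat_sel [simp]:
  "carrier (mat_alg_with r A N) = mats r (carrier A)" "cnorm (mat_alg_with r A N) = N"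
  "zero (mat_alg_with r A N) = (\<lambda>p\<in>idx r. \<zero>\<^bsub>A\<^esub>)"
  by (simp_all add: mat_alg_with_def)

lemma mat_entry:
  assumes "i < r" "j < r"
  shows "(x \<oplus>\<^bsub>mat_alg_with r A N\<^esub> y) (i, j) = x (i, j) \<oplus>\<^bsub>A\<^esub> y (i, j)"
    "(x \<otimes>\<^bsub>mat_alg_with r A N\<^esub> y) (i, j) = (\<Oplus>\<^bsub>A\<^esub>k\<in>{..<r}. x (i, k) \<otimes>\<^bsub>A\<^esub> y (k, j))"
    "(c \<odot>\<^bsub>mat_alg_with r A N\<^esub> x) (i, j) = c \<odot>\<^bsub>A\<^esub> x (i, j)"
    "star (mat_alg_with r A N) x (i, j) = star A (x (j, i))"
    "zero (mat_alg_with r A N) (i, j) = \<zero>\<^bsub>A\<^esub>"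
  using assms by (simp_all add: mat_alg_with_def)

lemma cscale_complex: "cscale (c + d) x = cscale c x + cscale d x"
  "cscale (c * d) x = cscale c (cscale d x)" "cscale 1 x = x" "adj (cscale c x) = cscale (cnj c) (adj x)"
proof -
  show "cscale (c + d) x = cscale c x + cscale d x" "cscale 1 x = x"
    by (simp_all add: cscale_def scaleR_left_distrib)
  show "cscale (c * d) x = cscale c (cscale d x)"
    by (simp add: cscale_def distrib_left scaleR_left_distrib scaleR_left_diff_distrib scaleR_add_right scaleR_diff_right)
  show "adj (cscale c x) = cscale (cnj c) (adj x)"
    by (simp add: cscale_def adj_add adj_mult iu_commute[of "adj x"])
qed

context
  fixes A :: "'a cstar" and r :: nat
  assumes A: "cstar_algebra A"
begin

interpretation cstar_algebra A by (rule A)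

lemma mat_closed_aux:
  assumes x: "x \<in> mats r (carrier A)" and y: "y \<in> mats r (carrier A)"
  shows "x \<oplus>\<^bsub>mat_alg_with r A N\<^esub> y \<in> mats r (carrier A)"
    "x \<otimes>\<^bsub>mat_alg_with r A N\<^esub> y \<in> mats r (carrier A)"
    "c \<odot>\<^bsub>mat_alg_with r A N\<^esub> x \<in> mats r (carrier A)"
    "star (mat_alg_with r A N) x \<in> mats r (carrier A)"
    "zero (mat_alg_with r A N) \<in> mats r (carrier A)"
proof -
  note [simp] = mats_entry[OF x] mats_entry[OF y]
  show "x \<oplus>\<^bsub>mat_alg_with r A N\<^esub> y \<in> mats r (carrier A)"
    "x \<otimes>\<^bsub>mat_alg_with r A N\<^esub> y \<in> mats r (carrier A)"
    "c \<odot>\<^bsub>mat_alg_with r A N\<^esub> x \<in> mats r (carrier A)"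
    "star (mat_alg_with r A N) x \<in> mats r (carrier A)"
    "zero (mat_alg_with r A N) \<in> mats r (carrier A)"
    by (auto simp: mats_iff mat_entry finsum_closed) (auto simp: mat_alg_with_def)
qed

lemma mat_zero_closed: "(\<lambda>p\<in>idx r. \<zero>\<^bsub>A\<^esub>) \<in> mats r (carrier A)"
  by (simp add: mats_iff)

text \<open>The unary operations carry along the second matrix of the joint statement; it is set
  equal to the first.\<close>

lemmas mat_closed = mat_closed_aux(1,2) mat_closed_aux(3)[where x = x and y = x for x]
  mat_closed_aux(4)[where x = x and y = x for x] mat_zero_closed

lemma J_mat_aux:
  assumes "x \<in> mats r (carrier A)" "y \<in> mats r (carrier A)" "i < r" "j < r"
  shows "J A ((x \<oplus>\<^bsub>mat_alg_with r A N\<^esub> y) (i, j)) = J A (x (i, j)) + J A (y (i, j))"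
    "J A ((x \<otimes>\<^bsub>mat_alg_with r A N\<^esub> y) (i, j)) = (\<Sum>k<r. J A (x (i, k)) * J A (y (k, j)))"
    "J A ((c \<odot>\<^bsub>mat_alg_with r A N\<^esub> x) (i, j)) = cscale c (J A (x (i, j)))"
    "J A (star (mat_alg_with r A N) x (i, j)) = adj (J A (x (j, i)))"
    "J A (zero (mat_alg_with r A N) (i, j)) = 0"
proof -
  have "J A (\<Oplus>\<^bsub>A\<^esub>k\<in>{..<r}. x (i, k) \<otimes>\<^bsub>A\<^esub> y (k, j)) = (\<Sum>k<r. J A (x (i, k) \<otimes>\<^bsub>A\<^esub> y (k, j)))"
    using assms by (intro J_sum[OF A]) (auto simp: mats_entry)
  also have "\<dots> = (\<Sum>k<r. J A (x (i, k)) * J A (y (k, j)))"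
    using assms by (intro sum.cong) (auto simp: mats_entry J_mult[OF A])
  finally show "J A ((x \<otimes>\<^bsub>mat_alg_with r A N\<^esub> y) (i, j)) = (\<Sum>k<r. J A (x (i, k)) * J A (y (k, j)))"
    using assms by (simp add: mat_entry)
qed (use assms in \<open>simp_all add: mat_entry mats_entry J_add[OF A] J_smult[OF A] J_star[OF A] J_zero[OF A]\<close>)

lemmas J_mat = J_mat_aux(1,2) J_mat_aux(3)[where x = x and y = x for x]
  J_mat_aux(4)[where x = x and y = x for x]

text \<open>Turns matrix identities into entrywise identities in the ring \<open>'a uni\<close>,
  where \<open>finsum\<close> becomes an ordinary sum and the algebra axioms are left to the
  simplifier.\<close>

lemma mats_J_eqI:
  assumes "x \<in> mats r (carrier A)" "y \<in> mats r (carrier A)"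
    "\<And>i j. i < r \<Longrightarrow> j < r \<Longrightarrow> J A (x (i, j)) = J A (y (i, j))"
  shows "x = y"
  using assms by (intro mats_eqI[OF assms(1,2)]) (simp add: J_inject[OF A] mats_entry)

lemma mat_abelian_group: "abelian_group (mat_alg_with r A N)"
proof (rule abelian_groupI; unfold mat_sel(1))
  fix x y z assume c: "x \<in> mats r (carrier A)" "y \<in> mats r (carrier A)" "z \<in> mats r (carrier A)"
  let ?M = "mat_alg_with r A N"
  note [simp] = mat_closed J_mat c
  show "x \<oplus>\<^bsub>?M\<^esub> y \<oplus>\<^bsub>?M\<^esub> z = x \<oplus>\<^bsub>?M\<^esub> (y \<oplus>\<^bsub>?M\<^esub> z)" by (rule mats_J_eqI) (auto simp: add.assoc)
next
  fix x y assume c: "x \<in> mats r (carrier A)" "y \<in> mats r (carrier A)"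
  let ?M = "mat_alg_with r A N"
  note [simp] = mat_closed J_mat c
  show "x \<oplus>\<^bsub>?M\<^esub> y \<in> mats r (carrier A)" by simp
  show "x \<oplus>\<^bsub>?M\<^esub> y = y \<oplus>\<^bsub>?M\<^esub> x" by (rule mats_J_eqI) auto
next
  fix x assume c: "x \<in> mats r (carrier A)"
  let ?M = "mat_alg_with r A N"
  note [simp] = mat_closed J_mat c J_zero[OF A]
  show "\<zero>\<^bsub>?M\<^esub> \<oplus>\<^bsub>?M\<^esub> x = x" by (rule mats_J_eqI) auto
  have "(- 1) \<odot>\<^bsub>?M\<^esub> x \<oplus>\<^bsub>?M\<^esub> x = \<zero>\<^bsub>?M\<^esub>"
    by (rule mats_J_eqI) (auto simp: cscale_def)
  then show "\<exists>y\<in>mats r (carrier A). y \<oplus>\<^bsub>?M\<^esub> x = \<zero>\<^bsub>?M\<^esub>"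
    by (intro bexI[of _ "(- 1) \<odot>\<^bsub>?M\<^esub> x"]) auto
qed (auto simp: mats_iff)

lemma mat_minus_entry:
  assumes x: "x \<in> mats r (carrier A)" and y: "y \<in> mats r (carrier A)"
  shows "x \<ominus>\<^bsub>mat_alg_with r A N\<^esub> y \<in> mats r (carrier A)"
   "i < r \<Longrightarrow> j < r \<Longrightarrow> (x \<ominus>\<^bsub>mat_alg_with r A N\<^esub> y) (i, j) = x (i, j) \<ominus>\<^bsub>A\<^esub> y (i, j)"
proof -
  let ?M = "mat_alg_with r A N"
  interpret M: abelian_group ?M by (rule mat_abelian_group)
  note [simp] = mat_closed J_mat x y J_zero[OF A]
  have "(- 1) \<odot>\<^bsub>?M\<^esub> y \<oplus>\<^bsub>?M\<^esub> y = \<zero>\<^bsub>?M\<^esub>"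
    by (rule mats_J_eqI) (auto simp: cscale_def)
  then have m: "\<ominus>\<^bsub>?M\<^esub> y = (- 1) \<odot>\<^bsub>?M\<^esub> y"
    by (intro M.minus_equality) simp_all
  then show "x \<ominus>\<^bsub>?M\<^esub> y \<in> mats r (carrier A)" by (simp add: a_minus_def)
  show "i < r \<Longrightarrow> j < r \<Longrightarrow> (x \<ominus>\<^bsub>?M\<^esub> y) (i, j) = x (i, j) \<ominus>\<^bsub>A\<^esub> y (i, j)"
    using smult_minus_one[OF mats_entry[OF y]] by (simp add: a_minus_def m mat_entry)
qed

text \<open>The algebra axioms hold for all matrices, so only the norm is left to the caller. The
  two comparisons with entry norms give definiteness and completeness; homogeneity as an inequality
  becomes an equality by scaling back.\<close>

lemma mat_cstarI:
  fixes N :: "(nat \<times> nat \<Rightarrow> 'a) \<Rightarrow> real"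
  defines "M \<equiv> mat_alg_with r A N"
  assumes nn: "\<And>x. x \<in> mats r (carrier A) \<Longrightarrow> 0 \<le> N x"
    and E1: "\<And>x i j. x \<in> mats r (carrier A) \<Longrightarrow> i < r \<Longrightarrow> j < r \<Longrightarrow> cnorm A (x (i, j)) \<le> N x"
    and E2: "\<And>x. x \<in> mats r (carrier A) \<Longrightarrow> N x \<le> (\<Sum>p\<in>idx r. cnorm A (x p))"
    and tri: "\<And>x y. x \<in> mats r (carrier A) \<Longrightarrow> y \<in> mats r (carrier A) \<Longrightarrow> N (x \<oplus>\<^bsub>M\<^esub> y) \<le> N x + N y"
    and sm: "\<And>c x. x \<in> mats r (carrier A) \<Longrightarrow> N (c \<odot>\<^bsub>M\<^esub> x) \<le> cmod c * N x"
    and ml: "\<And>x y. x \<in> mats r (carrier A) \<Longrightarrow> y \<in> mats r (carrier A) \<Longrightarrow> N (x \<otimes>\<^bsub>M\<^esub> y) \<le> N x * N y"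
    and cs: "\<And>x. x \<in> mats r (carrier A) \<Longrightarrow> N (star M x \<otimes>\<^bsub>M\<^esub> x) = (N x)\<^sup>2"
  shows "cstar_algebra M"
proof -
  note [simp] = mat_closed J_mat mat_minus_entry J_zero[OF A]
  interpret M: abelian_group M unfolding M_def by (rule mat_abelian_group)
  have cM [simp]: "carrier M = mats r (carrier A)" "cnorm M = N" by (simp_all add: M_def)
  have z: "zero M \<in> mats r (carrier A)" using M.zero_closed by simp
  have nz: "N x = 0 \<longleftrightarrow> x = \<zero>\<^bsub>M\<^esub>" if x: "x \<in> mats r (carrier A)" for x
  proof
    assume "N x = 0"
    then have "cnorm A (x (i, j)) = 0" if "i < r" "j < r" for i j
      using E1[OF x that] norm_nonneg[OF mats_entry[OF x that]] by simp
    then show "x = \<zero>\<^bsub>M\<^esub>"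
      using x z by (intro mats_eqI[OF x z]) (simp add: norm_eq_zero mats_entry M_def)
  next
    assume "x = \<zero>\<^bsub>M\<^esub>"
    then have "N x \<le> 0" using E2[OF x] by (simp add: M_def)
    then show "N x = 0" using nn[OF x] by simp
  qed
  have nm: "N (x \<ominus>\<^bsub>M\<^esub> y) \<le> (\<Sum>p\<in>idx r. cnorm A (x p \<ominus>\<^bsub>A\<^esub> y p))" "x \<ominus>\<^bsub>M\<^esub> y \<in> mats r (carrier A)"
    "i < r \<Longrightarrow> j < r \<Longrightarrow> (x \<ominus>\<^bsub>M\<^esub> y) (i, j) = x (i, j) \<ominus>\<^bsub>A\<^esub> y (i, j)"
    if "x \<in> mats r (carrier A)" "y \<in> mats r (carrier A)" for x y i j
  proof -
    have "N (x \<ominus>\<^bsub>M\<^esub> y) \<le> (\<Sum>p\<in>idx r. cnorm A ((x \<ominus>\<^bsub>M\<^esub> y) p))"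
      using that by (intro E2) (simp add: M_def)
    also have "\<dots> = (\<Sum>p\<in>idx r. cnorm A (x p \<ominus>\<^bsub>A\<^esub> y p))"
      using that by (intro sum.cong) (auto simp: idx_def M_def)
    finally show "N (x \<ominus>\<^bsub>M\<^esub> y) \<le> (\<Sum>p\<in>idx r. cnorm A (x p \<ominus>\<^bsub>A\<^esub> y p))" .
  qed (use that in \<open>auto simp: M_def\<close>)
  have sm': "N (c \<odot>\<^bsub>M\<^esub> x) = cmod c * N x" if x: "x \<in> mats r (carrier A)" for c x
  proof (cases "c = 0")
    case True
    then show ?thesis using sm[OF x, of c] nn[of "c \<odot>\<^bsub>M\<^esub> x"] x by (simp add: M_def)
  next
    case False
    have cx: "c \<odot>\<^bsub>M\<^esub> x \<in> mats r (carrier A)" using x by (simp add: M_def)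
    have "(1 / c) \<odot>\<^bsub>M\<^esub> (c \<odot>\<^bsub>M\<^esub> x) = x"
      unfolding M_def by (rule mats_J_eqI) (use x False in \<open>auto simp flip: cscale_complex(2) simp: cscale_complex(3)\<close>)
    then have "N x \<le> cmod (1 / c) * N (c \<odot>\<^bsub>M\<^esub> x)" using sm[OF cx, of "1 / c"] by simp
    then have "cmod c * N x \<le> N (c \<odot>\<^bsub>M\<^esub> x)" using False by (simp add: norm_divide field_simps)
    then show ?thesis using sm[OF x, of c] by simp
  qed
  have metric: "Metric_space (carrier M) (cdist M)"
  proof
    fix x y w
    have anti: "N (x \<ominus>\<^bsub>M\<^esub> y) \<le> N (y \<ominus>\<^bsub>M\<^esub> x)" if "x \<in> carrier M" "y \<in> carrier M" for x y
    proof -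
      have "x \<ominus>\<^bsub>M\<^esub> y = (- 1) \<odot>\<^bsub>M\<^esub> (y \<ominus>\<^bsub>M\<^esub> x)"
        unfolding M_def by (rule mats_J_eqI) (use that in \<open>auto simp: J_minus[OF A] mats_entry cscale_def\<close>)
      then show ?thesis using sm[of "y \<ominus>\<^bsub>M\<^esub> x" "-1"] that nm by simp
    qed
    show "0 \<le> cdist M x y" by (auto simp: cdist_def nn nm)
    show "cdist M x y = cdist M y x" using anti[of x y] anti[of y x] by (auto simp: cdist_def)
    show "x \<in> carrier M \<Longrightarrow> y \<in> carrier M \<Longrightarrow> cdist M x y = 0 \<longleftrightarrow> x = y"
      using nz[of "x \<ominus>\<^bsub>M\<^esub> y"] nm[of x y] by (simp add: cdist_def M.minus_eq_zero_iff)
    assume c: "x \<in> carrier M" "y \<in> carrier M" "w \<in> carrier M"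
    have "x \<ominus>\<^bsub>M\<^esub> w = (x \<ominus>\<^bsub>M\<^esub> y) \<oplus>\<^bsub>M\<^esub> (y \<ominus>\<^bsub>M\<^esub> w)"
      unfolding M_def by (rule mats_J_eqI) (use c in \<open>auto simp: J_minus[OF A] mats_entry\<close>)
    then show "cdist M x w \<le> cdist M x y + cdist M y w"
      using c tri[OF nm(2) nm(2)] by (simp add: cdist_def)
  qed
  have compl: "Metric_space.mcomplete (carrier M) (cdist M)"
  proof (rule mcompleteI[OF metric])
    fix s :: "nat \<Rightarrow> nat \<times> nat \<Rightarrow> 'a" assume s: "\<And>n. s n \<in> carrier M"
      and C: "\<And>e. e > 0 \<Longrightarrow> \<exists>N. \<forall>m\<ge>N. \<forall>n\<ge>N. cnorm M (s m \<ominus>\<^bsub>M\<^esub> s n) < e"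
    have "\<exists>l. l \<in> carrier A \<and> (\<lambda>n. cnorm A (s n (i, j) \<ominus>\<^bsub>A\<^esub> l)) \<longlonglongrightarrow> 0" if ij: "i < r" "j < r" for i j
    proof -
      have le: "cnorm A (s m (i, j) \<ominus>\<^bsub>A\<^esub> s n (i, j)) \<le> cnorm M (s m \<ominus>\<^bsub>M\<^esub> s n)" for m n
        using E1[of "s m \<ominus>\<^bsub>M\<^esub> s n" i j] nm(2,3)[of "s m" "s n"] s ij by simp
      have "\<exists>N. \<forall>m\<ge>N. \<forall>n\<ge>N. cnorm A (s m (i, j) \<ominus>\<^bsub>A\<^esub> s n (i, j)) < e" if "e > 0" for e
        using C[OF that] le by (meson le_less_trans)
      then obtain l where "l \<in> carrier A" "(\<lambda>n. cnorm A (s n (i, j) \<ominus>\<^bsub>A\<^esub> l)) \<longlonglongrightarrow> 0"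
        using converges[of "\<lambda>n. s n (i, j)"] s ij by (metis cM(1) mats_entry)
      then show ?thesis by blast
    qed
    note ex = this
    define l where "l = (\<lambda>p\<in>idx r. SOME l. l \<in> carrier A \<and> (\<lambda>n. cnorm A (s n p \<ominus>\<^bsub>A\<^esub> l)) \<longlonglongrightarrow> 0)"
    have l: "l p \<in> carrier A" "(\<lambda>n. cnorm A (s n p \<ominus>\<^bsub>A\<^esub> l p)) \<longlonglongrightarrow> 0" if "p \<in> idx r" for p
      using someI_ex[OF ex, of "fst p" "snd p"] that by (auto simp: l_def idx_def)
    have lM: "l \<in> mats r (carrier A)" using l(1) by (auto simp: mats_iff l_def)
    have "(\<lambda>n. \<Sum>p\<in>idx r. cnorm A (s n p \<ominus>\<^bsub>A\<^esub> l p)) \<longlonglongrightarrow> (\<Sum>p\<in>idx r. 0)"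
      by (intro tendsto_sum l)
    then have lim: "(\<lambda>n. \<Sum>p\<in>idx r. cnorm A (s n p \<ominus>\<^bsub>A\<^esub> l p)) \<longlonglongrightarrow> 0" by simp
    have "(\<lambda>n. N (s n \<ominus>\<^bsub>M\<^esub> l)) \<longlonglongrightarrow> 0"
      by (rule tendsto_sandwich[OF _ _ tendsto_const lim]) (use nm[OF _ lM] s nn in auto)
    then show "\<exists>l\<in>carrier M. (\<lambda>n. cnorm M (s n \<ominus>\<^bsub>M\<^esub> l)) \<longlonglongrightarrow> 0" using lM by auto
  qed
  show ?thesis
  proof (unfold_locales, unfold cM)
    fix x y z :: "nat \<times> nat \<Rightarrow> 'a" and c d :: complex
    assume [simp]: "x \<in> mats r (carrier A)"
    show "c \<odot>\<^bsub>M\<^esub> x \<in> mats r (carrier A)" "star M x \<in> mats r (carrier A)" by (simp_all add: M_def)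
    show "(c + d) \<odot>\<^bsub>M\<^esub> x = c \<odot>\<^bsub>M\<^esub> x \<oplus>\<^bsub>M\<^esub> d \<odot>\<^bsub>M\<^esub> x" "(c * d) \<odot>\<^bsub>M\<^esub> x = c \<odot>\<^bsub>M\<^esub> (d \<odot>\<^bsub>M\<^esub> x)"
      "1 \<odot>\<^bsub>M\<^esub> x = x"
      unfolding M_def by (rule mats_J_eqI; simp add: cscale_complex)+
    show "star M (star M x) = x" "star M (c \<odot>\<^bsub>M\<^esub> x) = cnj c \<odot>\<^bsub>M\<^esub> star M x"
      unfolding M_def by (rule mats_J_eqI; simp add: cscale_complex)+
    show "0 \<le> N x" "N x = 0 \<longleftrightarrow> x = \<zero>\<^bsub>M\<^esub>" "N (c \<odot>\<^bsub>M\<^esub> x) = cmod c * N x" "N (star M x \<otimes>\<^bsub>M\<^esub> x) = (N x)\<^sup>2"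
      by (simp_all add: nn nz sm' cs)
    assume [simp]: "y \<in> mats r (carrier A)"
    show "c \<odot>\<^bsub>M\<^esub> (x \<oplus>\<^bsub>M\<^esub> y) = c \<odot>\<^bsub>M\<^esub> x \<oplus>\<^bsub>M\<^esub> c \<odot>\<^bsub>M\<^esub> y"
      unfolding M_def by (rule mats_J_eqI; simp add: cscale_add)
    show "x \<otimes>\<^bsub>M\<^esub> y \<in> mats r (carrier A)" by (simp add: M_def)
    show "(c \<odot>\<^bsub>M\<^esub> x) \<otimes>\<^bsub>M\<^esub> y = c \<odot>\<^bsub>M\<^esub> (x \<otimes>\<^bsub>M\<^esub> y)" "x \<otimes>\<^bsub>M\<^esub> (c \<odot>\<^bsub>M\<^esub> y) = c \<odot>\<^bsub>M\<^esub> (x \<otimes>\<^bsub>M\<^esub> y)"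
      unfolding M_def by (rule mats_J_eqI; simp add: cscale_mult cscale_sum)+
    show "star M (x \<oplus>\<^bsub>M\<^esub> y) = star M x \<oplus>\<^bsub>M\<^esub> star M y" "star M (x \<otimes>\<^bsub>M\<^esub> y) = star M y \<otimes>\<^bsub>M\<^esub> star M x"
      unfolding M_def by (rule mats_J_eqI; simp add: adj_add adj_sum adj_mult)+
    show "N (x \<oplus>\<^bsub>M\<^esub> y) \<le> N x + N y" "N (x \<otimes>\<^bsub>M\<^esub> y) \<le> N x * N y" by (simp_all add: tri ml)
    assume [simp]: "z \<in> mats r (carrier A)"
    show "(x \<oplus>\<^bsub>M\<^esub> y) \<otimes>\<^bsub>M\<^esub> z = x \<otimes>\<^bsub>M\<^esub> z \<oplus>\<^bsub>M\<^esub> y \<otimes>\<^bsub>M\<^esub> z" "z \<otimes>\<^bsub>M\<^esub> (x \<oplus>\<^bsub>M\<^esub> y) = z \<otimes>\<^bsub>M\<^esub> x \<oplus>\<^bsub>M\<^esub> z \<otimes>\<^bsub>M\<^esub> y"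
      unfolding M_def by (rule mats_J_eqI; simp add: distrib_left distrib_right sum.distrib)+
    show "(x \<otimes>\<^bsub>M\<^esub> y) \<otimes>\<^bsub>M\<^esub> z = x \<otimes>\<^bsub>M\<^esub> (y \<otimes>\<^bsub>M\<^esub> z)"
    proof (unfold M_def, rule mats_J_eqI, goal_cases)
      case (3 i j)
      then show ?case
        by (simp add: sum_distrib_left sum_distrib_right mult.assoc) (rule sum.swap)
    qed simp_all
  qed (use compl in auto)
qed

text \<open>Existence of a C*-norm on matrices, which gives the choice in \<open>mat_alg\<close> its
  meaning.\<close>

lemma mat_alg_opn: "cstar_algebra (mat_alg_with r A (\<lambda>x. opn r (\<lambda>p. J A (x p))))"
proof (rule mat_cstarI)
  let ?M = "mat_alg_with r A (\<lambda>x. opn r (\<lambda>p. J A (x p)))"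
  fix x y c assume x: "x \<in> mats r (carrier A)"
  show "0 \<le> opn r (\<lambda>p. J A (x p))" by (rule opn_nonneg)
  show "cnorm A (x (i, j)) \<le> opn r (\<lambda>p. J A (x p))" if "i < r" "j < r" for i j
    using norm_le_opn[of "(i, j)" r "\<lambda>p. J A (x p)"] that x by (simp add: norm_J[OF A] mats_entry)
  have "(\<Sum>p\<in>idx r. norm (J A (x p))) = (\<Sum>p\<in>idx r. cnorm A (x p))"
    using x by (intro sum.cong) (auto simp: norm_J[OF A] idx_def mats_entry)
  then show "opn r (\<lambda>p. J A (x p)) \<le> (\<Sum>p\<in>idx r. cnorm A (x p))"
    using opn_le_sum[of r "\<lambda>p. J A (x p)"] by simp
  have "opn r (\<lambda>p. J A ((c \<odot>\<^bsub>?M\<^esub> x) p)) = opn r (\<lambda>p. cscale c (J A (x p)))"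
    using x by (intro opn_cong) (auto simp: J_mat idx_def)
  then show "opn r (\<lambda>p. J A ((c \<odot>\<^bsub>?M\<^esub> x) p)) \<le> cmod c * opn r (\<lambda>p. J A (x p))"
    using opn_cscale[of r c "\<lambda>p. J A (x p)"] by simp
  have "opn r (\<lambda>p. J A ((star ?M x \<otimes>\<^bsub>?M\<^esub> x) p)) = opn r (mm r (mstar (\<lambda>p. J A (x p))) (\<lambda>p. J A (x p)))"
    using x by (intro opn_cong) (auto simp: J_mat idx_def mat_closed mm_def mstar_def)
  then show "opn r (\<lambda>p. J A ((star ?M x \<otimes>\<^bsub>?M\<^esub> x) p)) = (opn r (\<lambda>p. J A (x p)))\<^sup>2"
    by (simp add: opn_cstar)
  assume y: "y \<in> mats r (carrier A)"
  have "opn r (\<lambda>p. J A ((x \<oplus>\<^bsub>?M\<^esub> y) p)) = opn r (\<lambda>p. J A (x p) + J A (y p))"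
    using x y by (intro opn_cong) (auto simp: J_mat idx_def)
  then show "opn r (\<lambda>p. J A ((x \<oplus>\<^bsub>?M\<^esub> y) p)) \<le> opn r (\<lambda>p. J A (x p)) + opn r (\<lambda>p. J A (y p))"
    using opn_add[of r "\<lambda>p. J A (x p)" "\<lambda>p. J A (y p)"] by simp
  have "opn r (\<lambda>p. J A ((x \<otimes>\<^bsub>?M\<^esub> y) p)) = opn r (mm r (\<lambda>p. J A (x p)) (\<lambda>p. J A (y p)))"
    using x y by (intro opn_cong) (auto simp: J_mat idx_def mm_def)
  then show "opn r (\<lambda>p. J A ((x \<otimes>\<^bsub>?M\<^esub> y) p)) \<le> opn r (\<lambda>p. J A (x p)) * opn r (\<lambda>p. J A (y p))"
    using opn_mm[of r "\<lambda>p. J A (x p)" "\<lambda>p. J A (y p)"] by simp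
qed

lemma mat_alg_cstar: "cstar_algebra (mat_alg r A)"
  unfolding mat_alg_def by (rule someI[of "\<lambda>N. cstar_algebra (mat_alg_with r A N)", OF mat_alg_opn])

text \<open>For two C*-norms on the same matrices the identity is a *-homomorphism in either
  direction, so \<open>star_hom_contractive\<close> bounds each norm by the other.\<close>

lemma mat_norm_unique:
  assumes "cstar_algebra (mat_alg_with r A N)" "x \<in> mats r (carrier A)"
  shows "cnorm (mat_alg r A) x = N x"
proof -
  have le: "N1 x \<le> N2 x" if c: "cstar_algebra (mat_alg_with r A N1)" "cstar_algebra (mat_alg_with r A N2)" for N1 N2
  proof -
    have "cnorm (mat_alg_with r A N1) (id x) \<le> cnorm (mat_alg_with r A N2) x"
      by (rule star_hom_contractive[OF c(2,1)]) (use assms in \<open>auto simp: mat_alg_with_def\<close>)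
    then show ?thesis by simp
  qed
  let ?N = "SOME N. cstar_algebra (mat_alg_with r A N)"
  have "cstar_algebra (mat_alg_with r A ?N)" using mat_alg_cstar unfolding mat_alg_def .
  then show ?thesis
    unfolding mat_alg_def mat_sel using le[OF assms(1)] le[OF _ assms(1)] by (simp add: order_antisym)
qed

lemma mat_norm_bounds:
  assumes x: "x \<in> mats r (carrier A)"
  shows "i < r \<Longrightarrow> j < r \<Longrightarrow> cnorm A (x (i, j)) \<le> cnorm (mat_alg r A) x"
    "cnorm (mat_alg r A) x \<le> (\<Sum>p\<in>idx r. cnorm A (x p))"
proof -
  have e: "cnorm (mat_alg r A) x = opn r (\<lambda>p. J A (x p))"
    by (rule mat_norm_unique[OF mat_alg_opn x])
  show "cnorm A (x (i, j)) \<le> cnorm (mat_alg r A) x" if "i < r" "j < r"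
    using norm_le_opn[of "(i, j)" r "\<lambda>p. J A (x p)"] that x by (simp add: norm_J[OF A] mats_entry e)
  have "(\<Sum>p\<in>idx r. norm (J A (x p))) = (\<Sum>p\<in>idx r. cnorm A (x p))"
    using x by (intro sum.cong) (auto simp: norm_J[OF A] idx_def mats_entry)
  then show "cnorm (mat_alg r A) x \<le> (\<Sum>p\<in>idx r. cnorm A (x p))"
    using opn_le_sum[of r "\<lambda>p. J A (x p)"] by (simp add: e)
qed

end

section \<open>Completely positive contractions\<close>

lemma mat_alg_carrier [simp]: "carrier (mat_alg r A) = mats r (carrier A)"
  by (simp add: mat_alg_def)

text \<open>\<open>mat_alg\<close> is \<open>mat_alg_with\<close> at a chosen norm. As the
  operations ignore the norm, the facts are instantiated at the choice and folded.\<close>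

lemmas mat_alg_entry = mat_entry[where r = r and A = A and N = "SOME N. cstar_algebra (mat_alg_with r A N)" for r A, folded mat_alg_def]
lemmas mat_alg_closed = mat_zero_closed mat_closed(1-4)[where r = r and A = A and N = "SOME N. cstar_algebra (mat_alg_with r A N)" for r A, folded mat_alg_def]
lemmas J_mat_alg = J_mat[where r = r and A = A and N = "SOME N. cstar_algebra (mat_alg_with r A N)" for r A, folded mat_alg_def]
lemmas mat_alg_minus = mat_minus_entry[where r = r and A = A and N = "SOME N. cstar_algebra (mat_alg_with r A N)" for r A, folded mat_alg_def]

lemma norm_add_square_le:
  fixes M :: "'a cstar" (structure)
  assumes M: "cstar_algebra M"
    and c: "x0 \<in> carrier M" "x1 \<in> carrier M" "y0 \<in> carrier M" "y1 \<in> carrier M"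
  shows "(cnorm M (star M x0 \<otimes> y0 \<oplus> star M x1 \<otimes> y1))\<^sup>2 \<le>
    cnorm M (star M x0 \<otimes> x0 \<oplus> star M x1 \<otimes> x1) * cnorm M (star M y0 \<otimes> y0 \<oplus> star M y1 \<otimes> y1)"
proof -
  interpret cstar_algebra M by (rule M)
  let ?x = "\<lambda>b. if b then x0 else x1" and ?y = "\<lambda>b. if b then y0 else y1"
  have "(\<Oplus>b\<in>{True, False}. star M (if b then u0 else u1) \<otimes> (if b then v0 else v1)) = star M u0 \<otimes> v0 \<oplus> star M u1 \<otimes> v1"
    if "u0 \<in> carrier M" "u1 \<in> carrier M" "v0 \<in> carrier M" "v1 \<in> carrier M" for u0 u1 v0 v1
    using that by (subst finsum_insert) (auto simp: Pi_iff)
  then show ?thesis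
    using cauchy_schwarz_carrier[OF M, of "{True, False}" ?x ?y] c by simp
qed

text \<open>\<open>root_carrier\<close> for \<open>star M z\<close> presents 1 - z
  \<open>star M z\<close> as the square of 1 - k. The witness is 1 - k times y, written y - k y to
  avoid a unit.\<close>

lemma gram_deficiency:
  fixes M :: "'a cstar" (structure)
  assumes M: "cstar_algebra M" and c: "z \<in> carrier M" "y \<in> carrier M" and z: "cnorm M z \<le> 1"
  obtains w where "w \<in> carrier M"
    "star M w \<otimes> w = star M y \<otimes> y \<ominus> star M (star M z \<otimes> y) \<otimes> (star M z \<otimes> y)"
proof -
  interpret cstar_algebra M by (rule M)
  obtain k where k: "k \<in> carrier M" "star M k = k" "star M (star M z) \<otimes> star M z = (k \<oplus> k) \<ominus> k \<otimes> k"
    using root_carrier[OF M, of "star M z"] c z by auto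
  let ?w = "y \<ominus> k \<otimes> y"
  note J = J_mult[OF M] J_star[OF M] J_minus[OF M] J_add[OF M]
  have kk: "J M z * adj (J M z) = J M k + J M k - J M k * J M k"
    using k(1) c arg_cong[OF k(3), of "J M"] by (simp add: J)
  have ak: "adj (J M k) = J M k" using k by (simp flip: J)
  have "J M (star M ?w \<otimes> ?w) = adj (J M y) * J M y - adj (J M y) * (J M k + J M k - J M k * J M k) * J M y"
    using c k(1) ak by (simp add: J adj_diff adj_mult algebra_simps mult.assoc)
  also have "\<dots> = J M (star M y \<otimes> y \<ominus> star M (star M z \<otimes> y) \<otimes> (star M z \<otimes> y))"
    using c k(1) by (simp add: J adj_mult mult.assoc flip: kk)
  finally have w: "star M ?w \<otimes> ?w = star M y \<otimes> y \<ominus> star M (star M z \<otimes> y) \<otimes> (star M z \<otimes> y)"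
    using c k(1) by (subst (asm) J_inject[OF M]) auto
  show thesis by (rule that[OF _ w]) (use c k(1) in simp)
qed

lemma sum_lessThan_add:
  fixes f :: "nat \<Rightarrow> 'a::comm_monoid_add"
  shows "(\<Sum>s<m+n. f s) = (\<Sum>s<m. f s) + (\<Sum>s<n. f (m + s))"
  by (induction n) (simp_all add: add.assoc)

locale cpc_map =
  fixes A :: "'a cstar" and B :: "'b cstar" and \<phi> :: "'a \<Rightarrow> 'b"
  assumes cpc: "cpc A B \<phi>"
begin

lemma A: "cstar_algebra A" and B: "cstar_algebra B"
  using cpc by (auto simp: cpc_def completely_positive_def star_linear_def)

sublocale A: cstar_algebra A by (rule A)
sublocale B: cstar_algebra B by (rule B)

lemma map_closed [simp]: "x \<in> carrier A \<Longrightarrow> \<phi> x \<in> carrier B"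
  and map_add: "x \<in> carrier A \<Longrightarrow> y \<in> carrier A \<Longrightarrow> \<phi> (x \<oplus>\<^bsub>A\<^esub> y) = \<phi> x \<oplus>\<^bsub>B\<^esub> \<phi> y"
  and map_smult: "x \<in> carrier A \<Longrightarrow> \<phi> (c \<odot>\<^bsub>A\<^esub> x) = c \<odot>\<^bsub>B\<^esub> \<phi> x"
  and map_star: "x \<in> carrier A \<Longrightarrow> \<phi> (star A x) = star B (\<phi> x)"
  and map_norm: "x \<in> carrier A \<Longrightarrow> cnorm B (\<phi> x) \<le> cnorm A x"
  using cpc by (auto simp: cpc_def completely_positive_def star_linear_def)

lemma map_pos: "1 \<le> r \<Longrightarrow> positive (mat_alg r A) T \<Longrightarrow> positive (mat_alg r B) (amplify r \<phi> T)"
  using cpc positive_carrier[OF mat_alg_cstar[OF A], of r T]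
  by (simp add: cpc_def completely_positive_def)

lemma map_minus: "x \<in> carrier A \<Longrightarrow> y \<in> carrier A \<Longrightarrow> \<phi> (x \<ominus>\<^bsub>A\<^esub> y) = \<phi> x \<ominus>\<^bsub>B\<^esub> \<phi> y"
  by (simp add: A.minus_smult B.minus_smult map_add map_smult)

lemma map_zero [simp]: "\<phi> \<zero>\<^bsub>A\<^esub> = \<zero>\<^bsub>B\<^esub>"
  using map_smult[of "\<zero>\<^bsub>A\<^esub>" 0] by simp

lemma amplify_closed: "x \<in> mats r (carrier A) \<Longrightarrow> amplify r \<phi> x \<in> mats r (carrier B)"
  by (auto simp: mats_iff amplify_def)

lemma amplify_entry: "i < r \<Longrightarrow> j < r \<Longrightarrow> amplify r \<phi> x (i, j) = \<phi> (x (i, j))"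
  by (simp add: amplify_def)

text \<open>Complete positivity applied to the Gram matrix of the columns of a, whose r rows are
  padded with zeros to a square matrix. The conclusion speaks about any g with the right image under
  \<open>J\<close>, so that a caller can write the Gram entries in its own form.\<close>

lemma gram:
  assumes n: "1 \<le> n" "r \<le> n" and a: "\<And>p c. p < r \<Longrightarrow> c < n \<Longrightarrow> a p c \<in> carrier A"
  obtains Z where "Z \<in> mats n (carrier B)"
    "\<And>c d g. c < n \<Longrightarrow> d < n \<Longrightarrow> g \<in> carrier A \<Longrightarrow> J A g = (\<Sum>p<r. adj (J A (a p c)) * J A (a p d)) \<Longrightarrow>
       J B (\<phi> g) = (\<Sum>s<n. adj (J B (Z (s, c))) * J B (Z (s, d)))"
proof -
  let ?MA = "mat_alg n A" and ?MB = "mat_alg n B"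
  define T where "T = (\<lambda>(p, c)\<in>idx n. if p < r then a p c else \<zero>\<^bsub>A\<^esub>)"
  have T: "T \<in> mats n (carrier A)" using a by (auto simp: mats_iff T_def)
  define G where "G = star ?MA T \<otimes>\<^bsub>?MA\<^esub> T"
  have G: "G \<in> mats n (carrier A)" using T by (simp add: G_def mat_alg_closed[OF A])
  have "positive ?MA G" using T by (auto simp: positive_def G_def)
  then have "positive ?MB (amplify n \<phi> G)" using map_pos n by blast
  then obtain Z where Z: "Z \<in> mats n (carrier B)" "amplify n \<phi> G = star ?MB Z \<otimes>\<^bsub>?MB\<^esub> Z"
    by (auto simp: positive_def)
  have "J B (\<phi> g) = (\<Sum>s<n. adj (J B (Z (s, c))) * J B (Z (s, d)))"
    if cd: "c < n" "d < n" and g: "g \<in> carrier A" "J A g = (\<Sum>p<r. adj (J A (a p c)) * J A (a p d))" for c d g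
  proof -
    have "J A (G (c, d)) = (\<Sum>p<n. adj (J A (T (p, c))) * J A (T (p, d)))"
      using T cd by (simp add: G_def J_mat_alg[OF A] mat_alg_closed[OF A])
    also have "\<dots> = (\<Sum>p<r. adj (J A (T (p, c))) * J A (T (p, d)))"
      using cd n by (intro sum.mono_neutral_right) (auto simp: T_def J_zero[OF A])
    also have "\<dots> = J A g" unfolding g(2) using cd n by (intro sum.cong) (auto simp: T_def)
    finally have "G (c, d) = g" using g(1) G cd by (simp add: J_inject[OF A] mats_entry)
    then have "\<phi> g = (star ?MB Z \<otimes>\<^bsub>?MB\<^esub> Z) (c, d)" using cd by (simp add: amplify_entry flip: Z(2))
    then show ?thesis using Z(1) cd by (simp add: J_mat_alg[OF B] mat_alg_closed[OF B])
  qed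
  then show thesis using that Z(1) by blast
qed

lemma amplify_norm_crude:
  assumes x: "x \<in> mats r (carrier A)"
  shows "cnorm (mat_alg r B) (amplify r \<phi> x) \<le> (\<Sum>p\<in>idx r. cnorm A (x p))"
proof -
  have "cnorm (mat_alg r B) (amplify r \<phi> x) \<le> (\<Sum>p\<in>idx r. cnorm B (amplify r \<phi> x p))"
    by (intro mat_norm_bounds[OF B] amplify_closed x)
  also have "\<dots> \<le> (\<Sum>p\<in>idx r. cnorm A (x p))"
    using x by (intro sum_mono) (auto simp: idx_def amplify_entry map_norm mats_entry)
  finally show ?thesis .
qed

lemma amplify_minus:
  assumes "x \<in> mats r (carrier A)" "y \<in> mats r (carrier A)"
  shows "amplify r \<phi> (x \<ominus>\<^bsub>mat_alg r A\<^esub> y) = amplify r \<phi> x \<ominus>\<^bsub>mat_alg r B\<^esub> amplify r \<phi> y"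
  by (rule mats_eqI[of _ r "carrier B" _ "carrier B"])
    (use assms in \<open>auto simp: amplify_closed mat_alg_minus[OF A] mat_alg_minus[OF B] amplify_entry
      map_minus mats_entry\<close>)

end

definition diag_mat :: "nat \<Rightarrow> 'a cstar \<Rightarrow> 'a \<Rightarrow> nat \<times> nat \<Rightarrow> 'a" where
  "diag_mat r A b = (\<lambda>(i, j)\<in>idx r. if i = j then b else \<zero>\<^bsub>A\<^esub>)"

text \<open>The diagonal embedding is a *-homomorphism, hence contractive.\<close>

lemma diag_mat_norm:
  assumes A: "cstar_algebra A" and b: "b \<in> carrier A"
  shows "cnorm (mat_alg r A) (diag_mat r A b) \<le> cnorm A b"
proof (rule star_hom_contractive[OF A mat_alg_cstar[OF A] _ _ _ _ _ b])
  interpret cstar_algebra A by (rule A)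
  have cl: "diag_mat r A x \<in> mats r (carrier A)" if "x \<in> carrier A" for x
    using that by (auto simp: mats_iff diag_mat_def)
  have e: "diag_mat r A x (i, j) = (if i = j then x else \<zero>\<^bsub>A\<^esub>)" if "i < r" "j < r" for x i j
    using that by (simp add: diag_mat_def)
  note [simp] = mat_alg_closed[OF A] J_mat_alg[OF A] J_zero[OF A]
  fix x y c assume x: "x \<in> carrier A"
  show "diag_mat r A x \<in> carrier (mat_alg r A)" using cl x by simp
  show "diag_mat r A (c \<odot>\<^bsub>A\<^esub> x) = c \<odot>\<^bsub>mat_alg r A\<^esub> diag_mat r A x"
    by (rule mats_J_eqI[OF A, where r = r]) (use x in \<open>auto simp: cl e J_smult[OF A]\<close>)
  show "diag_mat r A (star A x) = star (mat_alg r A) (diag_mat r A x)"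
    by (rule mats_J_eqI[OF A, where r = r]) (use x in \<open>auto simp: cl e J_star[OF A]\<close>)
  assume y: "y \<in> carrier A"
  show "diag_mat r A (x \<oplus>\<^bsub>A\<^esub> y) = diag_mat r A x \<oplus>\<^bsub>mat_alg r A\<^esub> diag_mat r A y"
    by (rule mats_J_eqI[OF A, where r = r]) (use x y in \<open>auto simp: cl e J_add[OF A]\<close>)
  show "diag_mat r A (x \<otimes>\<^bsub>A\<^esub> y) = diag_mat r A x \<otimes>\<^bsub>mat_alg r A\<^esub> diag_mat r A y"
  proof (rule mats_J_eqI[OF A, where r = r])
    fix i j assume ij: "i < r" "j < r"
    have "(\<Sum>k<r. J A (diag_mat r A x (i, k)) * J A (diag_mat r A y (k, j))) =
      (\<Sum>k<r. if k = i then J A (diag_mat r A x (i, i)) * J A (diag_mat r A y (i, j)) else 0)"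
      using ij by (intro sum.cong) (auto simp: e)
    then show "J A (diag_mat r A (x \<otimes>\<^bsub>A\<^esub> y) (i, j)) = J A ((diag_mat r A x \<otimes>\<^bsub>mat_alg r A\<^esub> diag_mat r A y) (i, j))"
      using x y ij by (simp add: cl e J_mult[OF A])
  qed (use x y in \<open>auto simp: cl\<close>)
qed

context cpc_map
begin

text \<open>In the unital case this is the Kadison--Schwarz inequality; \<open>e\<close> stands in for the unit.\<close>

lemma kadison_schwarz_aux:
  assumes r: "1 \<le> r" and x: "x \<in> mats r (carrier A)"
    and e: "e \<in> carrier A" "star A e = e" "cnorm A e \<le> 1"
  shows "(cnorm (mat_alg r B) (amplify r \<phi> (\<lambda>p\<in>idx r. e \<otimes>\<^bsub>A\<^esub> x p)))\<^sup>2 \<le>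
    cnorm (mat_alg r B) (amplify r \<phi> (star (mat_alg r A) x \<otimes>\<^bsub>mat_alg r A\<^esub> x))"
proof -
  let ?MA = "mat_alg r A" and ?MB = "mat_alg r B"
  note [simp] = mats_entry[OF x] e(1)
  define a where "a p c = (if c < r then if c = p then e else \<zero>\<^bsub>A\<^esub> else x (p, c - r))" for p c
  have a: "a p c \<in> carrier A" if "p < r" "c < r + r" for p c
    using that by (auto simp: a_def)
  obtain Z where Z: "Z \<in> mats (r + r) (carrier B)"
    "\<And>c d g. c < r + r \<Longrightarrow> d < r + r \<Longrightarrow> g \<in> carrier A \<Longrightarrow> J A g = (\<Sum>p<r. adj (J A (a p c)) * J A (a p d)) \<Longrightarrow>
       J B (\<phi> g) = (\<Sum>s<r + r. adj (J B (Z (s, c))) * J B (Z (s, d)))"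
    by (rule gram[of "r + r" r a]) (use r a in auto)
  \<comment> \<open>The r by r blocks of Z, in block row k and block column i.\<close>
  define W where "W k i = (\<lambda>(p, q)\<in>idx r. Z (k * r + p, i * r + q))" for k i :: nat
  have W: "W k i \<in> mats r (carrier B)" if "k < 2" "i < 2" for k i
    using that mats_entry[OF Z(1)] by (auto simp: mats_iff W_def less_2_cases_iff)
  have We: "W k i (p, q) = Z (k * r + p, i * r + q)" if "p < r" "q < r" for k i p q
    using that by (simp add: W_def)
  note mB = mat_alg_closed[OF B] J_mat_alg[OF B] and mA = mat_alg_closed[OF A] J_mat_alg[OF A]
  have prod: "amplify r \<phi> g = star ?MB (W 0 i) \<otimes>\<^bsub>?MB\<^esub> W 0 j \<oplus>\<^bsub>?MB\<^esub> star ?MB (W 1 i) \<otimes>\<^bsub>?MB\<^esub> W 1 j"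
    if ij: "i < 2" "j < 2" and g: "g \<in> mats r (carrier A)"
      "\<And>q q'. q < r \<Longrightarrow> q' < r \<Longrightarrow> J A (g (q, q')) = (\<Sum>p<r. adj (J A (a p (i * r + q))) * J A (a p (j * r + q')))"
    for g i j
  proof (rule mats_J_eqI[OF B, where r = r])
    show "amplify r \<phi> g \<in> mats r (carrier B)" by (rule amplify_closed[OF g(1)])
    show "star ?MB (W 0 i) \<otimes>\<^bsub>?MB\<^esub> W 0 j \<oplus>\<^bsub>?MB\<^esub> star ?MB (W 1 i) \<otimes>\<^bsub>?MB\<^esub> W 1 j \<in> mats r (carrier B)"
      using W ij by (simp add: mB)
    fix q q' assume q: "q < r" "q' < r"
    have lt: "i * r + q < r + r" "j * r + q' < r + r"
      using ij q by (auto simp: less_2_cases_iff)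
    have "J B (amplify r \<phi> g (q, q')) = J B (\<phi> (g (q, q')))" using q by (simp add: amplify_entry)
    also have "\<dots> = (\<Sum>s<r + r. adj (J B (Z (s, i * r + q))) * J B (Z (s, j * r + q')))"
      by (rule Z(2)[OF lt mats_entry[OF g(1) q] g(2)[OF q]])
    also have "\<dots> = (\<Sum>s<r. adj (J B (W 0 i (s, q))) * J B (W 0 j (s, q'))) +
       (\<Sum>s<r. adj (J B (W 1 i (s, q))) * J B (W 1 j (s, q')))"
      using q by (simp add: sum_lessThan_add We)
    also have "\<dots> = J B ((star ?MB (W 0 i) \<otimes>\<^bsub>?MB\<^esub> W 0 j \<oplus>\<^bsub>?MB\<^esub> star ?MB (W 1 i) \<otimes>\<^bsub>?MB\<^esub> W 1 j) (q, q'))"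
      using W ij q by (simp add: mB)
    finally show "J B (amplify r \<phi> g (q, q')) =
      J B ((star ?MB (W 0 i) \<otimes>\<^bsub>?MB\<^esub> W 0 j \<oplus>\<^bsub>?MB\<^esub> star ?MB (W 1 i) \<otimes>\<^bsub>?MB\<^esub> W 1 j) (q, q'))" .
  qed
  have ae: "adj (J A e) = J A e" using e by (simp flip: J_star[OF A])
  have delta: "(\<Sum>p<r. adj (J A (a p q)) * f p) = J A e * f q" if "q < r" for q f
  proof -
    have "(\<Sum>p<r. adj (J A (a p q)) * f p) = (\<Sum>p<r. if p = q then J A e * f q else 0)"
      using that by (intro sum.cong) (auto simp: a_def ae J_zero[OF A])
    then show ?thesis using that by simp
  qed
  have 1: "amplify r \<phi> (\<lambda>p\<in>idx r. e \<otimes>\<^bsub>A\<^esub> x p) =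
     star ?MB (W 0 0) \<otimes>\<^bsub>?MB\<^esub> W 0 1 \<oplus>\<^bsub>?MB\<^esub> star ?MB (W 1 0) \<otimes>\<^bsub>?MB\<^esub> W 1 1"
    by (rule prod) (auto simp: mats_iff delta J_mult[OF A], simp add: a_def)
  have 2: "amplify r \<phi> (star ?MA x \<otimes>\<^bsub>?MA\<^esub> x) =
     star ?MB (W 0 1) \<otimes>\<^bsub>?MB\<^esub> W 0 1 \<oplus>\<^bsub>?MB\<^esub> star ?MB (W 1 1) \<otimes>\<^bsub>?MB\<^esub> W 1 1"
    by (rule prod) (auto simp: x mA a_def)
  have 3: "amplify r \<phi> (diag_mat r A (e \<otimes>\<^bsub>A\<^esub> e)) =
     star ?MB (W 0 0) \<otimes>\<^bsub>?MB\<^esub> W 0 0 \<oplus>\<^bsub>?MB\<^esub> star ?MB (W 1 0) \<otimes>\<^bsub>?MB\<^esub> W 1 0"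
  proof (rule prod)
    show "diag_mat r A (e \<otimes>\<^bsub>A\<^esub> e) \<in> mats r (carrier A)" by (auto simp: mats_iff diag_mat_def)
    fix q q' assume "q < r" "q' < r"
    then show "J A (diag_mat r A (e \<otimes>\<^bsub>A\<^esub> e) (q, q')) = (\<Sum>p<r. adj (J A (a p (0 * r + q))) * J A (a p (0 * r + q')))"
      by (simp add: delta) (simp add: a_def diag_mat_def J_mult[OF A] J_zero[OF A])
  qed auto
  have "amplify r \<phi> (diag_mat r A (e \<otimes>\<^bsub>A\<^esub> e)) = diag_mat r B (\<phi> (e \<otimes>\<^bsub>A\<^esub> e))"
    by (auto simp: amplify_def diag_mat_def idx_def fun_eq_iff)
  then have "cnorm ?MB (amplify r \<phi> (diag_mat r A (e \<otimes>\<^bsub>A\<^esub> e))) \<le> cnorm B (\<phi> (e \<otimes>\<^bsub>A\<^esub> e))"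
    using diag_mat_norm[OF B] by simp
  also have "\<dots> \<le> cnorm A (e \<otimes>\<^bsub>A\<^esub> e)" by (rule map_norm) simp
  also have "\<dots> \<le> cnorm A e * cnorm A e" by (rule A.norm_mult) simp_all
  also have "\<dots> \<le> 1" using e A.norm_nonneg by (intro mult_le_one) auto
  finally have 4: "cnorm ?MB (amplify r \<phi> (diag_mat r A (e \<otimes>\<^bsub>A\<^esub> e))) \<le> 1" .
  \<comment> \<open>Cauchy-Schwarz between the two block columns of Z, in the algebra of r by r
    matrices.\<close>
  have "(cnorm ?MB (amplify r \<phi> (\<lambda>p\<in>idx r. e \<otimes>\<^bsub>A\<^esub> x p)))\<^sup>2 \<le>
     cnorm ?MB (amplify r \<phi> (diag_mat r A (e \<otimes>\<^bsub>A\<^esub> e))) * cnorm ?MB (amplify r \<phi> (star ?MA x \<otimes>\<^bsub>?MA\<^esub> x))"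
    unfolding 1 2 3 by (rule norm_add_square_le[OF mat_alg_cstar[OF B]]) (simp_all add: W)
  also have "\<dots> \<le> 1 * cnorm ?MB (amplify r \<phi> (star ?MA x \<otimes>\<^bsub>?MA\<^esub> x))"
    using 4 amplify_closed[of "star ?MA x \<otimes>\<^bsub>?MA\<^esub> x" r] x
    by (intro mult_right_mono cstar_algebra.norm_nonneg[OF mat_alg_cstar[OF B]]) (simp_all add: mA)
  finally show ?thesis by simp
qed

text \<open>The factor e is removed by taking it as an approximate unit for all entries of x;
  entrywise closeness is enough because of \<open>amplify_norm_crude\<close>.\<close>

lemma kadison_schwarz:
  assumes r: "1 \<le> r" and x: "x \<in> mats r (carrier A)"
  shows "(cnorm (mat_alg r B) (amplify r \<phi> x))\<^sup>2 \<le>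
    cnorm (mat_alg r B) (amplify r \<phi> (star (mat_alg r A) x \<otimes>\<^bsub>mat_alg r A\<^esub> x))" (is "_ \<le> ?R")
proof -
  let ?MB = "mat_alg r B"
  interpret MB: cstar_algebra ?MB by (rule mat_alg_cstar[OF B])
  note [simp] = mats_entry[OF x]
  have R: "0 \<le> ?R"
    using x by (intro MB.norm_nonneg) (simp add: amplify_closed mat_alg_closed[OF A])
  have "cnorm ?MB (amplify r \<phi> x) \<le> sqrt ?R + \<epsilon>" if "\<epsilon> > 0" for \<epsilon>
  proof -
    \<comment> \<open>The errors of all entries together stay below \<epsilon>.\<close>
    define \<delta> where "\<delta> = \<epsilon> / (real (card (idx r)) + 1)"
    have \<delta>: "\<delta> > 0" using that by (simp add: \<delta>_def add_nonneg_pos)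
    obtain e where e: "e \<in> carrier A" "star A e = e" "cnorm A e \<le> 1"
        "\<forall>p\<in>idx r. cnorm A (e \<otimes>\<^bsub>A\<^esub> x p \<ominus>\<^bsub>A\<^esub> x p) < \<delta>"
      by (rule approximate_unit_carrier[OF A finite_idx, of r x \<delta>]) (use \<delta> in \<open>auto simp: idx_def\<close>)
    define y where "y = (\<lambda>p\<in>idx r. e \<otimes>\<^bsub>A\<^esub> x p)"
    have y: "y \<in> mats r (carrier A)" using e by (auto simp: mats_iff y_def)
    have ap: "amplify r \<phi> x \<in> carrier ?MB" "amplify r \<phi> y \<in> carrier ?MB" using amplify_closed x y by simp_all
    have "cnorm ?MB (amplify r \<phi> y \<ominus>\<^bsub>?MB\<^esub> amplify r \<phi> x) \<le> (\<Sum>p\<in>idx r. cnorm A ((y \<ominus>\<^bsub>mat_alg r A\<^esub> x) p))"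
      using amplify_norm_crude[of "y \<ominus>\<^bsub>mat_alg r A\<^esub> x" r] x y by (simp add: amplify_minus mat_alg_minus[OF A])
    also have "\<dots> \<le> (\<Sum>p\<in>idx r. \<delta>)"
      using e(4) x y by (intro sum_mono less_imp_le) (auto simp: idx_def mat_alg_minus[OF A] y_def)
    also have "\<dots> \<le> \<epsilon>" using that by (simp add: \<delta>_def field_simps)
    finally have "cnorm ?MB (amplify r \<phi> y \<ominus>\<^bsub>?MB\<^esub> amplify r \<phi> x) \<le> \<epsilon>" .
    moreover have "cnorm ?MB (amplify r \<phi> y) \<le> sqrt ?R"
      using kadison_schwarz_aux[OF r x e(1-3)] by (intro real_le_rsqrt) (simp add: y_def)
    moreover have "cnorm ?MB (amplify r \<phi> x) \<le> cnorm ?MB (amplify r \<phi> x \<ominus>\<^bsub>?MB\<^esub> amplify r \<phi> y) + cnorm ?MB (amplify r \<phi> y)"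
      using MB.norm_triangle_minus[OF ap MB.zero_closed] ap by (simp del: mat_alg_carrier)
    ultimately show ?thesis using MB.norm_minus_commute[OF ap] by simp
  qed
  then have "cnorm ?MB (amplify r \<phi> x) \<le> sqrt ?R" by (rule field_le_epsilon)
  then have "(cnorm ?MB (amplify r \<phi> x))\<^sup>2 \<le> (sqrt ?R)\<^sup>2"
    using amplify_closed[OF x] by (intro power_mono MB.norm_nonneg) simp_all
  then show ?thesis using R by simp
qed

text \<open>A power argument: iterating \<open>kadison_schwarz\<close> squares both sides, while the
  crude constant c, the number of entries, stays the same. If the ratio q of the two norms exceeded
  1, its powers would outgrow c.\<close>

lemma amplify_norm:
  assumes r: "1 \<le> r" and x: "x \<in> mats r (carrier A)"
  shows "cnorm (mat_alg r B) (amplify r \<phi> x) \<le> cnorm (mat_alg r A) x"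
proof (rule ccontr)
  let ?MA = "mat_alg r A" and ?MB = "mat_alg r B"
  interpret MA: cstar_algebra ?MA by (rule mat_alg_cstar[OF A])
  interpret MB: cstar_algebra ?MB by (rule mat_alg_cstar[OF B])
  define c where "c = real (card (idx r))"
  have crude: "cnorm ?MB (amplify r \<phi> y) \<le> c * cnorm ?MA y" if y: "y \<in> mats r (carrier A)" for y
  proof -
    have "(\<Sum>p\<in>idx r. cnorm A (y p)) \<le> (\<Sum>p\<in>idx r. cnorm ?MA y)"
      using y by (intro sum_mono) (auto simp: idx_def mat_norm_bounds[OF A])
    then show ?thesis using amplify_norm_crude[OF y] by (simp add: c_def)
  qed
  have it: "cnorm ?MB (amplify r \<phi> y) ^ (2 ^ n) \<le> c * cnorm ?MA y ^ (2 ^ n)"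
    if "y \<in> mats r (carrier A)" for y n
    using that
  proof (induction n arbitrary: y)
    case (Suc n)
    let ?z = "star ?MA y \<otimes>\<^bsub>?MA\<^esub> y"
    have z: "?z \<in> mats r (carrier A)" using Suc.prems by (simp add: mat_alg_closed[OF A])
    have "cnorm ?MB (amplify r \<phi> y) ^ (2 ^ Suc n) = ((cnorm ?MB (amplify r \<phi> y))\<^sup>2) ^ (2 ^ n)"
      by (simp add: power_mult)
    also have "\<dots> \<le> cnorm ?MB (amplify r \<phi> ?z) ^ (2 ^ n)"
      by (intro power_mono kadison_schwarz r Suc.prems) simp
    also have "\<dots> \<le> c * cnorm ?MA ?z ^ (2 ^ n)" by (rule Suc.IH[OF z])
    also have "cnorm ?MA ?z = (cnorm ?MA y)\<^sup>2" using Suc.prems by (intro MA.cstar_identity) simp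
    finally show ?case by (simp add: power_mult)
  qed (use crude in simp)
  assume "\<not> ?thesis"
  then have lt: "cnorm ?MA x < cnorm ?MB (amplify r \<phi> x)" by simp
  have "cnorm ?MA x \<noteq> 0" using crude[OF x] lt by auto
  then have p: "cnorm ?MA x > 0" using MA.norm_nonneg[of x] x by simp
  define q where "q = cnorm ?MB (amplify r \<phi> x) / cnorm ?MA x"
  have q: "q > 1" using lt p by (simp add: q_def)
  obtain n where n: "c < q ^ n" using real_arch_pow[OF q] by blast
  have "q ^ n \<le> q ^ (2 ^ n)" using q by (intro power_increasing) (auto intro: less_imp_le[OF less_exp])
  also have "\<dots> \<le> c" using it[OF x, of n] p by (simp add: q_def power_divide divide_le_eq)
  finally show False using n by simp
qed

end

section \<open>Multiplicativity defects of a composition\<close>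

lemma lessThan_3: "(\<Sum>k<3. f k) = f 0 + f 1 + (f (2::nat) :: 'a::comm_monoid_add)"
  by (simp add: numeral_3_eq_3 numeral_2_eq_2 lessThan_Suc add_ac)

context
  fixes A :: "'a cstar" and B :: "'b cstar" and C :: "'c cstar" and \<phi> \<psi>
  assumes \<phi>: "cpc A B \<phi>" and \<psi>: "cpc B C \<psi>"
begin

interpretation \<phi>: cpc_map A B \<phi> by (unfold_locales) (rule \<phi>)
interpretation \<psi>: cpc_map B C \<psi> by (unfold_locales) (rule \<psi>)

text \<open>Writing \<open>\<phi>\<close> of the Gram matrix of \<open>(e, a, b)\<close> as \<open>Z\<^sup>* Z\<close> with columns \<open>z, y\<^sub>a, y\<^sub>b\<close>, the
  defects are the entries \<open>y\<^sub>c\<^sup>* (1 - z z\<^sup>*) y\<^sub>d\<close>, again a Gram matrix because \<open>\<parallel>z\<parallel> \<le> 1\<close>.\<close>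

lemma defect_aux:
  assumes ab: "a \<in> carrier A" "b \<in> carrier A"
    and e: "e \<in> carrier A" "star A e = e" "cnorm A e \<le> 1"
  defines "D \<equiv> \<lambda>x y. \<phi> (star A x \<otimes>\<^bsub>A\<^esub> y) \<ominus>\<^bsub>B\<^esub> star B (\<phi> (e \<otimes>\<^bsub>A\<^esub> x)) \<otimes>\<^bsub>B\<^esub> \<phi> (e \<otimes>\<^bsub>A\<^esub> y)"
  shows "(cnorm C (\<psi> (D a b)))\<^sup>2 \<le> cnorm C (\<psi> (D a a)) * cnorm C (\<psi> (D b b))"
proof -
  note A = \<phi>.A and B = \<phi>.B and C = \<psi>.B
  define v where "v = (\<lambda>c::nat. if c = 0 then e else if c = 1 then a else b)"
  have v [simp]: "v c \<in> carrier A" for c using ab e by (simp add: v_def)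
  \<comment> \<open>\<open>gram\<close> with a single row formed by e, a and b.\<close>
  obtain Z where Z: "Z \<in> mats 3 (carrier B)"
    "\<And>c d g. c < 3 \<Longrightarrow> d < 3 \<Longrightarrow> g \<in> carrier A \<Longrightarrow> J A g = adj (J A (v c)) * J A (v d) \<Longrightarrow>
       J B (\<phi> g) = (\<Sum>s<3. adj (J B (Z (s, c))) * J B (Z (s, d)))"
  proof (rule \<phi>.gram[of 3 1 "\<lambda>p. v"])
    fix Z
    assume Z: "Z \<in> mats 3 (carrier B)"
      and *: "\<And>c d g. c < 3 \<Longrightarrow> d < 3 \<Longrightarrow> g \<in> carrier A \<Longrightarrow>
         J A g = (\<Sum>p<(1::nat). adj (J A (v c)) * J A (v d)) \<Longrightarrow>
         J B (\<phi> g) = (\<Sum>s<3. adj (J B (Z (s, c))) * J B (Z (s, d)))"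
    show thesis by (rule that[OF Z *]) auto
  qed auto
  have ZJ: "(\<Sum>s<3. adj (J B (Z (s, c))) * J B (Z (s, d))) = J B (\<phi> (star A (v c) \<otimes>\<^bsub>A\<^esub> v d))"
    if "c < 3" "d < 3" for c d
    using Z(2)[OF that, of "star A (v c) \<otimes>\<^bsub>A\<^esub> v d"] by (simp add: J_mult[OF A] J_star[OF A])
  let ?M = "mat_alg 3 B"
  interpret M: cstar_algebra ?M by (rule mat_alg_cstar[OF B])
  \<comment> \<open>Column 0 of Z, which stems from e, and the columns of a and b are kept as 3 by 3
    matrices, because \<open>gram_deficiency\<close> works inside one algebra. In
    \<open>star ?M z\<close> times z only the entry at (0, 0) is nonzero, and its norm is that of
    \<phi> at e e.\<close>
  define z where "z = (\<lambda>(s, c)\<in>idx 3. if c = 0 then Z (s, 0) else \<zero>\<^bsub>B\<^esub>)"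
  define y where "y = (\<lambda>(s, c)\<in>idx 3. if c = 0 then \<zero>\<^bsub>B\<^esub> else Z (s, c))"
  have zM: "z \<in> mats 3 (carrier B)" and yM: "y \<in> mats 3 (carrier B)"
    using mats_entry[OF Z(1)] by (auto simp: mats_iff z_def y_def)
  note mB = mat_alg_closed[OF B] J_mat_alg[OF B] zM yM
  have Jz: "J B (z (s, c)) = (if c = 0 then J B (Z (s, 0)) else 0)"
    and Jy: "J B (y (s, c)) = (if c = 0 then 0 else J B (Z (s, c)))" if "s < 3" "c < 3" for s c
    using that by (auto simp: z_def y_def J_zero[OF B])
  have "(cnorm ?M z)\<^sup>2 = cnorm ?M (star ?M z \<otimes>\<^bsub>?M\<^esub> z)" using zM by (simp add: M.cstar_identity)
  also have "\<dots> \<le> (\<Sum>p\<in>idx 3. cnorm B ((star ?M z \<otimes>\<^bsub>?M\<^esub> z) p))"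
    using zM by (intro mat_norm_bounds[OF B]) (simp add: mB)
  also have "\<dots> = (\<Sum>p\<in>idx 3. if p = (0, 0) then cnorm B (\<phi> (e \<otimes>\<^bsub>A\<^esub> e)) else 0)"
  proof (rule sum.cong[OF refl])
    fix p assume "p \<in> idx 3"
    then obtain c d where p: "p = (c, d)" "c < 3" "d < 3" by (auto simp: idx_def)
    have "(star ?M z \<otimes>\<^bsub>?M\<^esub> z) p \<in> carrier B" unfolding p(1) by (rule mats_entry[OF _ p(2,3)]) (simp add: mB)
    then have "cnorm B ((star ?M z \<otimes>\<^bsub>?M\<^esub> z) p) = norm (J B ((star ?M z \<otimes>\<^bsub>?M\<^esub> z) p))"
      by (simp add: norm_J[OF B])
    also have "\<dots> = norm (\<Sum>s<3. adj (J B (z (s, c))) * J B (z (s, d)))" using p by (simp add: mB)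
    also have "(\<Sum>s<3. adj (J B (z (s, c))) * J B (z (s, d))) =
       (if p = (0, 0) then (\<Sum>s<3. adj (J B (Z (s, 0))) * J B (Z (s, 0))) else 0)"
      using p by (auto simp: Jz intro!: sum.neutral)
    also have "norm \<dots> = (if p = (0, 0) then cnorm B (\<phi> (e \<otimes>\<^bsub>A\<^esub> e)) else 0)"
      using ZJ[of 0 0] e by (simp add: v_def norm_J[OF B])
    finally show "cnorm B ((star ?M z \<otimes>\<^bsub>?M\<^esub> z) p) = (if p = (0, 0) then cnorm B (\<phi> (e \<otimes>\<^bsub>A\<^esub> e)) else 0)" .
  qed
  also have "\<dots> = cnorm B (\<phi> (e \<otimes>\<^bsub>A\<^esub> e))" by (simp add: sum.delta)
  also have "\<dots> \<le> cnorm A (e \<otimes>\<^bsub>A\<^esub> e)" using e by (intro \<phi>.map_norm) simp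
  also have "\<dots> \<le> cnorm A e * cnorm A e" using e by (intro \<phi>.A.norm_mult)
  also have "\<dots> \<le> 1\<^sup>2" using e \<phi>.A.norm_nonneg[of e] by (simp add: mult_le_one)
  finally have z1: "cnorm ?M z \<le> 1" by (rule power2_le_imp_le) simp
  obtain w where w: "w \<in> mats 3 (carrier B)"
    "star ?M w \<otimes>\<^bsub>?M\<^esub> w = star ?M y \<otimes>\<^bsub>?M\<^esub> y \<ominus>\<^bsub>?M\<^esub> star ?M (star ?M z \<otimes>\<^bsub>?M\<^esub> y) \<otimes>\<^bsub>?M\<^esub> (star ?M z \<otimes>\<^bsub>?M\<^esub> y)"
    using gram_deficiency[OF mat_alg_cstar[OF B], of z 3 y] zM yM z1 by auto
  let ?P = "star ?M w \<otimes>\<^bsub>?M\<^esub> w"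
  have P: "?P \<in> mats 3 (carrier B)" using w(1) by (simp add: mB)
  have Dc: "D (v c) (v d) \<in> carrier B" for c d using e unfolding D_def by simp
  have PD: "?P (c, d) = D (v c) (v d)" if cd: "c < 3" "d < 3" "c \<noteq> 0" "d \<noteq> 0" for c d
  proof -
    let ?zy = "star ?M z \<otimes>\<^bsub>?M\<^esub> y"
    have zyM: "?zy \<in> mats 3 (carrier B)" by (simp add: mB)
    have zy: "J B (?zy (i, d)) = (if i = 0 then J B (\<phi> (e \<otimes>\<^bsub>A\<^esub> v d)) else 0)" if "i < 3" "d < 3" "d \<noteq> 0" for i d
      using that ZJ[of 0 d] e by (auto simp: mB Jz Jy v_def intro!: sum.neutral)
    have e1: "?P (c, d) = (star ?M y \<otimes>\<^bsub>?M\<^esub> y) (c, d) \<ominus>\<^bsub>B\<^esub> (star ?M ?zy \<otimes>\<^bsub>?M\<^esub> ?zy) (c, d)"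
      unfolding w(2) using cd zyM by (simp add: mat_alg_minus[OF B] mB)
    have "J B ((star ?M y \<otimes>\<^bsub>?M\<^esub> y) (c, d)) = J B (\<phi> (star A (v c) \<otimes>\<^bsub>A\<^esub> v d))"
      using cd ZJ[of c d] by (simp add: mB Jy)
    moreover have "(star ?M y \<otimes>\<^bsub>?M\<^esub> y) (c, d) \<in> carrier B" by (rule mats_entry[OF _ cd(1,2)]) (simp add: mB)
    ultimately have e2: "(star ?M y \<otimes>\<^bsub>?M\<^esub> y) (c, d) = \<phi> (star A (v c) \<otimes>\<^bsub>A\<^esub> v d)"
      by (subst (asm) J_inject[OF B]) simp_all
    have "J B ((star ?M ?zy \<otimes>\<^bsub>?M\<^esub> ?zy) (c, d)) = adj (J B (\<phi> (e \<otimes>\<^bsub>A\<^esub> v c))) * J B (\<phi> (e \<otimes>\<^bsub>A\<^esub> v d))"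
    proof -
      have "J B ((star ?M ?zy \<otimes>\<^bsub>?M\<^esub> ?zy) (c, d)) = (\<Sum>s<3. adj (J B (?zy (s, c))) * J B (?zy (s, d)))"
        using cd zyM J_mat_alg(2)[OF B, of "star ?M ?zy" 3 ?zy c d] by (simp add: J_mat_alg(4)[OF B zyM] mat_alg_closed[OF B])
      then show ?thesis using cd by (simp add: zy lessThan_3)
    qed
    moreover have "(star ?M ?zy \<otimes>\<^bsub>?M\<^esub> ?zy) (c, d) \<in> carrier B" by (rule mats_entry[OF _ cd(1,2)]) (simp add: mB)
    ultimately have e3: "(star ?M ?zy \<otimes>\<^bsub>?M\<^esub> ?zy) (c, d) = star B (\<phi> (e \<otimes>\<^bsub>A\<^esub> v c)) \<otimes>\<^bsub>B\<^esub> \<phi> (e \<otimes>\<^bsub>A\<^esub> v d)"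
      using e(1) by (subst J_inject[OF B, symmetric]) (simp_all add: J_mult[OF B] J_star[OF B])
    show ?thesis unfolding e1 e2 e3 D_def by simp
  qed
  \<comment> \<open>The amplified \<psi> sends the Gram matrix of the columns of w to one with a
    factor V over \<open>C\<close>; what remains is Cauchy-Schwarz for two columns of V.\<close>
  have "positive ?M ?P" using w(1) by (auto simp: positive_def)
  then have "positive (mat_alg 3 C) (amplify 3 \<psi> ?P)" by (intro \<psi>.map_pos) simp
  then obtain V where V: "V \<in> mats 3 (carrier C)" "amplify 3 \<psi> ?P = star (mat_alg 3 C) V \<otimes>\<^bsub>mat_alg 3 C\<^esub> V"
    by (auto simp: positive_def)
  have VD: "\<psi> (D (v c) (v d)) = (\<Oplus>\<^bsub>C\<^esub>s\<in>{..<3}. star C (V (s, c)) \<otimes>\<^bsub>C\<^esub> V (s, d))"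
    if cd: "c < 3" "d < 3" "c \<noteq> 0" "d \<noteq> 0" for c d
  proof -
    have "\<psi> (D (v c) (v d)) = amplify 3 \<psi> ?P (c, d)"
      unfolding \<psi>.amplify_entry[OF cd(1,2)] PD[OF cd] ..
    also have "\<dots> = (\<Oplus>\<^bsub>C\<^esub>s\<in>{..<3}. star (mat_alg 3 C) V (c, s) \<otimes>\<^bsub>C\<^esub> V (s, d))"
      unfolding V(2) using cd by (simp only: mat_alg_entry)
    also have "\<dots> = (\<Oplus>\<^bsub>C\<^esub>s\<in>{..<3}. star C (V (s, c)) \<otimes>\<^bsub>C\<^esub> V (s, d))"
      using cd mats_entry[OF V(1)] by (intro \<psi>.B.finsum_cong') (auto simp: mat_alg_entry)
    finally show ?thesis .
  qed
  have "(cnorm C (\<psi> (D (v 1) (v 2))))\<^sup>2 \<le> cnorm C (\<psi> (D (v 1) (v 1))) * cnorm C (\<psi> (D (v 2) (v 2)))"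
    using cauchy_schwarz_carrier[OF C, of "{..<3::nat}" "\<lambda>s. V (s, 1)" "\<lambda>s. V (s, 2)"] mats_entry[OF V(1)]
    by (simp add: VD)
  then show ?thesis by (simp add: v_def)
qed

text \<open>The limit of \<open>defect_aux\<close> along approximate units for a and b, on which all
  the defects depend continuously.\<close>

lemma defect_cauchy_schwarz:
  assumes ab: "a \<in> carrier A" "b \<in> carrier A"
  defines "D \<equiv> \<lambda>x y. \<phi> (star A x \<otimes>\<^bsub>A\<^esub> y) \<ominus>\<^bsub>B\<^esub> star B (\<phi> x) \<otimes>\<^bsub>B\<^esub> \<phi> y"
  shows "(cnorm C (\<psi> (D a b)))\<^sup>2 \<le> cnorm C (\<psi> (D a a)) * cnorm C (\<psi> (D b b))"
proof -
  note A = \<phi>.A and B = \<phi>.B and C = \<psi>.B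
  have "\<exists>e. e \<in> carrier A \<and> star A e = e \<and> cnorm A e \<le> 1 \<and> (\<forall>x\<in>{a, b}. cnorm A (e \<otimes>\<^bsub>A\<^esub> x \<ominus>\<^bsub>A\<^esub> x) < 1 / real (Suc n))" for n
    by (rule approximate_unit_carrier[OF A, of "{a, b}" "\<lambda>x. x" "1 / real (Suc n)"]) (use ab in auto)
  then obtain e where e: "\<And>n. e n \<in> carrier A" "\<And>n. star A (e n) = e n" "\<And>n. cnorm A (e n) \<le> 1"
      "\<And>n x. x \<in> {a, b} \<Longrightarrow> cnorm A (e n \<otimes>\<^bsub>A\<^esub> x \<ominus>\<^bsub>A\<^esub> x) < 1 / real (Suc n)"
    by metis
  define E where "E n x y = \<phi> (star A x \<otimes>\<^bsub>A\<^esub> y) \<ominus>\<^bsub>B\<^esub> star B (\<phi> (e n \<otimes>\<^bsub>A\<^esub> x)) \<otimes>\<^bsub>B\<^esub> \<phi> (e n \<otimes>\<^bsub>A\<^esub> y)" for n x y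
  have conv: "(\<lambda>n. J B (\<phi> (e n \<otimes>\<^bsub>A\<^esub> x))) \<longlonglongrightarrow> J B (\<phi> x)" if x: "x \<in> {a, b}" for x
  proof -
    have xA: "x \<in> carrier A" using x ab by auto
    have "cnorm B (\<phi> (e n \<otimes>\<^bsub>A\<^esub> x) \<ominus>\<^bsub>B\<^esub> \<phi> x) \<le> 1 / real (Suc n)" for n
      using \<phi>.map_norm[of "e n \<otimes>\<^bsub>A\<^esub> x \<ominus>\<^bsub>A\<^esub> x"] e(1) xA less_imp_le[OF e(4)[OF x, of n]]
      by (simp add: \<phi>.map_minus)
    then have "(\<lambda>n. cnorm B (\<phi> (e n \<otimes>\<^bsub>A\<^esub> x) \<ominus>\<^bsub>B\<^esub> \<phi> x)) \<longlonglongrightarrow> 0"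
      using e(1) xA by (intro tendsto_sandwich[OF _ _ tendsto_const LIMSEQ_Suc[OF lim_1_over_n]])
        (auto intro!: always_eventually \<phi>.B.norm_nonneg)
    then show ?thesis using e(1) xA by (subst tendsto_J[OF B]) auto
  qed
  have lim: "(\<lambda>n. cnorm C (\<psi> (E n x y))) \<longlonglongrightarrow> cnorm C (\<psi> (D x y))" if xy: "x \<in> {a, b}" "y \<in> {a, b}" for x y
  proof -
    have c: "x \<in> carrier A" "y \<in> carrier A" using xy ab by auto
    have "(\<lambda>n. J B (\<phi> (star A x \<otimes>\<^bsub>A\<^esub> y)) - adj (J B (\<phi> (e n \<otimes>\<^bsub>A\<^esub> x))) * J B (\<phi> (e n \<otimes>\<^bsub>A\<^esub> y))) \<longlonglongrightarrow>
       J B (\<phi> (star A x \<otimes>\<^bsub>A\<^esub> y)) - adj (J B (\<phi> x)) * J B (\<phi> y)"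
      by (intro tendsto_intros tendsto_adj conv xy)
    then have "(\<lambda>n. J B (E n x y)) \<longlonglongrightarrow> J B (D x y)"
      using c e(1) by (simp add: E_def D_def J_minus[OF B] J_mult[OF B] J_star[OF B])
    moreover have cl: "E n x y \<in> carrier B" "D x y \<in> carrier B" for n
      using c e(1) by (auto simp: E_def D_def)
    ultimately have BE: "(\<lambda>n. cnorm B (E n x y \<ominus>\<^bsub>B\<^esub> D x y)) \<longlonglongrightarrow> 0" by (simp add: tendsto_J[OF B])
    have "cnorm C (\<psi> (E n x y) \<ominus>\<^bsub>C\<^esub> \<psi> (D x y)) \<le> cnorm B (E n x y \<ominus>\<^bsub>B\<^esub> D x y)" for n
      using \<psi>.map_norm[of "E n x y \<ominus>\<^bsub>B\<^esub> D x y"] cl by (simp add: \<psi>.map_minus)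
    then have "(\<lambda>n. cnorm C (\<psi> (E n x y) \<ominus>\<^bsub>C\<^esub> \<psi> (D x y))) \<longlonglongrightarrow> 0"
      using cl by (intro tendsto_sandwich[OF _ _ tendsto_const BE]) (auto intro!: always_eventually \<psi>.B.norm_nonneg)
    then have "(\<lambda>n. J C (\<psi> (E n x y))) \<longlonglongrightarrow> J C (\<psi> (D x y))" using cl by (subst tendsto_J[OF C]) auto
    then have "(\<lambda>n. norm (J C (\<psi> (E n x y)))) \<longlonglongrightarrow> norm (J C (\<psi> (D x y)))" by (rule tendsto_norm)
    then show ?thesis using cl by (simp add: norm_J[OF C])
  qed
  have "(\<lambda>n. (cnorm C (\<psi> (E n a b)))\<^sup>2) \<longlonglongrightarrow> (cnorm C (\<psi> (D a b)))\<^sup>2"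
    by (intro tendsto_intros lim) auto
  moreover have "(\<lambda>n. cnorm C (\<psi> (E n a a)) * cnorm C (\<psi> (E n b b))) \<longlonglongrightarrow> cnorm C (\<psi> (D a a)) * cnorm C (\<psi> (D b b))"
    by (intro tendsto_intros lim) auto
  ultimately show ?thesis
    by (rule LIMSEQ_le) (use defect_aux[OF ab e(1-3)] in \<open>auto simp: E_def\<close>)
qed

end

section \<open>The sequence algebra\<close>

locale cstar_seq =
  fixes A :: "nat \<Rightarrow> 'a cstar"
  assumes A: "cstar_algebra (A n)"
begin

sublocale cstar_algebra "A n" for n by (rule A)

abbreviation "P \<equiv> prod_alg A"
abbreviation "B \<equiv> A_inf A"
abbreviation cls where "cls \<equiv> seq_class A"

lemma prod_sel [simp]:
  "mult P = (\<lambda>a b n. a n \<otimes>\<^bsub>A n\<^esub> b n)" "zero P = (\<lambda>n. \<zero>\<^bsub>A n\<^esub>)" "add P = (\<lambda>a b n. a n \<oplus>\<^bsub>A n\<^esub> b n)"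
  "smult P = (\<lambda>c a n. c \<odot>\<^bsub>A n\<^esub> a n)" "star P = (\<lambda>a n. star (A n) (a n))"
  by (simp_all add: prod_alg_def)

lemma prod_carrier:
  "a \<in> carrier P \<longleftrightarrow> (\<forall>n. a n \<in> carrier (A n)) \<and> (\<exists>K. \<forall>n. cnorm (A n) (a n) \<le> K)"
  by (auto simp: prod_alg_def bdd_above_def)

lemma prodI: "(\<And>n. a n \<in> carrier (A n)) \<Longrightarrow> (\<And>n. cnorm (A n) (a n) \<le> K) \<Longrightarrow> a \<in> carrier P"
  by (auto simp: prod_carrier)

lemma prodD: "a \<in> carrier P \<Longrightarrow> a n \<in> carrier (A n)"
  by (simp add: prod_carrier)

lemma prod_closed:
  assumes a: "a \<in> carrier P"
  shows "b \<in> carrier P \<Longrightarrow> (\<lambda>n. a n \<oplus>\<^bsub>A n\<^esub> b n) \<in> carrier P" "b \<in> carrier P \<Longrightarrow> (\<lambda>n. a n \<otimes>\<^bsub>A n\<^esub> b n) \<in> carrier P"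
    "b \<in> carrier P \<Longrightarrow> (\<lambda>n. a n \<ominus>\<^bsub>A n\<^esub> b n) \<in> carrier P"
    "(\<lambda>n. c \<odot>\<^bsub>A n\<^esub> a n) \<in> carrier P" "(\<lambda>n. star (A n) (a n)) \<in> carrier P"
proof -
  from a obtain K where K: "\<And>n. cnorm (A n) (a n) \<le> K" by (auto simp: prod_carrier)
  note [simp] = prodD[OF a]
  have K0: "0 \<le> K" using K[of 0] norm_nonneg[of "a 0" 0] by simp
  have sm: "(\<lambda>n. c \<odot>\<^bsub>A n\<^esub> a n) \<in> carrier P" if "a \<in> carrier P" for c a
  proof -
    from that obtain K where K: "\<And>n. cnorm (A n) (a n) \<le> K" by (auto simp: prod_carrier)
    show ?thesis
      by (rule prodI[of _ "cmod c * K"]) (auto simp: prodD[OF that] norm_smult mult_left_mono K)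
  qed
  then show "(\<lambda>n. c \<odot>\<^bsub>A n\<^esub> a n) \<in> carrier P" using a .
  show "(\<lambda>n. star (A n) (a n)) \<in> carrier P" by (rule prodI[of _ K]) (auto simp: K)
  have add: "(\<lambda>n. a n \<oplus>\<^bsub>A n\<^esub> b n) \<in> carrier P" if b: "b \<in> carrier P" for b
  proof -
    from b obtain L where L: "\<And>n. cnorm (A n) (b n) \<le> L" by (auto simp: prod_carrier)
    show ?thesis
      by (rule prodI[of _ "K + L"]) (auto simp: prodD[OF b] intro: order_trans[OF norm_triangle add_mono[OF K L]])
  qed
  assume b: "b \<in> carrier P"
  from b obtain L where L: "\<And>n. cnorm (A n) (b n) \<le> L" by (auto simp: prod_carrier)
  show "(\<lambda>n. a n \<oplus>\<^bsub>A n\<^esub> b n) \<in> carrier P" by (rule add[OF b])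
  show "(\<lambda>n. a n \<otimes>\<^bsub>A n\<^esub> b n) \<in> carrier P"
    by (rule prodI[of _ "K * L"])
      (auto simp: prodD[OF b] norm_nonneg K0 intro: order_trans[OF norm_mult mult_mono[OF K L]])
  show "(\<lambda>n. a n \<ominus>\<^bsub>A n\<^esub> b n) \<in> carrier P"
    using add[OF sm[OF b, of "-1"]] by (simp add: minus_smult prodD[OF b])
qed

lemma prod_zero: "(\<lambda>n. \<zero>\<^bsub>A n\<^esub>) \<in> carrier P"
  by (rule prodI[of _ 0]) auto

section \<open>Asymptotic equality of sequences and cosets\<close>

text \<open>Through \<open>J\<close> the entries of a sequence lie in one normed space although the
  algebras \<open>A n\<close> vary, so that null sequences and \<open>eqv\<close> are ordinary
  limits.\<close>

definition null :: "(nat \<Rightarrow> 'a) \<Rightarrow> bool" where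
  "null a \<longleftrightarrow> (\<lambda>n. J (A n) (a n)) \<longlonglongrightarrow> 0"

lemma null_iff: "a \<in> carrier P \<Longrightarrow> null a \<longleftrightarrow> (\<lambda>n. cnorm (A n) (a n)) \<longlonglongrightarrow> 0"
  unfolding null_def by (subst tendsto_norm_zero_iff[symmetric]) (simp add: norm_J[OF A] prodD)

lemma c0_iff: "h \<in> c0_sum A \<longleftrightarrow> h \<in> carrier P \<and> null h"
proof
  assume h: "h \<in> c0_sum A"
  then have "Bseq (\<lambda>n. cnorm (A n) (h n))" by (auto simp: c0_sum_def intro: convergentI convergent_imp_Bseq)
  then obtain K where "\<And>n. norm (cnorm (A n) (h n)) \<le> K" unfolding Bseq_def by blast
  then have "h \<in> carrier P" using h by (auto simp: prod_carrier c0_sum_def intro: exI[of _ K] order_trans[OF abs_ge_self])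
  then show "h \<in> carrier P \<and> null h" using h null_iff by (simp add: c0_sum_def)
next
  assume "h \<in> carrier P \<and> null h"
  then show "h \<in> c0_sum A" using null_iff by (auto simp: c0_sum_def prodD)
qed

definition eqv :: "(nat \<Rightarrow> 'a) \<Rightarrow> (nat \<Rightarrow> 'a) \<Rightarrow> bool" where
  "eqv a b \<longleftrightarrow> (\<lambda>n. J (A n) (a n) - J (A n) (b n)) \<longlonglongrightarrow> 0"

lemma eqv_refl: "eqv a a" by (simp add: eqv_def)

lemma eqv_sym: "eqv a b \<Longrightarrow> eqv b a"
  using tendsto_minus[of "\<lambda>n. J (A n) (a n) - J (A n) (b n)" 0] by (simp add: eqv_def)

lemma eqv_trans: "eqv a b \<Longrightarrow> eqv b c \<Longrightarrow> eqv a c"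
  unfolding eqv_def using tendsto_add[of "\<lambda>n. J (A n) (a n) - J (A n) (b n)" 0] by fastforce

lemma null_minus: "a \<in> carrier P \<Longrightarrow> b \<in> carrier P \<Longrightarrow> null (\<lambda>n. a n \<ominus>\<^bsub>A n\<^esub> b n) \<longleftrightarrow> eqv a b"
  unfolding null_def eqv_def by (simp add: J_minus[OF A] prodD)

lemma eqv_iff: "a \<in> carrier P \<Longrightarrow> b \<in> carrier P \<Longrightarrow> eqv a b \<longleftrightarrow> (\<lambda>n. cnorm (A n) (a n \<ominus>\<^bsub>A n\<^esub> b n)) \<longlonglongrightarrow> 0"
  by (simp add: null_minus[symmetric] null_iff prod_closed)

lemma minus_add_cancel':
  "x \<in> carrier (A n) \<Longrightarrow> a \<in> carrier (A n) \<Longrightarrow> (x \<ominus>\<^bsub>A n\<^esub> a) \<oplus>\<^bsub>A n\<^esub> a = x"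
  "x \<in> carrier (A n) \<Longrightarrow> a \<in> carrier (A n) \<Longrightarrow> (x \<oplus>\<^bsub>A n\<^esub> a) \<ominus>\<^bsub>A n\<^esub> a = x"
  by (subst J_inject[OF A, symmetric, of _ n]; simp add: J_minus[OF A] J_add[OF A])+

lemma cls_eq:
  assumes a: "a \<in> carrier P"
  shows "cls a = {x \<in> carrier P. eqv x a}"
proof -
  have "cls a = {(\<lambda>n. h n \<oplus>\<^bsub>A n\<^esub> a n) | h. h \<in> c0_sum A}"
    by (auto simp: seq_class_def a_r_coset_def')
  also have "\<dots> = {x \<in> carrier P. eqv x a}"
  proof (intro equalityI subsetI)
    fix x assume "x \<in> {(\<lambda>n. h n \<oplus>\<^bsub>A n\<^esub> a n) | h. h \<in> c0_sum A}"
    then obtain h where h: "h \<in> carrier P" "null h" "x = (\<lambda>n. h n \<oplus>\<^bsub>A n\<^esub> a n)" by (auto simp: c0_iff)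
    then have x: "x \<in> carrier P" using prod_closed(1)[OF h(1) a] by simp
    moreover have "(\<lambda>n. x n \<ominus>\<^bsub>A n\<^esub> a n) = h" using h a by (auto simp: minus_add_cancel' prodD)
    ultimately show "x \<in> {x \<in> carrier P. eqv x a}" using h(2) a by (simp flip: null_minus)
  next
    fix x assume x: "x \<in> {x \<in> carrier P. eqv x a}"
    have "x = (\<lambda>n. (x n \<ominus>\<^bsub>A n\<^esub> a n) \<oplus>\<^bsub>A n\<^esub> a n)" using x a by (auto simp: minus_add_cancel' prodD)
    moreover have "(\<lambda>n. x n \<ominus>\<^bsub>A n\<^esub> a n) \<in> c0_sum A"
      using x a by (simp add: c0_iff prod_closed null_minus)
    ultimately show "x \<in> {(\<lambda>n. h n \<oplus>\<^bsub>A n\<^esub> a n) | h. h \<in> c0_sum A}"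
      by (intro CollectI exI[of _ "\<lambda>n. x n \<ominus>\<^bsub>A n\<^esub> a n"] conjI)
  qed
  finally show ?thesis .
qed

lemma cls_self: "a \<in> carrier P \<Longrightarrow> a \<in> cls a"
  by (simp add: cls_eq eqv_refl)

lemma cls_eq_iff: "a \<in> carrier P \<Longrightarrow> b \<in> carrier P \<Longrightarrow> cls a = cls b \<longleftrightarrow> eqv a b"
proof -
  assume a: "a \<in> carrier P" and b: "b \<in> carrier P"
  show ?thesis
  proof
    assume "cls a = cls b"
    then show "eqv a b" using cls_self[OF a] b by (simp add: cls_eq)
  next
    assume ab: "eqv a b"
    have "eqv x a \<longleftrightarrow> eqv x b" for x
      using eqv_trans[OF _ ab, of x] eqv_trans[OF _ eqv_sym[OF ab], of x] by blast
    then show "cls a = cls b" using a b by (simp add: cls_eq)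
  qed
qed

lemma carrier_B: "carrier B = cls ` carrier P"
  by (auto simp: A_inf_def quot_alg_def seq_class_def A_RCOSETS_def RCOSETS_def a_r_coset_def)

lemma cls_closed: "a \<in> carrier P \<Longrightarrow> cls a \<in> carrier B"
  by (simp add: carrier_B)

lemma eqv_tendsto:
  "eqv a b \<Longrightarrow> eqv c d \<Longrightarrow> (\<lambda>n. (J (A n) (a n) + J (A n) (c n)) - (J (A n) (b n) + J (A n) (d n))) \<longlonglongrightarrow> 0"
  unfolding eqv_def using tendsto_add[of "\<lambda>n. J (A n) (a n) - J (A n) (b n)" 0 _ "\<lambda>n. J (A n) (c n) - J (A n) (d n)" 0]
  by (simp add: add_diff_add)

lemma eqv_add:
  assumes "a \<in> carrier P" "b \<in> carrier P" "c \<in> carrier P" "d \<in> carrier P" "eqv a b" "eqv c d"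
  shows "eqv (\<lambda>n. a n \<oplus>\<^bsub>A n\<^esub> c n) (\<lambda>n. b n \<oplus>\<^bsub>A n\<^esub> d n)"
  using eqv_tendsto[OF assms(5,6)] assms(1-4) by (simp add: eqv_def J_add[OF A] prodD)

lemma J_Bseq: "a \<in> carrier P \<Longrightarrow> Bseq (\<lambda>n. J (A n) (a n))"
proof -
  assume a: "a \<in> carrier P"
  then obtain K where "\<And>n. cnorm (A n) (a n) \<le> K" by (auto simp: prod_carrier)
  then show ?thesis using a by (intro BseqI'[of _ K]) (simp add: norm_J[OF A] prodD)
qed

lemma eqv_mult:
  assumes "a \<in> carrier P" "b \<in> carrier P" "c \<in> carrier P" "d \<in> carrier P" "eqv a b" "eqv c d"
  shows "eqv (\<lambda>n. a n \<otimes>\<^bsub>A n\<^esub> c n) (\<lambda>n. b n \<otimes>\<^bsub>A n\<^esub> d n)"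
proof -
  have *: "bounded_bilinear (\<lambda>x y :: 'a uni. x * y)" by (rule bounded_bilinear_mult)
  have "Zfun (\<lambda>n. (J (A n) (a n) - J (A n) (b n)) * J (A n) (c n)) sequentially"
    using assms(5) J_Bseq[OF assms(3)] by (intro bounded_bilinear.Zfun_prod_Bfun[OF *])
      (simp_all add: eqv_def tendsto_Zfun_iff)
  moreover have "Zfun (\<lambda>n. J (A n) (b n) * (J (A n) (c n) - J (A n) (d n))) sequentially"
    using assms(6) J_Bseq[OF assms(2)] by (intro bounded_bilinear.Bfun_prod_Zfun[OF *])
      (simp_all add: eqv_def tendsto_Zfun_iff)
  ultimately have "Zfun (\<lambda>n. (J (A n) (a n) - J (A n) (b n)) * J (A n) (c n) +
      J (A n) (b n) * (J (A n) (c n) - J (A n) (d n))) sequentially" by (rule Zfun_add)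
  then show ?thesis
    using assms(1-4) by (simp add: eqv_def J_mult[OF A] prodD tendsto_Zfun_iff algebra_simps)
qed

lemma eqv_smult:
  assumes "a \<in> carrier P" "b \<in> carrier P" "eqv a b"
  shows "eqv (\<lambda>n. c \<odot>\<^bsub>A n\<^esub> a n) (\<lambda>n. c \<odot>\<^bsub>A n\<^esub> b n)"
proof -
  have "(\<lambda>n. cscale c (J (A n) (a n) - J (A n) (b n))) \<longlonglongrightarrow> cscale c 0"
    unfolding cscale_def using assms(3) unfolding eqv_def by (intro tendsto_intros)
  moreover have "cscale c (x - y) = cscale c x - cscale c y" for x y :: "'a uni"
    by (simp add: cscale_def scaleR_diff_right right_diff_distrib)
  ultimately show ?thesis using assms by (simp add: eqv_def J_smult[OF A] prodD)
qed

lemma eqv_star: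
  assumes "a \<in> carrier P" "b \<in> carrier P" "eqv a b"
  shows "eqv (\<lambda>n. star (A n) (a n)) (\<lambda>n. star (A n) (b n))"
  using tendsto_adj[OF assms(3)[unfolded eqv_def]] assms
  by (simp add: eqv_def J_star[OF A] prodD adj_diff)

text \<open>In \<open>quot_alg\<close>, scalar multiplication and star of a coset are unions of
  cosets; such a union collapses once its members coincide.\<close>

lemma cls_UN:
  assumes a: "a \<in> carrier P" and f: "\<And>x. x \<in> cls a \<Longrightarrow> cls (f x) = cls (f a)"
  shows "(\<Union>x\<in>cls a. cls (f x)) = cls (f a)"
  using f cls_self[OF a] by blast

section \<open>Operations of the quotient on representatives\<close>

lemma B_ops:
  assumes a: "a \<in> carrier P" and b: "b \<in> carrier P"
  shows B_add: "cls a \<oplus>\<^bsub>B\<^esub> cls b = cls (\<lambda>n. a n \<oplus>\<^bsub>A n\<^esub> b n)"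
    and B_mult: "cls a \<otimes>\<^bsub>B\<^esub> cls b = cls (\<lambda>n. a n \<otimes>\<^bsub>A n\<^esub> b n)"
    and B_smult: "c \<odot>\<^bsub>B\<^esub> cls a = cls (\<lambda>n. c \<odot>\<^bsub>A n\<^esub> a n)"
    and B_star: "star B (cls a) = cls (\<lambda>n. star (A n) (a n))"
    and B_zero: "\<zero>\<^bsub>B\<^esub> = cls (\<lambda>n. \<zero>\<^bsub>A n\<^esub>)"
proof -
  have D: "x \<in> carrier P" "eqv x a" if "x \<in> cls a" for x using that a by (auto simp: cls_eq)
  have D': "x \<in> carrier P" "eqv x b" if "x \<in> cls b" for x using that b by (auto simp: cls_eq)
  show "cls a \<oplus>\<^bsub>B\<^esub> cls b = cls (\<lambda>n. a n \<oplus>\<^bsub>A n\<^esub> b n)"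
  proof -
    have "cls a \<oplus>\<^bsub>B\<^esub> cls b = {(\<lambda>n. x n \<oplus>\<^bsub>A n\<^esub> y n) | x y. x \<in> cls a \<and> y \<in> cls b}"
      by (auto simp: A_inf_def quot_alg_def set_add_def set_mult_def)
    also have "\<dots> = cls (\<lambda>n. a n \<oplus>\<^bsub>A n\<^esub> b n)"
    proof (intro equalityI subsetI)
      fix z assume "z \<in> {(\<lambda>n. x n \<oplus>\<^bsub>A n\<^esub> y n) | x y. x \<in> cls a \<and> y \<in> cls b}"
      then show "z \<in> cls (\<lambda>n. a n \<oplus>\<^bsub>A n\<^esub> b n)"
        using a b by (auto simp: cls_eq prod_closed intro!: eqv_add)
    next
      fix z assume "z \<in> cls (\<lambda>n. a n \<oplus>\<^bsub>A n\<^esub> b n)"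
      then have z: "z \<in> carrier P" "eqv z (\<lambda>n. a n \<oplus>\<^bsub>A n\<^esub> b n)" using a b by (auto simp: cls_eq prod_closed)
      have "eqv (\<lambda>n. z n \<ominus>\<^bsub>A n\<^esub> b n) a"
        using z a b by (simp add: eqv_def J_add[OF A] J_minus[OF A] prodD algebra_simps)
      then have "(\<lambda>n. z n \<ominus>\<^bsub>A n\<^esub> b n) \<in> cls a" using z a b by (simp add: cls_eq prod_closed)
      moreover have "z = (\<lambda>n. (z n \<ominus>\<^bsub>A n\<^esub> b n) \<oplus>\<^bsub>A n\<^esub> b n)"
        using z b by (auto simp: minus_add_cancel' prodD)
      ultimately show "z \<in> {(\<lambda>n. x n \<oplus>\<^bsub>A n\<^esub> y n) | x y. x \<in> cls a \<and> y \<in> cls b}"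
        using cls_self[OF b] by (intro CollectI exI[of _ "\<lambda>n. z n \<ominus>\<^bsub>A n\<^esub> b n"] exI[of _ b] conjI)
    qed
    finally show ?thesis .
  qed
  show "cls a \<otimes>\<^bsub>B\<^esub> cls b = cls (\<lambda>n. a n \<otimes>\<^bsub>A n\<^esub> b n)"
  proof -
    have "cls a \<otimes>\<^bsub>B\<^esub> cls b = (\<Union>x\<in>cls a. \<Union>y\<in>cls b. cls (\<lambda>n. x n \<otimes>\<^bsub>A n\<^esub> y n))"
      by (simp add: A_inf_def quot_alg_def rcoset_mult_def seq_class_def)
    also have "\<dots> = (\<Union>x\<in>cls a. \<Union>y\<in>cls b. cls (\<lambda>n. a n \<otimes>\<^bsub>A n\<^esub> b n))"
    proof (intro SUP_cong refl)
      fix x y assume "x \<in> cls a" "y \<in> cls b"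
      then show "cls (\<lambda>n. x n \<otimes>\<^bsub>A n\<^esub> y n) = cls (\<lambda>n. a n \<otimes>\<^bsub>A n\<^esub> b n)"
        using D D' a b by (subst cls_eq_iff) (auto simp: prod_closed intro!: eqv_mult)
    qed
    also have "\<dots> = cls (\<lambda>n. a n \<otimes>\<^bsub>A n\<^esub> b n)" using cls_self[OF a] cls_self[OF b] by blast
    finally show ?thesis .
  qed
  show "c \<odot>\<^bsub>B\<^esub> cls a = cls (\<lambda>n. c \<odot>\<^bsub>A n\<^esub> a n)"
  proof -
    have "c \<odot>\<^bsub>B\<^esub> cls a = (\<Union>x\<in>cls a. cls (\<lambda>n. c \<odot>\<^bsub>A n\<^esub> x n))"
      by (simp add: A_inf_def quot_alg_def seq_class_def)
    also have "\<dots> = cls (\<lambda>n. c \<odot>\<^bsub>A n\<^esub> a n)"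
      using D a by (intro cls_UN a, subst cls_eq_iff) (auto simp: prod_closed intro!: eqv_smult)
    finally show ?thesis .
  qed
  show "star B (cls a) = cls (\<lambda>n. star (A n) (a n))"
  proof -
    have "star B (cls a) = (\<Union>x\<in>cls a. cls (\<lambda>n. star (A n) (x n)))"
      by (simp add: A_inf_def quot_alg_def seq_class_def)
    also have "\<dots> = cls (\<lambda>n. star (A n) (a n))"
      using D a by (intro cls_UN a, subst cls_eq_iff) (auto simp: prod_closed intro!: eqv_star)
    finally show ?thesis .
  qed
  show "\<zero>\<^bsub>B\<^esub> = cls (\<lambda>n. \<zero>\<^bsub>A n\<^esub>)"
  proof -
    have "cls (\<lambda>n. \<zero>\<^bsub>A n\<^esub>) = c0_sum A"
      using prod_zero by (auto simp: cls_eq c0_iff eqv_def null_def J_zero[OF A])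
    then show ?thesis by (simp add: A_inf_def quot_alg_def)
  qed
qed

section \<open>The quotient norm as a limit superior\<close>

lemma cnorm_P_ge: "x \<in> carrier P \<Longrightarrow> cnorm (A n) (x n) \<le> cnorm P x"
  by (auto simp: prod_alg_def intro!: cSUP_upper2)

lemma cnorm_P_le: "(\<And>n. cnorm (A n) (x n) \<le> K) \<Longrightarrow> cnorm P x \<le> K"
  by (simp add: prod_alg_def cSUP_least)

lemma cnorm_P_nonneg: "x \<in> carrier P \<Longrightarrow> 0 \<le> cnorm P x"
  using cnorm_P_ge[of x 0] norm_nonneg[of "x 0" 0] prodD[of x 0] by simp

lemma cnorm_B: "cnorm B X = (INF x\<in>X. cnorm P x)"
  by (simp add: A_inf_def quot_alg_def)

text \<open>Finitely many entries can be replaced by zero without changing the class. Together with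
  \<open>norm_class_less\<close> this makes the quotient norm the limit superior of the entry
  norms.\<close>

lemma norm_class_le:
  assumes a: "a \<in> carrier P" and ev: "\<forall>\<^sub>F n in sequentially. cnorm (A n) (a n) \<le> K"
  shows "cnorm B (cls a) \<le> K"
proof -
  obtain N where N: "\<And>n. n \<ge> N \<Longrightarrow> cnorm (A n) (a n) \<le> K" using ev by (auto simp: eventually_sequentially)
  have K: "0 \<le> K" using N[of N] norm_nonneg[OF prodD[OF a], of N] by simp
  define x where "x n = (if n \<ge> N then a n else \<zero>\<^bsub>A n\<^esub>)" for n
  have xP: "x \<in> carrier P" by (rule prodI[of _ K]) (auto simp: x_def N K prodD[OF a])
  have "eqv x a" unfolding eqv_def
    by (rule tendsto_eventually) (auto simp: x_def eventually_sequentially intro!: exI[of _ N])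
  then have "x \<in> cls a" using xP a by (simp add: cls_eq)
  then have "cnorm B (cls a) \<le> cnorm P x"
    unfolding cnorm_B using a by (intro cINF_lower bdd_belowI2[of _ 0]) (auto simp: cls_eq cnorm_P_nonneg)
  also have "\<dots> \<le> K" by (rule cnorm_P_le) (auto simp: x_def N K)
  finally show ?thesis .
qed

lemma norm_class_less_rep:
  assumes a: "a \<in> carrier P" and "cnorm B (cls a) < K"
  obtains x where "x \<in> carrier P" "eqv x a" "\<forall>n. cnorm (A n) (x n) < K"
proof -
  have "\<exists>x\<in>cls a. cnorm P x < K"
    using assms(2) cls_self[OF a] unfolding cnorm_B
    by (subst (asm) cINF_less_iff) (auto intro!: bdd_belowI2[of _ 0] simp: cls_eq[OF a] cnorm_P_nonneg)
  then obtain x where x: "x \<in> carrier P" "eqv x a" "cnorm P x < K" by (auto simp: cls_eq[OF a])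
  then show thesis using that cnorm_P_ge le_less_trans by blast
qed

text \<open>Some representative has all its entry norms below an L < K and differs from a by a null
  sequence, eventually by less than K - L.\<close>

lemma norm_class_less:
  assumes a: "a \<in> carrier P" and lt: "cnorm B (cls a) < K"
  shows "\<forall>\<^sub>F n in sequentially. cnorm (A n) (a n) < K"
proof -
  obtain L where L: "cnorm B (cls a) < L" "L < K" using dense[OF lt] by blast
  obtain x where x: "x \<in> carrier P" "eqv x a" "\<forall>n. cnorm (A n) (x n) < L"
    by (rule norm_class_less_rep[OF a L(1)])
  have "(\<lambda>n. norm (J (A n) (x n) - J (A n) (a n))) \<longlonglongrightarrow> 0"
    using x(2) unfolding eqv_def by (rule tendsto_norm_zero)
  then have "\<forall>\<^sub>F n in sequentially. norm (J (A n) (x n) - J (A n) (a n)) < K - L"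
    using L by (intro order_tendstoD(2)[where a = "K - L"]) auto
  then show ?thesis
  proof eventually_elim
    case (elim n)
    have "norm (J (A n) (a n)) \<le> norm (J (A n) (x n)) + norm (J (A n) (x n) - J (A n) (a n))"
      using norm_triangle_sub[of "J (A n) (a n)" "J (A n) (x n)"]
      by (simp add: Real_Vector_Spaces.norm_minus_commute)
    then show ?case using elim x(3)[rule_format, of n] x(1) a by (simp add: norm_J[OF A] prodD)
  qed
qed

lemma norm_class_nonneg: "a \<in> carrier P \<Longrightarrow> 0 \<le> cnorm B (cls a)"
  unfolding cnorm_B using cls_self by (intro cINF_greatest) (auto simp: cls_eq cnorm_P_nonneg)

lemma norm_class_eventually:
  "a \<in> carrier P \<Longrightarrow> \<epsilon> > 0 \<Longrightarrow> \<forall>\<^sub>F n in sequentially. cnorm (A n) (a n) < cnorm B (cls a) + \<epsilon>"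
  by (rule norm_class_less) auto

lemma B_abelian_group: "abelian_group B"
proof (rule abelian_groupI)
  show "\<zero>\<^bsub>B\<^esub> \<in> carrier B" using prod_zero by (simp add: B_zero[OF prod_zero prod_zero] cls_closed)
  fix X assume "X \<in> carrier B"
  then obtain a where a: "a \<in> carrier P" "X = cls a" by (auto simp: carrier_B)
  note [simp] = prodD[OF a(1)]
  show "\<zero>\<^bsub>B\<^esub> \<oplus>\<^bsub>B\<^esub> X = X"
    using a prod_zero by (simp add: B_zero[OF prod_zero prod_zero] B_add)
  have m: "(\<lambda>n. (- 1) \<odot>\<^bsub>A n\<^esub> a n) \<in> carrier P" by (rule prod_closed(4)[OF a(1)])
  show "\<exists>Y\<in>carrier B. Y \<oplus>\<^bsub>B\<^esub> X = \<zero>\<^bsub>B\<^esub>"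
    using a m prod_zero
    by (intro bexI[of _ "cls (\<lambda>n. (- 1) \<odot>\<^bsub>A n\<^esub> a n)"])
      (auto simp: B_add B_zero[OF prod_zero prod_zero] cls_closed smult_minus_one l_neg)
  fix Y assume "Y \<in> carrier B"
  then obtain b where b: "b \<in> carrier P" "Y = cls b" by (auto simp: carrier_B)
  note [simp] = prodD[OF b(1)]
  show "X \<oplus>\<^bsub>B\<^esub> Y \<in> carrier B" using a b by (simp add: B_add cls_closed prod_closed)
  show "X \<oplus>\<^bsub>B\<^esub> Y = Y \<oplus>\<^bsub>B\<^esub> X" using a b by (simp add: B_add a_comm)
  fix Z assume "Z \<in> carrier B"
  then obtain c where c: "c \<in> carrier P" "Z = cls c" by (auto simp: carrier_B)
  note [simp] = prodD[OF c(1)]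
  show "X \<oplus>\<^bsub>B\<^esub> Y \<oplus>\<^bsub>B\<^esub> Z = X \<oplus>\<^bsub>B\<^esub> (Y \<oplus>\<^bsub>B\<^esub> Z)" using a b c by (simp add: B_add prod_closed a_assoc)
qed

lemma B_minus:
  assumes a: "a \<in> carrier P" and b: "b \<in> carrier P"
  shows "cls a \<ominus>\<^bsub>B\<^esub> cls b = cls (\<lambda>n. a n \<ominus>\<^bsub>A n\<^esub> b n)"
proof -
  interpret B: abelian_group B by (rule B_abelian_group)
  have m: "(\<lambda>n. (- 1) \<odot>\<^bsub>A n\<^esub> b n) \<in> carrier P" by (rule prod_closed(4)[OF b])
  have "cls (\<lambda>n. (- 1) \<odot>\<^bsub>A n\<^esub> b n) \<oplus>\<^bsub>B\<^esub> cls b = \<zero>\<^bsub>B\<^esub>"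
    using b m by (simp add: B_add B_zero[OF prod_zero prod_zero] smult_minus_one l_neg prodD)
  then have "\<ominus>\<^bsub>B\<^esub> cls b = cls (\<lambda>n. (- 1) \<odot>\<^bsub>A n\<^esub> b n)"
    using b m by (intro B.minus_equality) (simp_all add: cls_closed)
  then show ?thesis using a b m by (simp add: a_minus_def[of B] B_add minus_smult prodD)
qed

lemma B_norm_triangle:
  assumes a: "a \<in> carrier P" and b: "b \<in> carrier P"
  shows "cnorm B (cls (\<lambda>n. a n \<oplus>\<^bsub>A n\<^esub> b n)) \<le> cnorm B (cls a) + cnorm B (cls b)"
proof (rule field_le_epsilon)
  fix e :: real assume "e > 0"
  then have e2: "e / 2 > 0" by simp
  show "cnorm B (cls (\<lambda>n. a n \<oplus>\<^bsub>A n\<^esub> b n)) \<le> cnorm B (cls a) + cnorm B (cls b) + e"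
    using norm_class_eventually[OF a e2] norm_class_eventually[OF b e2]
  proof (intro norm_class_le prod_closed a b, eventually_elim)
    case (elim n)
    then show ?case using norm_triangle[OF prodD[OF a] prodD[OF b], of n] by simp
  qed
qed

lemma B_metric: "Metric_space (carrier B) (cdist B)"
proof -
  have n0: "cnorm B (cls a \<ominus>\<^bsub>B\<^esub> cls b) = 0 \<longleftrightarrow> cls a = cls b" if a: "a \<in> carrier P" and b: "b \<in> carrier P" for a b
  proof -
    let ?d = "\<lambda>n. a n \<ominus>\<^bsub>A n\<^esub> b n"
    have d: "?d \<in> carrier P" using a b by (simp add: prod_closed)
    have "cnorm B (cls ?d) = 0 \<longleftrightarrow> null ?d"
    proof
      assume z: "cnorm B (cls ?d) = 0"
      have "(\<lambda>n. cnorm (A n) (?d n)) \<longlonglongrightarrow> 0"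
      proof (rule order_tendstoI)
        show "\<forall>\<^sub>F n in sequentially. y < cnorm (A n) (?d n)" if "y < 0" for y
          using less_le_trans[OF that norm_nonneg[OF prodD[OF d]]] by (intro always_eventually allI)
        show "\<forall>\<^sub>F n in sequentially. cnorm (A n) (?d n) < y" if "0 < y" for y
          using norm_class_less[OF d, of y] z that by simp
      qed
      then show "null ?d" using null_iff d by simp
    next
      assume "null ?d"
      then have lim: "(\<lambda>n. cnorm (A n) (?d n)) \<longlonglongrightarrow> 0" using null_iff d by simp
      have "cnorm B (cls ?d) \<le> 0 + e" if "e > 0" for e
        using order_tendstoD(2)[OF lim that] by (intro norm_class_le d) (auto elim: eventually_mono)
      then have "cnorm B (cls ?d) \<le> 0" by (rule field_le_epsilon)
      then show "cnorm B (cls ?d) = 0" using norm_class_nonneg[OF d] by simp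
    qed
    then show ?thesis using a b by (simp add: B_minus cls_eq_iff null_minus)
  qed
  have mc: "cls a \<ominus>\<^bsub>B\<^esub> cls b = cls (\<lambda>n. a n \<ominus>\<^bsub>A n\<^esub> b n)" "(\<lambda>n. a n \<ominus>\<^bsub>A n\<^esub> b n) \<in> carrier P"
    if "a \<in> carrier P" "b \<in> carrier P" for a b using that by (simp_all add: B_minus prod_closed)
  have le: "cnorm B (cls a \<ominus>\<^bsub>B\<^esub> cls b) \<le> cnorm B (cls b \<ominus>\<^bsub>B\<^esub> cls a)" if a: "a \<in> carrier P" and b: "b \<in> carrier P" for a b
  proof (rule field_le_epsilon)
    fix e :: real assume "e > 0"
    from norm_class_eventually[OF mc(2)[OF b a] this]
    show "cnorm B (cls a \<ominus>\<^bsub>B\<^esub> cls b) \<le> cnorm B (cls b \<ominus>\<^bsub>B\<^esub> cls a) + e"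
      unfolding mc(1)[OF a b] mc(1)[OF b a]
      by (intro norm_class_le mc(2) a b) (auto elim!: eventually_mono simp: norm_minus_commute prodD[OF a] prodD[OF b])
  qed
  show ?thesis
  proof
    fix X Y Z
    show "0 \<le> cdist B X Y" by (auto simp: cdist_def carrier_B mc norm_class_nonneg)
    show "cdist B X Y = cdist B Y X" using le by (auto simp: cdist_def carrier_B intro!: antisym)
    show "X \<in> carrier B \<Longrightarrow> Y \<in> carrier B \<Longrightarrow> cdist B X Y = 0 \<longleftrightarrow> X = Y"
      using n0 by (auto simp: cdist_def carrier_B)
    assume "X \<in> carrier B" "Y \<in> carrier B" "Z \<in> carrier B"
    then obtain a b c where c: "a \<in> carrier P" "b \<in> carrier P" "c \<in> carrier P" "X = cls a" "Y = cls b" "Z = cls c"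
      by (auto simp: carrier_B)
    have "(\<lambda>n. (a n \<ominus>\<^bsub>A n\<^esub> b n) \<oplus>\<^bsub>A n\<^esub> (b n \<ominus>\<^bsub>A n\<^esub> c n)) = (\<lambda>n. a n \<ominus>\<^bsub>A n\<^esub> c n)"
      using c by (simp add: minus_add_minus prodD)
    then have "cnorm B (cls (\<lambda>n. a n \<ominus>\<^bsub>A n\<^esub> c n)) \<le> cnorm B (cls (\<lambda>n. a n \<ominus>\<^bsub>A n\<^esub> b n)) + cnorm B (cls (\<lambda>n. b n \<ominus>\<^bsub>A n\<^esub> c n))"
      using B_norm_triangle[OF mc(2)[OF c(1,2)] mc(2)[OF c(2,3)]] by simp
    then show "cdist B X Z \<le> cdist B X Y + cdist B Y Z"
      using c by (simp add: cdist_def cls_closed mc)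
  qed
qed

text \<open>A fast Cauchy subsequence is lifted successively, each lift within (1/2)^k of the
  previous one in every entry. The lifts converge entrywise, uniformly in the entry.\<close>

lemma B_complete: "Metric_space.mcomplete (carrier B) (cdist B)"
proof (rule mcompleteI[OF B_metric])
  interpret MB: Metric_space "carrier B" "cdist B" by (rule B_metric)
  fix s assume sB: "\<And>n::nat. s n \<in> carrier B"
    and Cau: "\<And>e. e > 0 \<Longrightarrow> \<exists>N. \<forall>m\<ge>N. \<forall>n\<ge>N. cnorm B (s m \<ominus>\<^bsub>B\<^esub> s n) < e"
  have "\<exists>N. \<forall>m\<ge>N. \<forall>n\<ge>N. cnorm B (s m \<ominus>\<^bsub>B\<^esub> s n) < (1/2)^k" for k :: nat by (rule Cau) simp
  then obtain N where N: "\<And>k m n. m \<ge> N k \<Longrightarrow> n \<ge> N k \<Longrightarrow> cnorm B (s m \<ominus>\<^bsub>B\<^esub> s n) < (1/2)^k" by metis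
  \<comment> \<open>With partial sums as indices, both t k and t (Suc k) lie past N k.\<close>
  define t where "t k = s (\<Sum>i\<le>k. N i)" for k
  have Nle: "N k \<le> (\<Sum>i\<le>k. N i)" "N k \<le> (\<Sum>i\<le>Suc k. N i)" for k
    by (auto intro: member_le_sum trans_le_add1)
  have t: "cnorm B (t (Suc k) \<ominus>\<^bsub>B\<^esub> t k) < (1/2)^k" for k
    unfolding t_def by (rule N) (rule Nle)+
  have tB: "t k \<in> carrier B" for k by (simp add: t_def sB)
  have "\<exists>x. \<forall>k. (x k \<in> carrier P \<and> cls (x k) = t k) \<and> (\<forall>n. cnorm (A n) (x (Suc k) n \<ominus>\<^bsub>A n\<^esub> x k n) < (1/2)^k)"
  proof (rule dependent_nat_choice)
    show "\<exists>x. x \<in> carrier P \<and> cls x = t 0" using tB[of 0] by (auto simp: carrier_B)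
    fix x k assume x: "x \<in> carrier P \<and> cls x = t k"
    obtain b where b: "b \<in> carrier P" "t (Suc k) = cls b" using tB[of "Suc k"] by (auto simp: carrier_B)
    have d: "(\<lambda>n. b n \<ominus>\<^bsub>A n\<^esub> x n) \<in> carrier P" using b x by (simp add: prod_closed)
    have "cnorm B (cls (\<lambda>n. b n \<ominus>\<^bsub>A n\<^esub> x n)) < (1/2)^k"
      using t[of k] x b B_minus[of b x] by simp
    then obtain z where z: "z \<in> carrier P" "eqv z (\<lambda>n. b n \<ominus>\<^bsub>A n\<^esub> x n)" "\<forall>n. cnorm (A n) (z n) < (1/2)^k"
      by (rule norm_class_less_rep[OF d])
    \<comment> \<open>The previous lift plus a representative of the difference of the classes whose
      entries are all small.\<close>
    let ?y = "\<lambda>n. z n \<oplus>\<^bsub>A n\<^esub> x n"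
    have y: "?y \<in> carrier P" using z x by (simp add: prod_closed)
    have "eqv ?y b" using z(1,2) x b by (simp add: eqv_def J_add[OF A] J_minus[OF A] prodD algebra_simps)
    then have "cls ?y = t (Suc k)" using y b by (simp add: cls_eq_iff)
    moreover have "?y n \<ominus>\<^bsub>A n\<^esub> x n = z n" for n using z x by (simp add: minus_add_cancel' prodD)
    ultimately show "\<exists>y. (y \<in> carrier P \<and> cls y = t (Suc k)) \<and> (\<forall>n. cnorm (A n) (y n \<ominus>\<^bsub>A n\<^esub> x n) < (1/2)^k)"
      using y z(3) by (intro exI[of _ ?y]) auto
  qed
  then obtain x where "\<forall>k. (x k \<in> carrier P \<and> cls (x k) = t k) \<and>
      (\<forall>n. cnorm (A n) (x (Suc k) n \<ominus>\<^bsub>A n\<^esub> x k n) < (1/2)^k)" ..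
  then have x: "x k \<in> carrier P" "cls (x k) = t k"
      "cnorm (A n) (x (Suc k) n \<ominus>\<^bsub>A n\<^esub> x k n) < (1/2)^k" for k n by simp_all
  have xA [simp]: "x k n \<in> carrier (A n)" for k n using prodD[OF x(1)] .
  have d: "cnorm (A n) (x (k + i) n \<ominus>\<^bsub>A n\<^esub> x k n) \<le> 2 * (1/2)^k - 2 * (1/2)^(k+i)" for n k i
  proof (induction i)
    case (Suc i)
    have "cnorm (A n) (x (k + Suc i) n \<ominus>\<^bsub>A n\<^esub> x k n) \<le>
        cnorm (A n) (x (Suc (k + i)) n \<ominus>\<^bsub>A n\<^esub> x (k + i) n) + cnorm (A n) (x (k + i) n \<ominus>\<^bsub>A n\<^esub> x k n)"
      using norm_triangle_minus[of "x (Suc (k + i)) n" n "x (k + i) n" "x k n"] by simp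
    also have "\<dots> \<le> (1/2)^(k+i) + (2 * (1/2)^k - 2 * (1/2)^(k+i))" using x(3)[of n "k + i"] Suc by simp
    finally show ?case by simp
  qed (use norm_minus_eq_zero[OF xA xA, THEN iffD2, OF refl] in simp)
  have d': "cnorm (A n) (x m n \<ominus>\<^bsub>A n\<^esub> x k n) \<le> 2 * (1/2)^k" if "m \<ge> k" for m k n
  proof -
    have "(0::real) \<le> (1/2)^m" by simp
    moreover have "cnorm (A n) (x m n \<ominus>\<^bsub>A n\<^esub> x k n) \<le> 2 * (1/2)^k - 2 * (1/2)^m"
      using d[of n k "m - k"] that by simp
    ultimately show ?thesis by linarith
  qed
  have "\<exists>l. l \<in> carrier (A n) \<and> (\<lambda>k. cnorm (A n) (x k n \<ominus>\<^bsub>A n\<^esub> l)) \<longlonglongrightarrow> 0" for n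
  proof -
    have "\<exists>N. \<forall>m\<ge>N. \<forall>k\<ge>N. cnorm (A n) (x m n \<ominus>\<^bsub>A n\<^esub> x k n) < e" if e: "e > 0" for e
    proof -
      obtain j where j: "(1/2)^j < e / 4" using real_arch_pow_inv[of "e/4" "1/2::real"] e by auto
      have "cnorm (A n) (x m n \<ominus>\<^bsub>A n\<^esub> x k n) < e" if "m \<ge> j" "k \<ge> j" for m k
        using norm_triangle_minus[of "x m n" n "x j n" "x k n"] d'[OF that(1), of n] d'[OF that(2), of n] j
        by (simp add: norm_minus_commute[of "x j n" n "x k n"])
      then show ?thesis by blast
    qed
    then obtain l where "l \<in> carrier (A n)" "(\<lambda>k. cnorm (A n) (x k n \<ominus>\<^bsub>A n\<^esub> l)) \<longlonglongrightarrow> 0"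
      by (rule converges[OF xA])
    then show ?thesis by blast
  qed
  then obtain y where y: "\<And>n. y n \<in> carrier (A n)" "\<And>n. (\<lambda>k. cnorm (A n) (x k n \<ominus>\<^bsub>A n\<^esub> y n)) \<longlonglongrightarrow> 0" by metis
  note [simp] = y(1)
  have xy: "cnorm (A n) (x k n \<ominus>\<^bsub>A n\<^esub> y n) \<le> 2 * (1/2)^k" for n k
  proof (rule LIMSEQ_le_const)
    show "(\<lambda>m. 2 * (1/2)^k + cnorm (A n) (x m n \<ominus>\<^bsub>A n\<^esub> y n)) \<longlonglongrightarrow> 2 * (1/2)^k"
      using tendsto_add[OF tendsto_const y(2)] by simp
    have "cnorm (A n) (x k n \<ominus>\<^bsub>A n\<^esub> y n) \<le> 2 * (1/2)^k + cnorm (A n) (x m n \<ominus>\<^bsub>A n\<^esub> y n)" if "m \<ge> k" for m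
      using norm_triangle_minus[of "x k n" n "x m n" "y n"] d'[OF that, of n]
      by (simp add: norm_minus_commute[of "x k n" n "x m n"])
    then show "\<exists>N. \<forall>m\<ge>N. cnorm (A n) (x k n \<ominus>\<^bsub>A n\<^esub> y n) \<le> 2 * (1/2)^k + cnorm (A n) (x m n \<ominus>\<^bsub>A n\<^esub> y n)"
      by blast
  qed
  obtain K where K: "\<And>n. cnorm (A n) (x 0 n) \<le> K" using x(1)[of 0] by (auto simp: prod_carrier)
  have yP: "y \<in> carrier P"
  proof (rule prodI[of _ "K + 2"])
    fix n
    have "cnorm (A n) (y n) \<le> cnorm (A n) (y n \<ominus>\<^bsub>A n\<^esub> x 0 n) + cnorm (A n) (x 0 n)"
      using norm_triangle_minus[of "y n" n "x 0 n" "\<zero>\<^bsub>A n\<^esub>"] by simp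
    then show "cnorm (A n) (y n) \<le> K + 2" using xy[of n 0] K[of n] by (simp add: norm_minus_commute[of "y n"])
  qed simp
  have ty: "cnorm B (t k \<ominus>\<^bsub>B\<^esub> cls y) \<le> 2 * (1/2)^k" for k
    unfolding x(2)[symmetric] B_minus[OF x(1) yP]
    by (intro norm_class_le prod_closed x(1) yP) (simp add: xy)
  have lB: "cls y \<in> carrier B" using yP by (rule cls_closed)
  have "(\<lambda>n. cnorm B (s n \<ominus>\<^bsub>B\<^esub> cls y)) \<longlonglongrightarrow> 0"
  proof (rule LIMSEQ_I)
    fix e :: real assume e: "e > 0"
    obtain k where k: "(1/2)^k < e / 3" using real_arch_pow_inv[of "e/3" "1/2::real"] e by auto
    have "norm (cnorm B (s n \<ominus>\<^bsub>B\<^esub> cls y) - 0) < e" if n: "n \<ge> N k" for n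
    proof -
      have "cnorm B (s n \<ominus>\<^bsub>B\<^esub> cls y) \<le> cnorm B (s n \<ominus>\<^bsub>B\<^esub> t k) + cnorm B (t k \<ominus>\<^bsub>B\<^esub> cls y)"
        using MB.triangle[OF sB tB lB, of n k] by (simp add: cdist_def sB tB lB)
      moreover have "cnorm B (s n \<ominus>\<^bsub>B\<^esub> t k) < (1/2)^k" unfolding t_def by (rule N[OF n Nle(1)])
      moreover have "0 \<le> cnorm B (s n \<ominus>\<^bsub>B\<^esub> cls y)" using MB.nonneg[of "s n" "cls y"] by (simp add: cdist_def sB lB)
      ultimately show ?thesis using ty[of k] k by simp
    qed
    then show "\<exists>no. \<forall>n\<ge>no. norm (cnorm B (s n \<ominus>\<^bsub>B\<^esub> cls y) - 0) < e" by blast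
  qed
  then show "\<exists>l\<in>carrier B. (\<lambda>n. cnorm B (s n \<ominus>\<^bsub>B\<^esub> l)) \<longlonglongrightarrow> 0" using lB by blast
qed

lemmas B_smult1 = B_smult[where a = a and b = a for a]
  and B_star1 = B_star[where a = a and b = a for a]
  and B_zero1 = B_zero[OF prod_zero prod_zero]

lemma norm_class_le_iff:
  assumes a: "a \<in> carrier P"
  shows "cnorm B (cls a) \<le> K \<longleftrightarrow> (\<forall>L>K. \<forall>\<^sub>F n in sequentially. cnorm (A n) (a n) < L)"
proof
  assume "cnorm B (cls a) \<le> K"
  then show "\<forall>L>K. \<forall>\<^sub>F n in sequentially. cnorm (A n) (a n) < L"
    using norm_class_less[OF a] by (meson le_less_trans)
next
  assume *: "\<forall>L>K. \<forall>\<^sub>F n in sequentially. cnorm (A n) (a n) < L"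
  show "cnorm B (cls a) \<le> K"
  proof (rule field_le_epsilon)
    fix e :: real assume "e > 0"
    then have "\<forall>\<^sub>F n in sequentially. cnorm (A n) (a n) < K + e" using * by simp
    then show "cnorm B (cls a) \<le> K + e" by (intro norm_class_le a) (auto elim: eventually_mono)
  qed
qed

text \<open>Entry norms are eventually below every K above the quotient norm but need not be below
  that norm itself, so products are first estimated with larger K and L.\<close>

lemma le_mult_dense:
  fixes x y z :: real
  assumes "0 \<le> x" "0 \<le> y" "\<And>K L. x < K \<Longrightarrow> y < L \<Longrightarrow> z \<le> K * L"
  shows "z \<le> x * y"
proof (rule LIMSEQ_le_const)
  show "(\<lambda>n. (x + 1 / real (Suc n)) * (y + 1 / real (Suc n))) \<longlonglongrightarrow> x * y"
    using tendsto_mult[OF tendsto_add[OF tendsto_const[of x] LIMSEQ_Suc[OF lim_1_over_n]]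
        tendsto_add[OF tendsto_const[of y] LIMSEQ_Suc[OF lim_1_over_n]]] by simp
  show "\<exists>N. \<forall>n\<ge>N. z \<le> (x + 1 / real (Suc n)) * (y + 1 / real (Suc n))"
    using assms(3) by (intro exI[of _ 0] allI impI) simp
qed

lemma B_cstar: "cstar_algebra B"
proof (intro cstar_algebra.intro[OF B_abelian_group] cstar_algebra_axioms.intro B_complete)
  have scale_le: "cnorm B (cls (\<lambda>n. c \<odot>\<^bsub>A n\<^esub> a n)) \<le> cmod c * cnorm B (cls a)" if a: "a \<in> carrier P" for a c
    unfolding norm_class_le_iff[OF prod_closed(4)[OF a]]
  proof (intro allI impI)
    fix L assume L: "cmod c * cnorm B (cls a) < L"
    show "\<forall>\<^sub>F n in sequentially. cnorm (A n) (c \<odot>\<^bsub>A n\<^esub> a n) < L"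
    proof (cases "c = 0")
      case True
      then show ?thesis using L a by (simp add: prodD norm_smult)
    next
      case False
      then have "cnorm B (cls a) < L / cmod c" using L by (simp add: field_simps)
      then have "\<forall>\<^sub>F n in sequentially. cnorm (A n) (a n) < L / cmod c" by (rule norm_class_less[OF a])
      then show ?thesis
        by eventually_elim (use False a in \<open>simp add: norm_smult prodD field_simps\<close>)
    qed
  qed
  have mult_le: "cnorm B (cls (\<lambda>n. a n \<otimes>\<^bsub>A n\<^esub> b n)) \<le> cnorm B (cls a) * cnorm B (cls b)"
    if a: "a \<in> carrier P" and b: "b \<in> carrier P" for a b
  proof (rule le_mult_dense)
    fix K L assume "cnorm B (cls a) < K" "cnorm B (cls b) < L"
    from norm_class_less[OF a this(1)] norm_class_less[OF b this(2)]
    show "cnorm B (cls (\<lambda>n. a n \<otimes>\<^bsub>A n\<^esub> b n)) \<le> K * L"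
    proof (intro norm_class_le prod_closed a b, eventually_elim)
      case (elim n)
      have "cnorm (A n) (a n \<otimes>\<^bsub>A n\<^esub> b n) \<le> cnorm (A n) (a n) * cnorm (A n) (b n)"
        using a b by (intro norm_mult prodD)
      also have "\<dots> \<le> K * L"
        using elim norm_nonneg[OF prodD[OF a], of n] norm_nonneg[OF prodD[OF b], of n]
        by (intro mult_mono) auto
      finally show ?case .
    qed
  qed (use a b norm_class_nonneg in auto)
  fix X assume "X \<in> carrier B"
  then obtain a where a: "a \<in> carrier P" "X = cls a" by (auto simp: carrier_B)
  note [simp] = prodD[OF a(1)] a(2) prod_closed B_add B_mult B_smult1 B_star1 cls_closed a(1)
  show "c \<odot>\<^bsub>B\<^esub> X \<in> carrier B" "star B X \<in> carrier B" for c by simp_all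
  show "(c + d) \<odot>\<^bsub>B\<^esub> X = c \<odot>\<^bsub>B\<^esub> X \<oplus>\<^bsub>B\<^esub> d \<odot>\<^bsub>B\<^esub> X" for c d by (simp add: smult_l_distr)
  show "(c * d) \<odot>\<^bsub>B\<^esub> X = c \<odot>\<^bsub>B\<^esub> (d \<odot>\<^bsub>B\<^esub> X)" for c d by (simp add: smult_assoc1)
  show "1 \<odot>\<^bsub>B\<^esub> X = X" by (simp add: smult_one)
  show "star B (star B X) = X" by (simp add: star_star)
  show "star B (c \<odot>\<^bsub>B\<^esub> X) = cnj c \<odot>\<^bsub>B\<^esub> star B X" for c by (simp add: star_smult)
  show "0 \<le> cnorm B X" by (simp add: norm_class_nonneg)
  show "cnorm B X = 0 \<longleftrightarrow> X = \<zero>\<^bsub>B\<^esub>"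
  proof -
    interpret MB: Metric_space "carrier B" "cdist B" by (rule B_metric)
    have z: "\<zero>\<^bsub>B\<^esub> \<in> carrier B" by (simp add: B_zero1 prod_zero)
    have "X \<ominus>\<^bsub>B\<^esub> \<zero>\<^bsub>B\<^esub> = X" by (simp add: B_zero1 B_minus prod_zero)
    then show ?thesis using MB.zero[of X "\<zero>\<^bsub>B\<^esub>"] z by (simp add: cdist_def)
  qed
  show "cnorm B (c \<odot>\<^bsub>B\<^esub> X) = cmod c * cnorm B X" for c
  proof (cases "c = 0")
    case True
    then show ?thesis using scale_le[OF a(1), of c] norm_class_nonneg[OF prod_closed(4)[OF a(1)], of c] by simp
  next
    case False
    have "(\<lambda>n. (1 / c) \<odot>\<^bsub>A n\<^esub> (c \<odot>\<^bsub>A n\<^esub> a n)) = a" using False by (simp add: smult_one flip: smult_assoc1)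
    then have "cnorm B (cls a) \<le> cmod (1 / c) * cnorm B (cls (\<lambda>n. c \<odot>\<^bsub>A n\<^esub> a n))"
      using scale_le[of "\<lambda>n. c \<odot>\<^bsub>A n\<^esub> a n" "1 / c"] by simp
    then have "cmod c * cnorm B (cls a) \<le> cnorm B (cls (\<lambda>n. c \<odot>\<^bsub>A n\<^esub> a n))"
      using False by (simp add: norm_divide field_simps)
    then show ?thesis using scale_le[OF a(1), of c] by simp
  qed
  show "cnorm B (star B X \<otimes>\<^bsub>B\<^esub> X) = (cnorm B X)\<^sup>2"
  proof (rule antisym)
    have "cnorm B (cls (\<lambda>n. star (A n) (a n))) \<le> cnorm B (cls a)"
      by (subst norm_class_le_iff) (auto intro: norm_class_less)
    then show "cnorm B (star B X \<otimes>\<^bsub>B\<^esub> X) \<le> (cnorm B X)\<^sup>2"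
      using mult_le[of "\<lambda>n. star (A n) (a n)" a] mult_right_mono[OF _ norm_class_nonneg[OF a(1)]]
      by (fastforce simp: power2_eq_square)
    let ?N = "cnorm B (cls (\<lambda>n. star (A n) (a n) \<otimes>\<^bsub>A n\<^esub> a n))"
    have N: "0 \<le> ?N" by (intro norm_class_nonneg) simp
    have "cnorm B (cls a) \<le> sqrt ?N"
      unfolding norm_class_le_iff[OF a(1)]
    proof (intro allI impI)
      fix L assume L: "sqrt ?N < L"
      then have L0: "0 \<le> L" using N by (meson less_imp_le order_trans real_sqrt_ge_zero)
      have "?N < L\<^sup>2" using L N by (metis real_sqrt_less_iff real_sqrt_unique L0 real_sqrt_pow2 power2_less_imp_less real_less_lsqrt sqrt_le_D not_le)
      then have "\<forall>\<^sub>F n in sequentially. cnorm (A n) (star (A n) (a n) \<otimes>\<^bsub>A n\<^esub> a n) < L\<^sup>2"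
        by (intro norm_class_less) simp_all
      then show "\<forall>\<^sub>F n in sequentially. cnorm (A n) (a n) < L"
        by (auto elim!: eventually_mono simp: cstar_identity intro: power2_less_imp_less[OF _ L0])
    qed
    then have "(cnorm B (cls a))\<^sup>2 \<le> (sqrt ?N)\<^sup>2" by (intro power_mono norm_class_nonneg a(1))
    then show "(cnorm B X)\<^sup>2 \<le> cnorm B (star B X \<otimes>\<^bsub>B\<^esub> X)" using N by simp
  qed
  fix Y assume "Y \<in> carrier B"
  then obtain b where b: "b \<in> carrier P" "Y = cls b" by (auto simp: carrier_B)
  note [simp] = prodD[OF b(1)] b(2) b(1)
  show "c \<odot>\<^bsub>B\<^esub> (X \<oplus>\<^bsub>B\<^esub> Y) = c \<odot>\<^bsub>B\<^esub> X \<oplus>\<^bsub>B\<^esub> c \<odot>\<^bsub>B\<^esub> Y" for c by (simp add: smult_r_distr)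
  show "X \<otimes>\<^bsub>B\<^esub> Y \<in> carrier B" by simp
  show "c \<odot>\<^bsub>B\<^esub> X \<otimes>\<^bsub>B\<^esub> Y = c \<odot>\<^bsub>B\<^esub> (X \<otimes>\<^bsub>B\<^esub> Y)" for c by (simp add: smult_mult_l)
  show "X \<otimes>\<^bsub>B\<^esub> (c \<odot>\<^bsub>B\<^esub> Y) = c \<odot>\<^bsub>B\<^esub> (X \<otimes>\<^bsub>B\<^esub> Y)" for c by (simp add: smult_mult_r)
  show "star B (X \<oplus>\<^bsub>B\<^esub> Y) = star B X \<oplus>\<^bsub>B\<^esub> star B Y" by (simp add: star_add)
  show "star B (X \<otimes>\<^bsub>B\<^esub> Y) = star B Y \<otimes>\<^bsub>B\<^esub> star B X" by (simp add: star_mult)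
  show "cnorm B (X \<oplus>\<^bsub>B\<^esub> Y) \<le> cnorm B X + cnorm B Y" by (simp add: B_norm_triangle)
  show "cnorm B (X \<otimes>\<^bsub>B\<^esub> Y) \<le> cnorm B X * cnorm B Y" by (simp add: mult_le)
  fix Z assume "Z \<in> carrier B"
  then obtain c where c: "c \<in> carrier P" "Z = cls c" by (auto simp: carrier_B)
  note [simp] = prodD[OF c(1)] c(2) c(1)
  show "X \<otimes>\<^bsub>B\<^esub> Y \<otimes>\<^bsub>B\<^esub> Z = X \<otimes>\<^bsub>B\<^esub> (Y \<otimes>\<^bsub>B\<^esub> Z)" by (simp add: m_assoc)
  show "(X \<oplus>\<^bsub>B\<^esub> Y) \<otimes>\<^bsub>B\<^esub> Z = X \<otimes>\<^bsub>B\<^esub> Z \<oplus>\<^bsub>B\<^esub> Y \<otimes>\<^bsub>B\<^esub> Z" by (simp add: l_distr)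
  show "Z \<otimes>\<^bsub>B\<^esub> (X \<oplus>\<^bsub>B\<^esub> Y) = Z \<otimes>\<^bsub>B\<^esub> X \<oplus>\<^bsub>B\<^esub> Z \<otimes>\<^bsub>B\<^esub> Y" by (simp add: r_distr)
qed

end

subsection \<open>Matrices over the sequence algebra\<close>

context cstar_seq
begin

abbreviation "MA r \<equiv> (\<lambda>n. mat_alg r (A n))"
abbreviation "MB r \<equiv> mat_alg r B"

lemma MA: "cstar_seq (MA r)"
  by (rule cstar_seq.intro) (rule mat_alg_cstar[OF A])

text \<open>The identification of matrices over \<open>A_inf A\<close> with classes of sequences of
  matrices. It is kept as a relation since representing sequences are not unique.\<close>

definition rep :: "nat \<Rightarrow> (nat \<Rightarrow> nat \<times> nat \<Rightarrow> 'a) \<Rightarrow> (nat \<times> nat \<Rightarrow> (nat \<Rightarrow> 'a) set) \<Rightarrow> bool" where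
  "rep r x X \<longleftrightarrow> X \<in> mats r (carrier B) \<and> (\<forall>n. x n \<in> mats r (carrier (A n))) \<and>
     (\<forall>i<r. \<forall>j<r. (\<lambda>n. x n (i, j)) \<in> carrier P \<and> X (i, j) = cls (\<lambda>n. x n (i, j)))"

lemma repD:
  assumes "rep r x X"
  shows "X \<in> mats r (carrier B)" "x n \<in> mats r (carrier (A n))"
    "i < r \<Longrightarrow> j < r \<Longrightarrow> (\<lambda>n. x n (i, j)) \<in> carrier P" "i < r \<Longrightarrow> j < r \<Longrightarrow> X (i, j) = cls (\<lambda>n. x n (i, j))"
  using assms by (auto simp: rep_def)

lemma rep_exists:
  assumes X: "X \<in> mats r (carrier B)" obtains x where "rep r x X"
proof -
  have "\<exists>a. p \<in> idx r \<longrightarrow> a \<in> carrier P \<and> X p = cls a" for p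
    using mats_entry[OF X, of "fst p" "snd p"] unfolding carrier_B by (cases p) auto
  then obtain a where a: "\<And>p. p \<in> idx r \<Longrightarrow> a p \<in> carrier P \<and> X p = cls (a p)" by metis
  define x where "x n = (\<lambda>p\<in>idx r. a p n)" for n
  have "rep r x X"
    using X a by (auto simp: rep_def x_def mats_iff prodD)
  then show thesis using that by blast
qed

lemma rep_prod: assumes "rep r x X" shows "x \<in> carrier (prod_alg (MA r))"
proof -
  interpret M: cstar_seq "MA r" by (rule MA)
  have "\<exists>K. \<forall>n. cnorm (A n) (x n p) \<le> K" if "p \<in> idx r" for p
    using that repD(3)[OF assms] by (cases p) (auto simp: prod_carrier)
  then obtain K where K: "\<And>p n. p \<in> idx r \<Longrightarrow> cnorm (A n) (x n p) \<le> K p" by metis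
  show ?thesis
  proof (rule M.prodI)
    show "x n \<in> carrier (MA r n)" for n using repD(2)[OF assms] by simp
    show "cnorm (MA r n) (x n) \<le> (\<Sum>p\<in>idx r. K p)" for n
      by (rule order_trans[OF mat_norm_bounds(2)[OF A repD(2)[OF assms]] sum_mono]) (rule K)
  qed
qed

lemma prod_rep:
  assumes x: "x \<in> carrier (prod_alg (MA r))"
  shows "rep r x (\<lambda>p\<in>idx r. cls (\<lambda>n. x n p))"
proof -
  interpret M: cstar_seq "MA r" by (rule MA)
  have xm: "x n \<in> mats r (carrier (A n))" for n using M.prodD[OF x, of n] by simp
  obtain K where K: "\<And>n. cnorm (MA r n) (x n) \<le> K" using x by (auto simp: M.prod_carrier)
  have "(\<lambda>n. x n (i, j)) \<in> carrier P" if "i < r" "j < r" for i j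
    by (rule prodI[of _ K]) (use that mats_entry[OF xm] mat_norm_bounds(1)[OF A xm] K order_trans in blast)+
  then show ?thesis using xm by (auto simp: rep_def mats_iff cls_closed)
qed

lemma cls_finsum:
  assumes "finite I" "\<And>k. k \<in> I \<Longrightarrow> a k \<in> carrier P"
  shows "(\<lambda>n. \<Oplus>\<^bsub>A n\<^esub>k\<in>I. a k n) \<in> carrier P \<and> (\<Oplus>\<^bsub>B\<^esub>k\<in>I. cls (a k)) = cls (\<lambda>n. \<Oplus>\<^bsub>A n\<^esub>k\<in>I. a k n)"
  using assms
proof (induction I rule: finite_induct)
  case empty
  interpret B: cstar_algebra B by (rule B_cstar)
  show ?case by (simp add: prod_zero B_zero1)
next
  case (insert k I)
  interpret B: cstar_algebra B by (rule B_cstar)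
  have "(\<Oplus>\<^bsub>A n\<^esub>k\<in>insert k I. a k n) = a k n \<oplus>\<^bsub>A n\<^esub> (\<Oplus>\<^bsub>A n\<^esub>k\<in>I. a k n)" for n
    using insert by (intro finsum_insert) (auto simp: prodD)
  moreover have "(\<Oplus>\<^bsub>B\<^esub>k\<in>insert k I. cls (a k)) = cls (a k) \<oplus>\<^bsub>B\<^esub> (\<Oplus>\<^bsub>B\<^esub>k\<in>I. cls (a k))"
    using insert by (intro B.finsum_insert) (auto simp: cls_closed)
  ultimately show ?case using insert by (simp add: prod_closed B_add)
qed

lemma rep_ops:
  assumes x: "rep r x X" and y: "rep r y Y"
  shows rep_add: "rep r (\<lambda>n. x n \<oplus>\<^bsub>MA r n\<^esub> y n) (X \<oplus>\<^bsub>MB r\<^esub> Y)"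
    and rep_mult: "rep r (\<lambda>n. x n \<otimes>\<^bsub>MA r n\<^esub> y n) (X \<otimes>\<^bsub>MB r\<^esub> Y)"
    and rep_smult: "rep r (\<lambda>n. c \<odot>\<^bsub>MA r n\<^esub> x n) (c \<odot>\<^bsub>MB r\<^esub> X)"
    and rep_star: "rep r (\<lambda>n. star (MA r n) (x n)) (star (MB r) X)"
proof -
  note D = repD[OF x] repD[OF y]
  note C = mat_alg_closed[OF B_cstar] mat_alg_closed[OF A]
  show "rep r (\<lambda>n. x n \<oplus>\<^bsub>MA r n\<^esub> y n) (X \<oplus>\<^bsub>MB r\<^esub> Y)"
    unfolding rep_def using D by (auto simp: C mat_alg_entry B_add prod_closed)
  show "rep r (\<lambda>n. c \<odot>\<^bsub>MA r n\<^esub> x n) (c \<odot>\<^bsub>MB r\<^esub> X)"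
    unfolding rep_def using D by (auto simp: C mat_alg_entry B_smult1 prod_closed)
  show "rep r (\<lambda>n. star (MA r n) (x n)) (star (MB r) X)"
    unfolding rep_def using D by (auto simp: C mat_alg_entry B_star1 prod_closed)
  show "rep r (\<lambda>n. x n \<otimes>\<^bsub>MA r n\<^esub> y n) (X \<otimes>\<^bsub>MB r\<^esub> Y)"
    unfolding rep_def
  proof (intro conjI allI impI)
    fix i j assume ij: "i < r" "j < r"
    have P: "(\<lambda>n. x n (i, k) \<otimes>\<^bsub>A n\<^esub> y n (k, j)) \<in> carrier P" if "k < r" for k
      using ij that by (intro prod_closed D)
    have f: "(\<Oplus>\<^bsub>B\<^esub>k\<in>{..<r}. X (i, k) \<otimes>\<^bsub>B\<^esub> Y (k, j)) = (\<Oplus>\<^bsub>B\<^esub>k\<in>{..<r}. cls (\<lambda>n. x n (i, k) \<otimes>\<^bsub>A n\<^esub> y n (k, j)))"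
    proof -
      interpret B: cstar_algebra B by (rule B_cstar)
      show ?thesis using ij P by (intro B.finsum_cong') (auto simp: D B_mult cls_closed)
    qed
    note cf = cls_finsum[of "{..<r}" "\<lambda>k n. x n (i, k) \<otimes>\<^bsub>A n\<^esub> y n (k, j)"]
    show "(\<lambda>n. (x n \<otimes>\<^bsub>MA r n\<^esub> y n) (i, j)) \<in> carrier P"
      using cf P ij by (simp add: mat_alg_entry)
    show "(X \<otimes>\<^bsub>MB r\<^esub> Y) (i, j) = cls (\<lambda>n. (x n \<otimes>\<^bsub>MA r n\<^esub> y n) (i, j))"
      using cf P ij by (simp add: mat_alg_entry f)
  qed (auto simp: C D)
qed

lemmas rep_smult1 = rep_smult[where x = x and X = X and y = x and Y = X for x X]
  and rep_star1 = rep_star[where x = x and X = X and y = x and Y = X for x X]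

lemma rep_eqv:
  assumes x: "rep r x X" and y: "rep r y X"
  shows "cstar_seq.eqv (MA r) x y"
proof -
  interpret M: cstar_seq "MA r" by (rule MA)
  have e: "eqv (\<lambda>n. x n (i, j)) (\<lambda>n. y n (i, j))" if "i < r" "j < r" for i j
    using repD(3,4)[OF x that] repD(3,4)[OF y that] by (metis cls_eq_iff)
  have lim: "(\<lambda>n. \<Sum>p\<in>idx r. norm (J (A n) (x n p) - J (A n) (y n p))) \<longlonglongrightarrow> 0"
    using e by (intro tendsto_null_sum tendsto_norm_zero) (auto simp: idx_def eqv_def)
  have "cnorm (MA r n) (x n \<ominus>\<^bsub>MA r n\<^esub> y n) \<le> (\<Sum>p\<in>idx r. norm (J (A n) (x n p) - J (A n) (y n p)))" for n
  proof -
    have xy: "x n \<in> mats r (carrier (A n))" "y n \<in> mats r (carrier (A n))" using repD x y by blast+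
    have "cnorm (MA r n) (x n \<ominus>\<^bsub>MA r n\<^esub> y n) \<le> (\<Sum>p\<in>idx r. cnorm (A n) ((x n \<ominus>\<^bsub>MA r n\<^esub> y n) p))"
      by (intro mat_norm_bounds[OF A] mat_alg_minus[OF A] xy)
    also have "\<dots> = (\<Sum>p\<in>idx r. norm (J (A n) (x n p) - J (A n) (y n p)))"
      using mats_entry[OF xy(1)] mats_entry[OF xy(2)]
      by (intro sum.cong) (auto simp: idx_def mat_alg_minus[OF A xy] norm_J[OF A] simp flip: J_minus[OF A])
    finally show ?thesis .
  qed
  then have "(\<lambda>n. cnorm (MA r n) (x n \<ominus>\<^bsub>MA r n\<^esub> y n)) \<longlonglongrightarrow> 0"
    by (intro tendsto_sandwich[OF _ _ tendsto_const lim])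
      (use repD(2)[OF x] repD(2)[OF y] in \<open>auto intro!: always_eventually M.norm_nonneg simp: mat_alg_minus[OF A]\<close>)
  then show ?thesis using M.eqv_iff rep_prod x y by blast
qed

lemma eqv_rep:
  assumes x: "rep r x X" and y: "rep r y Y" and e: "cstar_seq.eqv (MA r) x y"
  shows "X = Y"
proof (rule mats_eqI)
  interpret M: cstar_seq "MA r" by (rule MA)
  show "X \<in> mats r (carrier B)" "Y \<in> mats r (carrier B)" using repD x y by auto
  fix i j assume ij: "i < r" "j < r"
  have lim: "(\<lambda>n. cnorm (MA r n) (x n \<ominus>\<^bsub>MA r n\<^esub> y n)) \<longlonglongrightarrow> 0"
    using e M.eqv_iff rep_prod x y by blast
  have "cnorm (A n) (x n (i, j) \<ominus>\<^bsub>A n\<^esub> y n (i, j)) \<le> cnorm (MA r n) (x n \<ominus>\<^bsub>MA r n\<^esub> y n)" for n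
    using mat_norm_bounds(1)[OF A mat_alg_minus(1)[OF A repD(2)[OF x] repD(2)[OF y]] ij] ij
    by (simp add: mat_alg_minus(2)[OF A repD(2)[OF x] repD(2)[OF y]])
  then have "(\<lambda>n. cnorm (A n) (x n (i, j) \<ominus>\<^bsub>A n\<^esub> y n (i, j))) \<longlonglongrightarrow> 0"
    by (intro tendsto_sandwich[OF _ _ tendsto_const lim])
      (use mats_entry[OF repD(2)[OF x] ij] mats_entry[OF repD(2)[OF y] ij] in \<open>auto intro!: always_eventually norm_nonneg\<close>)
  then show "X (i, j) = Y (i, j)"
    using repD(3,4)[OF x ij] repD(3,4)[OF y ij] by (simp add: cls_eq_iff eqv_iff)
qed

text \<open>Passing from a matrix of classes to the class of a representing sequence, and back,
  gives the *-homomorphisms \<Phi> and \<Psi>, both contractive. Hence the norm chosen for matrices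
  over \<open>A_inf A\<close> is a limit superior of matrix norms.\<close>

lemma rep_norm:
  assumes x: "rep r x X"
  shows "cnorm (MB r) X = cnorm (A_inf (MA r)) (seq_class (MA r) x)"
proof -
  interpret M: cstar_seq "MA r" by (rule MA)
  define \<Phi> where "\<Phi> X = M.cls (SOME x. rep r x X)" for X
  define \<Psi> where "\<Psi> Y = (SOME X. \<exists>x. rep r x X \<and> Y = M.cls x)" for Y
  have \<Phi>: "\<Phi> X = M.cls x" if "rep r x X" for x X
  proof -
    have s: "rep r (SOME x. rep r x X) X" using someI[of "\<lambda>x. rep r x X" x] that by blast
    show ?thesis unfolding \<Phi>_def
      using M.cls_eq_iff[OF rep_prod[OF s] rep_prod[OF that]] rep_eqv[OF s that] by simp
  qed
  have \<Psi>: "\<Psi> (M.cls x) = X" if "rep r x X" for x X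
    unfolding \<Psi>_def
  proof (rule some_equality)
    fix Y assume "\<exists>y. rep r y Y \<and> M.cls x = M.cls y"
    then obtain y where y: "rep r y Y" "M.cls x = M.cls y" by blast
    then show "Y = X" using M.cls_eq_iff[OF rep_prod[OF that] rep_prod[OF y(1)]] eqv_rep[OF that y(1)] by simp
  qed (use that in blast)
  have ex: "\<exists>x X. rep r x X \<and> Y = M.cls x" if "Y \<in> carrier M.B" for Y
    using that prod_rep by (auto simp: M.carrier_B)
  have ops: "M.cls x \<oplus>\<^bsub>M.B\<^esub> M.cls y = M.cls (\<lambda>n. x n \<oplus>\<^bsub>MA r n\<^esub> y n)"
    "M.cls x \<otimes>\<^bsub>M.B\<^esub> M.cls y = M.cls (\<lambda>n. x n \<otimes>\<^bsub>MA r n\<^esub> y n)"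
    "c \<odot>\<^bsub>M.B\<^esub> M.cls x = M.cls (\<lambda>n. c \<odot>\<^bsub>MA r n\<^esub> x n)"
    "star M.B (M.cls x) = M.cls (\<lambda>n. star (MA r n) (x n))" if "rep r x X" "rep r y Y" for x X y Y c
    using rep_prod[OF that(1)] rep_prod[OF that(2)] by (rule M.B_ops)+
  show ?thesis
  proof (rule antisym)
    have "cnorm (MB r) (\<Psi> (M.cls x)) \<le> cnorm M.B (M.cls x)"
    proof (rule star_hom_contractive[OF M.B_cstar mat_alg_cstar[OF B_cstar]])
      show "M.cls x \<in> carrier M.B" using rep_prod[OF x] by (rule M.cls_closed)
      fix Y c assume "Y \<in> carrier M.B"
      then obtain y Y' where y: "rep r y Y'" "Y = M.cls y" using ex by blast
      show "\<Psi> Y \<in> carrier (MB r)" using y by (simp add: \<Psi>[OF y(1)] repD)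
      show "\<Psi> (c \<odot>\<^bsub>M.B\<^esub> Y) = c \<odot>\<^bsub>MB r\<^esub> \<Psi> Y"
        unfolding y(2) ops(3)[OF y(1) y(1)] \<Psi>[OF y(1)] by (rule \<Psi>[OF rep_smult1[OF y(1) y(1)]])
      show "\<Psi> (star M.B Y) = star (MB r) (\<Psi> Y)"
        unfolding y(2) ops(4)[OF y(1) y(1)] \<Psi>[OF y(1)] by (rule \<Psi>[OF rep_star1[OF y(1) y(1)]])
      fix Z assume "Z \<in> carrier M.B"
      then obtain z Z' where z: "rep r z Z'" "Z = M.cls z" using ex by blast
      show "\<Psi> (Y \<oplus>\<^bsub>M.B\<^esub> Z) = \<Psi> Y \<oplus>\<^bsub>MB r\<^esub> \<Psi> Z"
        unfolding y(2) z(2) ops(1)[OF y(1) z(1)] \<Psi>[OF y(1)] \<Psi>[OF z(1)] by (rule \<Psi>[OF rep_add[OF y(1) z(1)]])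
      show "\<Psi> (Y \<otimes>\<^bsub>M.B\<^esub> Z) = \<Psi> Y \<otimes>\<^bsub>MB r\<^esub> \<Psi> Z"
        unfolding y(2) z(2) ops(2)[OF y(1) z(1)] \<Psi>[OF y(1)] \<Psi>[OF z(1)] by (rule \<Psi>[OF rep_mult[OF y(1) z(1)]])
    qed
    then show "cnorm (MB r) X \<le> cnorm M.B (M.cls x)" by (simp add: \<Psi>[OF x])
    have "cnorm M.B (\<Phi> X) \<le> cnorm (MB r) X"
    proof (rule star_hom_contractive[OF mat_alg_cstar[OF B_cstar] M.B_cstar])
      show "X \<in> carrier (MB r)" using repD[OF x] by simp
      fix Y c assume "Y \<in> carrier (MB r)"
      then obtain y where y: "rep r y Y" using rep_exists by auto
      show "\<Phi> Y \<in> carrier M.B" unfolding \<Phi>[OF y] using rep_prod[OF y] by (rule M.cls_closed)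
      show "\<Phi> (c \<odot>\<^bsub>MB r\<^esub> Y) = c \<odot>\<^bsub>M.B\<^esub> \<Phi> Y"
        unfolding \<Phi>[OF y] ops(3)[OF y y] by (rule \<Phi>[OF rep_smult1[OF y y]])
      show "\<Phi> (star (MB r) Y) = star M.B (\<Phi> Y)"
        unfolding \<Phi>[OF y] ops(4)[OF y y] by (rule \<Phi>[OF rep_star1[OF y y]])
      fix Z assume "Z \<in> carrier (MB r)"
      then obtain z where z: "rep r z Z" using rep_exists by auto
      show "\<Phi> (Y \<oplus>\<^bsub>MB r\<^esub> Z) = \<Phi> Y \<oplus>\<^bsub>M.B\<^esub> \<Phi> Z"
        unfolding \<Phi>[OF y] \<Phi>[OF z] ops(1)[OF y z] by (rule \<Phi>[OF rep_add[OF y z]])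
      show "\<Phi> (Y \<otimes>\<^bsub>MB r\<^esub> Z) = \<Phi> Y \<otimes>\<^bsub>M.B\<^esub> \<Phi> Z"
        unfolding \<Phi>[OF y] \<Phi>[OF z] ops(2)[OF y z] by (rule \<Phi>[OF rep_mult[OF y z]])
    qed
    then show "cnorm M.B (M.cls x) \<le> cnorm (MB r) X" by (simp add: \<Phi>[OF x])
  qed
qed

lemma rep_norm_le:
  assumes "rep r x X" "\<forall>\<^sub>F n in sequentially. cnorm (MA r n) (x n) \<le> K"
  shows "cnorm (MB r) X \<le> K"
  unfolding rep_norm[OF assms(1)] using cstar_seq.norm_class_le[OF MA rep_prod[OF assms(1)]] assms(2) by simp

lemma rep_norm_less:
  assumes "rep r x X" "cnorm (MB r) X < K"
  shows "\<forall>\<^sub>F n in sequentially. cnorm (MA r n) (x n) < K"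
  using assms(2) unfolding rep_norm[OF assms(1)]
  by (rule cstar_seq.norm_class_less[OF MA rep_prod[OF assms(1)]])

end

section \<open>The limit of an encoding system\<close>

lemma selfadjoint_subspace_carrier: "cstar_algebra A \<Longrightarrow> selfadjoint_subspace A (carrier A)"
proof -
  assume "cstar_algebra A"
  then interpret cstar_algebra A .
  show ?thesis by (simp add: selfadjoint_subspace_def)
qed

lemma amplify_id: "x \<in> mats r X \<Longrightarrow> amplify r (\<lambda>x. x) x = x"
  by (auto simp: amplify_def mats_def PiE_def extensional_def fun_eq_iff)

lemma amplify_comp: "amplify r (\<psi> \<circ> \<phi>) x = amplify r \<psi> (amplify r \<phi> x)"
  by (auto simp: amplify_def fun_eq_iff)

lemma cpc_id: fixes A :: "'a cstar" assumes "cstar_algebra A" shows "cpc A A id"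
proof -
  have "positive (mat_alg r A) (amplify r id x)" if "x \<in> mats r (carrier A)" "positive (mat_alg r A) x" for r x
    using amplify_id[OF that(1)] that(2) by (simp add: id_def)
  then show ?thesis using assms selfadjoint_subspace_carrier[OF assms]
    by (simp add: cpc_def completely_positive_def star_linear_def)
qed

lemma cpc_comp: fixes A :: "'a cstar" and B :: "'b cstar" and C :: "'c cstar" assumes "cpc A B \<phi>" "cpc B C \<psi>" shows "cpc A C (\<psi> \<circ> \<phi>)"
proof -
  interpret p: cpc_map A B \<phi> by unfold_locales (rule assms)
  interpret q: cpc_map B C \<psi> by unfold_locales (rule assms)
  have "positive (mat_alg r C) (amplify r (\<psi> \<circ> \<phi>) x)" if "1 \<le> r" "positive (mat_alg r A) x" for r x
    unfolding amplify_comp using that by (intro q.map_pos p.map_pos)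
  moreover have "cnorm C (\<psi> (\<phi> x)) \<le> cnorm A x" if "x \<in> carrier A" for x
    using q.map_norm[of "\<phi> x"] p.map_norm[of x] that by simp
  ultimately show ?thesis
    using selfadjoint_subspace_carrier[OF p.A] selfadjoint_subspace_carrier[OF q.B] p.A q.B
    by (simp add: cpc_def completely_positive_def star_linear_def
        p.map_add q.map_add p.map_smult q.map_smult p.map_star q.map_star)
qed

lemma norm_diff_triangle3:
  fixes p q :: "'a::real_normed_vector"
  shows "norm (p - q) \<le> norm (p - p') + norm (p' - q') + norm (q - q')"
  using norm_triangle_ineq4[of "(p - p') + (p' - q')" "q - q'"] norm_triangle_ineq[of "p - p'" "p' - q'"]
  by simp

section \<open>Connecting maps, limit maps and the subspace \<open>L\<close>\<close>

locale encoding =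
  fixes A :: "nat \<Rightarrow> 'a cstar" and \<rho> :: "nat \<Rightarrow> 'a \<Rightarrow> 'a"
  assumes enc: "cstar_encoding A \<rho>"
begin

sublocale cstar_seq A
  using enc by (intro cstar_seq.intro) (simp add: cstar_encoding_def cpc_system_def)

sublocale B: cstar_algebra B by (rule B_cstar)

abbreviation "tm \<equiv> trans_map \<rho>"
abbreviation "R \<equiv> limit_map A \<rho>"
abbreviation "L \<equiv> system_limit A \<rho>"
abbreviation "JB \<equiv> J B"

lemma tm_same [simp]: "tm n n = id"
  by (cases n) auto

lemma tm_Suc: "n \<le> m \<Longrightarrow> tm (Suc m) n = \<rho> m \<circ> tm m n"
  by simp

lemma tm_cpc: "n \<le> m \<Longrightarrow> cpc (A n) (A m) (tm m n)"
proof (induction m rule: dec_induct)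
  case base
  show ?case unfolding tm_same by (rule cpc_id[OF A])
next
  case (step m)
  have "cpc (A m) (A (Suc m)) (\<rho> m)" using enc by (simp add: cstar_encoding_def cpc_system_def)
  then show ?case using cpc_comp[OF step.IH] step.hyps(1) by (simp only: tm_Suc)
qed

lemma tm_map: "n \<le> m \<Longrightarrow> cpc_map (A n) (A m) (tm m n)"
  by unfold_locales (rule tm_cpc)

lemma tm_tm:
  assumes "n \<le> k" "k \<le> m" shows "tm m k (tm k n x) = tm m n x"
  using assms(2)
proof (induction m rule: dec_induct)
  case (step m)
  then show ?case using tm_Suc[of k m] tm_Suc[of n m] assms(1) by simp
qed simp

lemmas tm_closed = cpc_map.map_closed[OF tm_map]
  and tm_norm = cpc_map.map_norm[OF tm_map]
  and tm_add = cpc_map.map_add[OF tm_map]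
  and tm_minus = cpc_map.map_minus[OF tm_map]
  and tm_smult = cpc_map.map_smult[OF tm_map]
  and tm_star = cpc_map.map_star[OF tm_map]

text \<open>Differs from the representative in \<open>limit_map\<close> only at m = n, where the
  entry is x instead of 0; so the entry is the image of x from stage n on.\<close>

definition sq :: "nat \<Rightarrow> 'a \<Rightarrow> nat \<Rightarrow> 'a" where
  "sq n x = (\<lambda>m. if m \<ge> n then tm m n x else \<zero>\<^bsub>A m\<^esub>)"

lemma sq_P: "x \<in> carrier (A n) \<Longrightarrow> sq n x \<in> carrier P"
  by (rule prodI[of _ "cnorm (A n) x"]) (auto simp: sq_def tm_closed tm_norm norm_nonneg)

lemma eqv_eventually: "\<forall>\<^sub>F n in sequentially. a n = b n \<Longrightarrow> eqv a b"
  unfolding eqv_def by (rule tendsto_eventually) (auto elim: eventually_mono)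

lemma R_cls: assumes x: "x \<in> carrier (A n)" shows "R n x = cls (sq n x)"
proof -
  let ?s = "\<lambda>m. if m > n then tm m n x else \<zero>\<^bsub>A m\<^esub>"
  have s: "?s \<in> carrier P"
    by (rule prodI[of _ "cnorm (A n) x"]) (auto simp: x tm_closed tm_norm norm_nonneg)
  have "eqv ?s (sq n x)"
    by (rule eqv_eventually, rule eventually_mono[OF eventually_gt_at_top[of n]]) (auto simp: sq_def)
  then show ?thesis using s sq_P[OF x] by (simp add: limit_map_def cls_eq_iff)
qed

lemma R_closed [simp]: "x \<in> carrier (A n) \<Longrightarrow> R n x \<in> carrier B"
  by (simp add: R_cls sq_P cls_closed)

lemma R_norm: assumes x: "x \<in> carrier (A n)" shows "cnorm B (R n x) \<le> cnorm (A n) x"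
  unfolding R_cls[OF x] by (intro norm_class_le sq_P x) (auto simp: sq_def x tm_norm norm_nonneg)

lemma R_tm: assumes x: "x \<in> carrier (A n)" and "n \<le> m" shows "R m (tm m n x) = R n x"
proof -
  have "eqv (sq m (tm m n x)) (sq n x)"
    by (rule eqv_eventually) (use assms in \<open>auto simp: sq_def tm_tm eventually_sequentially intro!: exI[of _ m]\<close>)
  then show ?thesis using assms by (simp add: R_cls tm_closed sq_P cls_eq_iff)
qed

lemma R_add: "x \<in> carrier (A n) \<Longrightarrow> y \<in> carrier (A n) \<Longrightarrow> R n (x \<oplus>\<^bsub>A n\<^esub> y) = R n x \<oplus>\<^bsub>B\<^esub> R n y"
  by (simp add: R_cls sq_P B_add) (rule arg_cong[of _ _ cls], auto simp: sq_def tm_add)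

lemma R_smult: "x \<in> carrier (A n) \<Longrightarrow> R n (c \<odot>\<^bsub>A n\<^esub> x) = c \<odot>\<^bsub>B\<^esub> R n x"
  by (simp add: R_cls sq_P B_smult1) (rule arg_cong[of _ _ cls], auto simp: sq_def tm_smult)

lemma R_star: "x \<in> carrier (A n) \<Longrightarrow> R n (star (A n) x) = star B (R n x)"
  by (simp add: R_cls sq_P B_star1) (rule arg_cong[of _ _ cls], auto simp: sq_def tm_star)

lemma R_minus: "x \<in> carrier (A n) \<Longrightarrow> y \<in> carrier (A n) \<Longrightarrow> R n (x \<ominus>\<^bsub>A n\<^esub> y) = R n x \<ominus>\<^bsub>B\<^esub> R n y"
  by (simp add: minus_smult R_add R_smult B.minus_smult)

lemma R_zero: "R n \<zero>\<^bsub>A n\<^esub> = \<zero>\<^bsub>B\<^esub>"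
  using R_smult[of "\<zero>\<^bsub>A n\<^esub>" n 0] by simp

lemma JR_minus: "x \<in> carrier (A n) \<Longrightarrow> y \<in> carrier (A n) \<Longrightarrow> JB (R n (x \<ominus>\<^bsub>A n\<^esub> y)) = JB (R n x) - JB (R n y)"
  by (simp add: R_minus J_minus[OF B_cstar])

lemma JR_norm: "x \<in> carrier (A n) \<Longrightarrow> norm (JB (R n x)) \<le> cnorm (A n) x"
  by (simp add: norm_J[OF B_cstar] R_norm)

lemma L_iff: "X \<in> L \<longleftrightarrow> X \<in> carrier B \<and> (\<forall>\<epsilon>>0. \<exists>k. \<exists>x\<in>carrier (A k). cnorm B (X \<ominus>\<^bsub>B\<^esub> R k x) < \<epsilon>)"
proof -
  interpret M: Metric_space "carrier B" "cdist B" by (rule B_metric)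
  have "X \<in> L \<longleftrightarrow> X \<in> carrier B \<and> (\<forall>\<epsilon>>0. \<exists>k. \<exists>x\<in>carrier (A k). R k x \<in> M.mball X \<epsilon>)"
    unfolding system_limit_def ctopology_def M.metric_closure_of by blast
  also have "\<dots> \<longleftrightarrow> X \<in> carrier B \<and> (\<forall>\<epsilon>>0. \<exists>k. \<exists>x\<in>carrier (A k). cnorm B (X \<ominus>\<^bsub>B\<^esub> R k x) < \<epsilon>)"
    by (cases "X \<in> carrier B") (simp_all add: cdist_def cong: bex_cong)
  finally show ?thesis .
qed

lemma L_carrier: "X \<in> L \<Longrightarrow> X \<in> carrier B" by (simp add: L_iff)

lemma R_L: "x \<in> carrier (A k) \<Longrightarrow> R k x \<in> L"
  unfolding L_iff using B.norm_minus_eq_zero[OF R_closed R_closed, THEN iffD2, OF _ _ refl]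
  by (auto intro!: exI[of _ k] bexI[of _ x])

lemma L_closed:
  assumes "\<And>n. X n \<in> L" "Y \<in> carrier B" "(\<lambda>n. JB (X n)) \<longlonglongrightarrow> JB Y" shows "Y \<in> L"
  unfolding L_iff
proof (intro conjI allI impI assms)
  fix \<epsilon> :: real assume e: "\<epsilon> > 0"
  have XB: "X n \<in> carrier B" for n using assms(1) L_carrier by blast
  have lim: "(\<lambda>n. cnorm B (X n \<ominus>\<^bsub>B\<^esub> Y)) \<longlonglongrightarrow> 0"
    using tendsto_J[OF B_cstar, of X Y] XB assms by simp
  have "\<forall>\<^sub>F n in sequentially. cnorm B (X n \<ominus>\<^bsub>B\<^esub> Y) < \<epsilon> / 2"
    using e by (intro order_tendstoD(2)[OF lim]) simp
  then obtain n where n: "cnorm B (X n \<ominus>\<^bsub>B\<^esub> Y) < \<epsilon> / 2" by (auto simp: eventually_sequentially)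
  obtain k x where x: "x \<in> carrier (A k)" "cnorm B (X n \<ominus>\<^bsub>B\<^esub> R k x) < \<epsilon> / 2"
    using assms(1)[of n] e unfolding L_iff by (metis half_gt_zero)
  then show "\<exists>k. \<exists>x\<in>carrier (A k). cnorm B (Y \<ominus>\<^bsub>B\<^esub> R k x) < \<epsilon>"
    using B.norm_triangle_minus[of Y "X n" "R k x"] n XB[of n] assms(2)
    by (intro exI[of _ k] bexI[of _ x]) (auto simp: B.norm_minus_commute[of Y "X n"])
qed

lemma L_approx:
  assumes "X \<in> L" obtains k x where "\<forall>n. x n \<in> carrier (A (k n))" "(\<lambda>n. JB (R (k n) (x n))) \<longlonglongrightarrow> JB X"
proof -
  have X: "X \<in> carrier B" using assms L_carrier by blast
  have "\<exists>k x. x \<in> carrier (A k) \<and> cnorm B (X \<ominus>\<^bsub>B\<^esub> R k x) < 1 / real (Suc n)" for n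
    using assms unfolding L_iff by (metis of_nat_0_less_iff zero_less_Suc zero_less_divide_1_iff)
  then obtain k x where kx: "\<And>n. x n \<in> carrier (A (k n))" "\<And>n. cnorm B (X \<ominus>\<^bsub>B\<^esub> R (k n) (x n)) < 1 / real (Suc n)"
    by metis
  have "(\<lambda>n. cnorm B (R (k n) (x n) \<ominus>\<^bsub>B\<^esub> X)) \<longlonglongrightarrow> 0"
  proof (rule tendsto_sandwich[OF _ _ tendsto_const LIMSEQ_Suc[OF lim_1_over_n]]; intro always_eventually allI)
    fix n
    show "0 \<le> cnorm B (R (k n) (x n) \<ominus>\<^bsub>B\<^esub> X)" using kx X by (simp add: B.norm_nonneg)
    show "cnorm B (R (k n) (x n) \<ominus>\<^bsub>B\<^esub> X) \<le> 1 / real (Suc n)"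
      using less_imp_le[OF kx(2)[of n]] kx(1) X by (simp add: B.norm_minus_commute[of X])
  qed
  then have "(\<lambda>n. JB (R (k n) (x n))) \<longlonglongrightarrow> JB X" using kx X by (subst tendsto_J[OF B_cstar]) auto
  then show thesis using that kx(1) by blast
qed

lemma L_subspace: "selfadjoint_subspace B L"
  unfolding selfadjoint_subspace_def
proof (intro conjI allI ballI)
  show "L \<subseteq> carrier B" using L_carrier by blast
  show "\<zero>\<^bsub>B\<^esub> \<in> L" using R_L[of "\<zero>\<^bsub>A 0\<^esub>" 0] by (simp add: R_zero)
  fix X assume X: "X \<in> L"
  then have XB: "X \<in> carrier B" by (rule L_carrier)
  obtain k x where x: "\<forall>n. x n \<in> carrier (A (k n))" "(\<lambda>n. JB (R (k n) (x n))) \<longlonglongrightarrow> JB X"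
    by (rule L_approx[OF X])
  show "c \<odot>\<^bsub>B\<^esub> X \<in> L" for c
  proof (rule L_closed)
    show "R (k n) (c \<odot>\<^bsub>A (k n)\<^esub> x n) \<in> L" for n using x by (simp add: R_L)
    have "(\<lambda>n. cscale c (JB (R (k n) (x n)))) \<longlonglongrightarrow> cscale c (JB X)"
      unfolding cscale_def by (intro tendsto_intros x)
    then show "(\<lambda>n. JB (R (k n) (c \<odot>\<^bsub>A (k n)\<^esub> x n))) \<longlonglongrightarrow> JB (c \<odot>\<^bsub>B\<^esub> X)"
      using x XB by (simp add: R_smult J_smult[OF B_cstar])
  qed (use XB in simp)
  show "star B X \<in> L"
  proof (rule L_closed)
    show "R (k n) (star (A (k n)) (x n)) \<in> L" for n using x by (simp add: R_L)
    show "(\<lambda>n. JB (R (k n) (star (A (k n)) (x n)))) \<longlonglongrightarrow> JB (star B X)"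
      using x XB tendsto_adj[OF x(2)] by (simp add: R_star J_star[OF B_cstar])
  qed (use XB in simp)
  fix Y assume Y: "Y \<in> L"
  then have YB: "Y \<in> carrier B" by (rule L_carrier)
  obtain l y where y: "\<forall>n. y n \<in> carrier (A (l n))" "(\<lambda>n. JB (R (l n) (y n))) \<longlonglongrightarrow> JB Y"
    by (rule L_approx[OF Y])
  show "X \<oplus>\<^bsub>B\<^esub> Y \<in> L"
  proof (rule L_closed)
    fix n
    let ?m = "max (k n) (l n)"
    have "R (k n) (x n) \<oplus>\<^bsub>B\<^esub> R (l n) (y n) = R ?m (tm ?m (k n) (x n)) \<oplus>\<^bsub>B\<^esub> R ?m (tm ?m (l n) (y n))"
      using x y by (simp add: R_tm)
    also have "\<dots> = R ?m (tm ?m (k n) (x n) \<oplus>\<^bsub>A ?m\<^esub> tm ?m (l n) (y n))"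
      using x y by (intro R_add[symmetric] tm_closed) auto
    finally show "R (k n) (x n) \<oplus>\<^bsub>B\<^esub> R (l n) (y n) \<in> L"
      using x y by (simp add: R_L tm_closed)
    show "(\<lambda>n. JB (R (k n) (x n) \<oplus>\<^bsub>B\<^esub> R (l n) (y n))) \<longlonglongrightarrow> JB (X \<oplus>\<^bsub>B\<^esub> Y)"
      using x y XB YB tendsto_add[OF x(2) y(2)] by (simp add: J_add[OF B_cstar])
  qed (use XB YB in simp)
qed

lemma L_ops:
  "X \<in> L \<Longrightarrow> Y \<in> L \<Longrightarrow> X \<oplus>\<^bsub>B\<^esub> Y \<in> L" "X \<in> L \<Longrightarrow> c \<odot>\<^bsub>B\<^esub> X \<in> L" "X \<in> L \<Longrightarrow> star B X \<in> L" "\<zero>\<^bsub>B\<^esub> \<in> L"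
  "X \<in> L \<Longrightarrow> Y \<in> L \<Longrightarrow> X \<ominus>\<^bsub>B\<^esub> Y \<in> L"
  using L_subspace L_carrier by (auto simp: selfadjoint_subspace_def B.minus_smult)

text \<open>A representative eventually follows the images of any x that approximates its
  class.\<close>

lemma rep_close:
  assumes a: "a \<in> carrier P" and x: "x \<in> carrier (A k)" and lt: "cnorm B (cls a \<ominus>\<^bsub>B\<^esub> R k x) < \<delta>"
  shows "\<forall>\<^sub>F n in sequentially. n \<ge> k \<and> cnorm (A n) (a n \<ominus>\<^bsub>A n\<^esub> tm n k x) < \<delta>"
proof -
  have "cls a \<ominus>\<^bsub>B\<^esub> R k x = cls (\<lambda>n. a n \<ominus>\<^bsub>A n\<^esub> sq k x n)" using a sq_P[OF x] by (simp add: R_cls x B_minus)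
  then have "\<forall>\<^sub>F n in sequentially. cnorm (A n) (a n \<ominus>\<^bsub>A n\<^esub> sq k x n) < \<delta>"
    using lt a sq_P[OF x] by (intro norm_class_less prod_closed) auto
  then show ?thesis
    using eventually_ge_at_top[of k] by eventually_elim (auto simp: sq_def)
qed

text \<open>Once a_n is close to \<rho>_{n,k}(x), contractivity makes \<rho>_n(a_n) close to
  \<rho>_n(\<rho>_{n,k}(x)), which is \<rho>_k(x). So each representative recovers its class through
  the limit maps.\<close>

lemma R_rep_tendsto:
  assumes a: "a \<in> carrier P" and L: "cls a \<in> L"
  shows "(\<lambda>n. JB (R n (a n))) \<longlonglongrightarrow> JB (cls a)"
proof (rule tendstoI)
  fix e :: real assume e: "e > 0"
  then obtain k x where x: "x \<in> carrier (A k)" "cnorm B (cls a \<ominus>\<^bsub>B\<^esub> R k x) < e / 2"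
    using L unfolding L_iff by (metis half_gt_zero)
  show "\<forall>\<^sub>F n in sequentially. dist (JB (R n (a n))) (JB (cls a)) < e"
    using rep_close[OF a x]
  proof eventually_elim
    case (elim n)
    note [simp] = prodD[OF a] x(1) tm_closed cls_closed[OF a]
    have "norm (JB (R n (a n)) - JB (R k x)) < e / 2"
      using JR_norm[of "a n \<ominus>\<^bsub>A n\<^esub> tm n k x" n] elim R_tm[OF x(1), of n] by (simp add: JR_minus)
    moreover have "norm (JB (cls a) - JB (R k x)) < e / 2"
      using x(2) by (simp add: norm_J[OF B_cstar] flip: J_minus[OF B_cstar])
    ultimately show ?case using norm_triangle_ineq4[of "JB (R n (a n)) - JB (R k x)" "JB (cls a) - JB (R k x)"]
      by (simp add: dist_norm)
  qed
qed

section \<open>Existence of the product from the encoding condition\<close>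

lemma encoding_bound:
  assumes "x \<in> carrier (A k)" "y \<in> carrier (A k)" "\<epsilon> > 0"
  obtains M where "k < M" "\<forall>m n j. M < n \<longrightarrow> M < j \<longrightarrow> n < m \<longrightarrow> j < m \<longrightarrow>
    cnorm (A m) (tm m n (tm n k x \<otimes>\<^bsub>A n\<^esub> tm n k y) \<ominus>\<^bsub>A m\<^esub> tm m j (tm j k x \<otimes>\<^bsub>A j\<^esub> tm j k y)) < \<epsilon>"
proof -
  have "\<exists>M>k. \<forall>m n j. n > M \<and> j > M \<and> m > max n j \<longrightarrow>
    cnorm (A m) (tm m n (tm n k x \<otimes>\<^bsub>A n\<^esub> tm n k y) \<ominus>\<^bsub>A m\<^esub> tm m j (tm j k x \<otimes>\<^bsub>A j\<^esub> tm j k y)) < \<epsilon>"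
    using enc assms unfolding cstar_encoding_def by simp
  then show thesis using that by (auto simp: less_max_iff_disj)
qed

text \<open>The encoding condition bounds the difference at all late stages m; for the classes only
  the limit superior over m counts.\<close>

lemma R_mult_Cauchy_basic:
  assumes x: "x \<in> carrier (A k)" and y: "y \<in> carrier (A k)" and e: "\<epsilon> > 0"
  obtains M where "k \<le> M" "\<forall>n j. M < n \<longrightarrow> M < j \<longrightarrow>
    norm (JB (R n (tm n k x \<otimes>\<^bsub>A n\<^esub> tm n k y)) - JB (R j (tm j k x \<otimes>\<^bsub>A j\<^esub> tm j k y))) \<le> \<epsilon>"
proof -
  obtain M where M: "k < M" "\<forall>m n j. M < n \<longrightarrow> M < j \<longrightarrow> n < m \<longrightarrow> j < m \<longrightarrow>
    cnorm (A m) (tm m n (tm n k x \<otimes>\<^bsub>A n\<^esub> tm n k y) \<ominus>\<^bsub>A m\<^esub> tm m j (tm j k x \<otimes>\<^bsub>A j\<^esub> tm j k y)) < \<epsilon>"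
    by (rule encoding_bound[OF x y e])
  have "norm (JB (R n (tm n k x \<otimes>\<^bsub>A n\<^esub> tm n k y)) - JB (R j (tm j k x \<otimes>\<^bsub>A j\<^esub> tm j k y))) \<le> \<epsilon>"
    if n: "M < n" and j: "M < j" for n j
  proof -
    let ?u = "\<lambda>n. tm n k x \<otimes>\<^bsub>A n\<^esub> tm n k y"
    have u: "?u n \<in> carrier (A n)" if "M < n" for n using that M(1) x y by (simp add: tm_closed)
    have "cnorm B (cls (\<lambda>m. sq n (?u n) m \<ominus>\<^bsub>A m\<^esub> sq j (?u j) m)) \<le> \<epsilon>"
    proof (intro norm_class_le prod_closed sq_P u n j)
      show "\<forall>\<^sub>F m in sequentially. cnorm (A m) (sq n (?u n) m \<ominus>\<^bsub>A m\<^esub> sq j (?u j) m) \<le> \<epsilon>"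
        using eventually_gt_at_top[of "max n j"]
        by eventually_elim (use M(2) n j in \<open>auto simp: sq_def intro: less_imp_le\<close>)
    qed
    then have "cnorm B (R n (?u n) \<ominus>\<^bsub>B\<^esub> R j (?u j)) \<le> \<epsilon>"
      using u[OF n] u[OF j] by (simp add: R_cls sq_P B_minus)
    then show ?thesis using u[OF n] u[OF j] by (simp add: norm_J[OF B_cstar] flip: J_minus[OF B_cstar])
  qed
  then show thesis using that[of M] M(1) by simp
qed

lemma L_common:
  assumes "X \<in> L" "Y \<in> L" "\<delta> > 0"
  obtains k x y where "x \<in> carrier (A k)" "y \<in> carrier (A k)"
    "cnorm B (X \<ominus>\<^bsub>B\<^esub> R k x) < \<delta>" "cnorm B (Y \<ominus>\<^bsub>B\<^esub> R k y) < \<delta>"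
proof -
  obtain k x where x: "x \<in> carrier (A k)" "cnorm B (X \<ominus>\<^bsub>B\<^esub> R k x) < \<delta>"
    using assms unfolding L_iff by metis
  obtain l y where y: "y \<in> carrier (A l)" "cnorm B (Y \<ominus>\<^bsub>B\<^esub> R l y) < \<delta>"
    using assms unfolding L_iff by metis
  let ?m = "max k l"
  show thesis
    by (rule that[of "tm ?m k x" ?m "tm ?m l y"]) (use x y in \<open>simp_all add: tm_closed R_tm\<close>)
qed

text \<open>From a b - a' b' = a (b - b') + (a - a') b', where b' has norm at most K + 1 because
  \<delta> \<le> 1; hence the constant 2 K + 1.\<close>

lemma mult_close:
  assumes "a \<in> carrier (A n)" "b \<in> carrier (A n)" "a' \<in> carrier (A n)" "b' \<in> carrier (A n)"
    and "cnorm (A n) a \<le> K" "cnorm (A n) b \<le> K" "cnorm (A n) (a \<ominus>\<^bsub>A n\<^esub> a') \<le> \<delta>" "cnorm (A n) (b \<ominus>\<^bsub>A n\<^esub> b') \<le> \<delta>" "\<delta> \<le> 1"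
  shows "cnorm (A n) (a \<otimes>\<^bsub>A n\<^esub> b \<ominus>\<^bsub>A n\<^esub> a' \<otimes>\<^bsub>A n\<^esub> b') \<le> (2 * K + 1) * \<delta>"
proof -
  note c = assms(1-4)
  have n: "cnorm (A n) z = norm (J (A n) z)" if "z \<in> carrier (A n)" for z using that by (simp add: norm_J[OF A])
  let ?a = "J (A n) a" and ?b = "J (A n) b" and ?a' = "J (A n) a'" and ?b' = "J (A n) b'"
  have h: "norm ?a \<le> K" "norm ?b \<le> K" "norm (?a - ?a') \<le> \<delta>" "norm (?b - ?b') \<le> \<delta>"
    using assms by (simp_all add: n J_minus[OF A])
  have b': "norm ?b' \<le> K + 1"
    using norm_triangle_sub[of ?b' ?b] h assms(9) by (simp add: Real_Vector_Spaces.norm_minus_commute)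
  have d0: "0 \<le> \<delta>" using h(3) norm_ge_zero order_trans by blast
  have "?a * ?b - ?a' * ?b' = ?a * (?b - ?b') + (?a - ?a') * ?b'" by (simp add: algebra_simps)
  also have "norm \<dots> \<le> norm ?a * norm (?b - ?b') + norm (?a - ?a') * norm ?b'"
    by (intro norm_triangle_mono norm_mult_ineq)
  also have "\<dots> \<le> K * \<delta> + \<delta> * (K + 1)"
    using h b' d0 by (intro add_mono mult_mono) (auto intro: order_trans[OF norm_ge_zero])
  finally show ?thesis using c by (simp add: n J_minus[OF A] J_mult[OF A] algebra_simps)
qed

lemma prod_bound:
  assumes "a \<in> carrier P" "b \<in> carrier P"
  obtains K where "K > 0" "\<forall>n. cnorm (A n) (a n) \<le> K" "\<forall>n. cnorm (A n) (b n) \<le> K"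
proof -
  obtain K1 K2 where "\<forall>n. cnorm (A n) (a n) \<le> K1" "\<forall>n. cnorm (A n) (b n) \<le> K2"
    using assms by (auto simp: prod_carrier)
  then show thesis by (intro that[of "max 1 (max K1 K2)"]) (auto simp: le_max_iff_disj)
qed

text \<open>The entries are replaced by images of x and y from a common level k. This changes the
  products little by \<open>mult_close\<close>, and for the images the encoding condition
  applies.\<close>

lemma R_mult_Cauchy:
  assumes a: "a \<in> carrier P" "cls a \<in> L" and b: "b \<in> carrier P" "cls b \<in> L"
  shows "Cauchy (\<lambda>n. JB (R n (a n \<otimes>\<^bsub>A n\<^esub> b n)))"
  unfolding Cauchy_def dist_norm
proof (intro allI impI)
  fix e :: real assume e: "e > 0"
  obtain K where K: "K > 0" "\<forall>n. cnorm (A n) (a n) \<le> K" "\<forall>n. cnorm (A n) (b n) \<le> K"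
    by (rule prod_bound[OF a(1) b(1)])
  \<comment> \<open>\<open>mult_close\<close> requires \<delta> \<le> 1; the other bound keeps each
    of the two replacement errors at e / 4.\<close>
  define \<delta> where "\<delta> = min 1 (e / (4 * (2 * K + 1)))"
  have d: "\<delta> > 0" "\<delta> \<le> 1" "(2 * K + 1) * \<delta> \<le> e / 4"
  proof -
    show "\<delta> > 0" "\<delta> \<le> 1" using e K by (simp_all add: \<delta>_def)
    have "c * min 1 (e / (4 * c)) \<le> e / 4" if "c > 0" for c :: real
      using mult_left_mono[of "min 1 (e / (4 * c))" "e / (4 * c)" c] that by simp
    from this[of "2 * K + 1"] show "(2 * K + 1) * \<delta> \<le> e / 4" using K unfolding \<delta>_def by simp
  qed
  obtain k x y where xy: "x \<in> carrier (A k)" "y \<in> carrier (A k)"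
    "cnorm B (cls a \<ominus>\<^bsub>B\<^esub> R k x) < \<delta>" "cnorm B (cls b \<ominus>\<^bsub>B\<^esub> R k y) < \<delta>"
    by (rule L_common[OF a(2) b(2) d(1)])
  let ?u = "\<lambda>n. tm n k x \<otimes>\<^bsub>A n\<^esub> tm n k y" and ?v = "\<lambda>n. a n \<otimes>\<^bsub>A n\<^esub> b n"
  obtain M where M: "k \<le> M" "\<forall>n j. M < n \<longrightarrow> M < j \<longrightarrow> norm (JB (R n (?u n)) - JB (R j (?u j))) \<le> e / 4"
    by (rule R_mult_Cauchy_basic[OF xy(1,2), of "e / 4"]) (use e in auto)
  have "\<forall>\<^sub>F n in sequentially. M < n \<and> norm (JB (R n (?v n)) - JB (R n (?u n))) \<le> e / 4"
    using rep_close[OF a(1) xy(1,3)] rep_close[OF b(1) xy(2,4)] eventually_gt_at_top[of M]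
  proof eventually_elim
    case (elim n)
    note [simp] = prodD[OF a(1)] prodD[OF b(1)] xy(1,2) tm_closed
    have "cnorm (A n) (?v n \<ominus>\<^bsub>A n\<^esub> ?u n) \<le> (2 * K + 1) * \<delta>"
      using elim K d by (intro mult_close) auto
    then have "norm (JB (R n (?v n \<ominus>\<^bsub>A n\<^esub> ?u n))) \<le> e / 4"
      using JR_norm[of "?v n \<ominus>\<^bsub>A n\<^esub> ?u n" n] d(3) elim by simp
    then show ?case using elim by (simp add: JR_minus)
  qed
  then obtain N where N: "\<And>n. n \<ge> N \<Longrightarrow> M < n \<and> norm (JB (R n (?v n)) - JB (R n (?u n))) \<le> e / 4"
    by (auto simp: eventually_sequentially)
  have "norm (JB (R m (?v m)) - JB (R n (?v n))) < e" if "m \<ge> N" "n \<ge> N" for m n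
  proof -
    have "norm (JB (R m (?v m)) - JB (R n (?v n))) \<le> e / 4 + e / 4 + e / 4"
      by (rule order_trans[OF norm_diff_triangle3[of _ _ "JB (R m (?u m))" "JB (R n (?u n))"]])
        (intro add_mono N[OF that(1), THEN conjunct2] N[OF that(2), THEN conjunct2] M(2)[rule_format]
          N[OF that(1), THEN conjunct1] N[OF that(2), THEN conjunct1])
    then show ?thesis using e by simp
  qed
  then show "\<exists>N. \<forall>m\<ge>N. \<forall>n\<ge>N. norm (JB (R m (?v m)) - JB (R n (?v n))) < e" by blast
qed

lemma R_eqv_tendsto:
  assumes "a \<in> carrier P" "b \<in> carrier P" "eqv a b" "(\<lambda>n. JB (R n (a n))) \<longlonglongrightarrow> l"
  shows "(\<lambda>n. JB (R n (b n))) \<longlonglongrightarrow> l"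
proof -
  note [simp] = prodD[OF assms(1)] prodD[OF assms(2)]
  have lim: "(\<lambda>n. cnorm (A n) (a n \<ominus>\<^bsub>A n\<^esub> b n)) \<longlonglongrightarrow> 0" using assms eqv_iff by simp
  have "(\<lambda>n. norm (JB (R n (a n)) - JB (R n (b n)))) \<longlonglongrightarrow> 0"
    using JR_norm[of "a _ \<ominus>\<^bsub>A _\<^esub> b _"]
    by (intro tendsto_sandwich[OF _ _ tendsto_const lim] always_eventually) (simp_all flip: JR_minus)
  then have "(\<lambda>n. JB (R n (a n)) - JB (R n (b n))) \<longlonglongrightarrow> 0" by (rule tendsto_norm_zero_cancel)
  from tendsto_diff[OF assms(4) this] show ?thesis by simp
qed

text \<open>An explicit candidate for \<bullet>, later shown to agree with \<open>limit_mult\<close>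
  on \<open>L\<close>. The result does not depend on the representatives, by \<open>eqv_mult\<close>
  and \<open>R_eqv_tendsto\<close>, and the freedom to choose them makes the bilinear laws
  immediate.\<close>

definition P0 :: "(nat \<Rightarrow> 'a) set \<Rightarrow> (nat \<Rightarrow> 'a) set \<Rightarrow> (nat \<Rightarrow> 'a) set" where
  "P0 X Y = (SOME Z. Z \<in> carrier B \<and> (\<exists>a\<in>carrier P. \<exists>b\<in>carrier P. X = cls a \<and> Y = cls b \<and>
     (\<lambda>n. JB (R n (a n \<otimes>\<^bsub>A n\<^esub> b n))) \<longlonglongrightarrow> JB Z))"

lemma P0_tendsto:
  assumes a: "a \<in> carrier P" "cls a \<in> L" and b: "b \<in> carrier P" "cls b \<in> L"
  shows "P0 (cls a) (cls b) \<in> carrier B" "(\<lambda>n. JB (R n (a n \<otimes>\<^bsub>A n\<^esub> b n))) \<longlonglongrightarrow> JB (P0 (cls a) (cls b))"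
proof -
  obtain l where l: "(\<lambda>n. JB (R n (a n \<otimes>\<^bsub>A n\<^esub> b n))) \<longlonglongrightarrow> l"
    using R_mult_Cauchy[OF a b] Cauchy_convergent convergent_def by blast
  have "l \<in> JB ` carrier B"
    by (rule csub_closed[OF csub_J[OF B_cstar] _ l]) (use prodD[OF a(1)] prodD[OF b(1)] in simp)
  then obtain Z where Z: "Z \<in> carrier B" "l = JB Z" by blast
  let ?Q = "\<lambda>Z. Z \<in> carrier B \<and> (\<exists>a'\<in>carrier P. \<exists>b'\<in>carrier P. cls a = cls a' \<and> cls b = cls b' \<and>
     (\<lambda>n. JB (R n (a' n \<otimes>\<^bsub>A n\<^esub> b' n))) \<longlonglongrightarrow> JB Z)"
  have "?Q Z" using Z l a(1) b(1) by blast
  then have Q: "?Q (P0 (cls a) (cls b))" unfolding P0_def by (rule someI)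
  then show "P0 (cls a) (cls b) \<in> carrier B" by blast
  obtain a' b' where ab: "a' \<in> carrier P" "b' \<in> carrier P" "cls a = cls a'" "cls b = cls b'"
     "(\<lambda>n. JB (R n (a' n \<otimes>\<^bsub>A n\<^esub> b' n))) \<longlonglongrightarrow> JB (P0 (cls a) (cls b))" using Q by blast
  have "eqv a' a" "eqv b' b" using ab a b cls_eq_iff by (metis, metis)
  then show "(\<lambda>n. JB (R n (a n \<otimes>\<^bsub>A n\<^esub> b n))) \<longlonglongrightarrow> JB (P0 (cls a) (cls b))"
    using ab a b by (intro R_eqv_tendsto[OF _ _ _ ab(5)] prod_closed eqv_mult)
qed

lemma P0_eqI:
  assumes "a \<in> carrier P" "cls a \<in> L" "b \<in> carrier P" "cls b \<in> L" "Z \<in> carrier B"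
    "(\<lambda>n. JB (R n (a n \<otimes>\<^bsub>A n\<^esub> b n))) \<longlonglongrightarrow> JB Z"
  shows "P0 (cls a) (cls b) = Z"
  using LIMSEQ_unique[OF P0_tendsto(2)[OF assms(1-4)] assms(6)] P0_tendsto(1)[OF assms(1-4)] assms(5)
  by (simp add: J_inject[OF B_cstar])

lemma L_rep: assumes "X \<in> L" obtains a where "a \<in> carrier P" "X = cls a" "cls a \<in> L"
  using L_carrier[OF assms] assms by (auto simp: carrier_B)

lemma P0_L: assumes "X \<in> L" "Y \<in> L" shows "P0 X Y \<in> L"
proof -
  obtain a where a: "a \<in> carrier P" "X = cls a" "cls a \<in> L" by (rule L_rep[OF assms(1)])
  obtain b where b: "b \<in> carrier P" "Y = cls b" "cls b \<in> L" by (rule L_rep[OF assms(2)])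
  show ?thesis unfolding a(2) b(2)
    by (rule L_closed[OF _ P0_tendsto[OF a(1,3) b(1,3)]]) (use prodD[OF a(1)] prodD[OF b(1)] in \<open>simp add: R_L\<close>)
qed

section \<open>Associativity and the remaining laws of the product\<close>

lemma encoding_star_bound:
  assumes z: "z \<in> carrier (A k)" and e: "\<epsilon> > 0"
  obtains M where "k < M" "\<forall>m n j. M < n \<longrightarrow> M < j \<longrightarrow> n < m \<longrightarrow> j < m \<longrightarrow>
    cnorm (A m) (tm m n (star (A n) (tm n k z) \<otimes>\<^bsub>A n\<^esub> tm n k z) \<ominus>\<^bsub>A m\<^esub>
      tm m j (star (A j) (tm j k z) \<otimes>\<^bsub>A j\<^esub> tm j k z)) < \<epsilon>"
proof -
  obtain M where "k < M" "\<forall>m n j. M < n \<longrightarrow> M < j \<longrightarrow> n < m \<longrightarrow> j < m \<longrightarrow>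
    cnorm (A m) (tm m n (tm n k (star (A k) z) \<otimes>\<^bsub>A n\<^esub> tm n k z) \<ominus>\<^bsub>A m\<^esub>
      tm m j (tm j k (star (A k) z) \<otimes>\<^bsub>A j\<^esub> tm j k z)) < \<epsilon>"
    by (rule encoding_bound[OF star_closed[OF z] z e])
  moreover from this have "tm n k (star (A k) z) = star (A n) (tm n k z)" if "M < n" for n
    using that z by (intro tm_star) auto
  ultimately show thesis using that[of M] by simp
qed

text \<open>The image of w z at stage q is the image of the product formed at stage l, small because
  w has become small there, plus a multiplicativity defect. By \<open>defect_cauchy_schwarz\<close>
  the square of the latter is at most 2 K^2, from the defect of \<open>star (A n) w\<close> with
  itself, times \<delta>, from that of z.\<close>

lemma defect_bound:
  assumes w: "w \<in> carrier (A n)" and z: "z \<in> carrier (A n)" and nl: "n \<le> l" "l \<le> q"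
    and K: "cnorm (A n) w \<le> K" and \<delta>: "cnorm (A l) (tm l n w) \<le> \<delta>"
    and d: "cnorm (A q) (tm q n (star (A n) z \<otimes>\<^bsub>A n\<^esub> z) \<ominus>\<^bsub>A q\<^esub> tm q l (star (A l) (tm l n z) \<otimes>\<^bsub>A l\<^esub> tm l n z)) \<le> \<delta>"
  shows "cnorm (A q) (tm q n (w \<otimes>\<^bsub>A n\<^esub> z)) \<le> \<delta> * cnorm (A n) z + sqrt (2 * K\<^sup>2 * \<delta>)"
proof -
  note [simp] = w z nl tm_closed[OF nl(1)] tm_closed[OF nl(2)]
  have nq: "n \<le> q" by (rule order_trans[OF nl])
  let ?D = "\<lambda>x y. tm l n (star (A n) x \<otimes>\<^bsub>A n\<^esub> y) \<ominus>\<^bsub>A l\<^esub> star (A l) (tm l n x) \<otimes>\<^bsub>A l\<^esub> tm l n y"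
  have K0: "0 \<le> K" using K norm_nonneg[OF w] by simp
  have d0: "0 \<le> \<delta>" using \<delta> norm_nonneg[of "tm l n w" l] by simp
  \<comment> \<open>Defects are formed with a starred left factor, so w enters as the star of its
    star.\<close>
  have sw: "star (A l) (tm l n (star (A n) w)) = tm l n w" by (simp add: tm_star star_star)
  have 1: "tm q l (?D (star (A n) w) z) = tm q n (w \<otimes>\<^bsub>A n\<^esub> z) \<ominus>\<^bsub>A q\<^esub> tm q l (tm l n w \<otimes>\<^bsub>A l\<^esub> tm l n z)"
    by (simp add: sw tm_minus tm_tm star_star)
  have 2: "tm q l (?D z z) = tm q n (star (A n) z \<otimes>\<^bsub>A n\<^esub> z) \<ominus>\<^bsub>A q\<^esub> tm q l (star (A l) (tm l n z) \<otimes>\<^bsub>A l\<^esub> tm l n z)"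
    by (simp add: tm_minus tm_tm)
  have "cnorm (A q) (tm q l (?D (star (A n) w) (star (A n) w))) \<le> cnorm (A l) (?D (star (A n) w) (star (A n) w))"
    by (intro tm_norm) simp_all
  also have "\<dots> \<le> cnorm (A l) (tm l n (w \<otimes>\<^bsub>A n\<^esub> star (A n) w)) + cnorm (A l) (tm l n w \<otimes>\<^bsub>A l\<^esub> tm l n (star (A n) w))"
    using norm_triangle_minus[of "tm l n (w \<otimes>\<^bsub>A n\<^esub> star (A n) w)" l "\<zero>\<^bsub>A l\<^esub>" "tm l n w \<otimes>\<^bsub>A l\<^esub> tm l n (star (A n) w)"]
    by (simp add: sw star_star norm_minus_commute[of "\<zero>\<^bsub>A l\<^esub>"])
  also have "\<dots> \<le> K * K + K * K"
  proof (intro add_mono)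
    have "cnorm (A l) (tm l n (w \<otimes>\<^bsub>A n\<^esub> star (A n) w)) \<le> cnorm (A n) (w \<otimes>\<^bsub>A n\<^esub> star (A n) w)"
      by (intro tm_norm) simp_all
    also have "\<dots> \<le> cnorm (A n) w * cnorm (A n) (star (A n) w)" by (intro norm_mult) simp_all
    also have "\<dots> \<le> K * K" using K K0 by (intro mult_mono) (auto simp: norm_nonneg)
    finally show "cnorm (A l) (tm l n (w \<otimes>\<^bsub>A n\<^esub> star (A n) w)) \<le> K * K" .
    have "cnorm (A l) (tm l n w \<otimes>\<^bsub>A l\<^esub> tm l n (star (A n) w)) \<le> cnorm (A l) (tm l n w) * cnorm (A l) (tm l n (star (A n) w))"
      by (intro norm_mult) simp_all
    also have "\<dots> \<le> K * K"
      using tm_norm[OF nl(1) w] tm_norm[OF nl(1), of "star (A n) w"] K K0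
      by (intro mult_mono) (auto simp: norm_nonneg)
    finally show "cnorm (A l) (tm l n w \<otimes>\<^bsub>A l\<^esub> tm l n (star (A n) w)) \<le> K * K" .
  qed
  finally have 3: "cnorm (A q) (tm q l (?D (star (A n) w) (star (A n) w))) \<le> 2 * K\<^sup>2" by (simp add: power2_eq_square)
  have "(cnorm (A q) (tm q l (?D (star (A n) w) z)))\<^sup>2 \<le>
    cnorm (A q) (tm q l (?D (star (A n) w) (star (A n) w))) * cnorm (A q) (tm q l (?D z z))"
    by (rule defect_cauchy_schwarz[OF tm_cpc[OF nl(1)] tm_cpc[OF nl(2)]]) simp_all
  also have "\<dots> \<le> (2 * K\<^sup>2) * \<delta>"
    by (intro mult_mono 3) (use d in \<open>simp_all add: 2 norm_nonneg tm_closed[OF nq]\<close>)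
  finally have 4: "cnorm (A q) (tm q l (?D (star (A n) w) z)) \<le> sqrt (2 * K\<^sup>2 * \<delta>)" by (rule real_le_rsqrt)
  have "cnorm (A q) (tm q l (tm l n w \<otimes>\<^bsub>A l\<^esub> tm l n z)) \<le> cnorm (A l) (tm l n w \<otimes>\<^bsub>A l\<^esub> tm l n z)"
    by (intro tm_norm) simp_all
  also have "\<dots> \<le> cnorm (A l) (tm l n w) * cnorm (A l) (tm l n z)" by (intro norm_mult) simp_all
  also have "\<dots> \<le> \<delta> * cnorm (A n) z"
    using tm_norm[OF nl(1) z] \<delta> d0 by (intro mult_mono) (auto simp: norm_nonneg)
  finally have 5: "cnorm (A q) (tm q l (tm l n w \<otimes>\<^bsub>A l\<^esub> tm l n z)) \<le> \<delta> * cnorm (A n) z" .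
  show ?thesis
    using norm_triangle_minus[of "tm q n (w \<otimes>\<^bsub>A n\<^esub> z)" q "tm q l (tm l n w \<otimes>\<^bsub>A l\<^esub> tm l n z)" "\<zero>\<^bsub>A q\<^esub>"] 4 5
    by (simp add: 1 tm_closed[OF nq])
qed

text \<open>This replaces multiplicativity of the limit maps in the proof of associativity.\<close>

lemma R_null_mult_sq:
  assumes w: "w \<in> carrier P" and lim: "(\<lambda>n. JB (R n (w n))) \<longlonglongrightarrow> 0" and z: "z \<in> carrier (A k)"
  shows "(\<lambda>n. JB (R n (w n \<otimes>\<^bsub>A n\<^esub> sq k z n))) \<longlonglongrightarrow> 0"
proof (rule tendstoI)
  fix e :: real assume e: "e > 0"
  obtain K where K: "K > 0" "\<forall>n. cnorm (A n) (w n) \<le> K" by (rule prod_bound[OF w w])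
  let ?Z = "cnorm (A k) z"
  have Z0: "0 \<le> ?Z" using z by (simp add: norm_nonneg)
  \<comment> \<open>The two bounds make each of the two terms in \<open>defect_bound\<close> at most
    e / 2.\<close>
  define \<delta> where "\<delta> = min (e / (2 * (?Z + 1))) (e\<^sup>2 / (8 * K\<^sup>2))"
  have d: "\<delta> > 0" using e K Z0 by (simp add: \<delta>_def)
  have d1: "\<delta> * ?Z < e / 2"
  proof -
    have "\<delta> * ?Z \<le> e / (2 * (?Z + 1)) * ?Z" using Z0 by (intro mult_right_mono) (simp_all add: \<delta>_def)
    also have "\<dots> < e / 2" using e Z0 by (simp add: field_simps)
    finally show ?thesis .
  qed
  have d2: "sqrt (2 * K\<^sup>2 * \<delta>) \<le> e / 2"
  proof (rule real_le_lsqrt)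
    have "2 * K\<^sup>2 * \<delta> \<le> 2 * K\<^sup>2 * (e\<^sup>2 / (8 * K\<^sup>2))" by (intro mult_left_mono) (simp_all add: \<delta>_def)
    also have "\<dots> = (e / 2)\<^sup>2" using K by (simp add: power_divide)
    finally show "2 * K\<^sup>2 * \<delta> \<le> (e / 2)\<^sup>2" .
  qed (use e d in simp_all)
  obtain M where M: "k < M" "\<forall>m n j. M < n \<longrightarrow> M < j \<longrightarrow> n < m \<longrightarrow> j < m \<longrightarrow>
    cnorm (A m) (tm m n (star (A n) (tm n k z) \<otimes>\<^bsub>A n\<^esub> tm n k z) \<ominus>\<^bsub>A m\<^esub>
      tm m j (star (A j) (tm j k z) \<otimes>\<^bsub>A j\<^esub> tm j k z)) < \<delta>"
    by (rule encoding_star_bound[OF z d])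
  have "\<forall>\<^sub>F n in sequentially. norm (JB (R n (w n))) < \<delta>"
    using tendstoD[OF lim d] by simp
  then show "\<forall>\<^sub>F n in sequentially. dist (JB (R n (w n \<otimes>\<^bsub>A n\<^esub> sq k z n))) 0 < e"
    using eventually_gt_at_top[of M]
  proof eventually_elim
    case (elim n)
    note [simp] = prodD[OF w] z
    have kn: "k \<le> n" using elim M by simp
    let ?z = "tm n k z"
    have zn [simp]: "?z \<in> carrier (A n)" using kn by (simp add: tm_closed)
    \<comment> \<open>The norm of \<rho>_n(w_n) is a limit superior over later stages, so its
      smallness yields a stage l at which w_n has itself become small.\<close>
    have "cnorm B (cls (sq n (w n))) < \<delta>"
      using elim(1) by (simp add: norm_J[OF B_cstar] R_cls sq_P cls_closed)
    then have "\<forall>\<^sub>F l in sequentially. cnorm (A l) (sq n (w n) l) < \<delta>"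
      by (intro norm_class_less sq_P) simp_all
    then have "\<forall>\<^sub>F l in sequentially. n < l \<and> cnorm (A l) (sq n (w n) l) < \<delta>"
      using eventually_gt_at_top[of n] by eventually_elim simp
    then obtain l where l: "n < l" "cnorm (A l) (sq n (w n) l) < \<delta>"
      by (auto simp: eventually_sequentially)
    have b: "cnorm (A q) (tm q n (w n \<otimes>\<^bsub>A n\<^esub> ?z)) \<le> \<delta> * ?Z + e / 2" if q: "l < q" for q
    proof -
      have "cnorm (A q) (tm q n (w n \<otimes>\<^bsub>A n\<^esub> ?z)) \<le> \<delta> * cnorm (A n) ?z + sqrt (2 * K\<^sup>2 * \<delta>)"
      proof (rule defect_bound[where l = l])
        show "cnorm (A l) (tm l n (w n)) \<le> \<delta>" using l by (simp add: sq_def)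
        have "tm l n ?z = tm l k z" using kn l by (simp add: tm_tm)
        then show "cnorm (A q) (tm q n (star (A n) ?z \<otimes>\<^bsub>A n\<^esub> ?z) \<ominus>\<^bsub>A q\<^esub> tm q l (star (A l) (tm l n ?z) \<otimes>\<^bsub>A l\<^esub> tm l n ?z)) \<le> \<delta>"
          using M(2)[rule_format, of n l q] elim(2) l(1) q by simp
      qed (use l q K in simp_all)
      also have "\<dots> \<le> \<delta> * ?Z + e / 2"
        using d2 d tm_norm[OF kn z] by (intro add_mono mult_left_mono) auto
      finally show ?thesis .
    qed
    have "cnorm B (R n (w n \<otimes>\<^bsub>A n\<^esub> ?z)) \<le> \<delta> * ?Z + e / 2"
    proof -
      have "\<forall>\<^sub>F q in sequentially. cnorm (A q) (sq n (w n \<otimes>\<^bsub>A n\<^esub> ?z) q) \<le> \<delta> * ?Z + e / 2"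
        using eventually_gt_at_top[of l] by eventually_elim (use b l in \<open>auto simp: sq_def\<close>)
      then show ?thesis by (simp add: R_cls) (intro norm_class_le sq_P, simp_all)
    qed
    then have "norm (JB (R n (w n \<otimes>\<^bsub>A n\<^esub> ?z))) < e" using d1 by (simp add: norm_J[OF B_cstar])
    then show ?case using kn by (simp add: sq_def)
  qed
qed

text \<open>By density c is replaced by the images of some z, and the bound K on w controls the
  replacement.\<close>

lemma R_null_mult:
  assumes w: "w \<in> carrier P" and lim: "(\<lambda>n. JB (R n (w n))) \<longlonglongrightarrow> 0" and c: "c \<in> carrier P" "cls c \<in> L"
  shows "(\<lambda>n. JB (R n (w n \<otimes>\<^bsub>A n\<^esub> c n))) \<longlonglongrightarrow> 0"
proof (rule tendstoI)
  fix e :: real assume e: "e > 0"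
  obtain K where K: "K > 0" "\<forall>n. cnorm (A n) (w n) \<le> K" by (rule prod_bound[OF w w])
  define \<delta> where "\<delta> = e / (2 * K)"
  have d: "\<delta> > 0" using e K by (simp add: \<delta>_def)
  obtain k z where z: "z \<in> carrier (A k)" "cnorm B (cls c \<ominus>\<^bsub>B\<^esub> R k z) < \<delta>"
    using c(2) d unfolding L_iff by blast
  have "\<forall>\<^sub>F n in sequentially. norm (JB (R n (w n \<otimes>\<^bsub>A n\<^esub> sq k z n))) < e / 2"
    using tendstoD[OF R_null_mult_sq[OF w lim z(1)], of "e / 2"] e by simp
  then show "\<forall>\<^sub>F n in sequentially. dist (JB (R n (w n \<otimes>\<^bsub>A n\<^esub> c n))) 0 < e"
    using rep_close[OF c(1) z]
  proof eventually_elim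
    case (elim n)
    note [simp] = prodD[OF w] prodD[OF c(1)] prodD[OF sq_P[OF z(1)]]
    have "cnorm (A n) (w n \<otimes>\<^bsub>A n\<^esub> (c n \<ominus>\<^bsub>A n\<^esub> sq k z n)) \<le> cnorm (A n) (w n) * cnorm (A n) (c n \<ominus>\<^bsub>A n\<^esub> sq k z n)"
      by (intro norm_mult) simp_all
    also have "\<dots> \<le> K * \<delta>"
      using K elim(2) by (intro mult_mono) (auto simp: norm_nonneg sq_def tm_closed z(1))
    also have "\<dots> = e / 2" using K by (simp add: \<delta>_def)
    finally have "norm (JB (R n (w n \<otimes>\<^bsub>A n\<^esub> (c n \<ominus>\<^bsub>A n\<^esub> sq k z n)))) \<le> e / 2"
      using JR_norm[of "w n \<otimes>\<^bsub>A n\<^esub> (c n \<ominus>\<^bsub>A n\<^esub> sq k z n)" n] by simp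
    then have "norm (JB (R n (w n \<otimes>\<^bsub>A n\<^esub> c n)) - JB (R n (w n \<otimes>\<^bsub>A n\<^esub> sq k z n))) \<le> e / 2"
      by (simp flip: JR_minus minus_mult_r)
    then show ?case
      using elim(1) norm_triangle_sub[of "JB (R n (w n \<otimes>\<^bsub>A n\<^esub> c n))" "JB (R n (w n \<otimes>\<^bsub>A n\<^esub> sq k z n))"]
      by simp
  qed
qed

lemma JR_star: "x \<in> carrier (A n) \<Longrightarrow> JB (R n (star (A n) x)) = adj (JB (R n x))"
  by (simp add: R_star J_star[OF B_cstar])

lemma R_null_mult_left:
  assumes w: "w \<in> carrier P" and lim: "(\<lambda>n. JB (R n (w n))) \<longlonglongrightarrow> 0" and c: "c \<in> carrier P" "cls c \<in> L"
  shows "(\<lambda>n. JB (R n (c n \<otimes>\<^bsub>A n\<^esub> w n))) \<longlonglongrightarrow> 0"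
proof -
  note [simp] = prodD[OF w] prodD[OF c(1)]
  have "(\<lambda>n. JB (R n (star (A n) (w n) \<otimes>\<^bsub>A n\<^esub> star (A n) (c n)))) \<longlonglongrightarrow> 0"
  proof (rule R_null_mult)
    show "(\<lambda>n. JB (R n (star (A n) (w n)))) \<longlonglongrightarrow> 0" using tendsto_adj[OF lim] by (simp add: JR_star)
    show "cls (\<lambda>n. star (A n) (c n)) \<in> L" using L_ops(3)[OF c(2)] by (simp add: B_star1 c)
  qed (intro prod_closed w c)+
  from tendsto_adj[OF this] show ?thesis by (simp add: star_star star_mult flip: JR_star)
qed

text \<open>For a representative d of X \<bullet> Y, what is known about d_n - a_n b_n is that its
  image under \<rho>_n tends to 0. \<open>R_null_mult\<close> and \<open>R_null_mult_left\<close>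
  let this survive multiplication by c_n on the right and a_n on the left, so both bracketings are
  compared through a_n b_n c_n.\<close>

lemma P0_assoc:
  assumes "X \<in> L" "Y \<in> L" "Z \<in> L" shows "P0 (P0 X Y) Z = P0 X (P0 Y Z)"
proof -
  obtain a where a: "a \<in> carrier P" "X = cls a" "cls a \<in> L" by (rule L_rep[OF assms(1)])
  obtain b where b: "b \<in> carrier P" "Y = cls b" "cls b \<in> L" by (rule L_rep[OF assms(2)])
  obtain c where c: "c \<in> carrier P" "Z = cls c" "cls c \<in> L" by (rule L_rep[OF assms(3)])
  obtain d where d: "d \<in> carrier P" "P0 X Y = cls d" "cls d \<in> L" by (rule L_rep[OF P0_L[OF assms(1,2)]])
  obtain f where f: "f \<in> carrier P" "P0 Y Z = cls f" "cls f \<in> L" by (rule L_rep[OF P0_L[OF assms(2,3)]])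
  note [simp] = prodD[OF a(1)] prodD[OF b(1)] prodD[OF c(1)] prodD[OF d(1)] prodD[OF f(1)]
  have null: "(\<lambda>n. JB (R n (g n \<ominus>\<^bsub>A n\<^esub> u n \<otimes>\<^bsub>A n\<^esub> v n))) \<longlonglongrightarrow> 0"
    if u: "u \<in> carrier P" "cls u \<in> L" and v: "v \<in> carrier P" "cls v \<in> L"
      and g: "g \<in> carrier P" "P0 (cls u) (cls v) = cls g" "cls g \<in> L" for u v g
  proof -
    have "(\<lambda>n. JB (R n (g n)) - JB (R n (u n \<otimes>\<^bsub>A n\<^esub> v n))) \<longlonglongrightarrow> JB (cls g) - JB (cls g)"
      using P0_tendsto(2)[OF u v] unfolding g(2) by (intro tendsto_diff R_rep_tendsto g)
    then show ?thesis using prodD[OF u(1)] prodD[OF v(1)] prodD[OF g(1)] by (simp add: JR_minus)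
  qed
  have n1: "(\<lambda>n. JB (R n ((d n \<ominus>\<^bsub>A n\<^esub> a n \<otimes>\<^bsub>A n\<^esub> b n) \<otimes>\<^bsub>A n\<^esub> c n))) \<longlonglongrightarrow> 0"
    using a b c d by (intro R_null_mult null prod_closed) auto
  have n2: "(\<lambda>n. JB (R n (a n \<otimes>\<^bsub>A n\<^esub> (f n \<ominus>\<^bsub>A n\<^esub> b n \<otimes>\<^bsub>A n\<^esub> c n)))) \<longlonglongrightarrow> 0"
    using a b c f by (intro R_null_mult_left null prod_closed) auto
  have "(\<lambda>n. JB (R n (d n \<otimes>\<^bsub>A n\<^esub> c n)) - (JB (R n ((d n \<ominus>\<^bsub>A n\<^esub> a n \<otimes>\<^bsub>A n\<^esub> b n) \<otimes>\<^bsub>A n\<^esub> c n)) -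
      JB (R n (a n \<otimes>\<^bsub>A n\<^esub> (f n \<ominus>\<^bsub>A n\<^esub> b n \<otimes>\<^bsub>A n\<^esub> c n))))) \<longlonglongrightarrow> JB (P0 (cls d) (cls c)) - (0 - 0)"
    by (intro tendsto_diff P0_tendsto d c n1 n2)
  moreover have "JB (R n (d n \<otimes>\<^bsub>A n\<^esub> c n)) - (JB (R n ((d n \<ominus>\<^bsub>A n\<^esub> a n \<otimes>\<^bsub>A n\<^esub> b n) \<otimes>\<^bsub>A n\<^esub> c n)) -
      JB (R n (a n \<otimes>\<^bsub>A n\<^esub> (f n \<ominus>\<^bsub>A n\<^esub> b n \<otimes>\<^bsub>A n\<^esub> c n)))) = JB (R n (a n \<otimes>\<^bsub>A n\<^esub> f n))" for n
    by (simp add: JR_minus m_assoc flip: minus_mult_l minus_mult_r)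
  ultimately have "(\<lambda>n. JB (R n (a n \<otimes>\<^bsub>A n\<^esub> f n))) \<longlonglongrightarrow> JB (P0 (cls d) (cls c))" by simp
  then have "P0 (cls a) (cls f) = P0 (cls d) (cls c)"
    by (intro P0_eqI a f P0_tendsto(1) d c)
  then show ?thesis unfolding d(2) f(2) using a c by simp
qed

lemma P0_norm: assumes "X \<in> L" "Y \<in> L" shows "cnorm B (P0 X Y) \<le> cnorm B X * cnorm B Y"
proof -
  obtain a where a: "a \<in> carrier P" "X = cls a" "cls a \<in> L" by (rule L_rep[OF assms(1)])
  obtain b where b: "b \<in> carrier P" "Y = cls b" "cls b \<in> L" by (rule L_rep[OF assms(2)])
  show ?thesis
  proof (rule le_mult_dense)
    fix K M assume K: "cnorm B X < K" "cnorm B Y < M"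
    have "\<forall>\<^sub>F n in sequentially. norm (JB (R n (a n \<otimes>\<^bsub>A n\<^esub> b n))) \<le> K * M"
      using norm_class_less[OF a(1) K(1)[unfolded a(2)]] norm_class_less[OF b(1) K(2)[unfolded b(2)]]
    proof eventually_elim
      case (elim n)
      note [simp] = prodD[OF a(1)] prodD[OF b(1)]
      have "norm (JB (R n (a n \<otimes>\<^bsub>A n\<^esub> b n))) \<le> cnorm (A n) (a n \<otimes>\<^bsub>A n\<^esub> b n)" by (simp add: JR_norm)
      also have "\<dots> \<le> cnorm (A n) (a n) * cnorm (A n) (b n)" by (intro norm_mult) simp_all
      also have "\<dots> \<le> K * M" using elim norm_nonneg[of "a n" n] norm_nonneg[of "b n" n] by (intro mult_mono) auto
      finally show ?case .
    qed
    then have "norm (JB (P0 X Y)) \<le> K * M"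
      using tendsto_upperbound[OF tendsto_norm[OF P0_tendsto(2)[OF a(1,3) b(1,3)]]] a b by simp
    then show "cnorm B (P0 X Y) \<le> K * M" using P0_tendsto(1)[OF a(1,3) b(1,3)] a b by (simp add: norm_J[OF B_cstar])
  qed (use assms L_carrier in \<open>auto simp: B.norm_nonneg\<close>)
qed

lemma P0_add:
  assumes "X \<in> L" "Y \<in> L" "Z \<in> L"
  shows "P0 (X \<oplus>\<^bsub>B\<^esub> Y) Z = P0 X Z \<oplus>\<^bsub>B\<^esub> P0 Y Z" "P0 Z (X \<oplus>\<^bsub>B\<^esub> Y) = P0 Z X \<oplus>\<^bsub>B\<^esub> P0 Z Y"
    "P0 (c \<odot>\<^bsub>B\<^esub> X) Z = c \<odot>\<^bsub>B\<^esub> P0 X Z" "P0 Z (c \<odot>\<^bsub>B\<^esub> X) = c \<odot>\<^bsub>B\<^esub> P0 Z X"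
    "P0 (star B Z) (star B X) = star B (P0 X Z)"
proof -
  obtain a where a: "a \<in> carrier P" "X = cls a" "cls a \<in> L" by (rule L_rep[OF assms(1)])
  obtain b where b: "b \<in> carrier P" "Y = cls b" "cls b \<in> L" by (rule L_rep[OF assms(2)])
  obtain z where z: "z \<in> carrier P" "Z = cls z" "cls z \<in> L" by (rule L_rep[OF assms(3)])
  note [simp] = prodD[OF a(1)] prodD[OF b(1)] prodD[OF z(1)] a(2) b(2) z(2)
  note T = P0_tendsto(2)[OF a(1,3) z(1,3)] P0_tendsto(2)[OF b(1,3) z(1,3)]
    P0_tendsto(2)[OF z(1,3) a(1,3)] P0_tendsto(2)[OF z(1,3) b(1,3)]
  note C [simp] = P0_tendsto(1)[OF a(1,3) z(1,3)] P0_tendsto(1)[OF b(1,3) z(1,3)]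
    P0_tendsto(1)[OF z(1,3) a(1,3)] P0_tendsto(1)[OF z(1,3) b(1,3)]
  have JR_add: "JB (R n (x \<oplus>\<^bsub>A n\<^esub> y)) = JB (R n x) + JB (R n y)" if "x \<in> carrier (A n)" "y \<in> carrier (A n)" for n x y
    using that by (simp add: R_add J_add[OF B_cstar])
  have JR_smult: "JB (R n (c \<odot>\<^bsub>A n\<^esub> x)) = cscale c (JB (R n x))" if "x \<in> carrier (A n)" for n x
    using that by (simp add: R_smult J_smult[OF B_cstar])
  have ab: "cls a \<oplus>\<^bsub>B\<^esub> cls b = cls (\<lambda>n. a n \<oplus>\<^bsub>A n\<^esub> b n)" "cls (\<lambda>n. a n \<oplus>\<^bsub>A n\<^esub> b n) \<in> L"
    using B_add[OF a(1) b(1)] L_ops(1)[OF a(3) b(3)] by simp_all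
  have ca: "c \<odot>\<^bsub>B\<^esub> cls a = cls (\<lambda>n. c \<odot>\<^bsub>A n\<^esub> a n)" "cls (\<lambda>n. c \<odot>\<^bsub>A n\<^esub> a n) \<in> L"
    using B_smult1[OF a(1) a(1), of c] L_ops(2)[OF a(3), of c] by simp_all
  have st: "star B (cls u) = cls (\<lambda>n. star (A n) (u n))" "cls (\<lambda>n. star (A n) (u n)) \<in> L"
    if "u \<in> carrier P" "cls u \<in> L" for u
    using B_star1[OF that(1) that(1)] L_ops(3)[OF that(2)] by simp_all
  have "P0 (cls (\<lambda>n. a n \<oplus>\<^bsub>A n\<^esub> b n)) (cls z) = P0 (cls a) (cls z) \<oplus>\<^bsub>B\<^esub> P0 (cls b) (cls z)"
    using tendsto_add[OF T(1,2)]
    by (intro P0_eqI prod_closed a b z ab) (simp_all add: l_distr JR_add J_add[OF B_cstar])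
  then show "P0 (X \<oplus>\<^bsub>B\<^esub> Y) Z = P0 X Z \<oplus>\<^bsub>B\<^esub> P0 Y Z" by (simp add: ab)
  have "P0 (cls z) (cls (\<lambda>n. a n \<oplus>\<^bsub>A n\<^esub> b n)) = P0 (cls z) (cls a) \<oplus>\<^bsub>B\<^esub> P0 (cls z) (cls b)"
    using tendsto_add[OF T(3,4)]
    by (intro P0_eqI prod_closed a b z ab) (simp_all add: r_distr JR_add J_add[OF B_cstar])
  then show "P0 Z (X \<oplus>\<^bsub>B\<^esub> Y) = P0 Z X \<oplus>\<^bsub>B\<^esub> P0 Z Y" by (simp add: ab)
  have cs: "(\<lambda>n. cscale c (s n)) \<longlonglongrightarrow> cscale c l" if "s \<longlonglongrightarrow> l" for s and l :: "(nat \<Rightarrow> 'a) set uni"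
    unfolding cscale_def by (intro tendsto_intros that)
  have "P0 (cls (\<lambda>n. c \<odot>\<^bsub>A n\<^esub> a n)) (cls z) = c \<odot>\<^bsub>B\<^esub> P0 (cls a) (cls z)"
    using cs[OF T(1)] by (intro P0_eqI prod_closed a z ca) (simp_all add: smult_mult_l JR_smult J_smult[OF B_cstar])
  then show "P0 (c \<odot>\<^bsub>B\<^esub> X) Z = c \<odot>\<^bsub>B\<^esub> P0 X Z" by (simp add: ca)
  have "P0 (cls z) (cls (\<lambda>n. c \<odot>\<^bsub>A n\<^esub> a n)) = c \<odot>\<^bsub>B\<^esub> P0 (cls z) (cls a)"
    using cs[OF T(3)] by (intro P0_eqI prod_closed a z ca) (simp_all add: smult_mult_r JR_smult J_smult[OF B_cstar])
  then show "P0 Z (c \<odot>\<^bsub>B\<^esub> X) = c \<odot>\<^bsub>B\<^esub> P0 Z X" by (simp add: ca)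
  have "P0 (cls (\<lambda>n. star (A n) (z n))) (cls (\<lambda>n. star (A n) (a n))) = star B (P0 (cls a) (cls z))"
    using tendsto_adj[OF T(1)]
    by (intro P0_eqI prod_closed a z st) (simp_all add: J_star[OF B_cstar] JR_star flip: star_mult)
  then show "P0 (star B Z) (star B X) = star B (P0 X Z)" by (simp add: st a z)
qed

lemmas P0_scale = P0_add(3,4)[where X = X and Y = X for X]
  and P0_star = P0_add(5)[where X = X and Y = X for X]

section \<open>Agreement with the chosen product\<close>

lemma limitin_iff:
  "limitin (ctopology B) f l sequentially \<longleftrightarrow> l \<in> carrier B \<and>
    (\<forall>\<epsilon>>0. \<forall>\<^sub>F n in sequentially. f n \<in> carrier B \<and> cdist B (f n) l < \<epsilon>)"
proof -
  interpret M: Metric_space "carrier B" "cdist B" by (rule B_metric)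
  show ?thesis unfolding ctopology_def by (rule M.limitin_metric)
qed

lemma limitin_J:
  assumes l: "limitin (ctopology B) f l sequentially" shows "l \<in> carrier B" "(\<lambda>n. JB (f n)) \<longlonglongrightarrow> JB l"
proof -
  show lB: "l \<in> carrier B" using l by (simp add: limitin_iff)
  show "(\<lambda>n. JB (f n)) \<longlonglongrightarrow> JB l"
  proof (rule tendstoI)
    fix e :: real assume "e > 0"
    then have "\<forall>\<^sub>F n in sequentially. f n \<in> carrier B \<and> cdist B (f n) l < e" using l by (simp add: limitin_iff)
    then show "\<forall>\<^sub>F n in sequentially. dist (JB (f n)) (JB l) < e"
      by eventually_elim (use lB in \<open>auto simp: cdist_def dist_norm norm_J[OF B_cstar] simp flip: J_minus[OF B_cstar]\<close>)
  qed
qed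

lemma P0_R:
  assumes x: "x \<in> carrier (A k)" and y: "y \<in> carrier (A k)"
  shows "limitin (ctopology B) (\<lambda>n. R n (tm n k x \<otimes>\<^bsub>A n\<^esub> tm n k y)) (P0 (R k x) (R k y)) sequentially"
proof -
  have L: "cls (sq k x) \<in> L" "cls (sq k y) \<in> L" using R_L[OF x] R_L[OF y] by (simp_all add: R_cls x y)
  note T = P0_tendsto[OF sq_P[OF x] L(1) sq_P[OF y] L(2)]
  show ?thesis unfolding limitin_iff
  proof (intro conjI allI impI)
    show lB: "P0 (R k x) (R k y) \<in> carrier B" using T(1) x y by (simp add: R_cls)
    fix e :: real assume "e > 0"
    show "\<forall>\<^sub>F n in sequentially. R n (tm n k x \<otimes>\<^bsub>A n\<^esub> tm n k y) \<in> carrier B \<and>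
         cdist B (R n (tm n k x \<otimes>\<^bsub>A n\<^esub> tm n k y)) (P0 (R k x) (R k y)) < e"
      using tendstoD[OF T(2) \<open>e > 0\<close>] eventually_ge_at_top[of k]
    proof eventually_elim
      case (elim n)
      then show ?case using x y lB
        by (simp add: sq_def tm_closed cdist_def dist_norm R_cls[OF x] R_cls[OF y] norm_J[OF B_cstar] flip: J_minus[OF B_cstar])
    qed
  qed
qed

lemma is_limit_mult_P0: "is_limit_mult A \<rho> P0"
proof -
  have "\<exists>K. \<forall>a\<in>L. \<forall>b\<in>L. cnorm B (P0 a b) \<le> K * cnorm B a * cnorm B b"
    using P0_norm by (intro exI[of _ 1]) simp
  then show ?thesis
    unfolding is_limit_mult_def Let_def
    by (intro conjI ballI allI) (simp_all add: P0_L P0_assoc P0_add P0_scale P0_R)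
qed

lemma limit_mult: "is_limit_mult A \<rho> (limit_mult A \<rho>)"
  unfolding limit_mult_def by (rule someI[of "is_limit_mult A \<rho>", OF is_limit_mult_P0])

text \<open>Additivity and boundedness give continuity, and the images of the limit maps are dense
  in \<open>L\<close>.\<close>

lemma additive_eq_on_L:
  assumes f: "\<And>X. X \<in> L \<Longrightarrow> f X \<in> L" "\<And>X Y. X \<in> L \<Longrightarrow> Y \<in> L \<Longrightarrow> f (X \<oplus>\<^bsub>B\<^esub> Y) = f X \<oplus>\<^bsub>B\<^esub> f Y"
      "\<And>X. X \<in> L \<Longrightarrow> cnorm B (f X) \<le> K * cnorm B X"
    and g: "\<And>X. X \<in> L \<Longrightarrow> g X \<in> L" "\<And>X Y. X \<in> L \<Longrightarrow> Y \<in> L \<Longrightarrow> g (X \<oplus>\<^bsub>B\<^esub> Y) = g X \<oplus>\<^bsub>B\<^esub> g Y"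
      "\<And>X. X \<in> L \<Longrightarrow> cnorm B (g X) \<le> K * cnorm B X"
    and eq: "\<And>k x. x \<in> carrier (A k) \<Longrightarrow> f (R k x) = g (R k x)" and X: "X \<in> L"
  shows "f X = g X"
proof -
  obtain k x where x: "\<forall>n. x n \<in> carrier (A (k n))" "(\<lambda>n. JB (R (k n) (x n))) \<longlonglongrightarrow> JB X"
    by (rule L_approx[OF X])
  have XB: "X \<in> carrier B" by (rule L_carrier[OF X])
  have lim: "(\<lambda>n. JB (h (R (k n) (x n)))) \<longlonglongrightarrow> JB (h X)"
    if h: "\<And>X. X \<in> L \<Longrightarrow> h X \<in> L" "\<And>X Y. X \<in> L \<Longrightarrow> Y \<in> L \<Longrightarrow> h (X \<oplus>\<^bsub>B\<^esub> Y) = h X \<oplus>\<^bsub>B\<^esub> h Y"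
      "\<And>X. X \<in> L \<Longrightarrow> cnorm B (h X) \<le> K * cnorm B X" for h
  proof -
    have RL: "R (k n) (x n) \<in> L" "R (k n) (x n) \<in> carrier B" for n using x by (simp_all add: R_L)
    have b: "norm (JB (h (R (k n) (x n))) - JB (h X)) \<le> K * norm (JB (R (k n) (x n)) - JB X)" for n
    proof -
      let ?d = "R (k n) (x n) \<ominus>\<^bsub>B\<^esub> X"
      have dL: "?d \<in> L" using RL X by (simp add: L_ops)
      have "?d \<oplus>\<^bsub>B\<^esub> X = R (k n) (x n)"
        using RL XB by (subst J_inject[OF B_cstar, symmetric]) (simp_all add: J_add[OF B_cstar] J_minus[OF B_cstar])
      then have "h (R (k n) (x n)) = h ?d \<oplus>\<^bsub>B\<^esub> h X" using h(2)[OF dL X] by simp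
      then have "JB (h (R (k n) (x n))) - JB (h X) = JB (h ?d)"
        using L_carrier[OF h(1)[OF dL]] L_carrier[OF h(1)[OF X]] by (simp add: J_add[OF B_cstar])
      then show ?thesis
        using h(3)[OF dL] L_carrier[OF h(1)[OF dL]] RL XB by (simp add: norm_J[OF B_cstar] flip: J_minus[OF B_cstar])
    qed
    have "(\<lambda>n. norm (JB (R (k n) (x n)) - JB X)) \<longlonglongrightarrow> 0"
      using x(2) by (intro tendsto_norm_zero) (simp add: LIM_zero_iff)
    then have lim: "(\<lambda>n. K * norm (JB (R (k n) (x n)) - JB X)) \<longlonglongrightarrow> 0"
      by (rule tendsto_mult_right_zero)
    have "(\<lambda>n. norm (JB (h (R (k n) (x n))) - JB (h X))) \<longlonglongrightarrow> 0"
      by (rule tendsto_sandwich[OF _ _ tendsto_const lim]) (simp_all add: b)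
    then have "(\<lambda>n. JB (h (R (k n) (x n))) - JB (h X)) \<longlonglongrightarrow> 0" by (rule tendsto_norm_zero_cancel)
    then show ?thesis by (rule LIM_zero_cancel)
  qed
  have "JB (f X) = JB (g X)"
    using lim[of f, OF f] lim[of g, OF g] x(1) eq by (intro LIMSEQ_unique[of "\<lambda>n. JB (f (R (k n) (x n)))"]) simp_all
  then show ?thesis using L_carrier[OF f(1)[OF X]] L_carrier[OF g(1)[OF X]] by (simp add: J_inject[OF B_cstar])
qed

text \<open>The defining limit fixes a product only for two elements of a common level.
  \<open>R_tm\<close> extends this to different levels, and density is then applied to one argument
  at a time.\<close>

lemma limit_mult_unique:
  assumes Q: "is_limit_mult A \<rho> Q" and X: "X \<in> L" and Y: "Y \<in> L"
  shows "Q X Y = P0 X Y"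
proof -
  from Q have Q1: "\<And>a b. a \<in> L \<Longrightarrow> b \<in> L \<Longrightarrow> Q a b \<in> L"
    and Q2: "\<And>a b c. a \<in> L \<Longrightarrow> b \<in> L \<Longrightarrow> c \<in> L \<Longrightarrow> Q (a \<oplus>\<^bsub>B\<^esub> b) c = Q a c \<oplus>\<^bsub>B\<^esub> Q b c"
    and Q3: "\<And>a b c. a \<in> L \<Longrightarrow> b \<in> L \<Longrightarrow> c \<in> L \<Longrightarrow> Q a (b \<oplus>\<^bsub>B\<^esub> c) = Q a b \<oplus>\<^bsub>B\<^esub> Q a c"
    and Q4: "\<And>k x y. x \<in> carrier (A k) \<Longrightarrow> y \<in> carrier (A k) \<Longrightarrow>
        limitin (ctopology B) (\<lambda>n. R n (tm n k x \<otimes>\<^bsub>A n\<^esub> tm n k y)) (Q (R k x) (R k y)) sequentially"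
    unfolding is_limit_mult_def Let_def by auto
  obtain K where K: "\<forall>a\<in>L. \<forall>b\<in>L. cnorm B (Q a b) \<le> K * cnorm B a * cnorm B b"
    using Q unfolding is_limit_mult_def Let_def by auto
  \<comment> \<open>One constant for both products, as \<open>P0\<close> satisfies the bound with
    1.\<close>
  define K' where "K' = max K 1"
  have K': "cnorm B (Q a b) \<le> K' * cnorm B a * cnorm B b" "cnorm B (P0 a b) \<le> K' * cnorm B a * cnorm B b"
    if "a \<in> L" "b \<in> L" for a b
  proof -
    have nn: "0 \<le> cnorm B a * cnorm B b" using that by (simp add: B.norm_nonneg L_carrier)
    have "K * (cnorm B a * cnorm B b) \<le> K' * (cnorm B a * cnorm B b)" "1 * (cnorm B a * cnorm B b) \<le> K' * (cnorm B a * cnorm B b)"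
      by (intro mult_right_mono nn; simp add: K'_def)+
    then show "cnorm B (Q a b) \<le> K' * cnorm B a * cnorm B b" "cnorm B (P0 a b) \<le> K' * cnorm B a * cnorm B b"
      using K that P0_norm[OF that] by (auto simp: mult.assoc intro: order_trans)
  qed
  have base: "Q (R k x) (R k y) = P0 (R k x) (R k y)" if "x \<in> carrier (A k)" "y \<in> carrier (A k)" for k x y
    using LIMSEQ_unique[OF limitin_J(2)[OF Q4[OF that]] limitin_J(2)[OF P0_R[OF that]]]
      limitin_J(1)[OF Q4[OF that]] limitin_J(1)[OF P0_R[OF that]] by (simp add: J_inject[OF B_cstar])
  have "Q (R k x) (R l y) = P0 (R k x) (R l y)" if "x \<in> carrier (A k)" "y \<in> carrier (A l)" for k l x y
    using base[of "tm (max k l) k x" "max k l" "tm (max k l) l y"] that by (simp add: tm_closed R_tm)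
  then have "Q X (R l y) = P0 X (R l y)" if "y \<in> carrier (A l)" for l y
    using that K'[OF _ R_L[OF that]] X
    by (intro additive_eq_on_L[of "\<lambda>X. Q X (R l y)" "K' * cnorm B (R l y)" "\<lambda>X. P0 X (R l y)" X])
       (auto simp: Q1 Q2 P0_L P0_add R_L mult_ac)
  then show ?thesis
    using K'[OF X] Y by (intro additive_eq_on_L[of "Q X" "K' * cnorm B X" "P0 X" Y]) (auto simp: Q1 Q3 P0_L P0_add X)
qed

end

section \<open>Matrices over the limit\<close>

context encoding
begin

abbreviation "Q \<equiv> limit_mult A \<rho>"
abbreviation "C \<equiv> cstar_limit A \<rho>"
abbreviation "Rm r n \<equiv> amplify r (R n)"

lemma Q_eq: "X \<in> L \<Longrightarrow> Y \<in> L \<Longrightarrow> Q X Y = P0 X Y"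
  by (rule limit_mult_unique[OF limit_mult])

lemma C_sel [simp]:
  "carrier C = L" "mult C = Q" "zero C = zero B" "add C = add B" "smult C = smult B" "star C = star B" "cnorm C = cnorm B"
  by (simp_all add: cstar_limit_def)

lemma C_abelian_group: "abelian_group C"
proof (rule abelian_groupI)
  fix x y z assume "x \<in> carrier C" "y \<in> carrier C" "z \<in> carrier C"
  then show "x \<oplus>\<^bsub>C\<^esub> y \<oplus>\<^bsub>C\<^esub> z = x \<oplus>\<^bsub>C\<^esub> (y \<oplus>\<^bsub>C\<^esub> z)" by (simp add: L_carrier B.a_assoc)
next
  fix x y assume "x \<in> carrier C" "y \<in> carrier C"
  then show "x \<oplus>\<^bsub>C\<^esub> y = y \<oplus>\<^bsub>C\<^esub> x" by (simp add: L_carrier B.a_comm)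
next
  fix x assume x: "x \<in> carrier C"
  then have "(- 1) \<odot>\<^bsub>B\<^esub> x \<in> carrier C" using L_ops(2) by simp
  moreover have "(- 1) \<odot>\<^bsub>B\<^esub> x \<oplus>\<^bsub>C\<^esub> x = \<zero>\<^bsub>C\<^esub>" using x by (simp add: L_carrier B.smult_minus_one B.l_neg)
  ultimately show "\<exists>y\<in>carrier C. y \<oplus>\<^bsub>C\<^esub> x = \<zero>\<^bsub>C\<^esub>" by blast
qed (simp_all add: L_ops L_carrier)

lemma C_minus: assumes "X \<in> L" "Y \<in> L" shows "X \<ominus>\<^bsub>C\<^esub> Y = X \<ominus>\<^bsub>B\<^esub> Y"
proof -
  interpret C: abelian_group C by (rule C_abelian_group)
  have "(- 1) \<odot>\<^bsub>B\<^esub> Y \<oplus>\<^bsub>C\<^esub> Y = \<zero>\<^bsub>C\<^esub>" using assms by (simp add: L_carrier B.smult_minus_one B.l_neg)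
  then have "\<ominus>\<^bsub>C\<^esub> Y = (- 1) \<odot>\<^bsub>B\<^esub> Y" using assms L_ops(2) by (intro C.minus_equality) simp_all
  then show ?thesis using assms by (simp add: a_minus_def[of C] B.minus_smult L_carrier)
qed

lemma mats_L: "X \<in> mats r L \<Longrightarrow> X \<in> mats r (carrier B)"
  by (auto simp: mats_iff L_carrier)

lemma mat_C_ops:
  "X \<oplus>\<^bsub>mat_alg_with r C N\<^esub> Y = X \<oplus>\<^bsub>MB r\<^esub> Y" "c \<odot>\<^bsub>mat_alg_with r C N\<^esub> X = c \<odot>\<^bsub>MB r\<^esub> X"
  "star (mat_alg_with r C N) X = star (MB r) X"
  by (simp_all add: mat_alg_def mat_alg_with_def)

lemma mats_L_ops:
  assumes "X \<in> mats r L" "Y \<in> mats r L"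
  shows "X \<oplus>\<^bsub>MB r\<^esub> Y \<in> mats r L" "X \<ominus>\<^bsub>MB r\<^esub> Y \<in> mats r L" "c \<odot>\<^bsub>MB r\<^esub> X \<in> mats r L" "star (MB r) X \<in> mats r L"
proof -
  note X = mats_L[OF assms(1)] and Y = mats_L[OF assms(2)]
  note mB = mat_alg_closed[OF B_cstar] mat_alg_minus[OF B_cstar]
  have e: "Z \<in> extensional (idx r)" if "Z \<in> mats r (carrier B)" for Z using that by (simp add: mats_iff)
  show "X \<oplus>\<^bsub>MB r\<^esub> Y \<in> mats r L" "X \<ominus>\<^bsub>MB r\<^esub> Y \<in> mats r L" "c \<odot>\<^bsub>MB r\<^esub> X \<in> mats r L" "star (MB r) X \<in> mats r L"
    using mats_entry[OF assms(1)] mats_entry[OF assms(2)] X Y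
    by (simp_all add: mats_iff[of _ r L] e mB mat_alg_entry L_ops)
qed

lemma finsum_C:
  assumes "finite I" "\<And>k. k \<in> I \<Longrightarrow> f k \<in> L"
  shows "finsum C f I \<in> L \<and> JB (finsum C f I) = (\<Sum>k\<in>I. JB (f k))"
  using assms
proof (induction I rule: finite_induct)
  case empty
  interpret C: abelian_group C by (rule C_abelian_group)
  show ?case by (simp add: L_ops J_zero[OF B_cstar])
next
  case (insert k I)
  interpret C: abelian_group C by (rule C_abelian_group)
  have "finsum C f (insert k I) = f k \<oplus>\<^bsub>C\<^esub> finsum C f I" using insert by (intro C.finsum_insert) auto
  then show ?case using insert by (simp add: L_ops J_add[OF B_cstar] L_carrier)
qed

lemma JR_finsum:
  assumes "finite I" "\<And>k. k \<in> I \<Longrightarrow> f k \<in> carrier (A n)"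
  shows "JB (R n (finsum (A n) f I)) = (\<Sum>k\<in>I. JB (R n (f k)))"
  using assms
proof (induction I rule: finite_induct)
  case (insert k I)
  have "finsum (A n) f (insert k I) = f k \<oplus>\<^bsub>A n\<^esub> finsum (A n) f I" using insert by (intro finsum_insert) auto
  then show ?case using insert by (simp add: R_add J_add[OF B_cstar] finsum_closed Pi_iff)
qed (simp add: R_zero J_zero[OF B_cstar])

text \<open>N stays arbitrary here and below, as the product does not depend on it; the facts then
  serve both for the norm of \<open>MB r\<close> and for the norm chosen in
  \<open>mat_alg r C\<close>.\<close>

lemma mat_C_mult_closed:
  assumes "X \<in> mats r L" "Y \<in> mats r L"
  shows "X \<otimes>\<^bsub>mat_alg_with r C N\<^esub> Y \<in> mats r L"
proof -
  have "finsum C (\<lambda>k. X (i, k) \<otimes>\<^bsub>C\<^esub> Y (k, j)) {..<r} \<in> L" if "i < r" "j < r" for i j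
    using that finsum_C[of "{..<r}" "\<lambda>k. X (i, k) \<otimes>\<^bsub>C\<^esub> Y (k, j)"] mats_entry[OF assms(1)] mats_entry[OF assms(2)]
    by (simp add: Q_eq P0_L)
  then show ?thesis by (simp add: mats_iff mat_entry) (simp add: mat_alg_with_def)
qed

lemma mat_product_tendsto:
  assumes X: "X \<in> mats r L" "rep r x X" and Y: "Y \<in> mats r L" "rep r y Y" and ij: "i < r" "j < r"
  shows "(\<lambda>n. JB (Rm r n (x n \<otimes>\<^bsub>MA r n\<^esub> y n) (i, j))) \<longlonglongrightarrow> JB ((X \<otimes>\<^bsub>mat_alg_with r C N\<^esub> Y) (i, j))"
proof -
  have "JB ((X \<otimes>\<^bsub>mat_alg_with r C N\<^esub> Y) (i, j)) = (\<Sum>k<r. JB (Q (X (i, k)) (Y (k, j))))"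
    using ij finsum_C[of "{..<r}" "\<lambda>k. X (i, k) \<otimes>\<^bsub>C\<^esub> Y (k, j)"] mats_entry[OF X(1)] mats_entry[OF Y(1)]
    by (simp add: Q_eq P0_L mat_entry)
  moreover have "JB (Rm r n (x n \<otimes>\<^bsub>MA r n\<^esub> y n) (i, j)) = (\<Sum>k<r. JB (R n (x n (i, k) \<otimes>\<^bsub>A n\<^esub> y n (k, j))))" for n
    using ij mats_entry[OF repD(2)[OF X(2)]] mats_entry[OF repD(2)[OF Y(2)]]
      JR_finsum[of "{..<r}" "\<lambda>k. x n (i, k) \<otimes>\<^bsub>A n\<^esub> y n (k, j)" n]
    by (simp add: amplify_def mat_alg_entry)
  moreover have "(\<lambda>n. \<Sum>k<r. JB (R n (x n (i, k) \<otimes>\<^bsub>A n\<^esub> y n (k, j)))) \<longlonglongrightarrow> (\<Sum>k<r. JB (Q (X (i, k)) (Y (k, j))))"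
  proof (rule tendsto_sum)
    fix k assume "k \<in> {..<r}"
    then have k: "k < r" by simp
    note x = repD(3,4)[OF X(2) ij(1) k] and y = repD(3,4)[OF Y(2) k ij(2)]
    have L: "X (i, k) \<in> L" "Y (k, j) \<in> L" using mats_entry[OF X(1) ij(1) k] mats_entry[OF Y(1) k ij(2)] by auto
    show "(\<lambda>n. JB (R n (x n (i, k) \<otimes>\<^bsub>A n\<^esub> y n (k, j)))) \<longlonglongrightarrow> JB (Q (X (i, k)) (Y (k, j)))"
      using P0_tendsto(2)[OF x(1) _ y(1)] L by (simp add: Q_eq x(2) y(2))
  qed
  ultimately show ?thesis by simp
qed

lemma mat_tendsto:
  assumes Z: "\<And>n. Z n \<in> mats r (carrier B)" "W \<in> mats r (carrier B)"
    and lim: "\<And>i j. i < r \<Longrightarrow> j < r \<Longrightarrow> (\<lambda>n. JB (Z n (i, j))) \<longlonglongrightarrow> JB (W (i, j))"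
  shows "(\<lambda>n. cnorm (MB r) (Z n \<ominus>\<^bsub>MB r\<^esub> W)) \<longlonglongrightarrow> 0" "(\<lambda>n. cnorm (MB r) (Z n)) \<longlonglongrightarrow> cnorm (MB r) W"
proof -
  interpret M: cstar_algebra "MB r" by (rule mat_alg_cstar[OF B_cstar])
  have zW: "Z n \<ominus>\<^bsub>MB r\<^esub> W \<in> mats r (carrier B)" for n using Z by (simp add: mat_alg_minus[OF B_cstar])
  have le: "cnorm (MB r) (Z n \<ominus>\<^bsub>MB r\<^esub> W) \<le> (\<Sum>p\<in>idx r. norm (JB (Z n p) - JB (W p)))" for n
  proof -
    have "cnorm (MB r) (Z n \<ominus>\<^bsub>MB r\<^esub> W) \<le> (\<Sum>p\<in>idx r. cnorm B ((Z n \<ominus>\<^bsub>MB r\<^esub> W) p))"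
      by (rule mat_norm_bounds(2)[OF B_cstar zW])
    also have "\<dots> = (\<Sum>p\<in>idx r. norm (JB (Z n p) - JB (W p)))"
      using mats_entry[OF Z(1)] mats_entry[OF Z(2)] Z
      by (intro sum.cong) (auto simp: idx_def mat_alg_minus[OF B_cstar] norm_J[OF B_cstar] simp flip: J_minus[OF B_cstar])
    finally show ?thesis .
  qed
  have lim0: "(\<lambda>n. \<Sum>p\<in>idx r. norm (JB (Z n p) - JB (W p))) \<longlonglongrightarrow> 0"
  proof (rule tendsto_null_sum)
    fix p assume "p \<in> idx r"
    then obtain i j where "p = (i, j)" "i < r" "j < r" by (auto simp: idx_def)
    then show "(\<lambda>n. norm (JB (Z n p) - JB (W p))) \<longlonglongrightarrow> 0"
      using lim by (intro tendsto_norm_zero) (simp add: LIM_zero_iff)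
  qed
  show l0: "(\<lambda>n. cnorm (MB r) (Z n \<ominus>\<^bsub>MB r\<^esub> W)) \<longlonglongrightarrow> 0"
    by (rule tendsto_sandwich[OF _ _ tendsto_const lim0]) (use le zW in \<open>auto intro!: always_eventually M.norm_nonneg\<close>)
  have "(\<lambda>n. J (MB r) (Z n)) \<longlonglongrightarrow> J (MB r) W"
    using l0 Z by (subst tendsto_J[OF mat_alg_cstar[OF B_cstar]]) simp_all
  from tendsto_norm[OF this] show "(\<lambda>n. cnorm (MB r) (Z n)) \<longlonglongrightarrow> cnorm (MB r) W"
    using Z by (simp add: norm_J[OF mat_alg_cstar[OF B_cstar]])
qed

lemma Rm_closed: "z \<in> mats r (carrier (A n)) \<Longrightarrow> Rm r n z \<in> mats r (carrier B)"
  by (auto simp: mats_iff amplify_def)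

section \<open>Amplified limit maps\<close>

definition sqm :: "nat \<Rightarrow> nat \<Rightarrow> (nat \<times> nat \<Rightarrow> 'a) \<Rightarrow> nat \<Rightarrow> nat \<times> nat \<Rightarrow> 'a" where
  "sqm r n z = (\<lambda>m. if n \<le> m then amplify r (tm m n) z else (\<lambda>p\<in>idx r. \<zero>\<^bsub>A m\<^esub>))"

lemma sqm_rep: assumes z: "z \<in> mats r (carrier (A n))" shows "rep r (sqm r n z) (Rm r n z)"
proof -
  have e: "(\<lambda>m. sqm r n z m (i, j)) = sq n (z (i, j))" if "i < r" "j < r" for i j
    using that by (auto simp: sqm_def sq_def amplify_def)
  have "sqm r n z m \<in> mats r (carrier (A m))" for m
    using mats_entry[OF z] by (auto simp: mats_iff sqm_def amplify_def tm_closed)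
  then show ?thesis
    unfolding rep_def using mats_entry[OF z] Rm_closed[OF z] by (auto simp: e sq_P amplify_def R_cls)
qed

text \<open>The amplified connecting maps are contractions by \<open>amplify_norm\<close>, and the
  norm of the image is the limit superior of their values.\<close>

lemma Rm_norm:
  assumes r: "1 \<le> r" and z: "z \<in> mats r (carrier (A n))"
  shows "cnorm (MB r) (Rm r n z) \<le> cnorm (MA r n) z"
proof (rule rep_norm_le[OF sqm_rep[OF z]])
  show "\<forall>\<^sub>F m in sequentially. cnorm (MA r m) (sqm r n z m) \<le> cnorm (MA r n) z"
    using eventually_ge_at_top[of n]
    by eventually_elim (use cpc_map.amplify_norm[OF tm_map r z] in \<open>simp add: sqm_def\<close>)
qed

text \<open>The inequality holds at each stage m for the connecting map; both sides then pass to the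
  limit superior over m.\<close>

lemma Rm_kadison_schwarz:
  assumes r: "1 \<le> r" and z: "z \<in> mats r (carrier (A n))"
  shows "(cnorm (MB r) (Rm r n z))\<^sup>2 \<le> cnorm (MB r) (Rm r n (star (MA r n) z \<otimes>\<^bsub>MA r n\<^esub> z))"
proof (rule dense_ge)
  interpret M: cstar_algebra "MB r" by (rule mat_alg_cstar[OF B_cstar])
  let ?p = "star (MA r n) z \<otimes>\<^bsub>MA r n\<^esub> z"
  have p: "?p \<in> mats r (carrier (A n))" using z by (simp add: mat_alg_closed[OF A])
  fix K assume K: "cnorm (MB r) (Rm r n ?p) < K"
  have "0 \<le> cnorm (MB r) (Rm r n ?p)" using Rm_closed[OF p] by (intro M.norm_nonneg) simp
  with K have K0: "0 \<le> K" by simp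
  have "cnorm (MB r) (Rm r n z) \<le> sqrt K"
  proof (rule rep_norm_le[OF sqm_rep[OF z]])
    show "\<forall>\<^sub>F m in sequentially. cnorm (MA r m) (sqm r n z m) \<le> sqrt K"
      using rep_norm_less[OF sqm_rep[OF p] K] eventually_ge_at_top[of n]
    proof eventually_elim
      case (elim m)
      then have "(cnorm (MA r m) (amplify r (tm m n) z))\<^sup>2 \<le> K"
        using cpc_map.kadison_schwarz[OF tm_map r z, of m] by (simp add: sqm_def)
      then show ?case using elim by (simp add: sqm_def real_le_rsqrt)
    qed
  qed
  then have "(cnorm (MB r) (Rm r n z))\<^sup>2 \<le> (sqrt K)\<^sup>2"
    using Rm_closed[OF z] by (intro power_mono M.norm_nonneg) simp_all
  then show "(cnorm (MB r) (Rm r n z))\<^sup>2 \<le> K" using K0 by simp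
qed

text \<open>At every stage from n on the image of p factors as \<open>star (MA r m) (w m)\<close>
  times \<open>w m\<close>. The squared norm of \<open>w m\<close> is the norm of that image, so the
  factors are bounded and their sequence represents a factor W over \<open>A_inf A\<close>.\<close>

lemma Rm_positive:
  assumes r: "1 \<le> r" and p: "positive (MA r n) p" shows "positive (MB r) (Rm r n p)"
proof -
  have pM: "p \<in> mats r (carrier (A n))" using positive_carrier[OF mat_alg_cstar[OF A] p] by simp
  have "\<exists>w\<in>mats r (carrier (A m)). n \<le> m \<longrightarrow> amplify r (tm m n) p = star (MA r m) w \<otimes>\<^bsub>MA r m\<^esub> w" for m
  proof (cases "n \<le> m")
    case True
    then show ?thesis using cpc_map.map_pos[OF tm_map[OF True] r p] by (auto simp: positive_def)
  next
    case False
    then show ?thesis by (intro bexI[of _ "\<lambda>p\<in>idx r. \<zero>\<^bsub>A m\<^esub>"]) (auto simp: mats_iff)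
  qed
  then obtain w0 where w0: "\<And>m. w0 m \<in> mats r (carrier (A m))"
      "\<And>m. n \<le> m \<Longrightarrow> amplify r (tm m n) p = star (MA r m) (w0 m) \<otimes>\<^bsub>MA r m\<^esub> w0 m" by metis
  define w where "w m = (if n \<le> m then w0 m else (\<lambda>p\<in>idx r. \<zero>\<^bsub>A m\<^esub>))" for m
  interpret M: cstar_seq "MA r" by (rule MA)
  have wM: "w m \<in> mats r (carrier (A m))" for m using w0 by (auto simp: w_def mats_iff)
  have sqw: "star (MA r m) (w m) \<otimes>\<^bsub>MA r m\<^esub> w m = sqm r n p m" if "n \<le> m" for m
    using w0(2)[OF that] that by (simp add: w_def sqm_def)
  have "w \<in> carrier M.P"
  proof (rule M.prodI)
    show "w m \<in> carrier (MA r m)" for m using wM by simp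
    show "cnorm (MA r m) (w m) \<le> sqrt (cnorm (MA r n) p)" for m
    proof (cases "n \<le> m")
      case True
      have "(cnorm (MA r m) (w m))\<^sup>2 = cnorm (MA r m) (sqm r n p m)"
        using M.cstar_identity[of "w m" m] wM sqw[OF True] by simp
      also have "\<dots> \<le> cnorm (MA r n) p" using True cpc_map.amplify_norm[OF tm_map[OF True] r pM] by (simp add: sqm_def)
      finally show ?thesis by (rule real_le_rsqrt)
    next
      case False
      then have "w m = \<zero>\<^bsub>MA r m\<^esub>" by (simp add: w_def mat_alg_def)
      then show ?thesis using M.norm_nonneg[of p n] pM by simp
    qed
  qed
  then obtain W where W: "rep r w W" using prod_rep by blast
  have "rep r (\<lambda>m. star (MA r m) (w m) \<otimes>\<^bsub>MA r m\<^esub> w m) (star (MB r) W \<otimes>\<^bsub>MB r\<^esub> W)"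
    by (rule rep_mult[OF rep_star1[OF W W] W])
  moreover have "M.eqv (sqm r n p) (\<lambda>m. star (MA r m) (w m) \<otimes>\<^bsub>MA r m\<^esub> w m)"
    unfolding M.eqv_def
    by (rule tendsto_eventually, rule eventually_mono[OF eventually_ge_at_top[of n]]) (simp add: sqw)
  ultimately have "Rm r n p = star (MB r) W \<otimes>\<^bsub>MB r\<^esub> W" using eqv_rep sqm_rep[OF pM] by blast
  then show ?thesis using repD(1)[OF W] by (auto simp: positive_def)
qed

lemma mat_C_norm_mult:
  assumes r: "1 \<le> r" and X: "X \<in> mats r L" and Y: "Y \<in> mats r L"
  shows "cnorm (MB r) (X \<otimes>\<^bsub>mat_alg_with r C N\<^esub> Y) \<le> cnorm (MB r) X * cnorm (MB r) Y"
proof -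
  interpret M: cstar_algebra "MB r" by (rule mat_alg_cstar[OF B_cstar])
  interpret MA: cstar_seq "MA r" by (rule MA)
  obtain x where x: "rep r x X" using rep_exists mats_L[OF X] by blast
  obtain y where y: "rep r y Y" using rep_exists mats_L[OF Y] by blast
  have xyM: "x n \<otimes>\<^bsub>MA r n\<^esub> y n \<in> mats r (carrier (A n))" for n
    using repD(2)[OF x] repD(2)[OF y] by (simp add: mat_alg_closed[OF A])
  have lim: "(\<lambda>n. cnorm (MB r) (Rm r n (x n \<otimes>\<^bsub>MA r n\<^esub> y n))) \<longlonglongrightarrow> cnorm (MB r) (X \<otimes>\<^bsub>mat_alg_with r C N\<^esub> Y)"
    by (rule mat_tendsto(2)[OF Rm_closed[OF xyM] mats_L[OF mat_C_mult_closed[OF X Y]]])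
      (rule mat_product_tendsto[OF X x Y y])
  show ?thesis
  proof (rule le_mult_dense)
    fix K K' assume K: "cnorm (MB r) X < K" "cnorm (MB r) Y < K'"
    show "cnorm (MB r) (X \<otimes>\<^bsub>mat_alg_with r C N\<^esub> Y) \<le> K * K'"
    proof (rule tendsto_upperbound[OF lim])
      show "\<forall>\<^sub>F n in sequentially. cnorm (MB r) (Rm r n (x n \<otimes>\<^bsub>MA r n\<^esub> y n)) \<le> K * K'"
        using rep_norm_less[OF x K(1)] rep_norm_less[OF y K(2)]
      proof eventually_elim
        case (elim n)
        have c: "x n \<in> carrier (MA r n)" "y n \<in> carrier (MA r n)" using repD(2) x y by simp_all
        have "cnorm (MB r) (Rm r n (x n \<otimes>\<^bsub>MA r n\<^esub> y n)) \<le> cnorm (MA r n) (x n \<otimes>\<^bsub>MA r n\<^esub> y n)"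
          by (rule Rm_norm[OF r xyM])
        also have "\<dots> \<le> cnorm (MA r n) (x n) * cnorm (MA r n) (y n)" by (rule MA.norm_mult[OF c])
        also have "\<dots> \<le> K * K'"
          using elim MA.norm_nonneg[OF c(1)] MA.norm_nonneg[OF c(2)] by (intro mult_mono) auto
        finally show ?case .
      qed
    qed simp
  qed (use mats_L X Y in \<open>auto intro!: M.norm_nonneg\<close>)
qed

lemma mat_C_cstar_identity:
  assumes r: "1 \<le> r" and X: "X \<in> mats r L"
  shows "cnorm (MB r) (star (MB r) X \<otimes>\<^bsub>mat_alg_with r C N\<^esub> X) = (cnorm (MB r) X)\<^sup>2"
proof (rule antisym)
  interpret M: cstar_algebra "MB r" by (rule mat_alg_cstar[OF B_cstar])
  have sX: "star (MB r) X \<in> mats r L" using mats_L_ops[OF X X] by simp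
  show "cnorm (MB r) (star (MB r) X \<otimes>\<^bsub>mat_alg_with r C N\<^esub> X) \<le> (cnorm (MB r) X)\<^sup>2"
    using mat_C_norm_mult[OF r sX X] mats_L[OF X] by (simp add: power2_eq_square)
  obtain x where x: "rep r x X" using rep_exists mats_L[OF X] by blast
  have sx: "rep r (\<lambda>n. star (MA r n) (x n)) (star (MB r) X)" by (rule rep_star1[OF x x])
  have xM: "star (MA r n) (x n) \<otimes>\<^bsub>MA r n\<^esub> x n \<in> mats r (carrier (A n))" for n
    using repD(2)[OF x] by (simp add: mat_alg_closed[OF A])
  have lim: "(\<lambda>n. cnorm (MB r) (Rm r n (star (MA r n) (x n) \<otimes>\<^bsub>MA r n\<^esub> x n))) \<longlonglongrightarrow>
     cnorm (MB r) (star (MB r) X \<otimes>\<^bsub>mat_alg_with r C N\<^esub> X)"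
    by (rule mat_tendsto(2)[OF Rm_closed[OF xM] mats_L[OF mat_C_mult_closed[OF sX X]]])
      (rule mat_product_tendsto[OF sX sx X x])
  have lim2: "(\<lambda>n. (cnorm (MB r) (Rm r n (x n)))\<^sup>2) \<longlonglongrightarrow> (cnorm (MB r) X)\<^sup>2"
  proof (intro tendsto_power mat_tendsto(2)[OF Rm_closed[OF repD(2)[OF x]] mats_L[OF X]])
    fix i j assume ij: "i < r" "j < r"
    show "(\<lambda>n. JB (Rm r n (x n) (i, j))) \<longlonglongrightarrow> JB (X (i, j))"
      using R_rep_tendsto[OF repD(3)[OF x ij]] mats_entry[OF X ij] ij by (simp add: amplify_def repD(4)[OF x ij])
  qed
  show "(cnorm (MB r) X)\<^sup>2 \<le> cnorm (MB r) (star (MB r) X \<otimes>\<^bsub>mat_alg_with r C N\<^esub> X)"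
    by (rule LIMSEQ_le[OF lim2 lim]) (use Rm_kadison_schwarz[OF r repD(2)[OF x]] in blast)
qed

section \<open>The C*-limit, its matrix norms and its positive matrices\<close>

lemma C_metric: "Metric_space (carrier C) (cdist C)"
proof
  interpret M: Metric_space "carrier B" "cdist B" by (rule B_metric)
  have e: "cdist C X Y = (if X \<in> L \<and> Y \<in> L then cdist B X Y else 0)" for X Y
    by (simp add: cdist_def C_minus L_carrier)
  fix X Y Z
  show "0 \<le> cdist C X Y" "cdist C X Y = cdist C Y X" by (simp_all add: e M.commute)
  show "X \<in> carrier C \<Longrightarrow> Y \<in> carrier C \<Longrightarrow> cdist C X Y = 0 \<longleftrightarrow> X = Y" by (simp add: e L_carrier)
  show "X \<in> carrier C \<Longrightarrow> Y \<in> carrier C \<Longrightarrow> Z \<in> carrier C \<Longrightarrow> cdist C X Z \<le> cdist C X Y + cdist C Y Z"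
    by (simp add: e L_carrier M.triangle)
qed

lemma C_complete: "Metric_space.mcomplete (carrier C) (cdist C)"
proof (rule mcompleteI[OF C_metric])
  fix s assume s: "\<And>n::nat. s n \<in> carrier C"
    and Cau: "\<And>e. e > 0 \<Longrightarrow> \<exists>N. \<forall>m\<ge>N. \<forall>n\<ge>N. cnorm C (s m \<ominus>\<^bsub>C\<^esub> s n) < e"
  have sL: "s n \<in> L" "s n \<in> carrier B" for n using s L_carrier by auto
  have "\<exists>N. \<forall>m\<ge>N. \<forall>n\<ge>N. cnorm B (s m \<ominus>\<^bsub>B\<^esub> s n) < e" if "e > 0" for e
    using Cau[OF that] sL by (simp add: C_minus)
  then obtain l where l: "l \<in> carrier B" "(\<lambda>n. cnorm B (s n \<ominus>\<^bsub>B\<^esub> l)) \<longlonglongrightarrow> 0"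
    by (rule B.converges[OF sL(2)])
  have "(\<lambda>n. JB (s n)) \<longlonglongrightarrow> JB l" using l sL by (simp add: tendsto_J[OF B_cstar])
  then have lL: "l \<in> L" using L_closed[of s l] sL(1) l(1) by blast
  then show "\<exists>l\<in>carrier C. (\<lambda>n. cnorm C (s n \<ominus>\<^bsub>C\<^esub> l)) \<longlonglongrightarrow> 0"
    using l sL by (intro bexI[of _ l]) (simp_all add: C_minus)
qed

text \<open>The C*-identity for \<bullet> is \<open>mat_C_cstar_identity\<close> for r = 1, read
  through the identification s of elements with 1 by 1 matrices; the linear and norm axioms come
  from \<open>A_inf A\<close>, the laws of the product from \<open>P0\<close>.\<close>

lemma C_cstar: "cstar_algebra C"
proof (intro cstar_algebra.intro[OF C_abelian_group] cstar_algebra_axioms.intro C_complete; unfold C_sel)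
  fix X Y Z :: "(nat \<Rightarrow> 'a) set" and c d
  interpret CG: abelian_group C by (rule C_abelian_group)
  define s where "s X = (\<lambda>p\<in>idx 1. X)" for X :: "(nat \<Rightarrow> 'a) set"
  have i1: "idx 1 = {(0, 0)}" by (auto simp: idx_def)
  have sM: "s X \<in> mats 1 L" if "X \<in> L" for X using that by (simp add: mats_iff s_def)
  have sn: "cnorm (MB 1) (s X) = cnorm B X" if "X \<in> L" for X
    using mat_norm_bounds[OF B_cstar mats_L[OF sM[OF that]]] i1 by (intro antisym) (simp_all add: s_def)
  \<comment> \<open>The norm argument is \<open>undefined\<close>, as it does not enter the
    product.\<close>
  have sm: "s X \<otimes>\<^bsub>mat_alg_with 1 C undefined\<^esub> s Y = s (Q X Y)" if "X \<in> L" "Y \<in> L" for X Y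
  proof (rule mats_eqI)
    show "s X \<otimes>\<^bsub>mat_alg_with 1 C undefined\<^esub> s Y \<in> mats 1 L" by (rule mat_C_mult_closed[OF sM[OF that(1)] sM[OF that(2)]])
    show "s (Q X Y) \<in> mats 1 L" by (rule sM) (use that in \<open>simp add: Q_eq P0_L\<close>)
    fix i j :: nat assume ij: "i < 1" "j < 1"
    have "finsum C (\<lambda>k. s X (i, k) \<otimes>\<^bsub>C\<^esub> s Y (k, j)) {0} = Q X Y"
      using that ij by (subst CG.finsum_insert) (simp_all add: s_def Q_eq P0_L L_carrier)
    moreover have "{..<1} = {0::nat}" by auto
    ultimately show "(s X \<otimes>\<^bsub>mat_alg_with 1 C undefined\<^esub> s Y) (i, j) = s (Q X Y) (i, j)"
      using ij by (simp only: mat_entry) (simp add: s_def)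
  qed
  have ss: "star (MB 1) (s X) = s (star B X)" if "X \<in> L" for X
  proof (rule mats_eqI)
    show "star (MB 1) (s X) \<in> mats 1 L" using that by (intro mats_L_ops(4)[OF sM sM])
    show "s (star B X) \<in> mats 1 L" using that by (intro sM) (simp add: L_ops)
    fix i j :: nat assume "i < 1" "j < 1"
    then show "star (MB 1) (s X) (i, j) = s (star B X) (i, j)" by (simp add: mat_alg_entry s_def)
  qed
  assume X: "X \<in> L"
  then have XB: "X \<in> carrier B" by (rule L_carrier)
  show "c \<odot>\<^bsub>B\<^esub> X \<in> L" "star B X \<in> L" using X by (simp_all add: L_ops)
  show "(c + d) \<odot>\<^bsub>B\<^esub> X = c \<odot>\<^bsub>B\<^esub> X \<oplus>\<^bsub>B\<^esub> d \<odot>\<^bsub>B\<^esub> X" "(c * d) \<odot>\<^bsub>B\<^esub> X = c \<odot>\<^bsub>B\<^esub> (d \<odot>\<^bsub>B\<^esub> X)" "1 \<odot>\<^bsub>B\<^esub> X = X"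
    using XB by (simp_all add: B.smult_l_distr B.smult_assoc1 B.smult_one)
  show "star B (star B X) = X" "star B (c \<odot>\<^bsub>B\<^esub> X) = cnj c \<odot>\<^bsub>B\<^esub> star B X"
    using XB by (simp_all add: B.star_star B.star_smult)
  show "0 \<le> cnorm B X" "cnorm B X = 0 \<longleftrightarrow> X = \<zero>\<^bsub>B\<^esub>" "cnorm B (c \<odot>\<^bsub>B\<^esub> X) = cmod c * cnorm B X"
    using XB by (simp_all add: B.norm_nonneg B.norm_eq_zero B.norm_smult)
  show "cnorm B (Q (star B X) X) = (cnorm B X)\<^sup>2"
  proof -
    have sX: "star B X \<in> L" using X by (simp add: L_ops)
    then have "Q (star B X) X \<in> L" using X by (simp add: Q_eq P0_L)
    then show ?thesis
      using mat_C_cstar_identity[OF order_refl sM[OF X], of undefined] by (simp only: ss[OF X] sm[OF sX X] sn X)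
  qed
  assume Y: "Y \<in> L"
  then have YB: "Y \<in> carrier B" by (rule L_carrier)
  show "c \<odot>\<^bsub>B\<^esub> (X \<oplus>\<^bsub>B\<^esub> Y) = c \<odot>\<^bsub>B\<^esub> X \<oplus>\<^bsub>B\<^esub> c \<odot>\<^bsub>B\<^esub> Y" "star B (X \<oplus>\<^bsub>B\<^esub> Y) = star B X \<oplus>\<^bsub>B\<^esub> star B Y"
    "cnorm B (X \<oplus>\<^bsub>B\<^esub> Y) \<le> cnorm B X + cnorm B Y"
    using XB YB by (simp_all add: B.smult_r_distr B.star_add B.norm_triangle)
  show "Q X Y \<in> L" "Q (c \<odot>\<^bsub>B\<^esub> X) Y = c \<odot>\<^bsub>B\<^esub> Q X Y" "Q X (c \<odot>\<^bsub>B\<^esub> Y) = c \<odot>\<^bsub>B\<^esub> Q X Y"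
    "star B (Q X Y) = Q (star B Y) (star B X)" "cnorm B (Q X Y) \<le> cnorm B X * cnorm B Y"
    using X Y by (simp_all add: Q_eq P0_L L_ops P0_scale P0_star P0_norm)
  assume Z: "Z \<in> L"
  show "Q (Q X Y) Z = Q X (Q Y Z)" "Q (X \<oplus>\<^bsub>B\<^esub> Y) Z = Q X Z \<oplus>\<^bsub>B\<^esub> Q Y Z" "Q Z (X \<oplus>\<^bsub>B\<^esub> Y) = Q Z X \<oplus>\<^bsub>B\<^esub> Q Z Y"
    using X Y Z by (simp_all add: Q_eq P0_L L_ops P0_assoc P0_add)
qed

lemma mat_C_norm:
  assumes r: "1 \<le> r" and X: "X \<in> mats r L"
  shows "cnorm (mat_alg r C) X = cnorm (MB r) X"
proof (rule mat_norm_unique[OF C_cstar])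
  interpret M: cstar_algebra "MB r" by (rule mat_alg_cstar[OF B_cstar])
  show "cstar_algebra (mat_alg_with r C (cnorm (MB r)))"
  proof (rule mat_cstarI[OF C_cstar]; unfold C_sel mat_C_ops)
    fix X Y :: "nat \<times> nat \<Rightarrow> (nat \<Rightarrow> 'a) set" and c i j
    assume X: "X \<in> mats r L"
    then have XM: "X \<in> carrier (MB r)" using mats_L by simp
    show "0 \<le> cnorm (MB r) X" by (rule M.norm_nonneg[OF XM])
    show "cnorm (MB r) X \<le> (\<Sum>p\<in>idx r. cnorm B (X p))" by (rule mat_norm_bounds(2)[OF B_cstar mats_L[OF X]])
    show "i < r \<Longrightarrow> j < r \<Longrightarrow> cnorm B (X (i, j)) \<le> cnorm (MB r) X" by (rule mat_norm_bounds(1)[OF B_cstar mats_L[OF X]])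
    show "cnorm (MB r) (c \<odot>\<^bsub>MB r\<^esub> X) \<le> cmod c * cnorm (MB r) X" using M.norm_smult[OF XM] by simp
    show "cnorm (MB r) (star (MB r) X \<otimes>\<^bsub>mat_alg_with r C (cnorm (MB r))\<^esub> X) = (cnorm (MB r) X)\<^sup>2"
      by (rule mat_C_cstar_identity[OF r X])
    assume Y: "Y \<in> mats r L"
    then have YM: "Y \<in> carrier (MB r)" using mats_L by simp
    show "cnorm (MB r) (X \<oplus>\<^bsub>MB r\<^esub> Y) \<le> cnorm (MB r) X + cnorm (MB r) Y" by (rule M.norm_triangle[OF XM YM])
    show "cnorm (MB r) (X \<otimes>\<^bsub>mat_alg_with r C (cnorm (MB r))\<^esub> Y) \<le> cnorm (MB r) X * cnorm (MB r) Y"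
      by (rule mat_C_norm_mult[OF r X Y])
  qed
qed (use X in simp)

lemma mat_C_positive:
  assumes r: "1 \<le> r" and X: "positive (mat_alg r C) X"
  shows "positive (MB r) X"
proof -
  obtain Y where Y: "Y \<in> mats r L" "X = star (mat_alg r C) Y \<otimes>\<^bsub>mat_alg r C\<^esub> Y"
    using X by (auto simp: positive_def)
  obtain N where N: "mat_alg r C = mat_alg_with r C N" using mat_alg_def by blast
  have XY: "X = star (MB r) Y \<otimes>\<^bsub>mat_alg_with r C N\<^esub> Y" using Y(2) by (simp add: N mat_C_ops)
  have sY: "star (MB r) Y \<in> mats r L" using mats_L_ops[OF Y(1) Y(1)] by simp
  obtain y where y: "rep r y Y" using rep_exists mats_L[OF Y(1)] by blast
  have sy: "rep r (\<lambda>n. star (MA r n) (y n)) (star (MB r) Y)" by (rule rep_star1[OF y y])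
  have yM: "star (MA r n) (y n) \<otimes>\<^bsub>MA r n\<^esub> y n \<in> mats r (carrier (A n))" for n
    using repD(2)[OF y] by (simp add: mat_alg_closed[OF A])
  have XM: "X \<in> mats r (carrier B)" unfolding XY by (rule mats_L[OF mat_C_mult_closed[OF sY Y(1)]])
  show ?thesis
  proof (rule positive_closed[OF mat_alg_cstar[OF B_cstar]])
    show "positive (MB r) (Rm r n (star (MA r n) (y n) \<otimes>\<^bsub>MA r n\<^esub> y n))" for n
      using repD(2)[OF y] by (intro Rm_positive r) (auto simp: positive_def)
    show "X \<in> carrier (MB r)" using XM by simp
    show "(\<lambda>n. cnorm (MB r) (Rm r n (star (MA r n) (y n) \<otimes>\<^bsub>MA r n\<^esub> y n) \<ominus>\<^bsub>MB r\<^esub> X)) \<longlonglongrightarrow> 0"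
      by (rule mat_tendsto(1)[OF Rm_closed[OF yM] XM], unfold XY)
        (rule mat_product_tendsto[OF sY sy Y(1) y])
  qed
qed

lemma mat_C_positive_converse:
  assumes r: "1 \<le> r" and X: "X \<in> mats r L" and pos: "positive (MB r) X"
  shows "positive (mat_alg r C) X"
proof -
  interpret M: cstar_algebra "MB r" by (rule mat_alg_cstar[OF B_cstar])
  interpret MC: cstar_algebra "mat_alg r C" by (rule mat_alg_cstar[OF C_cstar])
  obtain N where N: "mat_alg r C = mat_alg_with r C N" using mat_alg_def by blast
  have minus: "U \<ominus>\<^bsub>mat_alg r C\<^esub> V = U \<ominus>\<^bsub>MB r\<^esub> V" if "U \<in> mats r L" "V \<in> mats r L" for U V
  proof (rule mats_eqI)
    show "U \<ominus>\<^bsub>mat_alg r C\<^esub> V \<in> mats r L" using mat_alg_minus(1)[OF C_cstar, of U r V] that by simp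
    show "U \<ominus>\<^bsub>MB r\<^esub> V \<in> mats r L" by (rule mats_L_ops(2)[OF that])
    fix i j assume "i < r" "j < r"
    then show "(U \<ominus>\<^bsub>mat_alg r C\<^esub> V) (i, j) = (U \<ominus>\<^bsub>MB r\<^esub> V) (i, j)"
      using mat_alg_minus(2)[OF C_cstar, of U r V] that mats_L mats_entry[OF that(1)] mats_entry[OF that(2)]
      by (simp add: mat_alg_minus(2)[OF B_cstar] C_minus)
  qed
  \<comment> \<open>The criterion by contractions concerns norm at most 1, so X is scaled down and
    scaled back at the end; adding 1 excludes division by zero.\<close>
  define t where "t = 1 / (cnorm (MB r) X + 1)"
  have nX: "0 \<le> cnorm (MB r) X" using mats_L[OF X] by (intro M.norm_nonneg) simp
  have t: "t > 0" using nX by (simp add: t_def add_nonneg_pos)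
  define X' where "X' = of_real t \<odot>\<^bsub>MB r\<^esub> X"
  have X': "X' \<in> mats r L" unfolding X'_def by (rule mats_L_ops(3)[OF X X])
  have pX': "positive (MB r) X'" unfolding X'_def using t by (intro positive_smult[OF mat_alg_cstar[OF B_cstar]] pos) simp
  have nX': "cnorm (MB r) X' \<le> 1"
    using mats_L[OF X] t nX by (simp add: X'_def M.norm_smult t_def norm_divide)
  have "positive (mat_alg r C) X'"
  proof (rule positive_by_contractions[OF mat_alg_cstar[OF C_cstar]])
    show "X' \<in> carrier (mat_alg r C)" using X' by simp
    show "star (mat_alg r C) X' = X'"
      using positive_star[OF mat_alg_cstar[OF B_cstar] pX'] by (simp add: N mat_C_ops)
    fix b assume b: "positive (mat_alg r C) b" "cnorm (mat_alg r C) b \<le> 1"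
    have bL: "b \<in> mats r L" using positive_carrier[OF mat_alg_cstar[OF C_cstar] b(1)] by simp
    have "cnorm (MB r) (b \<ominus>\<^bsub>MB r\<^esub> X') \<le> 1"
      using b(2)[unfolded mat_C_norm[OF r bL]] bL mats_L[OF X'] mats_L[OF bL] nX' pX' mat_C_positive[OF r b(1)]
      by (intro norm_diff_contractions_carrier[OF mat_alg_cstar[OF B_cstar]]) (simp_all add: mat_C_norm r)
    then show "cnorm (mat_alg r C) (b \<ominus>\<^bsub>mat_alg r C\<^esub> X') \<le> 1"
      by (simp only: minus[OF bL X'] mat_C_norm[OF r mats_L_ops(2)[OF bL X']])
  qed
  then have "positive (mat_alg r C) (of_real (1 / t) \<odot>\<^bsub>mat_alg r C\<^esub> X')"
    using t by (intro positive_smult[OF mat_alg_cstar[OF C_cstar]]) simp_all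
  moreover have "of_real (1 / t) \<odot>\<^bsub>mat_alg r C\<^esub> X' = X"
    unfolding N mat_C_ops X'_def using mats_L[OF X] t
    by (simp add: M.smult_one flip: M.smult_assoc1)
  ultimately show ?thesis by simp
qed

theorem complete_order_embedding_id: "complete_order_embedding C L B (carrier B) (\<lambda>x. x)"
proof -
  have saB: "selfadjoint_subspace B (carrier B)" by (rule selfadjoint_subspace_carrier[OF B_cstar])
  have saC: "selfadjoint_subspace C L" using selfadjoint_subspace_carrier[OF C_cstar] by simp
  have lin: "star_linear C L B (carrier B) (\<lambda>x. x)"
    unfolding star_linear_def using C_cstar B_cstar saB saC by (auto simp: L_carrier)
  \<comment> \<open>The inverse map is an \<open>inv_into\<close>, whose values are determined only
    on \<open>L\<close>; the amplification of a matrix over \<open>L\<close> involves no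
    others.\<close>
  have inv: "inv_into L (\<lambda>x. x) x = x" if "x \<in> L" for x using that by (rule inv_into_f_f[rotated]) simp
  have amp: "amplify r (inv_into L (\<lambda>x. x)) x = x" if "x \<in> mats r L" for r x
  proof (rule mats_eqI[OF _ that])
    show "amplify r (inv_into L (\<lambda>x. x)) x \<in> mats r L"
      using mats_entry[OF that] by (auto simp: mats_iff amplify_def inv)
    show "i < r \<Longrightarrow> j < r \<Longrightarrow> amplify r (inv_into L (\<lambda>x. x)) x (i, j) = x (i, j)" for i j
      using mats_entry[OF that] by (simp add: amplify_def inv)
  qed
  have "completely_positive C L B (carrier B) (\<lambda>x. x)"
    unfolding completely_positive_def using lin by (simp add: amplify_id mat_C_positive)
  moreover have "completely_isometric C L B (carrier B) (\<lambda>x. x)"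
    unfolding completely_isometric_def using lin by (simp add: amplify_id mat_C_norm)
  moreover have "star_linear B L C L (inv_into L (\<lambda>x. x))"
    unfolding star_linear_def using C_cstar B_cstar L_subspace saC by (simp add: inv L_ops)
  then have "completely_positive B L C L (inv_into L (\<lambda>x. x))"
    unfolding completely_positive_def by (simp add: amp mat_C_positive_converse)
  ultimately show ?thesis unfolding complete_order_embedding_def by simp
qed

end

theorem proposition2p9:
  fixes A :: "nat \<Rightarrow> 'a cstar" and \<rho> :: "nat \<Rightarrow> 'a \<Rightarrow> 'a"
  assumes "cstar_encoding A \<rho>"
  shows "complete_order_embedding (cstar_limit A \<rho>) (system_limit A \<rho>)
           (A_inf A) (carrier (A_inf A)) (\<lambda>x. x)"
proof -
  interpret encoding A \<rho> by (rule encoding.intro) (rule assms)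
  show ?thesis by (rule complete_order_embedding_id)
qed

end
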